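(* For every integer $n \geq 5$, $$\mathrm{ex}_{\mathcal{P}}(n,C_5,C_3) = \left\lfloor \frac{n-3}{2} \right\rfloor \cdot \left\lceil \frac{n-3}{2} \right\rceil,$$ and an $n$-vertex triangle-free planar graph contains exactly this many copies of $C_5$ if and only if it belongs to $\mathcal{J}_n$.
   Context: For graphs $H$ and $F$, $\mathrm{ex}_{\mathcal{P}}(n,H,F)$ denotes the maximum number of copies of $H$ (subgraphs isomorphic to $H$) in an $n$-vertex simple planar graph that contains no subgraph isomorphic to $F$. $C_l$ denotes the cycle of length $l$. The class $\mathcal{J}_n$ ($n\ge 5$) consists of the $n$-vertex planar graphs obtained as follows (informally: take a pentagon, replace one vertex $x$ by an independent set $C$, and replace the edge opposite to $x$ by a tree with colour classes $A$ and $B$). Precisely: the vertex set is the disjoint union $\{u,v\}\cup C\cup A\cup B$ with $C,A,B$ nonempty; every vertex of $C$ is adjacent to both $u$ and $v$; every vertex of $A$ is adjacent to $u$; every vertex of $B$ is adjacent to $v$; the edges inside $A\cup B$ form a tree on $A\cup B$ whose two colour classes are $A$ and $B$; there are no other edges; and $|C|$ and $|A\cup B|-1$ are as equal as possible, i.e. $\big||C|-(|A|+|B|-1)\big|\le 1$ (with $|C|+|A|+|B|=n-2$). *)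

theory Defs
  imports "HOL-Analysis.Analysis"
begin

type_synonym 'a graph = "'a set \<times> 'a set set"

abbreviation verts :: "'a graph \<Rightarrow> 'a set" where "verts \<equiv> fst"

abbreviation edges :: "'a graph \<Rightarrow> 'a set set" where "edges \<equiv> snd"

definition simple_graph :: "'a graph \<Rightarrow> bool" where
  "simple_graph G \<longleftrightarrow>
     finite (verts G) \<and> (\<forall>e\<in>edges G. \<exists>x\<in>verts G. \<exists>y\<in>verts G. x \<noteq> y \<and> e = {x, y})"

definition subgraph :: "'a graph \<Rightarrow> 'a graph \<Rightarrow> bool" where
  "subgraph H G \<longleftrightarrow> simple_graph H \<and> verts H \<subseteq> verts G \<and> edges H \<subseteq> edges G"

definition isomorphic :: "'a graph \<Rightarrow> 'b graph \<Rightarrow> bool" where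
  "isomorphic G H \<longleftrightarrow>
     (\<exists>f. bij_betw f (verts G) (verts H) \<and>
          (\<forall>x\<in>verts G. \<forall>y\<in>verts G. {x, y} \<in> edges G \<longleftrightarrow> {f x, f y} \<in> edges H))"

definition copies :: "'b graph \<Rightarrow> 'a graph \<Rightarrow> 'a graph set" where
  "copies H G = {K. subgraph K G \<and> isomorphic K H}"

definition free_of :: "'b graph \<Rightarrow> 'a graph \<Rightarrow> bool" where
  "free_of F G \<longleftrightarrow> \<not> (\<exists>K. subgraph K G \<and> isomorphic K F)"

text \<open>This is the cycle of length \<open>l\<close> only for \<open>l \<ge> 3\<close>.\<close>
definition cycle_graph :: "nat \<Rightarrow> nat graph" where
  "cycle_graph l = ({..<l}, {{i, (i + 1) mod l} |i. i < l})"

text \<open>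
  The plane is \<^typ>\<open>complex\<close>, as in the library's Jordan curve theorem. A drawing places the
  vertices at distinct points and represents each edge by an arc joining its two ends; the
  arc contains no other vertex, and two arcs meet only in the ends the edges share.
\<close>
definition plane_drawing ::
    "'a graph \<Rightarrow> ('a \<Rightarrow> complex) \<Rightarrow> ('a set \<Rightarrow> real \<Rightarrow> complex) \<Rightarrow> bool" where
  "plane_drawing G p \<gamma> \<longleftrightarrow>
     inj_on p (verts G) \<and>
     (\<forall>e\<in>edges G. arc (\<gamma> e) \<and> {pathstart (\<gamma> e), pathfinish (\<gamma> e)} = p ` e \<and>
                    path_image (\<gamma> e) \<inter> p ` verts G = p ` e) \<and>
     (\<forall>e\<in>edges G. \<forall>e'\<in>edges G. e \<noteq> e' \<longrightarrow>
        path_image (\<gamma> e) \<inter> path_image (\<gamma> e') = p ` (e \<inter> e'))"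

definition planar :: "'a graph \<Rightarrow> bool" where
  "planar G \<longleftrightarrow> (\<exists>p \<gamma>. plane_drawing G p \<gamma>)"

text \<open>
  Every finite graph is isomorphic to one on natural numbers, so ranging over graphs of
  type \<^typ>\<open>nat graph\<close> loses nothing.
\<close>
definition ex_planar :: "nat \<Rightarrow> 'b graph \<Rightarrow> 'c graph \<Rightarrow> nat" where
  "ex_planar n H F =
     Max {card (copies H G) |G :: nat graph.
            simple_graph G \<and> card (verts G) = n \<and> planar G \<and> free_of F G}"

definition connected_graph :: "'a graph \<Rightarrow> bool" where
  "connected_graph G \<longleftrightarrow>
     verts G \<noteq> {} \<and> (\<forall>x\<in>verts G. \<forall>y\<in>verts G. (x, y) \<in> {(a, b). {a, b} \<in> edges G}\<^sup>*)"

definition is_tree :: "'a graph \<Rightarrow> bool" where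
  "is_tree G \<longleftrightarrow>
     simple_graph G \<and> connected_graph G \<and> (\<forall>l\<ge>3. free_of (cycle_graph l) G)"

text \<open>
  Planarity is a separate requirement: the remaining conditions do not imply it. For
  instance, if the tree has a vertex of \<open>B\<close> with three neighbours in \<open>A\<close>, each having a
  further neighbour in \<open>B\<close>, then the graph contains a subdivided \<open>K\<^sub>3\<^sub>,\<^sub>3\<close>.
\<close>
definition J_class :: "nat \<Rightarrow> 'a graph set" where
  "J_class n = {G. simple_graph G \<and> card (verts G) = n \<and> planar G \<and>
     (\<exists>u v A B C T.
        u \<noteq> v \<and> u \<notin> A \<union> B \<union> C \<and> v \<notin> A \<union> B \<union> C \<and>
        A \<inter> B = {} \<and> A \<inter> C = {} \<and> B \<inter> C = {} \<and>
        A \<noteq> {} \<and> B \<noteq> {} \<and> C \<noteq> {} \<and>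
        verts G = {u, v} \<union> C \<union> A \<union> B \<and>
        edges G = {{u, c} |c. c \<in> C} \<union> {{v, c} |c. c \<in> C} \<union>
                  {{u, a} |a. a \<in> A} \<union> {{v, b} |b. b \<in> B} \<union> T \<and>
        is_tree (A \<union> B, T) \<and> (\<forall>e\<in>T. \<exists>a\<in>A. \<exists>b\<in>B. e = {a, b}) \<and>
        \<bar>int (card C) - (int (card A) + int (card B) - 1)\<bar> \<le> 1)}"

text \<open>The maximum defining \<^const>\<open>ex_planar\<close> is taken over a finite set.\<close>
lemma finite_copy_counts:
  "finite {card (copies H G) |G :: nat graph.
     simple_graph G \<and> card (verts G) = n \<and> planar G \<and> free_of F G}"
proof -
  have "card (copies H G) \<le> 2 ^ n * 2 ^ 2 ^ n"
    if G: "simple_graph G" "card (verts G) = n" for G :: "nat graph"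
  proof -
    have fin: "finite (verts G)" using G by (simp add: simple_graph_def)
    have "copies H G \<subseteq> Pow (verts G) \<times> Pow (Pow (verts G))"
      using G(1) by (fastforce simp: copies_def subgraph_def simple_graph_def)
    then have "card (copies H G) \<le> card (Pow (verts G) \<times> Pow (Pow (verts G)))"
      using fin by (intro card_mono) auto
    then show ?thesis
      using fin G(2) by (simp add: card_cartesian_product card_Pow)
  qed
  then show ?thesis
    by (intro finite_subset[OF _ finite_atMost[of "2 ^ n * 2 ^ 2 ^ n"]]) auto
qed

end

theory Submission
  imports Defs "HOL-Complex_Analysis.Riemann_Mapping"
begin

text \<open>
  Induction on the number of vertices, by two reductions that keep the graph planar and
  triangle-free. If a 4-cycle has a side without vertices, two opposite vertices \<open>a\<close>, \<open>c\<close> of such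
  a cycle \<open>s a t c\<close> can be merged through that side, where \<open>s\<close> and \<open>t\<close> are the only common
  neighbours of \<open>a\<close> and \<open>c\<close> and no path of length three joins \<open>a\<close> to \<open>c\<close>; the number of pentagons
  lost is at most the number of paths of length three from \<open>s\<close> to \<open>t\<close>. If every side of every
  4-cycle contains a vertex, then a side with fewest vertices contains no vertex of a 4-cycle,
  and an edge on no 4-cycle is contracted; the loss is at most the number of paths of length
  four between its ends. In both cases the choice can be made so that the loss is at most
  \<open>\<lfloor>(n - 3) / 2\<rfloor>\<close>, which is the increment of the claimed maximum from \<open>n - 1\<close> to \<open>n\<close>. Merged
  and contracted drawings exist because an arc can be collapsed to a point by a continuous map
  of the plane, which comes from the Riemann mapping of the complement of the arc.

  The same reductions give at most \<open>2 n - 4\<close> edges, and at most \<open>2 n - 5\<close> if there is a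
  pentagon. Hence two vertices with \<open>c > 0\<close> common neighbours and \<open>e > 0\<close> paths of length three
  between them satisfy \<open>c + e \<le> n - 3\<close>. Following equality through the induction, an extremal
  graph has such a pair with \<open>c e\<close> pentagons through both vertices and no others; then \<open>c\<close> and
  \<open>e\<close> are balanced and the edge bound is attained, which forces the structure of \<open>J\<^sub>n\<close>.
\<close>

section \<open>Arcs and Jordan curves\<close>

text \<open>Faces are never defined and no Euler formula enters: the only topological objects are
  the two sides of a 4-cycle and theta curves built from paths. Merging works because a vertexless
  side of \<open>u a b c\<close> forces all other edges to the opposite side, where disjoint paths
  from \<open>u\<close> to \<open>b\<close> and from \<open>a\<close> to \<open>c\<close> would
  cross; so at least one diagonal can be merged without creating a triangle. The obstacle is the
  price. If \<open>s\<close> and \<open>t\<close> are joined by more than \<open>(n - 3) / 2\<close>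
  paths of length three, a neighbour \<open>w\<close> of one of them supplies another vertexless
  4-cycle, whose merge costs the paths between \<open>w\<close> and the other one; the two path
  counts add up to at most \<open>n - 3\<close>, so this merge is cheap. For
  \<open>n \<ge> 6\<close> a contraction never gives equality: if the contracted graph were
  extremal, it would have a pentagon that was a hexagon through the contracted edge before.
  Pentagons are counted as closed 5-walks, ten for each copy, because a merge then merely
  substitutes one letter in a tuple.\<close>

definition arc_set :: "complex set \<Rightarrow> complex \<Rightarrow> complex \<Rightarrow> bool" where
  "arc_set S a b \<longleftrightarrow> (\<exists>g. arc g \<and> pathstart g = a \<and> pathfinish g = b \<and> path_image g = S)"

lemma arc_set_sym: "arc_set S a b \<Longrightarrow> arc_set S b a"
  unfolding arc_set_def by (metis arc_reversepath path_image_reversepath pathfinish_reversepath pathstart_reversepath)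

lemma arc_set_ends: "arc_set S a b \<Longrightarrow> a \<in> S \<and> b \<in> S \<and> a \<noteq> b"
  unfolding arc_set_def using arc_distinct_ends pathfinish_in_path_image pathstart_in_path_image by fastforce

lemma arc_set_compact: "arc_set S a b \<Longrightarrow> compact S"
  unfolding arc_set_def using compact_arc_image by blast

lemma arc_set_closed: "arc_set S a b \<Longrightarrow> closed S"
  using arc_set_compact compact_imp_closed by blast

lemma arc_set_connected: "arc_set S a b \<Longrightarrow> connected S"
  unfolding arc_set_def using connected_arc_image by blast

lemma arc_set_join:
  assumes "arc_set S a b" "arc_set T b c" "S \<inter> T = {b}"
  shows "arc_set (S \<union> T) a c"
proof -
  obtain g h where g: "arc g" "pathstart g = a" "pathfinish g = b" "path_image g = S"
    and h: "arc h" "pathstart h = b" "pathfinish h = c" "path_image h = T"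
    using assms unfolding arc_set_def by metis
  have "arc (g +++ h)" using g h assms(3) by (intro arc_join) auto
  then show ?thesis unfolding arc_set_def using g h
    by (metis path_image_join pathfinish_join pathstart_join)
qed

lemma arc_set_split:
  assumes "arc_set S a b" "x \<in> S" "x \<noteq> a" "x \<noteq> b"
  obtains S1 S2 where "arc_set S1 a x" "arc_set S2 x b" "S1 \<inter> S2 = {x}" "S1 \<union> S2 = S"
proof -
  obtain g where g: "arc g" "pathstart g = a" "pathfinish g = b" "path_image g = S"
    using assms(1) unfolding arc_set_def by metis
  obtain r where r: "r \<in> {0..1}" "g r = x" using assms(2) g(4) unfolding path_image_def by auto
  have r01: "0 < r" "r < 1"
    using r assms g(2,3) by (auto simp: pathstart_def pathfinish_def less_le)
  have inj: "inj_on g {0..1}" using g(1) unfolding arc_def by auto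
  let ?S1 = "g ` {0..r}" and ?S2 = "g ` {r..1}"
  have 1: "arc_set ?S1 a x" unfolding arc_set_def
    apply (rule exI[of _ "subpath 0 r g"])
    using g r r01 by (simp add: arc_subpath_arc path_image_subpath pathstart_def) (simp add: subpath_def)
  have 2: "arc_set ?S2 x b" unfolding arc_set_def
    apply (rule exI[of _ "subpath r 1 g"])
    using g r r01 by (simp add: arc_subpath_arc path_image_subpath pathfinish_def) (simp add: subpath_def)
  have "g ` {0..r} \<inter> g ` {r..1} = g ` ({0..r} \<inter> {r..1})"
    using inj_on_image_Int[OF inj, of "{0..r}" "{r..1}"] r01 by auto
  also have "{0..r} \<inter> {r..1} = {r}" using r01 by auto
  finally have 3: "?S1 \<inter> ?S2 = {x}" using r by auto
  have "?S1 \<union> ?S2 = g ` ({0..r} \<union> {r..1})" by auto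
  also have "{0..r} \<union> {r..1} = {0..1}" using r01 by auto
  finally have 4: "?S1 \<union> ?S2 = S" using g(4) unfolding path_image_def by simp
  show ?thesis using that 1 2 3 4 by blast
qed

lemma arc_set_interior:
  assumes "arc_set S a b"
  shows "connected (S - {a, b})" "connected (S - {a})" "closure (S - {a, b}) = S" "S - {a,b} \<noteq> {}"
proof -
  obtain g where g: "arc g" "pathstart g = a" "pathfinish g = b" "path_image g = S"
    using assms(1) unfolding arc_set_def by metis
  have inj: "inj_on g {0..1}" and cont: "continuous_on {0..1} g"
    using g(1) unfolding arc_def path_def by auto
  have a: "a = g 0" and b: "b = g 1" and S: "S = g ` {0..1}"
    using g by (auto simp: pathstart_def pathfinish_def path_image_def)
  have "{0<..<1} = {0..1} - {0,1::real}" by auto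
  then have 1: "S - {a, b} = g ` {0<..<1}"
    using inj_on_image_set_diff[OF inj, of "{0..1}" "{0,1}"] unfolding a b S by auto
  have "{0<..1} = {0..1} - {0::real}" by auto
  then have 2: "S - {a} = g ` {0<..1}"
    using inj_on_image_set_diff[OF inj, of "{0..1}" "{0}"] unfolding a b S by auto
  show "connected (S - {a, b})" unfolding 1
    by (rule connected_continuous_image[OF continuous_on_subset[OF cont]]) auto
  show "connected (S - {a})" unfolding 2
    by (rule connected_continuous_image[OF continuous_on_subset[OF cont]]) auto
  show "S - {a,b} \<noteq> {}" unfolding 1 by auto
  have "g ` closure {0<..<1} \<subseteq> closure (g ` {0<..<1})"
    by (rule continuous_image_closure_subset[of "{0..1}"]) (use cont in auto)
  then have "S \<subseteq> closure (S - {a,b})" using closure_greaterThanLessThan[of 0 "1::real"] 1 S by simp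
  moreover have "closure (S - {a,b}) \<subseteq> S"
    using arc_set_closed[OF assms] closure_minimal[of "S - {a,b}" S] by blast
  ultimately show "closure (S - {a, b}) = S" by blast
qed

lemma arc_set_image:
  assumes "arc_set S a b" "continuous_on S f" "inj_on f S"
  shows "arc_set (f ` S) (f a) (f b)"
proof -
  obtain g where g: "arc g" "pathstart g = a" "pathfinish g = b" "path_image g = S"
    using assms(1) unfolding arc_set_def by metis
  have "continuous_on {0..1} (f \<circ> g)"
    using g(1,4) assms(2) unfolding arc_def path_def path_image_def
    by (intro continuous_on_compose) auto
  moreover have "inj_on (f \<circ> g) {0..1}"
    using g(1,4) assms(3) unfolding arc_def path_image_def by (intro comp_inj_on) auto
  ultimately have "arc (f \<circ> g)" unfolding arc_def path_def by blast
  then show ?thesis unfolding arc_set_def using g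
    by (metis path_image_compose pathfinish_compose pathstart_compose)
qed

section \<open>Jordan curves and their two sides\<close>

definition jordan :: "complex set \<Rightarrow> bool" where
  "jordan J \<longleftrightarrow> (\<exists>c. simple_path c \<and> pathfinish c = pathstart c \<and> path_image c = J)"

lemma jordan_arcs:
  assumes "arc_set S a b" "arc_set T a b" "S \<inter> T = {a, b}"
  shows "jordan (S \<union> T)"
proof -
  obtain g h where g: "arc g" "pathstart g = a" "pathfinish g = b" "path_image g = S"
    and h: "arc h" "pathstart h = a" "pathfinish h = b" "path_image h = T"
    using assms unfolding arc_set_def by metis
  have "simple_path (g +++ reversepath h)"
    using g h assms(3) by (intro simple_path_join_loop) (auto simp: arc_reversepath)
  then show ?thesis unfolding jordan_def
    apply (intro exI[of _ "g +++ reversepath h"]) using g h by (auto simp: path_image_join)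
qed

lemma jordan_facts:
  assumes "jordan J"
  shows "compact J" "inside J \<noteq> {}" "open (inside J)" "connected (inside J)"
    "outside J \<noteq> {}" "open (outside J)" "connected (outside J)" "bounded (inside J)"
    "inside J \<inter> outside J = {}" "inside J \<union> outside J = - J" "frontier (inside J) = J"
    "frontier (outside J) = J" "\<not> bounded (outside J)"
proof -
  obtain c where c: "simple_path c" "pathfinish c = pathstart c" "path_image c = J"
    using assms unfolding jordan_def by metis
  show "compact J" using c compact_simple_path_image by blast
  show "inside J \<noteq> {}" "open (inside J)" "connected (inside J)"
    "outside J \<noteq> {}" "open (outside J)" "connected (outside J)" "bounded (inside J)"
    "inside J \<inter> outside J = {}" "inside J \<union> outside J = - J" "frontier (inside J) = J"
    "frontier (outside J) = J" "\<not> bounded (outside J)"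
    using Jordan_inside_outside[OF c(1,2)] unfolding c(3) by auto
qed

text \<open>For a Jordan curve \<open>J\<close> and \<open>p\<close> off \<open>J\<close>, this is the side of \<open>J\<close> opposite to \<open>p\<close>; naming a
  side by a point off it treats the inside and the outside alike.\<close>

definition away :: "complex set \<Rightarrow> complex \<Rightarrow> complex set" where
  "away J p = {z. z \<notin> J \<and> \<not> connected_component (- J) p z}"

text \<open>A connected set off \<open>J\<close> cannot meet both sides, since they are disjoint
  open sets covering the complement, and each side is itself connected.\<close>

lemma jordan_component:
  assumes J: "jordan J"
  shows "x \<in> inside J \<Longrightarrow> connected_component (- J) x z \<longleftrightarrow> z \<in> inside J"
    and "x \<in> outside J \<Longrightarrow> connected_component (- J) x z \<longleftrightarrow> z \<in> outside J"
proof -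
  note F = jordan_facts[OF J]
  have sub: "inside J \<subseteq> -J" "outside J \<subseteq> -J" using F(10) by blast+
  have sep: "\<not> connected_component (- J) x y" if "x \<in> inside J" "y \<in> outside J" for x y
  proof
    assume "connected_component (- J) x y"
    then obtain T where "connected T" "T \<subseteq> - J" "x \<in> T" "y \<in> T"
      unfolding connected_component_def by blast
    then show False using F(3,6,9,10) that connectedD[of T "inside J" "outside J"] by blast
  qed
  have dec: "z \<in> inside J \<or> z \<in> outside J" if "connected_component (- J) x z"
    using connected_component_in[OF that] F(10) by blast
  show "x \<in> inside J \<Longrightarrow> connected_component (- J) x z \<longleftrightarrow> z \<in> inside J"
    using sep[of x z] dec F(4) sub(1) unfolding connected_component_def by blast
  show "x \<in> outside J \<Longrightarrow> connected_component (- J) x z \<longleftrightarrow> z \<in> outside J"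
    using sep[of z x] dec F(7) sub(2) connected_component_sym[of "-J" x z] unfolding connected_component_def by blast
qed

lemma jordan_inside_subset:
  assumes "jordan J" "connected M" "M \<inter> J = {}" "m \<in> M" "m \<in> inside J"
  shows "M \<subseteq> inside J"
proof
  fix z assume "z \<in> M"
  then have "connected_component (- J) m z" unfolding connected_component_def using assms by blast
  then show "z \<in> inside J" using jordan_component(1)[OF assms(1,5)] by blast
qed

lemma away_cases:
  assumes "jordan J" "p \<notin> J"
  shows "(p \<in> outside J \<and> away J p = inside J) \<or> (p \<in> inside J \<and> away J p = outside J)"
proof -
  note F = jordan_facts[OF assms(1)] and C = jordan_component[OF assms(1)]
  have "p \<in> inside J \<or> p \<in> outside J" using F(10) assms(2) by blast
  then show ?thesis
  proof
    assume "p \<in> inside J"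
    moreover have "away J p = outside J" unfolding away_def
      using C(1)[OF \<open>p \<in> inside J\<close>] F(9,10) by blast
    ultimately show ?thesis by blast
  next
    assume "p \<in> outside J"
    moreover have "away J p = inside J" unfolding away_def
      using C(2)[OF \<open>p \<in> outside J\<close>] F(9,10) by blast
    ultimately show ?thesis by blast
  qed
qed

lemma away_facts:
  assumes "jordan J" "p \<notin> J"
  shows "open (away J p)" "connected (away J p)" "away J p \<noteq> {}" "away J p \<inter> J = {}" "p \<notin> away J p"
    "frontier (away J p) = J" "closure (away J p) = away J p \<union> J"
proof -
  note F = jordan_facts[OF assms(1)]
  have *: "open (away J p) \<and> connected (away J p) \<and> away J p \<noteq> {} \<and> away J p \<inter> J = {} \<and>
      p \<notin> away J p \<and> frontier (away J p) = J"
    using away_cases[OF assms]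
  proof
    assume a: "p \<in> outside J \<and> away J p = inside J"
    have "p \<notin> inside J" using a F(9) by blast
    then show ?thesis using a F(2,3,4,11) by (simp add: inside_no_overlap)
  next
    assume a: "p \<in> inside J \<and> away J p = outside J"
    have "p \<notin> outside J" using a F(9) by blast
    then show ?thesis using a F(5,6,7,12) by (simp add: outside_no_overlap)
  qed
  then show "open (away J p)" "connected (away J p)" "away J p \<noteq> {}" "away J p \<inter> J = {}" "p \<notin> away J p"
    and fr: "frontier (away J p) = J" by simp_all
  show "closure (away J p) = away J p \<union> J" using closure_Un_frontier[of "away J p"] fr by simp
qed

lemma away_connected_subset:
  assumes "connected M" "M \<inter> J = {}" "m \<in> M" "m \<in> away J p"
  shows "M \<subseteq> away J p"
proof
  fix z assume "z \<in> M"
  then have "connected_component (- J) m z" unfolding connected_component_def using assms by blast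
  then have "\<not> connected_component (- J) p z"
    using assms(4) connected_component_trans[of "-J" p z m] connected_component_sym[of "-J" m z]
    unfolding away_def by blast
  then show "z \<in> away J p" using \<open>z \<in> M\<close> assms(2) unfolding away_def by blast
qed

lemma away_sym: "p \<notin> J \<Longrightarrow> q \<in> away J p \<Longrightarrow> p \<in> away J q"
  unfolding away_def using connected_component_sym by fastforce

text \<open>There are only two sides: a point off \<open>J\<close> that is not across from
  \<open>p\<close> lies in the component of \<open>p\<close>, hence is separated from every
  \<open>q\<close> that is across from \<open>p\<close>.\<close>

lemma away_third:
  assumes "jordan J" "p \<notin> J" "q \<in> away J p" "z \<notin> J" "z \<notin> away J p"
  shows "z \<in> away J q"
proof -
  have pz: "connected_component (- J) z p"
    using assms(4,5) connected_component_sym[of "-J" p z] unfolding away_def by blast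
  have "\<not> connected_component (- J) q z"
  proof
    assume "connected_component (- J) q z"
    then have "connected_component (- J) q p" using pz connected_component_trans by blast
    then show False using assms(3) connected_component_sym[of "-J" q p] unfolding away_def by blast
  qed
  then show ?thesis using assms(4) unfolding away_def by blast
qed

lemma away_third':
  assumes "jordan J" "p \<notin> J" "q \<in> away J p" "z \<in> away J p"
  shows "z \<notin> away J q"
proof -
  have "connected_component (- J) q z" unfolding connected_component_def
    using away_facts(2,4)[OF assms(1,2)] assms(3,4) by blast
  then show ?thesis unfolding away_def by blast
qed

section \<open>Inversion and theta curves\<close>

lemma inversion_facts:
  fixes p :: complex
  defines "\<phi> \<equiv> \<lambda>z. inverse (z - p)"
  shows "inj \<phi>" "p \<notin> S \<Longrightarrow> continuous_on S \<phi>"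
  unfolding \<phi>_def by (auto simp: inj_on_def intro!: continuous_intros)

text \<open>Inversion at \<open>p\<close> sends points near \<open>p\<close> to infinity, so the
  side of \<open>p\<close> becomes unbounded and cannot go into the inside of the image curve. The
  opposite side, whichever it was, thus becomes the inside, where the splitting theorem for closed
  curves applies.\<close>

lemma away_inversion:
  fixes p :: complex
  defines "\<phi> \<equiv> \<lambda>z. inverse (z - p)"
  assumes J: "jordan J" "p \<notin> J" and J': "jordan (\<phi> ` J)" and z: "z \<noteq> p"
  shows "z \<in> away J p \<longleftrightarrow> \<phi> z \<in> inside (\<phi> ` J)"
proof -
  let ?W = "away J p" and ?U = "connected_component_set (- J) p"
  note inj = inversion_facts(1)[of p, folded \<phi>_def]
    and cont = inversion_facts(2)[of p, folded \<phi>_def]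
  note F = away_facts[OF J] and F' = jordan_facts[OF J']
  have oJ: "open (- J)" using jordan_facts(1)[OF J(1)] compact_imp_closed by blast
  have oU: "open ?U" using oJ open_connected_component by blast
  have pU: "p \<in> ?U" using J(2) by (simp add: connected_component_refl)
  have cU: "connected (?U - {p})" by (rule connected_open_delete) (auto simp: oU)
  have U_eq: "- J - {p} = (?U - {p}) \<union> ?W" "?U \<inter> ?W = {}"
    using connected_component_subset[of "-J" p] F(5) unfolding away_def by auto
  obtain r where r: "r > 0" "ball p r \<subseteq> ?U" using oU pU openE by blast
  have "norm (\<phi> w) \<le> inverse r" if "w \<in> ?W" for w
  proof -
    have "w \<notin> ball p r" using r U_eq(2) that by blast
    then have "r \<le> norm (w - p)" by (simp add: dist_norm norm_minus_commute)
    then show ?thesis unfolding \<phi>_def norm_inverse using r(1) le_imp_inverse_le by blast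
  qed
  have "\<not> bounded (\<phi> ` (?U - {p}))"
  proof
    assume "bounded (\<phi> ` (?U - {p}))"
    then obtain B where B: "\<And>z. z \<in> ?U - {p} \<Longrightarrow> norm (\<phi> z) \<le> B" unfolding bounded_iff by blast
    define t where "t = min (r/2) (inverse (2 * (\<bar>B\<bar> + 1)))"
    have t: "t > 0" "t < r" "t \<le> inverse (2 * (\<bar>B\<bar> + 1))" using r(1) unfolding t_def by auto
    have "p + of_real t \<in> ?U - {p}" using r(2) t by (auto simp: dist_norm subset_iff)
    then have "inverse t \<le> B" using B[of "p + of_real t"] t(1) unfolding \<phi>_def by (simp add: norm_inverse)
    moreover have "2 * (\<bar>B\<bar> + 1) \<le> inverse t"
      using le_imp_inverse_le[OF t(3) t(1)] by simp
    ultimately show False using abs_ge_self[of B] by (simp add: algebra_simps)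
  qed
  then have nU: "\<not> \<phi> ` (?U - {p}) \<subseteq> inside (\<phi> ` J)" using F'(8) bounded_subset by blast
  have conU: "connected (\<phi> ` (?U - {p}))"
    by (rule connected_continuous_image[OF cont cU]) auto
  have disU: "\<phi> ` (?U - {p}) \<inter> \<phi> ` J = {}" "\<phi> ` ?W \<inter> \<phi> ` J = {}"
    using inj U_eq(1) F(4) by (auto simp: inj_on_def)
  have Uout: "\<phi> ` (?U - {p}) \<inter> inside (\<phi> ` J) = {}"
    using jordan_inside_subset[OF J' conU disU(1)] nU by blast
  have conW: "connected (\<phi> ` ?W)" by (rule connected_continuous_image[OF cont F(2)]) (rule F(5))
  have "0 \<notin> \<phi> ` (- J - {p})" unfolding \<phi>_def by auto
  \<comment> \<open>\<open>0\<close> is the only value not taken away from \<open>p\<close>; the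
    convention \<open>inverse 0 = 0\<close> gives it to \<open>p\<close> itself. The inside, being
    open, contains other values.\<close>
  have sur: "\<exists>z. z \<noteq> p \<and> z \<notin> J \<and> \<phi> z = y" if "y \<noteq> 0" "y \<notin> \<phi> ` J" for y
    using that by (intro exI[of _ "p + inverse y"]) (auto simp: \<phi>_def image_iff)
  have "\<exists>y \<in> inside (\<phi> ` J). y \<noteq> 0"
  proof (rule ccontr)
    assume "\<not> ?thesis"
    then have "inside (\<phi> ` J) = {0}" using F'(2) by auto
    then show False using F'(3) not_open_singleton by metis
  qed
  then obtain y where y: "y \<in> inside (\<phi> ` J)" "y \<noteq> 0" by blast
  then obtain z0 where "z0 \<noteq> p" "z0 \<notin> J" "\<phi> z0 = y" using sur F'(10) by blast
  then have "z0 \<in> ?W" using U_eq(1) Uout y(1) by blast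
  then have "\<phi> ` ?W \<inter> inside (\<phi> ` J) \<noteq> {}" using y(1) \<open>\<phi> z0 = y\<close> by blast
  then have Win: "\<phi> ` ?W \<subseteq> inside (\<phi> ` J)"
    using jordan_inside_subset[OF J' conW disU(2)] by blast
  show ?thesis
  proof
    assume "z \<in> ?W" then show "\<phi> z \<in> inside (\<phi> ` J)" using Win by blast
  next
    assume *: "\<phi> z \<in> inside (\<phi> ` J)"
    then have "z \<notin> J" using F'(10) by blast
    then show "z \<in> ?W" using U_eq(1) Uout * z by blast
  qed
qed

text \<open>With \<open>p\<close> moved to infinity by inversion this is the splitting of the inside
  of a closed curve by an arc that runs through it.\<close>

lemma theta_split:
  assumes S: "arc_set S1 s t" "arc_set S2 s t" "arc_set S3 s t"
    and int: "S1 \<inter> S2 = {s, t}" "S1 \<inter> S3 = {s, t}" "S2 \<inter> S3 = {s, t}"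
    and p: "p \<notin> S1" "p \<notin> S2" "p \<notin> S3"
    and x: "x \<in> S3" "x \<in> away (S1 \<union> S2) p"
  shows "away (S1 \<union> S3) p \<inter> away (S2 \<union> S3) p = {}"
    "away (S1 \<union> S3) p \<union> away (S2 \<union> S3) p \<union> (S3 - {s, t}) = away (S1 \<union> S2) p"
proof -
  define \<phi> where "\<phi> = (\<lambda>z. inverse (z - p))"
  note inj = inversion_facts(1)[of p, folded \<phi>_def]
    and cont = inversion_facts(2)[of p, folded \<phi>_def]
  have A: "arc_set (\<phi> ` S1) (\<phi> s) (\<phi> t)" "arc_set (\<phi> ` S2) (\<phi> s) (\<phi> t)" "arc_set (\<phi> ` S3) (\<phi> s) (\<phi> t)"
    using S cont p inj by (auto intro!: arc_set_image inj_on_subset[OF inj])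
  have I: "\<phi> ` S1 \<inter> \<phi> ` S2 = {\<phi> s, \<phi> t}" "\<phi> ` S1 \<inter> \<phi> ` S3 = {\<phi> s, \<phi> t}" "\<phi> ` S2 \<inter> \<phi> ` S3 = {\<phi> s, \<phi> t}"
    using int image_Int[OF inj] by (metis image_empty image_insert)+
  have J: "jordan (S1 \<union> S2)" "jordan (S1 \<union> S3)" "jordan (S2 \<union> S3)"
    using S int jordan_arcs by blast+
  have J': "jordan (\<phi> ` (S1 \<union> S2))" "jordan (\<phi> ` (S1 \<union> S3))" "jordan (\<phi> ` (S2 \<union> S3))"
    using jordan_arcs A I unfolding image_Un by blast+
  have E: "z \<in> away (S1 \<union> S2) p \<longleftrightarrow> \<phi> z \<in> inside (\<phi> ` (S1 \<union> S2))"
      "z \<in> away (S1 \<union> S3) p \<longleftrightarrow> \<phi> z \<in> inside (\<phi> ` (S1 \<union> S3))"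
      "z \<in> away (S2 \<union> S3) p \<longleftrightarrow> \<phi> z \<in> inside (\<phi> ` (S2 \<union> S3))" if "z \<noteq> p" for z
    using away_inversion[of "S1 \<union> S2" p z] away_inversion[of "S1 \<union> S3" p z] away_inversion[of "S2 \<union> S3" p z]
      J J' p that unfolding \<phi>_def by auto
  have x': "\<phi> ` S3 \<inter> inside (\<phi> ` S1 \<union> \<phi> ` S2) \<noteq> {}"
    using E(1)[of x] x p unfolding image_Un by blast
  obtain c1 c2 c where
     c1: "arc c1" "pathstart c1 = \<phi> s" "pathfinish c1 = \<phi> t" "path_image c1 = \<phi> ` S1"
    and c2: "arc c2" "pathstart c2 = \<phi> s" "pathfinish c2 = \<phi> t" "path_image c2 = \<phi> ` S2"
    and c: "arc c" "pathstart c = \<phi> s" "pathfinish c = \<phi> t" "path_image c = \<phi> ` S3"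
    using A unfolding arc_set_def by metis
  have st: "\<phi> s \<noteq> \<phi> t" using arc_set_ends[OF A(1)] by blast
  have T: "inside (\<phi> ` S1 \<union> \<phi> ` S3) \<inter> inside (\<phi> ` S2 \<union> \<phi> ` S3) = {}"
    "inside (\<phi> ` S1 \<union> \<phi> ` S3) \<union> inside (\<phi> ` S2 \<union> \<phi> ` S3) \<union> (\<phi> ` S3 - {\<phi> s, \<phi> t}) = inside (\<phi> ` S1 \<union> \<phi> ` S2)"
    using split_inside_simple_closed_curve[OF arc_imp_simple_path[OF c1(1)] c1(2,3) arc_imp_simple_path[OF c2(1)] c2(2,3)
        arc_imp_simple_path[OF c(1)] c(2,3) st] I x' c1(4) c2(4) c(4) by metis+
  have np: "p \<notin> away (S1 \<union> S3) p" "p \<notin> away (S2 \<union> S3) p" "p \<notin> away (S1 \<union> S2) p"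
    using away_facts(5) J p by auto
  show "away (S1 \<union> S3) p \<inter> away (S2 \<union> S3) p = {}"
  proof (rule equals0I)
    fix z assume z: "z \<in> away (S1 \<union> S3) p \<inter> away (S2 \<union> S3) p"
    then have "z \<noteq> p" using np by blast
    then show False using z E(2,3)[of z] T(1) unfolding image_Un by auto
  qed
  have S3: "z \<in> S3 - {s,t} \<longleftrightarrow> \<phi> z \<in> \<phi> ` S3 - {\<phi> s, \<phi> t}" for z
    using inj by (auto simp: inj_on_def)
  have "z \<in> away (S1 \<union> S3) p \<union> away (S2 \<union> S3) p \<union> (S3 - {s, t}) \<longleftrightarrow> z \<in> away (S1 \<union> S2) p" for z
  proof (cases "z = p")
    case True then show ?thesis using np p by blast
  next
    case False
    have "\<phi> z \<in> inside (\<phi> ` S1 \<union> \<phi> ` S3) \<or> \<phi> z \<in> inside (\<phi> ` S2 \<union> \<phi> ` S3) \<or> z \<in> S3 - {s, t}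
        \<longleftrightarrow> \<phi> z \<in> inside (\<phi> ` S1 \<union> \<phi> ` S2)"
      unfolding T(2)[symmetric] S3 by simp
    then show ?thesis using E[OF False] unfolding image_Un Un_iff by simp
  qed
  then show "away (S1 \<union> S3) p \<union> away (S2 \<union> S3) p \<union> (S3 - {s, t}) = away (S1 \<union> S2) p" by blast
qed

text \<open>Seen from any point off a theta curve, one of the three arcs lies behind the other two.
  If it is not the third, look from a point \<open>q\<close> across \<open>S1 \<union> S2\<close>:
  from there \<open>S3\<close> cuts the side of \<open>p\<close> into two parts, and the arc that
  does not bound the part of \<open>p\<close> is across from \<open>p\<close>.\<close>

lemma theta_one_inside:
  assumes S: "arc_set S1 s t" "arc_set S2 s t" "arc_set S3 s t"
    and int: "S1 \<inter> S2 = {s, t}" "S1 \<inter> S3 = {s, t}" "S2 \<inter> S3 = {s, t}"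
    and p: "p \<notin> S1" "p \<notin> S2" "p \<notin> S3"
    and x: "x1 \<in> S1 - {s,t}" "x2 \<in> S2 - {s,t}" "x3 \<in> S3 - {s,t}"
    and n3: "x3 \<notin> away (S1 \<union> S2) p"
  shows "x2 \<in> away (S1 \<union> S3) p \<or> x1 \<in> away (S2 \<union> S3) p"
proof -
  have J: "jordan (S1 \<union> S2)" "jordan (S1 \<union> S3)" "jordan (S2 \<union> S3)"
    using S int jordan_arcs by blast+
  obtain q where q: "q \<in> away (S1 \<union> S2) p" using away_facts(3)[OF J(1)] p by blast
  have qn: "q \<notin> S1 \<union> S2" using q away_facts(4)[OF J(1)] p by blast
  have qS3: "q \<notin> S3"
  proof
    assume "q \<in> S3"
    then have "S3 - {s,t} \<subseteq> away (S1 \<union> S2) p"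
      using away_connected_subset[OF arc_set_interior(1)[OF S(3)], of "S1 \<union> S2" q p] int qn q by blast
    then show False using x n3 by blast
  qed
  have x3q: "x3 \<in> away (S1 \<union> S2) q"
    using away_third[OF J(1) _ q] x int n3 p by blast
  have pq: "p \<in> away (S1 \<union> S2) q" using away_sym q p by blast
  note T = theta_split[OF S int, of q x3]
  have T: "away (S1 \<union> S3) q \<union> away (S2 \<union> S3) q \<union> (S3 - {s, t}) = away (S1 \<union> S2) q"
    using T(2) qn qS3 x3q x by blast
  have nx: "x1 \<notin> away (S1 \<union> S2) q" "x2 \<notin> away (S1 \<union> S2) q"
    using away_facts(4)[OF J(1), of q] qn x by blast+
  from T pq p consider "p \<in> away (S1 \<union> S3) q" | "p \<in> away (S2 \<union> S3) q" by blast
  then show ?thesis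
  proof cases
    case 1
    have "x2 \<in> away (S1 \<union> S3) p"
      by (rule away_third[OF J(2) _ 1]) (use T nx x int qn qS3 in blast)+
    then show ?thesis by blast
  next
    case 2
    have "x1 \<in> away (S2 \<union> S3) p"
      by (rule away_third[OF J(3) _ 2]) (use T nx x int qn qS3 in blast)+
    then show ?thesis by blast
  qed
qed

text \<open>\<open>M\<close> stays in one of the two parts into which \<open>S3\<close> cuts the
  side, and the closure of either part misses the inner points of \<open>S1\<close> or those of
  \<open>S2\<close>.\<close>

lemma theta_no_crossing:
  assumes S: "arc_set S1 s t" "arc_set S2 s t" "arc_set S3 s t"
    and int: "S1 \<inter> S2 = {s, t}" "S1 \<inter> S3 = {s, t}" "S2 \<inter> S3 = {s, t}"
    and p: "p \<notin> S1" "p \<notin> S2" "p \<notin> S3"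
    and x: "x \<in> S3" "x \<in> away (S1 \<union> S2) p"
    and a: "a \<in> S1 - {s,t}" "b \<in> S2 - {s,t}"
    and M: "connected M" "M \<inter> (S1 \<union> S2 \<union> S3) = {}" "m \<in> M" "m \<in> away (S1 \<union> S2) p"
      "a \<in> closure M" "b \<in> closure M"
  shows False
proof -
  note T = theta_split[OF S int p x]
  have J: "jordan (S1 \<union> S2)" "jordan (S1 \<union> S3)" "jordan (S2 \<union> S3)"
    using S int jordan_arcs by blast+
  have nin: "a \<notin> away (S1 \<union> S2) p" "b \<notin> away (S1 \<union> S2) p"
    using away_facts(4)[OF J(1), of p] p a by blast+
  from T(2) M(2,3,4) consider "m \<in> away (S1 \<union> S3) p" | "m \<in> away (S2 \<union> S3) p" by blast
  then show False
  proof cases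
    case 1
    then have "M \<subseteq> away (S1 \<union> S3) p" using away_connected_subset[OF M(1) _ M(3)] M(2) by blast
    then have "b \<in> away (S1 \<union> S3) p \<union> (S1 \<union> S3)"
      using away_facts(7)[OF J(2), of p] p M(6) closure_mono by blast
    then show False using a int T(2) nin by blast
  next
    case 2
    then have "M \<subseteq> away (S2 \<union> S3) p" using away_connected_subset[OF M(1) _ M(3)] M(2) by blast
    then have "a \<in> away (S2 \<union> S3) p \<union> (S2 \<union> S3)"
      using away_facts(7)[OF J(3), of p] p M(5) closure_mono by blast
    then show False using a int T(2) nin by blast
  qed
qed

section \<open>Collapsing an arc and crosscuts\<close>

text \<open>Inversion at the end \<open>s\<close> turns the arc into a closed connected set
  \<open>L\<close> running to infinity, so its complement is simply connected and homeomorphic to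
  the plane by some \<open>k\<close>. A point approaching the arc leaves every compact subset of
  that complement, so its \<open>k\<close>-image tends to infinity; a second inversion brings this
  limit to \<open>0\<close>.\<close>

lemma collapse_arc:
  assumes D: "arc_set D s t"
  obtains f :: "complex \<Rightarrow> complex" where "continuous_on UNIV f"
    "\<And>x y. f x = f y \<longleftrightarrow> x = y \<or> (x \<in> D \<and> y \<in> D)"
proof -
  define g where "g = (\<lambda>z::complex. inverse (z - s))"
  note inj = inversion_facts(1)[of s, folded g_def]
    and cont = inversion_facts(2)[of s, folded g_def]
  have gg: "g (s + inverse w) = w" for w unfolding g_def by simp
  have gg': "s + inverse (g w) = w" for w unfolding g_def by simp
  have g0: "g w = 0 \<longleftrightarrow> w = s" for w unfolding g_def by simp
  define L where "L = g ` (D - {s})"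
  define \<Omega> where "\<Omega> = - L"
  have cD: "compact D" and ends: "s \<in> D" "t \<in> D" "s \<noteq> t" using arc_set_compact arc_set_ends D by auto
  have "\<exists>M>0. \<forall>z\<in>D. norm (z - s) \<le> M"
  proof -
    have "bounded ((\<lambda>z. z - s) ` D)" using cD
      by (intro compact_imp_bounded compact_continuous_image continuous_intros)
    then show ?thesis using bounded_pos by (metis (no_types, lifting) image_eqI)
  qed
  then obtain M where M: "M > 0" "\<And>z. z \<in> D \<Longrightarrow> norm (z - s) \<le> M" by blast
  \<comment> \<open>Closedness of \<open>L\<close>: since \<open>D\<close> is bounded,
    \<open>L\<close> keeps a distance from \<open>0\<close>, and there the inverse map is
    continuous.\<close>
  have L_eq: "L = {w. inverse M \<le> norm w} \<inter> (\<lambda>w. s + inverse w) -` D"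
  proof (intro equalityI subsetI)
    fix w assume "w \<in> L"
    then obtain z where z: "z \<in> D" "z \<noteq> s" "w = g z" unfolding L_def by blast
    have "norm (z - s) \<le> M" using M(2) z(1) .
    then have "inverse M \<le> inverse (norm (z - s))" using z(2) by (simp add: le_imp_inverse_le)
    then show "w \<in> {w. inverse M \<le> norm w} \<inter> (\<lambda>w. s + inverse w) -` D"
      using z gg' by (simp add: g_def norm_inverse)
  next
    fix w assume w: "w \<in> {w. inverse M \<le> norm w} \<inter> (\<lambda>w. s + inverse w) -` D"
    then have "w \<noteq> 0" using M(1) by auto
    then have "s + inverse w \<in> D - {s}" using w by auto
    then show "w \<in> L" unfolding L_def using gg[of w] by (metis image_eqI)
  qed
  have clL: "closed L" unfolding L_eq
  proof (rule continuous_closed_preimage)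
    show "continuous_on {w. inverse M \<le> norm w} (\<lambda>w. s + inverse w)"
      using M(1) by (intro continuous_intros) auto
    show "closed {w::complex. inverse M \<le> norm w}" by (intro closed_Collect_le continuous_intros)
    show "closed D" using cD compact_imp_closed by blast
  qed
  have opO: "open \<Omega>" unfolding \<Omega>_def using clL by auto
  have conL: "connected L" unfolding L_def
    by (rule connected_continuous_image[OF cont]) (use arc_set_interior(2)[OF D] in auto)
  have unbL: "\<not> bounded L"
  proof
    assume "bounded L"
    then obtain B where B: "B > 0" "\<And>w. w \<in> L \<Longrightarrow> norm w \<le> B" unfolding bounded_pos by blast
    have "s \<in> closure (D - {s,t})" using arc_set_interior(3)[OF D] ends by simp
    then obtain z where z: "z \<in> D - {s,t}" "dist z s < inverse (B + 1)"
      using B(1) closure_approachable[of s "D - {s,t}"] by (metis add_pos_pos inverse_positive_iff_positive zero_less_one)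
    have "norm (g z) \<le> B" using B(2) z(1) unfolding L_def by blast
    moreover have "B + 1 \<le> norm (g z)"
      using z le_imp_inverse_le[of "norm (z - s)" "inverse (B+1)"] B(1)
      unfolding g_def norm_inverse by (auto simp: dist_norm)
    ultimately show False by simp
  qed
  \<comment> \<open>The extra point \<open>0\<close> is the image of infinity; it fills the puncture
    that would spoil simple connectedness.\<close>
  have O_eq: "\<Omega> = insert 0 (g ` (- D))"
  proof (intro equalityI subsetI)
    fix w assume w: "w \<in> \<Omega>"
    show "w \<in> insert 0 (g ` (- D))"
    proof (cases "w = 0")
      case False
      then have "s + inverse w \<notin> D" using w gg[of w] unfolding \<Omega>_def L_def by (force simp: image_iff)
      then show ?thesis using gg[of w] by (metis ComplI image_eqI insertI2)
    qed simp
  next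
    fix w assume "w \<in> insert 0 (g ` (- D))"
    then show "w \<in> \<Omega>" unfolding \<Omega>_def L_def using inj g0 by (auto simp: inj_on_def)
  qed
  have conD: "connected (- D)"
    using D unfolding arc_set_def by (metis connected_arc_complement DIM_complex order_refl)
  have con1: "connected (g ` (- D))" by (rule connected_continuous_image[OF cont conD]) (use ends in auto)
  have "0 \<in> closure (g ` (- D))"
  proof -
    have "\<Omega> - {0} = g ` (- D)" unfolding O_eq using g0 ends by auto
    moreover have "0 \<in> closure (\<Omega> - {0})"
      using opO O_eq islimpt_approachable by (metis insertI1 interior_limit_point interior_open islimpt_in_closure)
    ultimately show ?thesis by simp
  qed
  then have conO: "connected \<Omega>" unfolding O_eq
    using connected_intermediate_closure[OF con1] closure_subset by (metis insert_subset subset_insertI)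
  have "L \<noteq> {}" using unbL by auto
  then have "components (- \<Omega>) = {L}" unfolding \<Omega>_def using conL components_eq_sing_iff[of L] by simp
  then have "simply_connected \<Omega>"
    using simply_connected_eq_unbounded_complement_components[OF opO] conO unbL by auto
  then have "\<Omega> homeomorphic ball (0::complex) 1"
    using simply_connected_eq_homeomorphic_to_disc[OF opO] O_eq by auto
  then have "\<Omega> homeomorphic (UNIV :: complex set)"
    using homeomorphic_ball_UNIV[of 1 "0::complex"] homeomorphic_trans by auto
  then obtain k k' :: "complex \<Rightarrow> complex" where k: "homeomorphism \<Omega> UNIV k k'"
    unfolding homeomorphic_def by metis
  have k1: "continuous_on \<Omega> k" "continuous_on UNIV k'" "\<And>x. x \<in> \<Omega> \<Longrightarrow> k' (k x) = x" "\<And>y. k (k' y) = y" "\<And>y. k' y \<in> \<Omega>"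
    using k unfolding homeomorphism_def by auto
  have O0: "0 \<in> \<Omega>" and Og: "\<And>z. z \<notin> D \<Longrightarrow> g z \<in> \<Omega>" unfolding O_eq by auto
  \<comment> \<open>Subtracting \<open>k 0\<close>, the value belonging to infinity, makes
    \<open>h\<close> nonzero off \<open>D\<close>, so that its inverse is defined and injective
    there.\<close>
  define h where "h = (\<lambda>z. k (g z) - k 0)"
  have h0: "h z \<noteq> 0" if "z \<notin> D" for z
    using that k1(3) Og O0 g0 ends unfolding h_def by (metis right_minus_eq)
  define f where "f = (\<lambda>z. if z \<in> D then 0 else inverse (h z))"
  have cf: "continuous_on (- D) (\<lambda>z. inverse (h z))"
  proof (intro continuous_intros ballI)
    show "continuous_on (- D) h" unfolding h_def
      by (intro continuous_intros continuous_on_compose2[OF k1(1)] cont) (use Og ends in auto)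
  qed (use h0 in auto)
  have at: "isCont f z" for z
  proof (cases "z \<in> D")
    case False
    have "open (- D)" using cD compact_imp_closed by blast
    have "continuous_on (- D) f"
      by (rule continuous_on_eq[OF cf]) (simp add: f_def)
    then show ?thesis using False \<open>open (- D)\<close> continuous_on_eq_continuous_at by blast
  next
    case True
    show ?thesis unfolding isCont_def tendsto_iff
    proof (intro allI impI)
      fix \<epsilon> :: real assume e: "\<epsilon> > 0"
      define K where "K = k' ` cball (k 0) (inverse \<epsilon>)"
      have cK: "compact K" unfolding K_def
        by (intro compact_continuous_image continuous_on_subset[OF k1(2)]) auto
      have KO: "K \<subseteq> \<Omega>" unfolding K_def using k1(5) by auto
      obtain B where B: "B > 0" "\<And>w. w \<in> K \<Longrightarrow> norm w \<le> B"
        using compact_imp_bounded[OF cK] unfolding bounded_pos by blast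
      \<comment> \<open>The points off \<open>D\<close> where \<open>f\<close> may still be large
        lie in \<open>T\<close>, a closed set that misses \<open>D\<close>. The bound on the
        distance from \<open>s\<close> excludes \<open>s\<close> itself: by convention
        \<open>g s = 0\<close>, and \<open>0\<close> belongs to \<open>K\<close>.\<close>
      define T where "T = {w. inverse B \<le> norm (w - s)} \<inter> g -` K"
      have clT: "closed T" unfolding T_def
      proof (rule continuous_closed_preimage)
        show "continuous_on {w. inverse B \<le> norm (w - s)} g" using B(1) by (intro cont) auto
        show "closed {w. inverse B \<le> norm (w - s)}" by (intro closed_Collect_le continuous_intros)
      qed (use cK compact_imp_closed in auto)
      have inT: "w \<in> T" if "w \<noteq> s" "g w \<in> K" for w
      proof -
        have "inverse (norm (w - s)) \<le> B" using B(2)[OF that(2)] by (simp add: g_def norm_inverse)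
        then have "inverse B \<le> norm (w - s)"
          using le_imp_inverse_le[of "inverse (norm (w - s))" B] that(1) by simp
        then show ?thesis using that unfolding T_def by simp
      qed
      have "z \<notin> T"
      proof
        assume "z \<in> T"
        then have "z \<noteq> s" using B(1) unfolding T_def by auto
        then have "g z \<in> L" using True unfolding L_def by blast
        moreover have "g z \<in> \<Omega>" using \<open>z \<in> T\<close> KO unfolding T_def by blast
        ultimately show False unfolding \<Omega>_def by blast
      qed
      then have ev: "\<forall>\<^sub>F w in at z. w \<in> - T"
        using clT open_Compl eventually_at_in_open' by blast
      have small: "dist (f w) (f z) < \<epsilon>" if "w \<in> - T" for w
      proof (cases "w \<in> D")
        case True then show ?thesis using \<open>z \<in> D\<close> e unfolding f_def by simp
      next
        case False
        then have "g w \<notin> K" using inT[of w] that ends by auto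
        moreover have "k' (k (g w)) = g w" using k1(3) Og False by blast
        ultimately have "k (g w) \<notin> cball (k 0) (inverse \<epsilon>)" unfolding K_def by force
        then have *: "inverse \<epsilon> < norm (h w)" unfolding h_def by (simp add: dist_norm norm_minus_commute)
        then have "inverse (norm (h w)) < \<epsilon>"
          using less_imp_inverse_less[OF *] e by simp
        then show ?thesis using \<open>z \<in> D\<close> False unfolding f_def by (simp add: norm_inverse)
      qed
      show "\<forall>\<^sub>F w in at z. dist (f w) (f z) < \<epsilon>" using ev by (rule eventually_mono) (rule small)
    qed
  qed
  have injf: "f x = f y \<longleftrightarrow> x = y \<or> (x \<in> D \<and> y \<in> D)" for x y
  proof -
    have *: "x = y" if "x \<notin> D" "y \<notin> D" "h x = h y"
    proof -
      have "k (g x) = k (g y)" using that(3) unfolding h_def by simp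
      then have "g x = g y" using k1(3)[OF Og[OF that(1)]] k1(3)[OF Og[OF that(2)]] by metis
      then show "x = y" using inj by (simp add: inj_on_def)
    qed
    show ?thesis
    proof (cases "x \<in> D")
      case True
      then show ?thesis using h0[of y] ends unfolding f_def by (cases "y \<in> D") auto
    next
      case False
      then show ?thesis using h0[of x] * unfolding f_def by (cases "y \<in> D") auto
    qed
  qed
  show ?thesis using that[of f] at injf continuous_at_imp_continuous_on by blast
qed

text \<open>A segment from a point of the side to a nearest point of \<open>J\<close> cannot meet
  \<open>J\<close> earlier. The end point cannot be prescribed, but starting close to
  \<open>q\<close> keeps it outside \<open>K\<close>.\<close>

lemma accessible_boundary_point:
  assumes J: "jordan J" "p \<notin> J" and q: "q \<in> J" "closed K" "q \<notin> K"
  obtains w z where "w \<in> away J p" "z \<in> J" "z \<notin> K" "closed_segment w z \<subseteq> away J p \<union> {z}"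
proof -
  have cl: "closure (away J p) = away J p \<union> J" using away_facts[OF J] by simp
  obtain r where r: "r > 0" "ball q r \<inter> K = {}"
    using q(2,3) by (metis ComplI disjoint_eq_subset_Compl open_Compl openE)
  have "q \<in> closure (away J p)" using cl q(1) by blast
  \<comment> \<open>Half the radius, because \<open>z\<close> is at most twice as far from
    \<open>q\<close> as \<open>w\<close> is.\<close>
  then obtain w where w: "w \<in> away J p" "dist w q < r/2"
    using closure_approachable r(1) by (metis half_gt_zero)
  have "closed J" using jordan_facts(1)[OF J(1)] compact_imp_closed by blast
  then obtain z where z: "z \<in> J" "\<And>y. y \<in> J \<Longrightarrow> dist w z \<le> dist w y"
    using distance_attains_inf[of J w] q(1) by blast
  have "dist w z \<le> dist w q" using z(2) q(1) by blast
  moreover have "dist q z \<le> dist w q + dist w z" using dist_triangle3[of q z w] .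
  ultimately have "z \<in> ball q r" using w(2) by simp
  then have zK: "z \<notin> K" using r(2) by blast
  have wz: "w \<noteq> z" using w(1) z(1) away_facts(4)[OF J] by blast
  have "closed_segment w z - {z} \<subseteq> away J p"
  proof (rule away_connected_subset)
    show "connected (closed_segment w z - {z})"
    proof -
      have "arc_set (closed_segment w z) z w" unfolding arc_set_def
        using wz by (intro exI[of _ "linepath z w"]) (simp add: closed_segment_commute)
      then show ?thesis using arc_set_interior(2) by blast
    qed
    show "(closed_segment w z - {z}) \<inter> J = {}"
    proof (rule equals0I)
      fix y assume y: "y \<in> (closed_segment w z - {z}) \<inter> J"
      then have "dist w z \<le> dist w y" using z(2) by blast
      moreover have "dist w y < dist w z"
      proof -
        have "y \<noteq> w" using y w(1) away_facts(4)[OF J] by blast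
        then have "y \<in> open_segment w z" using y by (auto simp: open_segment_def)
        then show ?thesis using dist_in_open_segment[of y w z] by (simp add: dist_commute)
      qed
      ultimately show False by simp
    qed
    show "w \<in> closed_segment w z - {z}" using wz by simp
    show "w \<in> away J p" by (rule w(1))
  qed
  then show ?thesis using that w(1) z(1) zK by blast
qed

text \<open>Two straight approaches are joined through the side and an arc is extracted from the
  path. The last hypothesis makes the windows \<open>J - K\<close> and \<open>J - K'\<close>
  disjoint, so that the two ends differ.\<close>

lemma crosscut:
  assumes J: "jordan J" "p \<notin> J" and q: "q \<in> J" "closed K" "q \<notin> K" and q': "q' \<in> J" "closed K'" "q' \<notin> K'"
    and KK: "- K \<inter> - K' \<inter> J = {}"
  obtains D z z' where "arc_set D z z'" "D \<subseteq> away J p \<union> {z, z'}" "z \<in> J - K" "z' \<in> J - K'"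
proof -
  obtain w z where w: "w \<in> away J p" "z \<in> J" "z \<notin> K" "closed_segment w z \<subseteq> away J p \<union> {z}"
    using accessible_boundary_point[OF J q] by blast
  obtain w' z' where w': "w' \<in> away J p" "z' \<in> J" "z' \<notin> K'" "closed_segment w' z' \<subseteq> away J p \<union> {z'}"
    using accessible_boundary_point[OF J q'] by blast
  have "path_connected (away J p)"
    using away_facts(1,2)[OF J] connected_open_path_connected by blast
  then obtain g where g: "path g" "path_image g \<subseteq> away J p" "pathstart g = w" "pathfinish g = w'"
    using w(1) w'(1) unfolding path_connected_def by blast
  let ?P = "linepath z w +++ g +++ linepath w' z'"
  have P: "path ?P" "pathstart ?P = z" "pathfinish ?P = z'" using g by auto
  have PI: "path_image ?P \<subseteq> away J p \<union> {z, z'}"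
    using g w(4) w'(4) by (auto simp: path_image_join closed_segment_commute)
  have "z \<noteq> z'" using w w' KK by blast
  then obtain c where "arc c" "path_image c \<subseteq> path_image ?P" "pathstart c = z" "pathfinish c = z'"
    using path_contains_arc[OF P] by metis
  then show ?thesis using that[of "path_image c" z z'] w w' PI unfolding arc_set_def by blast
qed

section \<open>Drawings of graphs\<close>

text \<open>This is \<open>plane_drawing\<close> with arcs as point sets; since
  \<open>{x, y} = {y, x}\<close>, every arc is available in both directions.\<close>

definition drawn :: "'a set \<Rightarrow> 'a set set \<Rightarrow> ('a \<Rightarrow> complex) \<Rightarrow> ('a set \<Rightarrow> complex set) \<Rightarrow> bool" where
  "drawn V E p \<Gamma> \<longleftrightarrow> inj_on p V \<and>
     (\<forall>x y. {x, y} \<in> E \<longrightarrow> arc_set (\<Gamma> {x, y}) (p x) (p y)) \<and>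
     (\<forall>e\<in>E. \<Gamma> e \<inter> p ` V = p ` e) \<and>
     (\<forall>e\<in>E. \<forall>e'\<in>E. e \<noteq> e' \<longrightarrow> \<Gamma> e \<inter> \<Gamma> e' = p ` (e \<inter> e'))"

definition drawable :: "'a set \<Rightarrow> 'a set set \<Rightarrow> bool" where
  "drawable V E \<longleftrightarrow> (\<exists>p \<Gamma>. drawn V E p \<Gamma>)"

lemma drawnD:
  assumes "drawn V E p \<Gamma>"
  shows "inj_on p V" "\<And>x y. {x, y} \<in> E \<Longrightarrow> arc_set (\<Gamma> {x, y}) (p x) (p y)"
    "\<And>e. e \<in> E \<Longrightarrow> \<Gamma> e \<inter> p ` V = p ` e"
    "\<And>e e'. e \<in> E \<Longrightarrow> e' \<in> E \<Longrightarrow> e \<noteq> e' \<Longrightarrow> \<Gamma> e \<inter> \<Gamma> e' = p ` (e \<inter> e')"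
  using assms unfolding drawn_def by auto

lemma simple_graph_edge:
  assumes "simple_graph (V, E)" "{x, y} \<in> E"
  shows "x \<in> V" "y \<in> V" "x \<noteq> y"
  using assms unfolding simple_graph_def by (fastforce simp: doubleton_eq_iff)+

lemma simple_graph_edge_ex:
  assumes "simple_graph (V, E)" "e \<in> E"
  shows "\<exists>x y. e = {x, y} \<and> x \<in> V \<and> y \<in> V \<and> x \<noteq> y"
  using assms unfolding simple_graph_def fst_conv snd_conv by blast

lemma simple_graph_edge_subset: "simple_graph (V, E) \<Longrightarrow> e \<in> E \<Longrightarrow> e \<subseteq> V"
  using simple_graph_edge_ex by fastforce

lemma planar_drawable:
  assumes "simple_graph (V, E)"
  shows "planar (V, E) \<longleftrightarrow> drawable V E"
proof
  assume "planar (V, E)"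
  then obtain p \<gamma> where d: "plane_drawing (V, E) p \<gamma>" unfolding planar_def by blast
  have "drawn V E p (\<lambda>e. path_image (\<gamma> e))" unfolding drawn_def
  proof (intro conjI allI impI)
    fix x y assume xy: "{x, y} \<in> E"
    have "arc (\<gamma> {x,y})" "{pathstart (\<gamma> {x,y}), pathfinish (\<gamma> {x,y})} = {p x, p y}"
      using d xy unfolding plane_drawing_def by fastforce+
    then have "arc_set (path_image (\<gamma> {x,y})) (p x) (p y) \<or> arc_set (path_image (\<gamma> {x,y})) (p y) (p x)"
      unfolding arc_set_def doubleton_eq_iff by metis
    then show "arc_set (path_image (\<gamma> {x,y})) (p x) (p y)" using arc_set_sym by blast
  qed (use d in \<open>auto simp: plane_drawing_def\<close>)
  then show "drawable V E" unfolding drawable_def by blast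
next
  assume "drawable V E"
  then obtain p \<Gamma> where d: "drawn V E p \<Gamma>" unfolding drawable_def by blast
  have "\<exists>g. arc g \<and> {pathstart g, pathfinish g} = p ` e \<and> path_image g = \<Gamma> e" if eE: "e \<in> E" for e
  proof -
    obtain x y where "e = {x, y}" using simple_graph_edge_ex[OF assms eE] by blast
    then have "arc_set (\<Gamma> e) (p x) (p y)" using drawnD(2)[OF d, of x y] eE by simp
    then show ?thesis using \<open>e = {x, y}\<close> unfolding arc_set_def by auto
  qed
  then obtain \<gamma> where g: "\<And>e. e \<in> E \<Longrightarrow> arc (\<gamma> e) \<and> {pathstart (\<gamma> e), pathfinish (\<gamma> e)} = p ` e \<and> path_image (\<gamma> e) = \<Gamma> e"
    by metis
  have "plane_drawing (V, E) p \<gamma>" unfolding plane_drawing_def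
    using g drawnD(1,3,4)[OF d] by simp
  then show "planar (V, E)" unfolding planar_def by blast
qed

section \<open>Drawings after identifying two vertices\<close>

definition redirect :: "'a \<Rightarrow> 'a \<Rightarrow> 'a \<Rightarrow> 'a" where
  "redirect a b x = (if x = b then a else x)"

text \<open>As an image of a set it fuses the edges to a common neighbour into one. An edge
  \<open>{a, b}\<close> would become the singleton \<open>{a}\<close>, so it has to be removed
  beforehand.\<close>

definition identify :: "'a \<Rightarrow> 'a \<Rightarrow> 'a set set \<Rightarrow> 'a set set" where
  "identify a b E = (\<lambda>e. redirect a b ` e) ` E"

text \<open>The arc \<open>D\<close> plays the role of a fat vertex made of \<open>a\<close> and \<open>b\<close>; an edge at \<open>a\<close> or \<open>b\<close> may leave
  it anywhere, because \<open>D\<close> is shrunk to a point.\<close>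

lemma drawable_identify:
  assumes G: "simple_graph (V, F)" and p: "inj_on p V" and ab: "a \<in> V" "b \<in> V" "a \<noteq> b"
    and D: "arc_set D (p a) (p b)" "D \<inter> p ` V = {p a, p b}"
    and F: "{a, b} \<notin> F" "\<And>y. \<not> ({a, y} \<in> F \<and> {b, y} \<in> F)"
    and off: "\<And>x y. {x, y} \<in> F \<Longrightarrow> x \<notin> {a, b} \<Longrightarrow> y \<notin> {a, b} \<Longrightarrow> arc_set (\<Lambda> {x, y}) (p x) (p y) \<and> \<Lambda> {x, y} \<inter> D = {}"
    and at: "\<And>x y. {x, y} \<in> F \<Longrightarrow> x \<in> {a, b} \<Longrightarrow> \<exists>d\<in>D. arc_set (\<Lambda> {x, y}) d (p y) \<and> \<Lambda> {x, y} \<inter> D = {d}"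
    and V: "\<And>e. e \<in> F \<Longrightarrow> \<Lambda> e \<inter> p ` V \<subseteq> p ` e \<union> D"
    and cross: "\<And>e e'. e \<in> F \<Longrightarrow> e' \<in> F \<Longrightarrow> e \<noteq> e' \<Longrightarrow> \<Lambda> e \<inter> \<Lambda> e' \<subseteq> p ` (e \<inter> e') \<union> D"
  shows "drawable (V - {b}) (identify a b F)"
proof -
  let ?r = "redirect a b"
  obtain f :: "complex \<Rightarrow> complex" where f: "continuous_on UNIV f" "\<And>x y. f x = f y \<longleftrightarrow> x = y \<or> (x \<in> D \<and> y \<in> D)"
    using collapse_arc[OF D(1)] by blast
  have pD: "p a \<in> D" "p b \<in> D" using arc_set_ends[OF D(1)] by auto
  have fab: "f (p (?r x)) = f (p x)" for x using f(2) pD by (simp add: redirect_def)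
  define u where "u = inv_into F ((`) ?r)"
  have injr: "inj_on ((`) ?r) F"
  proof (rule inj_onI)
    fix e e' assume e: "e \<in> F" "e' \<in> F" "?r ` e = ?r ` e'"
    obtain x y where xy: "e = {x,y}" "x \<noteq> y" using simple_graph_edge_ex[OF G e(1)] by blast
    obtain x' y' where xy': "e' = {x',y'}" "x' \<noteq> y'" using simple_graph_edge_ex[OF G e(2)] by blast
    have "(?r x = ?r x' \<and> ?r y = ?r y') \<or> (?r x = ?r y' \<and> ?r y = ?r x')"
      using e(3) xy xy' by (simp add: doubleton_eq_iff)
    then show "e = e'" using e(1,2) xy xy' F(1) F(2)[of x] F(2)[of y] F(2)[of x'] F(2)[of y'] ab
      unfolding redirect_def by (auto split: if_splits simp: insert_commute)
  qed
  have u: "u e \<in> F" "?r ` u e = e" if "e \<in> identify a b F" for e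
    using that inv_into_into[of e "(`) ?r" F] f_inv_into_f[of e "(`) ?r" F] unfolding u_def identify_def by auto
  \<comment> \<open>This handles all collisions created by the collapse: points of two arcs that
    meet on \<open>D\<close> belong to edges at \<open>a\<close> or \<open>b\<close>, whose images
    share the merged vertex.\<close>
  have meets: "e \<inter> {a,b} \<noteq> {}" if eF: "e \<in> F" "\<Lambda> e \<inter> D \<noteq> {}" for e
  proof -
    obtain x y where xy: "e = {x,y}" using simple_graph_edge_ex[OF G eF(1)] by blast
    show ?thesis using off[of x y] eF xy by blast
  qed
  have arcs: "arc_set (f ` \<Lambda> {x,y}) (f (p x)) (f (p y))" if xy: "{x,y} \<in> F" for x y
  proof -
    have one: "arc_set (f ` \<Lambda> {x,y}) (f (p x)) (f (p y))" if xy: "{x,y} \<in> F" "x \<in> {a,b}" for x y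
    proof -
      obtain d where d: "d \<in> D" "arc_set (\<Lambda> {x, y}) d (p y)" "\<Lambda> {x, y} \<inter> D = {d}" using at[OF xy] by blast
      have "inj_on f (\<Lambda> {x,y})"
      proof (rule inj_onI)
        fix l l' assume "l \<in> \<Lambda> {x,y}" "l' \<in> \<Lambda> {x,y}" "f l = f l'"
        then show "l = l'" using f(2)[of l l'] d(3) by (metis IntI singletonD)
      qed
      then have "arc_set (f ` \<Lambda> {x,y}) (f d) (f (p y))"
        using arc_set_image[OF d(2) continuous_on_subset[OF f(1)]] by auto
      moreover have "f d = f (p x)" using f(2) d(1) pD xy(2) by auto
      ultimately show ?thesis by simp
    qed
    show ?thesis
    proof (cases "x \<in> {a,b} \<or> y \<in> {a,b}")
      case True
      then show ?thesis using one[of x y] one[of y x] xy arc_set_sym by (metis insert_commute)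
    next
      case False
      then have d: "arc_set (\<Lambda> {x, y}) (p x) (p y)" "\<Lambda> {x, y} \<inter> D = {}" using off[OF xy] by auto
      have "inj_on f (\<Lambda> {x,y})"
      proof (rule inj_onI)
        fix l l' assume "l \<in> \<Lambda> {x,y}" "l' \<in> \<Lambda> {x,y}" "f l = f l'"
        then show "l = l'" using f(2)[of l l'] d(2) by blast
      qed
      then show ?thesis using arc_set_image[OF d(1) continuous_on_subset[OF f(1)]] by auto
    qed
  qed
  let ?p = "\<lambda>x. f (p x)" and ?\<Gamma> = "\<lambda>e. f ` \<Lambda> (u e)"
  have endsL: "?p x \<in> f ` \<Lambda> e" if eF: "e \<in> F" "x \<in> e" for x e
  proof -
    obtain y z where yz: "e = {y,z}" using simple_graph_edge_ex[OF G eF(1)] by blast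
    show ?thesis using arcs[of y z] arc_set_ends eF yz by blast
  qed
  have image_r: "?p ` e = ?p ` (?r ` e)" for e unfolding image_image fab ..
  have hit: "a \<in> ?r ` e" if "e \<inter> {a,b} \<noteq> {}" for e using that ab by (auto simp: redirect_def image_iff)
  have "drawn (V - {b}) (identify a b F) ?p ?\<Gamma>" unfolding drawn_def
  proof (intro conjI allI impI ballI)
    show "inj_on ?p (V - {b})"
    proof (rule inj_onI)
      fix x y assume xy: "x \<in> V - {b}" "y \<in> V - {b}" "f (p x) = f (p y)"
      then have "p x = p y \<or> (p x \<in> {p a, p b} \<and> p y \<in> {p a, p b})" using f(2) D(2) by blast
      then show "x = y" using xy p ab by (auto simp: inj_on_def)
    qed
  next
    fix x y assume xy: "{x,y} \<in> identify a b F"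
    obtain x' y' where e: "u {x,y} = {x',y'}" using simple_graph_edge_ex[OF G u(1)[OF xy]] by blast
    have "{?r x', ?r y'} = {x, y}" using u(2)[OF xy] e by simp
    then have "(?r x' = x \<and> ?r y' = y) \<or> (?r x' = y \<and> ?r y' = x)" by (auto simp: doubleton_eq_iff)
    moreover have "arc_set (?\<Gamma> {x,y}) (?p (?r x')) (?p (?r y'))" using arcs[of x' y'] u(1)[OF xy] e fab by simp
    ultimately show "arc_set (?\<Gamma> {x,y}) (?p x) (?p y)" using arc_set_sym by auto
  next
    fix e assume e: "e \<in> identify a b F"
    note ue = u[OF e]
    show "?\<Gamma> e \<inter> ?p ` (V - {b}) = ?p ` e"
    proof (intro equalityI subsetI)
      fix w assume "w \<in> ?\<Gamma> e \<inter> ?p ` (V - {b})"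
      then obtain l v where l: "w = f l" "l \<in> \<Lambda> (u e)" and v: "w = ?p v" "v \<in> V" by blast
      have "p v \<in> p ` u e \<or> (l \<in> D \<and> p v \<in> D)" using f(2)[of l "p v"] l v V[OF ue(1)] by auto
      then show "w \<in> ?p ` e"
      proof
        assume "p v \<in> p ` u e"
        then have "w \<in> ?p ` u e" using v(1) by auto
        then show ?thesis using image_r[of "u e"] ue(2) by simp
      next
        assume *: "l \<in> D \<and> p v \<in> D"
        then have "a \<in> e" using hit[OF meets[OF ue(1)]] l(2) ue(2) by blast
        moreover have "w = ?p a" using v(1) * f(2) pD by simp
        ultimately show ?thesis by (rule image_eqI[rotated])
      qed
    next
      fix w assume w: "w \<in> ?p ` e"
      then obtain x where x: "x \<in> u e" "w = ?p x" using image_r[of "u e"] ue(2) by auto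
      have "u e \<subseteq> V" by (rule simple_graph_edge_subset[OF G ue(1)])
      then have "?r x \<in> V - {b}" using x(1) ab by (auto simp: redirect_def)
      moreover have "w = ?p (?r x)" using x(2) fab by simp
      ultimately have "w \<in> ?p ` (V - {b})" by (rule image_eqI[rotated])
      then show "w \<in> ?\<Gamma> e \<inter> ?p ` (V - {b})" using endsL[OF ue(1) x(1)] x(2) by simp
    qed
  next
    fix e e' assume e: "e \<in> identify a b F" "e' \<in> identify a b F" "e \<noteq> e'"
    note ue = u[OF e(1)] and ue' = u[OF e(2)]
    have ne: "u e \<noteq> u e'" using ue(2) ue'(2) e(3) by metis
    show "?\<Gamma> e \<inter> ?\<Gamma> e' = ?p ` (e \<inter> e')"
    proof (intro equalityI subsetI)
      fix w assume "w \<in> ?\<Gamma> e \<inter> ?\<Gamma> e'"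
      then obtain l l' where l: "w = f l" "l \<in> \<Lambda> (u e)" "w = f l'" "l' \<in> \<Lambda> (u e')" by blast
      have "l = l' \<or> (l \<in> D \<and> l' \<in> D)" using f(2)[of l l'] l(1,3) by simp
      then have "l \<in> p ` (u e \<inter> u e') \<or> (l \<in> D \<and> l' \<in> D)" using l(2,4) cross[OF ue(1) ue'(1) ne] by blast
      then show "w \<in> ?p ` (e \<inter> e')"
      proof
        assume "l \<in> p ` (u e \<inter> u e')"
        then obtain x where x: "x \<in> u e" "x \<in> u e'" "l = p x" by blast
        then have "?r x \<in> e \<inter> e'" using ue(2) ue'(2) by blast
        moreover have "w = ?p (?r x)" using x(3) l(1) fab by simp
        ultimately show ?thesis by (rule image_eqI[rotated])
      next
        assume *: "l \<in> D \<and> l' \<in> D"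
        then have "a \<in> e \<inter> e'" using hit[OF meets[OF ue(1)]] hit[OF meets[OF ue'(1)]] l(2,4) ue(2) ue'(2) by blast
        moreover have "w = ?p a" using l(1) * f(2) pD by simp
        ultimately show ?thesis by (rule image_eqI[rotated])
      qed
    next
      fix w assume "w \<in> ?p ` (e \<inter> e')"
      then obtain x where x: "x \<in> e" "x \<in> e'" "w = ?p x" by (elim imageE IntE)
      have "x \<in> ?r ` u e" "x \<in> ?r ` u e'" using x(1,2) ue(2) ue'(2) by simp_all
      then obtain y y' where y: "x = ?r y" "y \<in> u e" and y': "x = ?r y'" "y' \<in> u e'"
        by (elim imageE)
      have "w = ?p y" "w = ?p y'" using fab[of y] fab[of y'] x(3) y(1) y'(1) by metis+
      then show "w \<in> ?\<Gamma> e \<inter> ?\<Gamma> e'" using endsL[OF ue(1) y(2)] endsL[OF ue'(1) y'(2)] by simp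
    qed
  qed
  then show ?thesis unfolding drawable_def by blast
qed

lemma drawable_subgraph:
  assumes "drawable V E" "V' \<subseteq> V" "E' \<subseteq> E" "simple_graph (V', E')"
  shows "drawable V' E'"
proof -
  obtain p \<Gamma> where d: "drawn V E p \<Gamma>" using assms(1) unfolding drawable_def by blast
  have "\<Gamma> e \<inter> p ` V' = p ` e" if "e \<in> E'" for e
  proof -
    have "\<Gamma> e \<inter> p ` V = p ` e" using that drawnD(3)[OF d, of e] assms(3) by blast
    moreover have "e \<subseteq> V'" by (rule simple_graph_edge_subset[OF assms(4) that])
    ultimately show ?thesis using assms(2) by blast
  qed
  then have "drawn V' E' p \<Gamma>" unfolding drawn_def
    using inj_on_subset[OF drawnD(1)[OF d] assms(2)] drawnD(2,4)[OF d] subsetD[OF assms(3)] by simp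
  then show ?thesis unfolding drawable_def by blast
qed

text \<open>The arc of the edge itself is the one to collapse, and the other edges at its ends meet
  it only there.\<close>

lemma drawable_contract:
  assumes G: "simple_graph (V, E)" and d: "drawable V E" and ab: "{a, b} \<in> E"
    and nc: "\<And>y. \<not> ({a, y} \<in> E \<and> {b, y} \<in> E)"
  shows "drawable (V - {b}) (identify a b (E - {{a, b}}))"
proof -
  obtain p \<Gamma> where d: "drawn V E p \<Gamma>" using d unfolding drawable_def by blast
  note abV = simple_graph_edge[OF G ab]
  have arcs: "\<And>x y. {x,y} \<in> E \<Longrightarrow> arc_set (\<Gamma> {x,y}) (p x) (p y)"
    and vs: "\<And>e. e \<in> E \<Longrightarrow> \<Gamma> e \<inter> p ` V = p ` e"
    and cr: "\<And>e e'. e \<in> E \<Longrightarrow> e' \<in> E \<Longrightarrow> e \<noteq> e' \<Longrightarrow> \<Gamma> e \<inter> \<Gamma> e' = p ` (e \<inter> e')"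
    and inj: "inj_on p V"
    using drawnD[OF d] by auto
  show ?thesis
  proof (rule drawable_identify[where p = p and D = "\<Gamma> {a, b}" and \<Lambda> = \<Gamma>])
    show "simple_graph (V, E - {{a, b}})" using G unfolding simple_graph_def by auto
    show "inj_on p V" by (rule inj)
    show "arc_set (\<Gamma> {a, b}) (p a) (p b)" using arcs ab by blast
    show "\<Gamma> {a, b} \<inter> p ` V = {p a, p b}" using vs[OF ab] by simp
    show "arc_set (\<Gamma> {x, y}) (p x) (p y) \<and> \<Gamma> {x, y} \<inter> \<Gamma> {a, b} = {}"
      if "{x, y} \<in> E - {{a, b}}" "x \<notin> {a, b}" "y \<notin> {a, b}" for x y
    proof -
      have "{x,y} \<inter> {a,b} = {}" using that by auto
      then show ?thesis using arcs[of x y] cr[of "{x,y}" "{a,b}"] ab that by auto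
    qed
    show "\<exists>d\<in>\<Gamma> {a, b}. arc_set (\<Gamma> {x, y}) d (p y) \<and> \<Gamma> {x, y} \<inter> \<Gamma> {a, b} = {d}"
      if xy: "{x, y} \<in> E - {{a, b}}" "x \<in> {a, b}" for x y
    proof -
      have "y \<notin> {a, b}" using xy simple_graph_edge(3)[OF G, of x y] by (auto simp: insert_commute)
      then have "{x,y} \<inter> {a,b} = {x}" using xy(2) by auto
      then have "\<Gamma> {x, y} \<inter> \<Gamma> {a, b} = {p x}" using cr[of "{x,y}" "{a,b}"] ab xy by auto
      then show ?thesis using arcs[of x y] xy by blast
    qed
    show "\<Gamma> e \<inter> p ` V \<subseteq> p ` e \<union> \<Gamma> {a, b}" if "e \<in> E - {{a, b}}" for e using vs[of e] that by auto
    show "\<Gamma> e \<inter> \<Gamma> e' \<subseteq> p ` (e \<inter> e') \<union> \<Gamma> {a, b}" if "e \<in> E - {{a, b}}" "e' \<in> E - {{a, b}}" "e \<noteq> e'" for e e'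
      using cr[of e e'] that by auto
  qed (use abV nc in auto)
qed

section \<open>Facial 4-cycles\<close>

definition common :: "'a set set \<Rightarrow> 'a \<Rightarrow> 'a \<Rightarrow> 'a set" where
  "common E s t = {x. {s, x} \<in> E \<and> {x, t} \<in> E}"

text \<open>One pair of inner vertices for each walk. In a simple graph with \<open>s\<close>,
  \<open>t\<close> distinct and nonadjacent these walks are paths.\<close>

definition walks3 :: "'a set set \<Rightarrow> 'a \<Rightarrow> 'a \<Rightarrow> ('a \<times> 'a) set" where
  "walks3 E s t = {(x, y). {s, x} \<in> E \<and> {x, y} \<in> E \<and> {y, t} \<in> E}"

text \<open>Only opposite vertices are required to differ; in a simple graph the adjacent ones do so
  anyway.\<close>

definition cycle4 :: "'a set set \<Rightarrow> 'a \<Rightarrow> 'a \<Rightarrow> 'a \<Rightarrow> 'a \<Rightarrow> bool" where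
  "cycle4 E u a b c \<longleftrightarrow> {u, a} \<in> E \<and> {a, b} \<in> E \<and> {b, c} \<in> E \<and> {c, u} \<in> E \<and> u \<noteq> b \<and> a \<noteq> c"

locale plane_graph =
  fixes V :: "'a set" and E :: "'a set set" and p :: "'a \<Rightarrow> complex" and \<Gamma> :: "'a set \<Rightarrow> complex set"
  assumes simple: "simple_graph (V, E)" and drawing: "drawn V E p \<Gamma>"
    and trifree: "{x, y} \<in> E \<Longrightarrow> {y, z} \<in> E \<Longrightarrow> {x, z} \<notin> E"
begin

lemmas edge = simple_graph_edge[OF simple]
lemmas draw = drawnD[OF drawing]

lemma edge_sym: "{x, y} \<in> E \<Longrightarrow> {y, x} \<in> E"
  by (simp add: insert_commute)

lemma Gam_sym: "\<Gamma> {x, y} = \<Gamma> {y, x}"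
  by (simp add: insert_commute)

lemma p_eq: "x \<in> V \<Longrightarrow> y \<in> V \<Longrightarrow> p x = p y \<longleftrightarrow> x = y"
  using draw(1) by (auto simp: inj_on_def)

lemma p_mem: "x \<in> V \<Longrightarrow> W \<subseteq> V \<Longrightarrow> p x \<in> p ` W \<longleftrightarrow> x \<in> W"
  using draw(1) by (auto simp: inj_on_def)

definition UG :: "'a set set \<Rightarrow> complex set" where "UG F = (\<Union>e\<in>F. \<Gamma> e)"

lemma Gam_vertex: "e \<in> E \<Longrightarrow> p ` e \<subseteq> \<Gamma> e"
  using draw(3) by blast

lemma UG_V: "F \<subseteq> E \<Longrightarrow> UG F \<inter> p ` V = p ` \<Union>F"
  unfolding UG_def using draw(3) by blast

lemma UG_Int:
  assumes "F \<subseteq> E" "F' \<subseteq> E" "F \<inter> F' = {}"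
  shows "UG F \<inter> UG F' = p ` (\<Union>F \<inter> \<Union>F')"
proof (intro equalityI subsetI)
  fix z assume "z \<in> UG F \<inter> UG F'"
  then obtain e e' where e: "e \<in> F" "e' \<in> F'" "z \<in> \<Gamma> e" "z \<in> \<Gamma> e'" unfolding UG_def by blast
  then have "z \<in> p ` (e \<inter> e')" using draw(4)[of e e'] assms by blast
  then show "z \<in> p ` (\<Union>F \<inter> \<Union>F')" using e by blast
next
  fix z assume "z \<in> p ` (\<Union>F \<inter> \<Union>F')"
  then show "z \<in> UG F \<inter> UG F'" unfolding UG_def using Gam_vertex assms by blast
qed

lemma UG_un: "UG (F \<union> F') = UG F \<union> UG F'"
  unfolding UG_def by blast

lemma arc2:
  assumes "{u, a} \<in> E" "{a, b} \<in> E" "u \<noteq> b"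
  shows "arc_set (UG {{u, a}, {a, b}}) (p u) (p b)"
proof -
  have ne: "{u, a} \<noteq> {a, b}" using assms by (auto simp: doubleton_eq_iff)
  have int: "{u, a} \<inter> {a, b} = {a}" using assms(3) edge(3)[OF assms(1)] edge(3)[OF assms(2)] by auto
  have "\<Gamma> {u, a} \<inter> \<Gamma> {a, b} = {p a}" using draw(4)[OF assms(1,2) ne] unfolding int by simp
  then have "arc_set (\<Gamma> {u, a} \<union> \<Gamma> {a, b}) (p u) (p b)"
    by (rule arc_set_join[OF draw(2)[OF assms(1)] draw(2)[OF assms(2)]])
  then show ?thesis unfolding UG_def by simp
qed

lemma arc3:
  assumes "{u, a} \<in> E" "{a, c} \<in> E" "{c, b} \<in> E" "u \<noteq> b" "u \<noteq> c" "a \<noteq> b"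
  shows "arc_set (UG {{u, a}, {a, c}, {c, b}}) (p u) (p b)"
proof -
  have "UG {{u, a}, {a, c}} \<inter> UG {{c, b}} = p ` (\<Union>{{u, a}, {a, c}} \<inter> \<Union>{{c, b}})"
    by (rule UG_Int) (use assms in \<open>auto simp: doubleton_eq_iff\<close>)
  also have "\<Union>{{u, a}, {a, c}} \<inter> \<Union>{{c, b}} = {c}" using assms edge(3) by auto
  finally have "UG {{u, a}, {a, c}} \<inter> UG {{c, b}} = {p c}" by simp
  moreover have "arc_set (UG {{c, b}}) (p c) (p b)" using draw(2)[OF assms(3)] unfolding UG_def by simp
  ultimately have "arc_set (UG {{u, a}, {a, c}} \<union> UG {{c, b}}) (p u) (p b)"
    using arc_set_join arc2[OF assms(1,2,5)] by blast
  then show ?thesis unfolding UG_un[symmetric] by (simp add: insert_commute)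
qed

section \<open>Curves of 4-cycles and the edges around them\<close>

definition curve4 :: "'a \<Rightarrow> 'a \<Rightarrow> 'a \<Rightarrow> 'a \<Rightarrow> complex set" where
  "curve4 u a b c = UG {{u, a}, {a, b}, {b, c}, {c, u}}"

lemma cycle4D:
  assumes "cycle4 E u a b c"
  shows "{u, a} \<in> E" "{a, b} \<in> E" "{b, c} \<in> E" "{c, u} \<in> E" "{u, c} \<in> E" "{c, b} \<in> E" "{b, a} \<in> E" "{a, u} \<in> E"
    "u \<noteq> b" "a \<noteq> c" "u \<noteq> a" "a \<noteq> b" "b \<noteq> c" "c \<noteq> u"
    "{u, b} \<notin> E" "{a, c} \<notin> E" "u \<in> V" "a \<in> V" "b \<in> V" "c \<in> V"
proof -
  show 1: "{u, a} \<in> E" "{a, b} \<in> E" "{b, c} \<in> E" "{c, u} \<in> E" "u \<noteq> b" "a \<noteq> c"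
    using assms unfolding cycle4_def by simp_all
  then show "{u, c} \<in> E" "{c, b} \<in> E" "{b, a} \<in> E" "{a, u} \<in> E" by (simp_all add: edge_sym)
  show "u \<noteq> a" "a \<noteq> b" "b \<noteq> c" "c \<noteq> u" "u \<in> V" "a \<in> V" "b \<in> V" "c \<in> V"
    using edge[OF 1(1)] edge[OF 1(2)] edge[OF 1(3)] edge[OF 1(4)] by simp_all
  show "{u, b} \<notin> E" "{a, c} \<notin> E" using trifree[OF 1(1,2)] trifree[OF 1(2,3)] by simp_all
qed

lemma cycle4_rotate: "cycle4 E u a b c \<Longrightarrow> cycle4 E a b c u"
  and cycle4_flip: "cycle4 E u a b c \<Longrightarrow> cycle4 E u c b a"
  unfolding cycle4_def by (auto simp: insert_commute)

lemma curve4_rotate: "curve4 a b c u = curve4 u a b c"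
  and curve4_flip: "curve4 u c b a = curve4 u a b c"
  unfolding curve4_def by (rule arg_cong[of _ _ UG], auto simp: insert_commute)+

lemma curve4_arcs: "curve4 u a b c = UG {{u, a}, {a, b}} \<union> UG {{u, c}, {c, b}}"
  unfolding curve4_def UG_un[symmetric] by (rule arg_cong[of _ _ UG]) (auto simp: insert_commute)

lemma arcs_Int:
  assumes "{u, a} \<in> E" "{a, b} \<in> E" "{u, c} \<in> E" "{c, b} \<in> E" "u \<noteq> b" "a \<noteq> c"
  shows "UG {{u, a}, {a, b}} \<inter> UG {{u, c}, {c, b}} = {p u, p b}"
proof -
  note ne = edge(3)[OF assms(1)] edge(3)[OF assms(2)] edge(3)[OF assms(3)] edge(3)[OF assms(4)]
  have "UG {{u, a}, {a, b}} \<inter> UG {{u, c}, {c, b}} = p ` (\<Union>{{u, a}, {a, b}} \<inter> \<Union>{{u, c}, {c, b}})"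
    by (rule UG_Int) (use assms ne in \<open>auto simp: doubleton_eq_iff\<close>)
  also have "\<Union>{{u, a}, {a, b}} \<inter> \<Union>{{u, c}, {c, b}} = {u, b}" using assms ne by auto
  finally show ?thesis by simp
qed

lemma jordan_curve4:
  assumes "cycle4 E u a b c"
  shows "jordan (curve4 u a b c)"
proof -
  note cD = cycle4D[OF assms]
  show ?thesis unfolding curve4_arcs
    using jordan_arcs[OF arc2[OF cD(1,2,9)] arc2[OF cD(5,6,9)] arcs_Int[OF cD(1,2,5,6,9,10)]] .
qed

lemma curve4_V:
  assumes "cycle4 E u a b c"
  shows "curve4 u a b c \<inter> p ` V = p ` {u, a, b, c}"
proof -
  have "curve4 u a b c \<inter> p ` V = p ` \<Union>{{u, a}, {a, b}, {b, c}, {c, u}}"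
    unfolding curve4_def by (rule UG_V) (use cycle4D[OF assms] in auto)
  also have "\<Union>{{u, a}, {a, b}, {b, c}, {c, u}} = {u, a, b, c}" by auto
  finally show ?thesis .
qed

lemma on_curve4:
  assumes "cycle4 E u a b c" "x \<in> V"
  shows "p x \<in> curve4 u a b c \<longleftrightarrow> x \<in> {u, a, b, c}"
proof -
  have "p x \<in> curve4 u a b c \<longleftrightarrow> p x \<in> p ` {u, a, b, c}" using curve4_V[OF assms(1)] assms(2) by blast
  then show ?thesis using p_mem[OF assms(2), of "{u,a,b,c}"] cycle4D[OF assms(1)] by auto
qed

lemma edge_curve4:
  assumes "cycle4 E u a b c" "e \<in> E" "e \<notin> {{u, a}, {a, b}, {b, c}, {c, u}}"
  shows "\<Gamma> e \<inter> curve4 u a b c = p ` (e \<inter> {u, a, b, c})"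
proof -
  have "UG {e} \<inter> curve4 u a b c = p ` (\<Union>{e} \<inter> \<Union>{{u, a}, {a, b}, {b, c}, {c, u}})"
    unfolding curve4_def by (rule UG_Int) (use assms cycle4D[OF assms(1)] in auto)
  moreover have "\<Union>{{u, a}, {a, b}, {b, c}, {c, u}} = {u, a, b, c}" by auto
  ultimately show ?thesis unfolding UG_def by simp
qed

text \<open>A diagonal would close a triangle with two sides of the cycle.\<close>

lemma chordless:
  assumes "cycle4 E u a b c" "{x, y} \<in> E" "x \<in> {u, a, b, c}" "y \<in> {u, a, b, c}"
  shows "{x, y} \<in> {{u, a}, {a, b}, {b, c}, {c, u}}"
proof -
  note cD = cycle4D[OF assms(1)]
  have no: "{u, b} \<notin> E" "{b, u} \<notin> E" "{a, c} \<notin> E" "{c, a} \<notin> E" using cD edge_sym by blast+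
  have ne: "x \<noteq> y" by (rule edge(3)[OF assms(2)])
  have "x = u \<or> x = a \<or> x = b \<or> x = c" "y = u \<or> y = a \<or> y = b \<or> y = c" using assms(3,4) by simp_all
  then show ?thesis using assms(2) no ne by (elim disjE) (simp_all add: doubleton_eq_iff)
qed

text \<open>The edge meets the curve at most in its end \<open>y\<close>. Without that end it is
  still connected, so it stays on one side, and its ends off the cycle come along.\<close>

lemma edge_off_side:
  assumes C: "cycle4 E u a b c" and xy: "{x, y} \<in> E" and x: "x \<notin> {u, a, b, c}"
    and m: "m \<in> \<Gamma> {x, y}" "m \<in> away (curve4 u a b c) z" and z: "z \<notin> curve4 u a b c"
  shows "\<Gamma> {x, y} - p ` {u, a, b, c} \<subseteq> away (curve4 u a b c) z" "p x \<in> away (curve4 u a b c) z"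
    "y \<notin> {u, a, b, c} \<Longrightarrow> p y \<in> away (curve4 u a b c) z"
proof -
  let ?Q = "{u, a, b, c}" and ?J = "curve4 u a b c"
  have V: "x \<in> V" "y \<in> V" "?Q \<subseteq> V" using edge[OF xy] cycle4D[OF C] by auto
  have ne: "{x,y} \<notin> {{u, a}, {a, b}, {b, c}, {c, u}}" using x by auto
  have int: "\<Gamma> {x,y} \<inter> ?J = p ` ({x,y} \<inter> ?Q)" by (rule edge_curve4[OF C xy ne])
  have pQ: "p ` ?Q \<subseteq> ?J" using curve4_V[OF C] by blast
  have pV: "\<Gamma> {x,y} \<inter> p ` ?Q = p ` ({x,y} \<inter> ?Q)"
  proof -
    have "\<Gamma> {x,y} \<inter> p ` ?Q \<subseteq> \<Gamma> {x,y} \<inter> ?J" using pQ by (rule Int_mono[OF subset_refl])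
    moreover have "p ` ({x,y} \<inter> ?Q) \<subseteq> \<Gamma> {x,y}" using int by (metis Int_lower1)
    moreover have "p ` ({x,y} \<inter> ?Q) \<subseteq> p ` ?Q" by (rule image_mono) (rule Int_lower2)
    ultimately show ?thesis unfolding int by (meson Int_greatest subset_antisym)
  qed
  have sub: "{x,y} \<inter> ?Q \<subseteq> {y}" using x by auto
  have con: "connected (\<Gamma> {x,y} - p ` ?Q)"
  proof (cases "y \<in> ?Q")
    case True
    then have "\<Gamma> {x,y} - p ` ?Q = \<Gamma> {y,x} - {p y}" using pV sub by (auto simp: insert_commute)
    then show ?thesis using arc_set_interior(2)[OF draw(2)[OF edge_sym[OF xy]]] by simp
  next
    case False
    then have "\<Gamma> {x,y} - p ` ?Q = \<Gamma> {x,y}" using pV sub by auto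
    then show ?thesis using arc_set_connected[OF draw(2)[OF xy]] by simp
  qed
  have dis: "(\<Gamma> {x,y} - p ` ?Q) \<inter> ?J = {}" using int by auto
  have "m \<notin> ?J" using m(2) away_facts(4)[OF jordan_curve4[OF C] z] by blast
  then have "m \<in> \<Gamma> {x,y} - p ` ?Q" using m(1) pQ by (metis DiffI subsetD)
  then show 1: "\<Gamma> {x, y} - p ` ?Q \<subseteq> away ?J z"
    by (rule away_connected_subset[OF con dis _ m(2)])
  have "p x \<in> \<Gamma> {x,y}" "p y \<in> \<Gamma> {x,y}" using Gam_vertex[OF xy] by auto
  then show "p x \<in> away ?J z" "y \<notin> ?Q \<Longrightarrow> p y \<in> away ?J z"
    using 1 p_mem[OF V(1,3)] p_mem[OF V(2,3)] x by blast+
qed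

lemma empty_side_edges:
  assumes C: "cycle4 E u a b c" and z: "z \<notin> curve4 u a b c" and emp: "away (curve4 u a b c) z \<inter> p ` V = {}"
    and e: "e \<in> E"
  shows "\<Gamma> e \<inter> away (curve4 u a b c) z = {}"
proof (rule ccontr)
  assume "\<not> ?thesis"
  then obtain m where m: "m \<in> \<Gamma> e" "m \<in> away (curve4 u a b c) z" by blast
  obtain x y where xy: "e = {x, y}" using simple_graph_edge_ex[OF simple e] by blast
  have xyE: "{x, y} \<in> E" "{y, x} \<in> E" using e xy edge_sym by auto
  consider "x \<notin> {u,a,b,c}" | "y \<notin> {u,a,b,c}" | "x \<in> {u,a,b,c}" "y \<in> {u,a,b,c}" by blast
  then show False
  proof cases
    case 1
    then show False using edge_off_side(2)[OF C xyE(1) 1 _ m(2) z] m xy emp edge(1)[OF xyE(1)] by blast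
  next
    case 2
    then show False using edge_off_side(2)[OF C xyE(2) 2 _ m(2) z] m(1) xy emp edge(1)[OF xyE(2)] by (auto simp: insert_commute)
  next
    case 3
    then have "e \<in> {{u, a}, {a, b}, {b, c}, {c, u}}" using chordless[OF C xyE(1)] xy by simp
    then have "m \<in> curve4 u a b c" using m(1) unfolding curve4_def UG_def by blast
    then show False using m(2) away_facts(4)[OF jordan_curve4[OF C] z] by blast
  qed
qed

text \<open>The viewpoint \<open>z\<close> is an arbitrary point of the plane rather than a vertex,
  so that either side may be the vertexless one, including when all other vertices lie on the same
  side.\<close>

definition facial :: "'a \<Rightarrow> 'a \<Rightarrow> 'a \<Rightarrow> 'a \<Rightarrow> bool" where
  "facial u a b c \<longleftrightarrow> cycle4 E u a b c \<and> (\<exists>z. z \<notin> curve4 u a b c \<and> away (curve4 u a b c) z \<inter> p ` V = {})"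

lemma facial_rotate: "facial u a b c \<Longrightarrow> facial a b c u"
  unfolding facial_def using cycle4_rotate curve4_rotate by metis

text \<open>Both paths run on the side opposite to the vertexless one. There \<open>F1\<close> forms
  a theta curve with the two halves of the cycle, and \<open>F2\<close> would have to pass from one
  half to the other without touching it.\<close>

lemma facial_no_crossing:
  assumes F: "facial u a b c"
    and F1: "F1 \<subseteq> E" "arc_set (UG F1) (p u) (p b)" "\<Union>F1 \<inter> {u, a, b, c} = {u, b}"
    and F2: "F2 \<subseteq> E" "arc_set (UG F2) (p a) (p c)" "\<Union>F2 \<inter> {u, a, b, c} = {a, c}"
    and dis: "\<Union>F1 \<inter> \<Union>F2 = {}"
  shows False
proof -
  let ?J = "curve4 u a b c" and ?Q = "{u,a,b,c}"
  obtain z where C: "cycle4 E u a b c" and z: "z \<notin> ?J" "away ?J z \<inter> p ` V = {}"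
    using F unfolding facial_def by blast
  note cD = cycle4D[OF C] and J = jordan_curve4[OF C]
  \<comment> \<open>Seen from a point \<open>q\<close> of the vertexless side, everything drawn off
    the cycle lies across.\<close>
  obtain q where q: "q \<in> away ?J z" using away_facts(3)[OF J z(1)] by blast
  have qJ: "q \<notin> ?J" using q away_facts(4)[OF J z(1)] by blast
  have UGe: "UG F' \<inter> away ?J z = {}" if "F' \<subseteq> E" for F'
    unfolding UG_def using empty_side_edges[OF C z] that by blast
  have nonempty: "e \<noteq> {}" if "e \<in> E" for e using simple_graph_edge_ex[OF simple that] by auto
  have cyc: "?J = UG {{u, a}, {a, b}, {b, c}, {c, u}}" unfolding curve4_def ..
  have U: "\<Union>{{u, a}, {a, b}, {b, c}, {c, u}} = ?Q" by auto
  have F1J: "UG F1 \<inter> ?J = {p u, p b}"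
  proof -
    have "a \<notin> \<Union>F1" "c \<notin> \<Union>F1" using F1(3) cD(9-14) by (metis IntI insertCI insertE singletonD)+
    then have "{u, a} \<notin> F1" "{a, b} \<notin> F1" "{b, c} \<notin> F1" "{c, u} \<notin> F1" by blast+
    then have "F1 \<inter> {{u, a}, {a, b}, {b, c}, {c, u}} = {}" by simp
    then have "UG F1 \<inter> ?J = p ` (\<Union>F1 \<inter> ?Q)" unfolding cyc U[symmetric]
      by (intro UG_Int F1) (use cD in simp_all)
    then show ?thesis using F1(3) by simp
  qed
  have F2J: "UG F2 \<inter> ?J = {p a, p c}"
  proof -
    have "u \<notin> \<Union>F2" "b \<notin> \<Union>F2" using F2(3) cD(9-14) by (metis IntI insertCI insertE singletonD)+
    then have "{u, a} \<notin> F2" "{a, b} \<notin> F2" "{b, c} \<notin> F2" "{c, u} \<notin> F2" by blast+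
    then have "F2 \<inter> {{u, a}, {a, b}, {b, c}, {c, u}} = {}" by simp
    then have "UG F2 \<inter> ?J = p ` (\<Union>F2 \<inter> ?Q)" unfolding cyc U[symmetric]
      by (intro UG_Int F2) (use cD in simp_all)
    then show ?thesis using F2(3) by simp
  qed
  have F12: "UG F1 \<inter> UG F2 = {}"
  proof -
    have "F1 \<inter> F2 = {}"
    proof (rule equals0I)
      fix e assume e: "e \<in> F1 \<inter> F2"
      then have "e \<subseteq> \<Union>F1 \<inter> \<Union>F2" by blast
      then show False using nonempty[of e] e F1(1) dis by blast
    qed
    then show ?thesis using UG_Int[OF F1(1) F2(1)] dis by simp
  qed
  have pn: "p a \<notin> {p u, p b}" "p c \<notin> {p u, p b}" using cD(9-14,17-20) p_eq by simp_all
  let ?S1 = "UG {{u, a}, {a, b}}" and ?S2 = "UG {{u, c}, {c, b}}"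
  have J12: "?J = ?S1 \<union> ?S2" by (rule curve4_arcs)
  have S: "arc_set ?S1 (p u) (p b)" "arc_set ?S2 (p u) (p b)" using arc2 cD by blast+
  have int12: "?S1 \<inter> ?S2 = {p u, p b}" using arcs_Int cD by blast
  have ends: "p u \<in> ?S1" "p u \<in> ?S2" "p b \<in> ?S1" "p b \<in> ?S2" using int12 by auto
  have int13: "?S1 \<inter> UG F1 = {p u, p b}" "?S2 \<inter> UG F1 = {p u, p b}"
    using F1J J12 ends by blast+
  have other: "x \<in> away ?J q" if "x \<in> UG F'" "x \<notin> ?J" "F' \<subseteq> E" for x F'
    using away_third[OF J z(1) q that(2)] UGe[OF that(3)] that(1) by blast
  obtain x where x: "x \<in> UG F1 - {p u, p b}" using arc_set_interior(4)[OF F1(2)] by blast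
  have x': "x \<in> away (?S1 \<union> ?S2) q" using other[of x F1] x F1J F1(1) J12 by auto
  let ?M = "UG F2 - {p a, p c}"
  obtain m where m: "m \<in> ?M" using arc_set_interior(4)[OF F2(2)] by blast
  have m': "m \<in> away (?S1 \<union> ?S2) q" using other[of m F2] m F2J F2(1) J12 by auto
  show False
  proof (rule theta_no_crossing[OF S F1(2) int12 int13, of q x "p a" "p c" ?M m])
    show "q \<notin> ?S1" "q \<notin> ?S2" using qJ J12 by auto
    show "q \<notin> UG F1" using UGe[OF F1(1)] q by blast
    show "x \<in> UG F1" using x by blast
    show "x \<in> away (?S1 \<union> ?S2) q" by (rule x')
    have "p a \<in> ?S1" "p c \<in> ?S2" using Gam_vertex cD unfolding UG_def by auto
    then show "p a \<in> ?S1 - {p u, p b}" "p c \<in> ?S2 - {p u, p b}" using pn by auto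
    show "connected ?M" by (rule arc_set_interior(1)[OF F2(2)])
    show "?M \<inter> (?S1 \<union> ?S2 \<union> UG F1) = {}" using F2J J12 F12 by blast
    show "m \<in> ?M" by (rule m)
    show "m \<in> away (?S1 \<union> ?S2) q" by (rule m')
    show "p a \<in> closure ?M" "p c \<in> closure ?M"
      using arc_set_interior(3)[OF F2(2)] arc_set_ends[OF F2(2)] by auto
  qed
qed

text \<open>The inner vertices of a path of length three avoid \<open>a\<close> and
  \<open>c\<close>, since these are adjacent to both \<open>u\<close> and \<open>b\<close>. The last
  conclusion, that inner vertices are adjacent to \<open>u\<close> or \<open>b\<close>, serves to
  keep two such paths disjoint.\<close>

lemma linking_path:
  assumes C: "cycle4 E u a b c" and w: "walks3 E u b \<noteq> {} \<or> \<not> common E u b \<subseteq> {a, c}"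
  obtains F where "F \<subseteq> E" "arc_set (UG F) (p u) (p b)" "\<Union>F \<inter> {u, a, b, c} = {u, b}"
    "\<And>x. x \<in> \<Union>F \<Longrightarrow> x = u \<or> x = b \<or> {u, x} \<in> E \<or> {x, b} \<in> E"
proof (cases "walks3 E u b = {}")
  case True
  note cD = cycle4D[OF C]
  obtain x where x: "{u, x} \<in> E" "{x, b} \<in> E" "x \<noteq> a" "x \<noteq> c" using w True unfolding common_def by auto
  have "x \<noteq> u" "x \<noteq> b" using edge(3) x(1,2) by blast+
  then show ?thesis using that[of "{{u, x}, {x, b}}"] arc2[OF x(1,2) cD(9)] x cD by auto
next
  case False
  note cD = cycle4D[OF C]
  obtain x y where xy: "{u, x} \<in> E" "{x, y} \<in> E" "{y, b} \<in> E" using False unfolding walks3_def by auto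
  have ne: "x \<noteq> u" "y \<noteq> b" "x \<noteq> b" "y \<noteq> u" using edge(3) xy cD(15) by blast+
  have "x \<noteq> a" "x \<noteq> c" using trifree[OF xy(2,3)] cD by auto
  moreover have "y \<noteq> a" "y \<noteq> c" using trifree[OF xy(1,2)] cD by auto
  ultimately show ?thesis using that[of "{{u, x}, {x, y}, {y, b}}"] arc3[OF xy cD(9)] ne xy cD by auto
qed

text \<open>Linking paths for both diagonals would be disjoint: a shared inner vertex would be
  adjacent to one of \<open>u\<close>, \<open>b\<close> and to one of \<open>a\<close>,
  \<open>c\<close>, which are adjacent themselves. Disjoint ones would cross.\<close>

lemma facial_alternative:
  assumes F: "facial u a b c" and w: "walks3 E u b \<noteq> {} \<or> \<not> common E u b \<subseteq> {a, c}"
  shows "walks3 E a c = {} \<and> common E a c = {u, b}"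
proof -
  have C: "cycle4 E u a b c" using F unfolding facial_def by blast
  note cD = cycle4D[OF C]
  obtain F1 where F1: "F1 \<subseteq> E" "arc_set (UG F1) (p u) (p b)" "\<Union>F1 \<inter> {u, a, b, c} = {u, b}"
    "\<And>x. x \<in> \<Union>F1 \<Longrightarrow> x = u \<or> x = b \<or> {u, x} \<in> E \<or> {x, b} \<in> E"
    using linking_path[OF C w] by metis
  have "\<not> (walks3 E a c \<noteq> {} \<or> \<not> common E a c \<subseteq> {b, u})"
  proof
    assume *: "walks3 E a c \<noteq> {} \<or> \<not> common E a c \<subseteq> {b, u}"
    obtain F2 where F2: "F2 \<subseteq> E" "arc_set (UG F2) (p a) (p c)" "\<Union>F2 \<inter> {a, b, c, u} = {a, c}"
      "\<And>x. x \<in> \<Union>F2 \<Longrightarrow> x = a \<or> x = c \<or> {a, x} \<in> E \<or> {x, c} \<in> E"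
      using linking_path[OF cycle4_rotate[OF C] *] by metis
    have Q: "{a, b, c, u} = {u, a, b, c}" by auto
    have "\<Union>F1 \<inter> \<Union>F2 = {}"
    proof (rule equals0I)
      fix x assume x: "x \<in> \<Union>F1 \<inter> \<Union>F2"
      then have nQ: "x \<notin> {u,a,b,c}" using F1(3) F2(3) Q cD by (metis IntD1 IntD2 IntI insert_iff singletonD)
      then have 1: "{u, x} \<in> E \<or> {b, x} \<in> E" and 2: "{x, a} \<in> E \<or> {x, c} \<in> E"
        using F1(4)[of x] F2(4)[of x] x edge_sym by blast+
      then show False using trifree[of u x a] trifree[of u x c] trifree[of b x a] trifree[of b x c] cD by blast
    qed
    then show False using facial_no_crossing[OF F F1(1-3) F2(1,2)] F2(3) Q by simp
  qed
  then show ?thesis using cD unfolding common_def by auto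
qed

lemma subset_pair_singleton: "A \<subseteq> {x, y} \<Longrightarrow> x \<notin> A \<Longrightarrow> y \<in> A \<Longrightarrow> A = {y}"
  by blast

text \<open>A crosscut of the vertexless side cannot be made to end exactly at \<open>a\<close> and
  \<open>c\<close>; it ends inside the edges \<open>u a\<close> and \<open>c u\<close>. The
  collapsed arc therefore goes from \<open>a\<close> along the first edge, through the side, and
  along the second edge to \<open>c\<close>.\<close>

lemma drawable_merge:
  assumes F: "facial u a b c" and co: "common E a c = {u, b}"
  shows "drawable (V - {c}) (identify a c E)"
proof -
  let ?J = "curve4 u a b c" and ?Q = "{u,a,b,c}"
  obtain z where C: "cycle4 E u a b c" and z: "z \<notin> ?J" "away ?J z \<inter> p ` V = {}"
    using F unfolding facial_def by blast
  note cD = cycle4D[OF C] and J = jordan_curve4[OF C]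
  let ?R = "away ?J z"
  have emp: "\<Gamma> e \<inter> ?R = {}" if "e \<in> E" for e using empty_side_edges[OF C z that] .
  have RJ: "?R \<inter> ?J = {}" using away_facts(4)[OF J z(1)] .
  have JU: "?J = \<Gamma> {u,a} \<union> \<Gamma> {a,b} \<union> \<Gamma> {b,c} \<union> \<Gamma> {c,u}" unfolding curve4_def UG_def by auto
  have ua: "arc_set (\<Gamma> {u,a}) (p a) (p u)" and uc: "arc_set (\<Gamma> {c,u}) (p u) (p c)"
    using draw(2)[OF cD(1)] draw(2)[OF cD(4)] arc_set_sym by blast+
  obtain q where q: "q \<in> \<Gamma> {u,a} - {p a, p u}" using arc_set_interior(4)[OF ua] by blast
  obtain q' where q': "q' \<in> \<Gamma> {c,u} - {p u, p c}" using arc_set_interior(4)[OF uc] by blast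
  \<comment> \<open>The rest of the curve off \<open>K\<close> is the open edge \<open>u a\<close>,
    and off \<open>K'\<close> it is the open edge \<open>c u\<close>.\<close>
  define K where "K = \<Gamma> {a,b} \<union> \<Gamma> {b,c} \<union> \<Gamma> {c,u}"
  define K' where "K' = \<Gamma> {u,a} \<union> \<Gamma> {a,b} \<union> \<Gamma> {b,c}"
  have clG: "closed (\<Gamma> {x,y})" if "{x,y} \<in> E" for x y using arc_set_closed[OF draw(2)[OF that]] .
  have clK: "closed K" "closed K'" unfolding K_def K'_def using clG cD by (simp_all add: closed_Un)
  have I1: "\<Gamma> {u,a} \<inter> \<Gamma> {a,b} = {p a}" "\<Gamma> {u,a} \<inter> \<Gamma> {b,c} = {}" "\<Gamma> {u,a} \<inter> \<Gamma> {c,u} = {p u}"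
    "\<Gamma> {c,u} \<inter> \<Gamma> {a,b} = {}" "\<Gamma> {c,u} \<inter> \<Gamma> {b,c} = {p c}"
  proof -
    have d: "{u,a} \<noteq> {a,b}" "{u,a} \<noteq> {b,c}" "{u,a} \<noteq> {c,u}" "{c,u} \<noteq> {a,b}" "{c,u} \<noteq> {b,c}"
      using cD(9-14) by (simp_all add: doubleton_eq_iff)
    have i: "{u,a} \<inter> {a,b} = {a}" "{u,a} \<inter> {b,c} = {}" "{u,a} \<inter> {c,u} = {u}" "{c,u} \<inter> {a,b} = {}" "{c,u} \<inter> {b,c} = {c}"
      using cD(9-14) by auto
    show "\<Gamma> {u,a} \<inter> \<Gamma> {a,b} = {p a}" "\<Gamma> {u,a} \<inter> \<Gamma> {b,c} = {}" "\<Gamma> {u,a} \<inter> \<Gamma> {c,u} = {p u}"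
      "\<Gamma> {c,u} \<inter> \<Gamma> {a,b} = {}" "\<Gamma> {c,u} \<inter> \<Gamma> {b,c} = {p c}"
      using draw(4)[OF cD(1,2) d(1)] draw(4)[OF cD(1,3) d(2)] draw(4)[OF cD(1,4) d(3)]
        draw(4)[OF cD(4,2) d(4)] draw(4)[OF cD(4,3) d(5)] unfolding i by simp_all
  qed
  have qK: "q \<notin> K" "q' \<notin> K'" using q q' I1 unfolding K_def K'_def by blast+
  have qJ: "q \<in> ?J" "q' \<in> ?J" using q q' JU by blast+
  have KK: "- K \<inter> - K' \<inter> ?J = {}" unfolding K_def K'_def JU by blast
  obtain D0 y y' where D0: "arc_set D0 y y'" "D0 \<subseteq> ?R \<union> {y, y'}" "y \<in> ?J - K" "y' \<in> ?J - K'"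
    using crosscut[OF J z(1) qJ(1) clK(1) qK(1) qJ(2) clK(2) qK(2) KK] by blast
  have y: "y \<in> \<Gamma> {u,a}" "y \<noteq> p a" "y \<noteq> p u"
    using D0(3) I1 unfolding K_def JU by blast+
  have y': "y' \<in> \<Gamma> {c,u}" "y' \<noteq> p u" "y' \<noteq> p c"
    using D0(4) I1 unfolding K'_def JU by blast+
  obtain S1 R1 where S1: "arc_set S1 (p a) y" "arc_set R1 y (p u)" "S1 \<inter> R1 = {y}" "S1 \<union> R1 = \<Gamma> {u,a}"
    by (rule arc_set_split[OF ua y])
  obtain R2 S2 where S2: "arc_set R2 (p u) y'" "arc_set S2 y' (p c)" "R2 \<inter> S2 = {y'}" "R2 \<union> S2 = \<Gamma> {c,u}"
    by (rule arc_set_split[OF uc y'])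
  have pu: "p u \<notin> S1" "p u \<notin> S2"
  proof -
    have "p u \<in> R1" "p u \<in> R2" using arc_set_ends[OF S1(2)] arc_set_ends[OF S2(1)] by simp_all
    then show "p u \<notin> S1" "p u \<notin> S2" using S1(3) y(3) S2(3) y'(2) by (metis IntI singletonD)+
  qed
  have yy': "y \<notin> \<Gamma> {c,u}" "y' \<notin> \<Gamma> {u,a}" using y y' I1(3) by blast+
  have D0J: "D0 \<inter> ?J = {y, y'}" using D0(2-4) RJ arc_set_ends[OF D0(1)] by blast
  have SJ: "S1 \<subseteq> \<Gamma> {u,a}" "S2 \<subseteq> \<Gamma> {c,u}" "R1 \<subseteq> \<Gamma> {u,a}" "\<Gamma> {u,a} \<subseteq> ?J" "\<Gamma> {c,u} \<subseteq> ?J"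
    using S1(4) S2(4) JU by blast+
  have ye: "y \<in> S1" "y \<in> D0" "y' \<in> S2" "y' \<in> D0" "p a \<in> S1" "p c \<in> S2" "y \<in> R1"
    using arc_set_ends[OF S1(1)] arc_set_ends[OF D0(1)] arc_set_ends[OF S2(2)] arc_set_ends[OF S1(2)] by simp_all
  have D0S1: "D0 \<inter> \<Gamma> {u,a} = {y}" and D0S2: "D0 \<inter> \<Gamma> {c,u} = {y'}"
  proof -
    have "D0 \<inter> \<Gamma> {u,a} = {y, y'} \<inter> \<Gamma> {u,a}" using D0J SJ(4) by blast
    then show "D0 \<inter> \<Gamma> {u,a} = {y}" using yy' y(1) by simp
    have "D0 \<inter> \<Gamma> {c,u} = {y, y'} \<inter> \<Gamma> {c,u}" using D0J SJ(5) by blast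
    then show "D0 \<inter> \<Gamma> {c,u} = {y'}" using yy' y'(1) by simp
  qed
  have "S1 \<inter> S2 \<subseteq> {p u}" "R1 \<inter> S2 \<subseteq> {p u}" unfolding I1(3)[symmetric] using SJ(1,2,3) by blast+
  then have S12: "S1 \<inter> S2 = {}" "R1 \<inter> S2 = {}" using pu by blast+
  define D where "D = S1 \<union> D0 \<union> S2"
  have "S1 \<inter> D0 = {y}" using D0S1 SJ(1) ye by blast
  then have "arc_set (S1 \<union> D0) (p a) y'" using arc_set_join[OF S1(1) D0(1)] by simp
  moreover have "(S1 \<union> D0) \<inter> S2 = {y'}" using D0S2 SJ(2) ye S12 by blast
  ultimately have arcD: "arc_set D (p a) (p c)" unfolding D_def using arc_set_join S2(2) by blast
  have GV: "\<Gamma> {u,a} \<inter> p ` V = {p u, p a}" "\<Gamma> {c,u} \<inter> p ` V = {p c, p u}"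
    using draw(3)[OF cD(1)] draw(3)[OF cD(4)] by simp_all
  have D0V: "D0 \<inter> p ` V = {}"
  proof -
    have "y \<notin> p ` V" "y' \<notin> p ` V" using GV y y' by blast+
    then show ?thesis using D0(2) z(2) by blast
  qed
  have DV: "D \<inter> p ` V = {p a, p c}"
  proof -
    have "S1 \<inter> p ` V \<subseteq> {p u, p a}" unfolding GV(1)[symmetric] using SJ(1) by blast
    then have "S1 \<inter> p ` V = {p a}" by (rule subset_pair_singleton) (use pu(1) ye(5) cD(18) in simp_all)
    moreover have "S2 \<inter> p ` V \<subseteq> {p u, p c}" unfolding insert_commute[of "p u"] GV(2)[symmetric] using SJ(2) by blast
    then have "S2 \<inter> p ` V = {p c}" by (rule subset_pair_singleton) (use pu(2) ye(6) cD(20) in simp_all)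
    ultimately show ?thesis unfolding D_def using D0V by blast
  qed
  have DE: "\<Gamma> e \<inter> D = p ` (e \<inter> {a, c})" if e: "e \<in> E" "e \<noteq> {u, a}" "e \<noteq> {c, u}" for e
  proof -
    have g1: "\<Gamma> e \<inter> \<Gamma> {u,a} = p ` (e \<inter> {u,a})" and g2: "\<Gamma> e \<inter> \<Gamma> {c,u} = p ` (e \<inter> {c,u})"
      using draw(4)[OF e(1) cD(1) e(2)] draw(4)[OF e(1) cD(4) e(3)] .
    have "p ` (e \<inter> {u,a}) \<subseteq> {p u, p a}" "p ` (e \<inter> {c,u}) \<subseteq> {p u, p c}" by blast+
    then have "y \<notin> \<Gamma> e" "y' \<notin> \<Gamma> e" using g1 g2 y y' by blast+
    then have 0: "\<Gamma> e \<inter> D0 = {}" using D0(2) emp[OF e(1)] by blast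
    have pin: "p x \<in> \<Gamma> e \<longleftrightarrow> x \<in> e" if "x \<in> V" for x
      using draw(3)[OF e(1)] p_mem[OF that simple_graph_edge_subset[OF simple e(1)]] that by blast
    have "\<Gamma> e \<inter> S1 \<subseteq> {p u, p a}" "\<Gamma> e \<inter> S2 \<subseteq> {p u, p c}"
      using g1 g2 SJ(1,2) by blast+
    then have 1: "\<Gamma> e \<inter> S1 \<subseteq> {p a}" "\<Gamma> e \<inter> S2 \<subseteq> {p c}" using pu by blast+
    have "\<Gamma> e \<inter> D = (\<Gamma> e \<inter> S1) \<union> (\<Gamma> e \<inter> S2)" unfolding D_def using 0 by blast
    also have "\<dots> = {x. (x = p a \<and> a \<in> e) \<or> (x = p c \<and> c \<in> e)}"
      using 1 ye(5,6) pin[OF cD(18)] pin[OF cD(20)] by blast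
    also have "\<dots> = p ` (e \<inter> {a, c})" by auto
    finally show ?thesis .
  qed
  have RD: "R1 \<inter> D = {y}"
    unfolding D_def using S1(3) D0S1 SJ(3) S12(2) ye by blast
  let ?F = "E - {{c, u}, {c, b}}" and ?L = "\<lambda>e. if e = {u, a} then R1 else \<Gamma> e"
  have idF: "identify a c ?F = identify a c E"
  proof -
    have i: "redirect a c ` {c, x} = redirect a c ` {a, x}" for x by (auto simp: redirect_def)
    have e: "{a, u} \<in> ?F" "{a, b} \<in> ?F" using cD by (auto simp: doubleton_eq_iff)
    have m: "redirect a c ` {c, u} \<in> identify a c ?F" "redirect a c ` {c, b} \<in> identify a c ?F"
      unfolding identify_def i by (rule imageI, rule e)+
    have "E = insert {c, u} (insert {c, b} ?F)" using cD(4,6) by blast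
    then have "identify a c E = insert (redirect a c ` {c, u}) (insert (redirect a c ` {c, b}) (identify a c ?F))"
      unfolding identify_def by (metis image_insert)
    then show ?thesis using m by (simp only: insert_absorb)
  qed
  have LG: "?L e \<subseteq> \<Gamma> e" for e using SJ(3) by simp
  have nca: "{a, c} \<notin> E" by (rule cD(16))
  have "drawable (V - {c}) (identify a c ?F)"
  proof (rule drawable_identify[where p = p and D = D and \<Lambda> = ?L])
    show "simple_graph (V, ?F)" using simple unfolding simple_graph_def by auto
    show "inj_on p V" by (rule draw(1))
    show "arc_set D (p a) (p c)" by (rule arcD)
    show "D \<inter> p ` V = {p a, p c}" by (rule DV)
    show "a \<in> V" "c \<in> V" "a \<noteq> c" "{a, c} \<notin> ?F" using cD by auto
    show "\<not> ({a, x} \<in> ?F \<and> {c, x} \<in> ?F)" for x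
    proof
      assume x: "{a, x} \<in> ?F \<and> {c, x} \<in> ?F"
      then have "x \<in> common E a c" unfolding common_def using edge_sym by blast
      then show False using co x by auto
    qed
    show "arc_set (?L {x, w}) (p x) (p w) \<and> ?L {x, w} \<inter> D = {}"
      if xw: "{x, w} \<in> ?F" "x \<notin> {a, c}" "w \<notin> {a, c}" for x w
    proof -
      have ne: "{x,w} \<noteq> {u,a}" "{x,w} \<noteq> {c,u}" using xw(2,3) by (auto simp only: doubleton_eq_iff insert_iff)
      have xwE: "{x,w} \<in> E" using xw(1) by simp
      have "\<Gamma> {x,w} \<inter> D = p ` ({x,w} \<inter> {a,c})" by (rule DE[OF xwE ne])
      also have "{x,w} \<inter> {a,c} = {}" using xw by blast
      finally show ?thesis using draw(2)[OF xwE] ne by simp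
    qed
    show "\<exists>d\<in>D. arc_set (?L {x, w}) d (p w) \<and> ?L {x, w} \<inter> D = {d}"
      if xw: "{x, w} \<in> ?F" "x \<in> {a, c}" for x w
    proof (cases "{x,w} = {u,a}")
      case True
      then have xw': "x = a" "w = u" using xw(2) cD(14) by (auto simp only: doubleton_eq_iff insert_iff)
      have "y \<in> D" using ye(1) unfolding D_def by simp
      moreover have "?L {x,w} = R1" using True by simp
      ultimately show ?thesis using S1(2) RD xw' by auto
    next
      case False
      have xwE: "{x,w} \<in> E" and ne: "{x,w} \<noteq> {c,u}" using xw(1) by simp_all
      have "w \<notin> {a,c}" using xw(2) xwE nca edge(3)[OF xwE] edge_sym[OF xwE] by (auto simp only: insert_iff)
      then have i: "{x,w} \<inter> {a,c} = {x}" using xw(2) by auto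
      have px: "\<Gamma> {x,w} \<inter> D = {p x}" using DE[OF xwE False ne] unfolding i by simp
      then have "p x \<in> D" by blast
      moreover have "?L {x,w} = \<Gamma> {x,w}" using False by simp
      ultimately show ?thesis using draw(2)[OF xwE] px by auto
    qed
    show "?L e \<inter> p ` V \<subseteq> p ` e \<union> D" if "e \<in> ?F" for e
      using LG[of e] draw(3)[of e] that by blast
    show "?L e \<inter> ?L e' \<subseteq> p ` (e \<inter> e') \<union> D" if "e \<in> ?F" "e' \<in> ?F" "e \<noteq> e'" for e e'
      using LG[of e] LG[of e'] draw(4)[of e e'] that by blast
  qed
  then show ?thesis unfolding idF .
qed

end

section \<open>Regions between common neighbours\<close>

context plane_graph begin

lemma edge_avoids_side:
  assumes C: "cycle4 E u a b c" and z: "z \<notin> curve4 u a b c" and xy: "{x, y} \<in> E"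
    and out: "p x \<notin> away (curve4 u a b c) z" "p y \<notin> away (curve4 u a b c) z"
  shows "\<Gamma> {x, y} \<inter> away (curve4 u a b c) z = {}"
proof (rule ccontr)
  assume "\<not> ?thesis"
  then obtain m where m: "m \<in> \<Gamma> {x, y}" "m \<in> away (curve4 u a b c) z" by blast
  have m': "m \<in> \<Gamma> {y, x}" using m(1) Gam_sym[of x y] by simp
  consider "x \<notin> {u,a,b,c}" | "y \<notin> {u,a,b,c}" | "x \<in> {u,a,b,c}" "y \<in> {u,a,b,c}" by blast
  then show False
  proof cases
    case 1
    then show False using edge_off_side(2)[OF C xy 1 m z] out by blast
  next
    case 2
    then show False using edge_off_side(2)[OF C edge_sym[OF xy] 2 m' m(2) z] out by blast
  next
    case 3
    then have "{x, y} \<in> {{u, a}, {a, b}, {b, c}, {c, u}}" using chordless[OF C xy] by simp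
    then have "\<Gamma> {x, y} \<subseteq> curve4 u a b c" unfolding curve4_def UG_def by (rule UN_upper)
    then show False using m away_facts(4)[OF jordan_curve4[OF C] z] by blast
  qed
qed

lemma neighbour_side:
  assumes C: "cycle4 E u a b c" and z: "z \<notin> curve4 u a b c" and xy: "{x, y} \<in> E"
    and x: "p x \<in> away (curve4 u a b c) z" and y: "y \<notin> {u, a, b, c}"
  shows "p y \<in> away (curve4 u a b c) z"
proof -
  have "p x \<notin> curve4 u a b c" using x away_facts(4)[OF jordan_curve4[OF C] z] by blast
  then have "x \<notin> {u, a, b, c}" using on_curve4[OF C edge(1)[OF xy]] by blast
  moreover have "p x \<in> \<Gamma> {x, y}" using Gam_vertex[OF xy] by simp
  ultimately show ?thesis using edge_off_side(3)[OF C xy _ _ x z y] by blast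
qed

lemma side_off_cycle:
  assumes C: "cycle4 E u a b c" and z: "z \<notin> curve4 u a b c" and x: "x \<in> V" "p x \<in> away (curve4 u a b c) z"
  shows "x \<notin> {u, a, b, c}"
proof
  assume "x \<in> {u, a, b, c}"
  then have "p x \<in> curve4 u a b c" using on_curve4[OF C x(1)] by simp
  then show False using x(2) away_facts(4)[OF jordan_curve4[OF C] z] by blast
qed

lemma finite_V: "finite V"
  using simple unfolding simple_graph_def by simp

lemma theta_arcs:
  assumes st: "s \<noteq> t" and y: "y1 \<in> common E s t" "y2 \<in> common E s t" "y1 \<noteq> y2"
  shows "arc_set (UG {{s, y1}, {y1, t}}) (p s) (p t)"
    "UG {{s, y1}, {y1, t}} \<inter> UG {{s, y2}, {y2, t}} = {p s, p t}"
    "p y1 \<in> UG {{s, y1}, {y1, t}} - {p s, p t}" "cycle4 E s y1 t y2"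
    "\<And>r. r \<in> V \<Longrightarrow> r \<notin> {s, y1, t} \<Longrightarrow> p r \<notin> UG {{s, y1}, {y1, t}}"
proof -
  have e: "{s, y1} \<in> E" "{y1, t} \<in> E" "{s, y2} \<in> E" "{y2, t} \<in> E" using y unfolding common_def by auto
  show "arc_set (UG {{s, y1}, {y1, t}}) (p s) (p t)" by (rule arc2[OF e(1,2) st])
  show "UG {{s, y1}, {y1, t}} \<inter> UG {{s, y2}, {y2, t}} = {p s, p t}" by (rule arcs_Int[OF e st y(3)])
  show "cycle4 E s y1 t y2" unfolding cycle4_def using e st y(3) edge_sym by simp
  have "p y1 \<noteq> p s" "p y1 \<noteq> p t" using edge[OF e(1)] edge[OF e(2)] p_eq by metis+
  moreover have "p y1 \<in> UG {{s, y1}, {y1, t}}" unfolding UG_def using Gam_vertex[OF e(1)] by simp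
  ultimately show "p y1 \<in> UG {{s, y1}, {y1, t}} - {p s, p t}" by simp
  show "p r \<notin> UG {{s, y1}, {y1, t}}" if r: "r \<in> V" "r \<notin> {s, y1, t}" for r
  proof
    assume "p r \<in> UG {{s, y1}, {y1, t}}"
    then have "p r \<in> p ` \<Union>{{s, y1}, {y1, t}}" using UG_V[of "{{s, y1}, {y1, t}}"] e r(1) by blast
    moreover have U: "\<Union>{{s, y1}, {y1, t}} = {s, y1, t}" by auto
    ultimately have "p r \<in> p ` {s, y1, t}" by (simp only: U)
    moreover have "{s, y1, t} \<subseteq> V" using edge[OF e(1)] edge[OF e(2)] by simp
    ultimately show False using p_mem[OF r(1)] r(2) by blast
  qed
qed

lemma reg_split:
  assumes st: "s \<noteq> t" and y: "y1 \<in> common E s t" "y2 \<in> common E s t" "y3 \<in> common E s t" "y1 \<noteq> y2" "y1 \<noteq> y3" "y2 \<noteq> y3"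
    and r: "r \<in> V" "r \<notin> {s, t, y1, y2, y3}"
    and y3: "p y3 \<in> away (curve4 s y1 t y2) (p r)"
  shows "away (curve4 s y1 t y3) (p r) \<inter> away (curve4 s y3 t y2) (p r) = {}"
    "away (curve4 s y1 t y3) (p r) \<subseteq> away (curve4 s y1 t y2) (p r)"
    "away (curve4 s y3 t y2) (p r) \<subseteq> away (curve4 s y1 t y2) (p r)"
    "\<And>x. x \<in> V \<Longrightarrow> x \<noteq> y3 \<Longrightarrow> p x \<in> away (curve4 s y1 t y2) (p r) \<Longrightarrow>
       p x \<in> away (curve4 s y1 t y3) (p r) \<or> p x \<in> away (curve4 s y3 t y2) (p r)"
proof -
  let ?S1 = "UG {{s, y1}, {y1, t}}" and ?S2 = "UG {{s, y2}, {y2, t}}" and ?S3 = "UG {{s, y3}, {y3, t}}"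
  have c: "curve4 s y1 t y2 = ?S1 \<union> ?S2" "curve4 s y1 t y3 = ?S1 \<union> ?S3" "curve4 s y3 t y2 = ?S2 \<union> ?S3"
    using curve4_arcs by blast+
  note a1 = theta_arcs[OF st y(1,2,4)] and a13 = theta_arcs[OF st y(1,3,5)]
    and a2 = theta_arcs[OF st y(2,3,6)] and a3 = theta_arcs[OF st y(3,1) y(5)[symmetric]]
  have pr: "p r \<notin> ?S1" "p r \<notin> ?S2" "p r \<notin> ?S3" using a1(5)[OF r(1)] a2(5)[OF r(1)] a3(5)[OF r(1)] r(2) by simp_all
  have y3S: "p y3 \<in> ?S3" using a3(3) by simp
  note T = theta_split[OF a1(1) a2(1) a3(1) a1(2) a13(2) a2(2) pr y3S y3[unfolded c(1)]]
  show "away (curve4 s y1 t y3) (p r) \<inter> away (curve4 s y3 t y2) (p r) = {}" unfolding c by (rule T(1))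
  show "away (curve4 s y1 t y3) (p r) \<subseteq> away (curve4 s y1 t y2) (p r)"
    "away (curve4 s y3 t y2) (p r) \<subseteq> away (curve4 s y1 t y2) (p r)" unfolding c T(2)[symmetric] by blast+
  show "p x \<in> away (curve4 s y1 t y3) (p r) \<or> p x \<in> away (curve4 s y3 t y2) (p r)"
    if x: "x \<in> V" "x \<noteq> y3" "p x \<in> away (curve4 s y1 t y2) (p r)" for x
  proof -
    have rJ: "p r \<notin> curve4 s y1 t y2" using pr c by simp
    have "x \<notin> {s, y1, t, y2}" by (rule side_off_cycle[OF a1(4) rJ x(1,3)])
    then have "p x \<notin> ?S3" using a3(5)[OF x(1)] x(2) by simp
    then show ?thesis using x(3) unfolding c T(2)[symmetric] by blast
  qed
qed

lemma reg_one_inside: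
  assumes st: "s \<noteq> t" and y: "y1 \<in> common E s t" "y2 \<in> common E s t" "y3 \<in> common E s t" "y1 \<noteq> y2" "y1 \<noteq> y3" "y2 \<noteq> y3"
    and r: "r \<in> V" "r \<notin> {s, t, y1, y2, y3}"
    and y3: "p y3 \<notin> away (curve4 s y1 t y2) (p r)"
  shows "p y2 \<in> away (curve4 s y1 t y3) (p r) \<or> p y1 \<in> away (curve4 s y3 t y2) (p r)"
proof -
  let ?S1 = "UG {{s, y1}, {y1, t}}" and ?S2 = "UG {{s, y2}, {y2, t}}" and ?S3 = "UG {{s, y3}, {y3, t}}"
  have c: "curve4 s y1 t y2 = ?S1 \<union> ?S2" "curve4 s y1 t y3 = ?S1 \<union> ?S3" "curve4 s y3 t y2 = ?S2 \<union> ?S3"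
    using curve4_arcs by blast+
  note a1 = theta_arcs[OF st y(1,2,4)] and a13 = theta_arcs[OF st y(1,3,5)]
    and a2 = theta_arcs[OF st y(2,3,6)] and a3 = theta_arcs[OF st y(3,1) y(5)[symmetric]]
  have pr: "p r \<notin> ?S1" "p r \<notin> ?S2" "p r \<notin> ?S3" using a1(5)[OF r(1)] a2(5)[OF r(1)] a3(5)[OF r(1)] r(2) by simp_all
  show ?thesis unfolding c
    by (rule theta_one_inside[OF a1(1) a2(1) a3(1) a1(2) a13(2) a2(2) pr a1(3) a2(3) a3(3) y3[unfolded c(1)]])
qed

lemma curve4_swap: "curve4 s y t y' = curve4 s y' t y"
  unfolding curve4_arcs by blast

text \<open>The inner common neighbours cut the region into one more cell than their number, and
  every cell contains a vertex. A cell bounded by two consecutive ones contains no element of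
  \<open>Y\<close>, so that vertex counts on the right; this extra cell makes the inequality
  strict.\<close>

lemma region_count_between:
  assumes st: "s \<noteq> t" and Y: "Y \<subseteq> common E s t" "finite Y"
    and r: "r \<in> V" "r \<notin> Y" "r \<noteq> s" "r \<noteq> t"
    and ne: "\<And>y y'. y \<in> Y \<Longrightarrow> y' \<in> Y \<Longrightarrow> y \<noteq> y' \<Longrightarrow> away (curve4 s y t y') (p r) \<inter> p ` V \<noteq> {}"
    and y: "y \<in> Y" "y' \<in> Y" "y \<noteq> y'"
  shows "card {x\<in>Y. p x \<in> away (curve4 s y t y') (p r)} < card {x\<in>V - Y. p x \<in> away (curve4 s y t y') (p r)}"
  using y
proof (induction "card {x\<in>Y. p x \<in> away (curve4 s y t y') (p r)}" arbitrary: y y' rule: less_induct)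
  case (less y y')
  let ?reg = "\<lambda>y y'. away (curve4 s y t y') (p r)"
  let ?I = "\<lambda>y y'. {x\<in>Y. p x \<in> ?reg y y'}" and ?D = "\<lambda>y y'. {x\<in>V - Y. p x \<in> ?reg y y'}"
  have fin: "finite (?I a b)" "finite (?D a b)" for a b using Y(2) finite_V by simp_all
  show ?case
  proof (cases "?I y y' = {}")
    case True
    obtain x where x: "x \<in> V" "p x \<in> ?reg y y'" using ne[OF less.prems] by blast
    then have "x \<in> ?D y y'" using True by blast
    then have "?D y y' \<noteq> {}" by blast
    then have "card (?D y y') > 0" using fin(2) card_gt_0_iff by blast
    then show ?thesis unfolding True by simp
  next
    case False
    then obtain w where w: "w \<in> Y" "p w \<in> ?reg y y'" by blast
    have co: "y \<in> common E s t" "y' \<in> common E s t" "w \<in> common E s t" using Y less.prems w by auto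
    have C: "cycle4 E s y t y'" by (rule theta_arcs(4)[OF st co(1,2) less.prems(3)])
    have rn: "r \<notin> {s, y, t, y'}" using r less.prems by auto
    then have rJ: "p r \<notin> curve4 s y t y'" using on_curve4[OF C r(1)] by blast
    have wV: "w \<in> V" using co(3) edge unfolding common_def by blast
    have wn: "w \<notin> {s, y, t, y'}" by (rule side_off_cycle[OF C rJ wV w(2)])
    have wne: "y \<noteq> w" "y' \<noteq> w" using wn by auto
    have rn': "r \<notin> {s, t, y, y', w}" using rn r(2) w(1) by auto
    note S = reg_split[OF st co less.prems(3) wne r(1) rn' w(2)]
    have rJ': "p r \<notin> curve4 s y t w" "p r \<notin> curve4 s w t y'"
      using on_curve4[OF theta_arcs(4)[OF st co(1,3) wne(1)] r(1)] on_curve4[OF theta_arcs(4)[OF st co(3,2) wne(2)[symmetric]] r(1)] rn' by auto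
    have nw: "w \<notin> ?I y w" "w \<notin> ?I w y'"
      using side_off_cycle[OF theta_arcs(4)[OF st co(1,3) wne(1)] rJ'(1) wV]
        side_off_cycle[OF theta_arcs(4)[OF st co(3,2) wne(2)[symmetric]] rJ'(2) wV] by auto
    have I: "?I y y' = insert w (?I y w \<union> ?I w y')"
    proof (intro equalityI subsetI)
      fix x assume x: "x \<in> ?I y y'"
      then have "x \<in> V" using Y edge unfolding common_def by blast
      then show "x \<in> insert w (?I y w \<union> ?I w y')" using S(4)[of x] x by blast
    next
      fix x assume "x \<in> insert w (?I y w \<union> ?I w y')"
      then show "x \<in> ?I y y'" using S(2,3) w by blast
    qed
    have disI: "?I y w \<inter> ?I w y' = {}" "?D y w \<inter> ?D w y' = {}" using S(1) by blast+
    have "card (?I y y') = Suc (card (?I y w) + card (?I w y'))"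
      unfolding I using nw fin disI by (simp add: card_Un_disjoint)
    moreover have "card (?I y w) < card (?D y w)"
      by (rule less.hyps) (use calculation less.prems w wne in auto)
    moreover have "card (?I w y') < card (?D w y')"
      by (rule less.hyps) (use calculation less.prems w wne in auto)
    moreover have "card (?D y w) + card (?D w y') \<le> card (?D y y')"
    proof -
      have "?D y w \<union> ?D w y' \<subseteq> ?D y y'" using S(2,3) by blast
      then have "card (?D y w \<union> ?D w y') \<le> card (?D y y')" using fin card_mono by blast
      then show ?thesis using fin disI by (simp add: card_Un_disjoint)
    qed
    ultimately show ?thesis by linarith
  qed
qed

text \<open>Among all regions seen from \<open>r\<close> take one with the most elements of
  \<open>Y\<close> inside. By \<open>reg_one_inside\<close>, an element of \<open>Y\<close> left out
  would yield a larger region, so all of \<open>Y\<close> except the two bounding vertices is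
  inside.\<close>

lemma region_count:
  assumes st: "s \<noteq> t" and Y: "Y \<subseteq> common E s t" "finite Y" "card Y \<ge> 2"
    and r: "r \<in> V" "r \<notin> Y" "r \<noteq> s" "r \<noteq> t"
    and ne: "\<And>y y'. y \<in> Y \<Longrightarrow> y' \<in> Y \<Longrightarrow> y \<noteq> y' \<Longrightarrow> away (curve4 s y t y') (p r) \<inter> p ` V \<noteq> {}"
  obtains y y' where "y \<in> Y" "y' \<in> Y" "y \<noteq> y'"
    "card Y \<le> Suc (card {x\<in>V - Y. p x \<in> away (curve4 s y t y') (p r)})"
proof -
  let ?reg = "\<lambda>y y'. away (curve4 s y t y') (p r)"
  let ?I = "\<lambda>y y'. {x\<in>Y. p x \<in> ?reg y y'}"
  let ?P = "\<lambda>(y, y'). y \<in> Y \<and> y' \<in> Y \<and> y \<noteq> y'"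
  have fin: "finite (?I a b)" for a b using Y(2) by simp
  obtain y0 y0' where "y0 \<in> Y" "y0' \<in> Y" "y0 \<noteq> y0'"
    using Y(2,3) by (metis card_le_Suc0_iff_eq not_less_eq_eq numeral_2_eq_2)
  let ?S = "{m. ?P m}" and ?f = "\<lambda>(y, y'). card (?I y y')"
  have finS: "finite ?S" by (rule finite_subset[of _ "Y \<times> Y"]) (use Y(2) in auto)
  have "(y0, y0') \<in> ?S" using \<open>y0 \<in> Y\<close> \<open>y0' \<in> Y\<close> \<open>y0 \<noteq> y0'\<close> by simp
  then have "Max (?f ` ?S) \<in> ?f ` ?S" using finS by (intro Max_in) blast+
  then obtain m where m: "?P m" "?f m = Max (?f ` ?S)" by (smt (verit) imageE mem_Collect_eq)
  have mx: "?f x \<le> ?f m" if "?P x" for x unfolding m(2) using finS that by (intro Max_ge) auto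
  obtain y y' where mm: "m = (y, y')" by (cases m)
  have y: "y \<in> Y" "y' \<in> Y" "y \<noteq> y'" and max: "\<And>a b. a \<in> Y \<Longrightarrow> b \<in> Y \<Longrightarrow> a \<noteq> b \<Longrightarrow> card (?I a b) \<le> card (?I y y')"
    using m(1) mx[of "(_, _)"] unfolding mm by auto
  have grow: "p w \<in> ?reg y y'" if w: "w \<in> Y" "w \<noteq> y" "w \<noteq> y'" for w
  proof (rule ccontr)
    assume n: "p w \<notin> ?reg y y'"
    \<comment> \<open>Replacing \<open>b\<close> by \<open>w\<close> would enclose \<open>b\<close>
      in addition to everything enclosed before.\<close>
    have *: False if ab: "a \<in> Y" "b \<in> Y" "a \<noteq> b" "a \<noteq> w" "b \<noteq> w" and m': "card (?I a b) = card (?I y y')"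
      and h: "p b \<in> ?reg a w" for a b
    proof -
      have co: "a \<in> common E s t" "w \<in> common E s t" "b \<in> common E s t" using Y ab w by auto
      have rn: "r \<notin> {s, t, a, w, b}" using r ab w by auto
      note S = reg_split[OF st co ab(4) ab(3) ab(5)[symmetric] r(1) rn h]
      have C: "cycle4 E s a t b" by (rule theta_arcs(4)[OF st co(1,3) ab(3)])
      have rJ: "p r \<notin> curve4 s a t b" using on_curve4[OF C r(1)] rn by auto
      have "b \<in> V" using co(3) edge unfolding common_def by blast
      then have "b \<notin> ?I a b" using side_off_cycle[OF C rJ] by auto
      moreover have "b \<in> ?I a w" using h ab by simp
      moreover have "?I a b \<subseteq> ?I a w" using S(2) by blast
      ultimately have "?I a b \<subset> ?I a w" by blast
      then have "card (?I a b) < card (?I a w)" using fin psubset_card_mono by blast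
      moreover have "card (?I a w) \<le> card (?I y y')" by (rule max) (use ab w in auto)
      ultimately show False using m' by simp
    qed
    have co: "y \<in> common E s t" "y' \<in> common E s t" "w \<in> common E s t" using Y y w by auto
    have rn: "r \<notin> {s, t, y, y', w}" using r y w by auto
    consider "p y' \<in> ?reg y w" | "p y \<in> ?reg w y'"
      using reg_one_inside[OF st co y(3) w(2)[symmetric] w(3)[symmetric] r(1) rn n] by blast
    then show False
    proof cases
      case 1
      then show False using *[of y y'] y w by auto
    next
      case 2
      then have "p y \<in> ?reg y' w" using curve4_swap by metis
      moreover have "card (?I y' y) = card (?I y y')" using curve4_swap by metis
      ultimately show False using *[of y' y] y w by auto
    qed
  qed
  have "?I y y' = Y - {y, y'}"
  proof (intro equalityI subsetI)
    fix x assume x: "x \<in> ?I y y'"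
    have co: "y \<in> common E s t" "y' \<in> common E s t" "x \<in> common E s t" using Y y x by auto
    have C: "cycle4 E s y t y'" by (rule theta_arcs(4)[OF st co(1,2) y(3)])
    have rJ: "p r \<notin> curve4 s y t y'" using on_curve4[OF C r(1)] r y by auto
    have "x \<in> V" using co(3) edge unfolding common_def by blast
    then show "x \<in> Y - {y, y'}" using side_off_cycle[OF C rJ] x by auto
  next
    fix x assume "x \<in> Y - {y, y'}"
    then show "x \<in> ?I y y'" using grow by simp
  qed
  \<comment> \<open>The two bounding vertices are missing, and the strict inequality gives one back;
    hence the single \<open>Suc\<close> in the conclusion.\<close>
  then have "card (?I y y') = card Y - 2" using y Y(2) by (simp add: card_Diff_subset)
  then show ?thesis using that[OF y] region_count_between[OF st Y(1,2) r ne y] Y(3) by auto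
qed

text \<open>A 4-cycle through \<open>x\<close> inside the closed side would have a side of its own
  contained in the given one and missing \<open>x\<close>, hence with fewer vertices. If the vertex
  opposite to \<open>x\<close> lies beyond the given cycle, it can be replaced by a vertex of that
  cycle.\<close>

lemma minimal_side_no_cycle4:
  assumes C: "cycle4 E u a b c" and z: "z \<notin> curve4 u a b c"
    and min: "\<And>u' a' b' c' z'. cycle4 E u' a' b' c' \<Longrightarrow> z' \<notin> curve4 u' a' b' c' \<Longrightarrow>
      card {x\<in>V. p x \<in> away (curve4 u a b c) z} \<le> card {x\<in>V. p x \<in> away (curve4 u' a' b' c') z'}"
    and x: "x \<in> V" "p x \<in> away (curve4 u a b c) z"
  shows "\<not> cycle4 E x d e f"
proof
  assume C0: "cycle4 E x d e f"
  let ?J = "curve4 u a b c" and ?Q = "{u, a, b, c}"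
  let ?R = "away ?J z" and ?I = "{x\<in>V. p x \<in> away (curve4 u a b c) z}"
  note J = jordan_curve4[OF C]
  have inside: False if C2: "cycle4 E x d e f" and sub: "{d, e, f} \<subseteq> ?I \<union> ?Q" for d e f
  proof -
    let ?J2 = "curve4 x d e f"
    note cD = cycle4D[OF C2] and J2 = jordan_curve4[OF C2]
    have ed: "\<Gamma> {y, w} \<subseteq> ?R \<union> ?J" if yw: "{y, w} \<in> E" "y \<in> ?I \<union> ?Q" "w \<in> ?I \<union> ?Q" for y w
    proof -
      have pQ: "p ` ?Q \<subseteq> ?J" using curve4_V[OF C] by blast
      have off: "\<Gamma> {y, w} \<subseteq> ?R \<union> ?J" if yw: "{y, w} \<in> E" "y \<in> ?I" for y w
      proof -
        have "y \<notin> ?Q" using side_off_cycle[OF C z] yw(2) by blast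
        moreover have "p y \<in> \<Gamma> {y, w}" using Gam_vertex[OF yw(1)] by simp
        ultimately have "\<Gamma> {y, w} - p ` ?Q \<subseteq> ?R" using edge_off_side(1)[OF C yw(1) _ _ _ z] yw(2) by blast
        then show ?thesis using pQ by blast
      qed
      consider "y \<in> ?I" | "w \<in> ?I" | "y \<in> ?Q" "w \<in> ?Q" using yw(2,3) by blast
      then show ?thesis
      proof cases
        case 1 then show ?thesis by (rule off[OF yw(1)])
      next
        case 2 then show ?thesis using off[OF edge_sym[OF yw(1)]] Gam_sym[of y w] by simp
      next
        case 3
        then have "{y, w} \<in> {{u, a}, {a, b}, {b, c}, {c, u}}" using chordless[OF C yw(1)] by simp
        then have "\<Gamma> {y, w} \<subseteq> ?J" unfolding curve4_def UG_def by (rule UN_upper)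
        then show ?thesis by blast
      qed
    qed
    have xI: "x \<in> ?I \<union> ?Q" using x by blast
    have dI: "d \<in> ?I \<union> ?Q" "e \<in> ?I \<union> ?Q" "f \<in> ?I \<union> ?Q" using sub by blast+
    have J2sub: "?J2 \<subseteq> ?R \<union> ?J"
      using ed[OF cD(1) xI dI(1)] ed[OF cD(2) dI(1,2)] ed[OF cD(3) dI(2,3)] ed[OF cD(4) dI(3) xI]
      unfolding curve4_def[of x d e f] UG_def by simp
    have zR: "z \<notin> ?R" by (rule away_facts(5)[OF J z])
    then have z2: "z \<notin> ?J2" using J2sub z by blast
    obtain q where q: "q \<in> ?R" using away_facts(3)[OF J z] by blast
    have qJ: "q \<notin> ?J" using q away_facts(4)[OF J z] by blast
    \<comment> \<open>\<open>?R'\<close> is the side of \<open>z\<close>. It avoids the new curve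
      and contains \<open>z\<close>, so it is disjoint from \<open>?R2\<close>; since
      \<open>?R2\<close> is open, it misses the boundary \<open>?J\<close> of \<open>?R'\<close> as
      well and is confined to \<open>?R\<close>.\<close>
    let ?R' = "away ?J q" and ?R2 = "away ?J2 z"
    have RR': "?R \<inter> ?R' = {}" using away_third'[OF J z q] by blast
    have R'J: "?R' \<inter> ?J = {}" by (rule away_facts(4)[OF J qJ])
    have zR': "z \<in> ?R'" by (rule away_third[OF J z q z zR])
    have R'2: "?R' \<inter> ?R2 = {}"
    proof (rule equals0I)
      fix w assume w: "w \<in> ?R' \<inter> ?R2"
      have "?R' \<inter> ?J2 = {}" using J2sub RR' R'J by blast
      then have "?R' \<subseteq> ?R2" using away_connected_subset[OF away_facts(2)[OF J qJ], of ?J2 w z] w by blast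
      then show False using zR' away_facts(5)[OF J2 z2] by blast
    qed
    have clR': "?J \<subseteq> closure ?R'" using away_facts(7)[OF J qJ] by blast
    have "?J \<inter> ?R2 = {}"
    proof (rule equals0I)
      fix w assume w: "w \<in> ?J \<inter> ?R2"
      then have "w \<in> closure ?R'" using clR' by blast
      then have "?R2 \<inter> ?R' \<noteq> {}" using w away_facts(1)[OF J2 z2]
        by (metis IntD2 closure_iff_nhds_not_empty order_refl inf_commute)
      then show False using R'2 by blast
    qed
    moreover have "w \<in> ?R" if "w \<notin> ?J" "w \<notin> ?R'" for w
      using away_third[OF J qJ _ that] away_sym[OF z q] away_third[OF J z q that(1)] that(2) by blast
    ultimately have R2R: "?R2 \<subseteq> ?R" using R'2 by blast
    have "p x \<in> ?J2" using on_curve4[OF C2 x(1)] by simp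
    then have "p x \<notin> ?R2" using away_facts(4)[OF J2 z2] by blast
    then have "{x\<in>V. p x \<in> ?R2} \<subset> ?I" using R2R x by blast
    then have "card {x\<in>V. p x \<in> ?R2} < card ?I" using finite_V psubset_card_mono[of ?I] by simp
    then show False using min[OF C2 z2] by simp
  qed
  have nb: "y \<in> ?I \<union> ?Q" if "{w, y} \<in> E" "w \<in> ?I" for w y
  proof -
    have "p w \<in> ?R" using that(2) by simp
    then show ?thesis using neighbour_side[OF C z that(1)] edge(2)[OF that(1)] by blast
  qed
  note c0 = cycle4D[OF C0] and cD = cycle4D[OF C]
  have xI: "x \<in> ?I" using x by simp
  have d: "d \<in> ?I \<union> ?Q" "f \<in> ?I \<union> ?Q" using nb[OF c0(1) xI] nb[OF c0(5) xI] by blast+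
  show False
  proof (cases "e \<in> ?I \<union> ?Q")
    case True
    then show False using inside[OF C0] d by blast
  next
    case False
    \<comment> \<open>A path can leave the side only through the given cycle, so both neighbours of
      \<open>x\<close> lie on it. Having the common neighbour \<open>x\<close>, they are nonadjacent
      and therefore opposite.\<close>
    have dQ: "d \<in> ?Q" "f \<in> ?Q" using d False nb[OF c0(2)] nb[OF c0(6)] by blast+
    have nxQ: "x \<notin> ?Q" by (rule side_off_cycle[OF C z x])
    have "{d, f} = {u, b} \<or> {d, f} = {a, c}"
    proof -
      have "d = u \<or> d = a \<or> d = b \<or> d = c" "f = u \<or> f = a \<or> f = b \<or> f = c" using dQ by simp_all
      then show ?thesis using c0(10,16) cD(1-8) by (elim disjE) (simp_all add: doubleton_eq_iff)
    qed
    then show False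
    proof
      assume df: "{d, f} = {u, b}"
      then have xe: "{x, u} \<in> E" "{x, b} \<in> E" using c0(1,5) by (auto simp: doubleton_eq_iff)
      have "cycle4 E x u a b" unfolding cycle4_def using xe cD nxQ edge_sym[OF xe(2)] by simp
      then show False using inside[of u a b] by blast
    next
      assume df: "{d, f} = {a, c}"
      then have xe: "{x, a} \<in> E" "{x, c} \<in> E" using c0(1,5) by (auto simp: doubleton_eq_iff)
      have "cycle4 E x a b c" unfolding cycle4_def using xe cD nxQ edge_sym[OF xe(2)] by simp
      then show False using inside[of a b c] by blast
    qed
  qed
qed

end

context plane_graph begin

lemma not_facial_region:
  assumes "s \<noteq> t" "y \<in> common E s t" "y' \<in> common E s t" "y \<noteq> y'" "\<not> facial s y t y'" "r \<in> V" "r \<notin> {s, y, t, y'}"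
  shows "away (curve4 s y t y') (p r) \<inter> p ` V \<noteq> {}"
proof -
  have C: "cycle4 E s y t y'" by (rule theta_arcs(4)[OF assms(1-4)])
  have "p r \<notin> curve4 s y t y'" using on_curve4[OF C assms(6)] assms(7) by blast
  then show ?thesis using assms(5) C unfolding facial_def by blast
qed

lemma finite_common: "finite (common E s t)"
proof (rule finite_subset[OF _ finite_V])
  show "common E s t \<subseteq> V" unfolding common_def using edge(2) by blast
qed

lemma common_V: "common E s t \<subseteq> V"
  unfolding common_def using edge(2) by blast

text \<open>Seen from the inner vertex \<open>x\<close>, some region between common neighbours
  contains at least \<open>card (common E u b) - 1\<close> further vertices. The vertices
  \<open>u\<close>, \<open>x\<close>, \<open>y\<close>, \<open>b\<close> lie outside it,
  \<open>y\<close> because it is adjacent to \<open>x\<close>.\<close>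

lemma thin_path_bound:
  assumes nf: "\<And>u a b c. \<not> facial u a b c" and w: "(x, y) \<in> walks3 E u b" and ub: "u \<noteq> b"
    and two: "card (common E u b) \<ge> 2"
  shows "2 * card (common E u b) + 3 \<le> card V"
proof -
  let ?Y = "common E u b"
  have e: "{u, x} \<in> E" "{x, y} \<in> E" "{y, b} \<in> E" using w unfolding walks3_def by auto
  have "?Y \<noteq> {}" using two by auto
  then obtain c where "c \<in> ?Y" by blast
  then have nub: "{u, b} \<notin> E" using trifree[of u c b] unfolding common_def by blast
  have ne: "x \<noteq> u" "x \<noteq> y" "y \<noteq> b" "x \<noteq> b" "y \<noteq> u"
    using edge(3)[OF e(1)] edge(3)[OF e(2)] edge(3)[OF e(3)] nub e(1,3) by auto
  have xY: "x \<notin> ?Y" using trifree[OF e(2,3)] unfolding common_def by blast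
  have yY: "y \<notin> ?Y" using trifree[OF e(1,2)] unfolding common_def by blast
  have ubY: "u \<notin> ?Y" "b \<notin> ?Y" using edge(3) unfolding common_def by blast+
  have V: "u \<in> V" "x \<in> V" "y \<in> V" "b \<in> V" using edge[OF e(1)] edge[OF e(3)] by simp_all
  obtain y1 y2 where r: "y1 \<in> ?Y" "y2 \<in> ?Y" "y1 \<noteq> y2"
    "card ?Y \<le> Suc (card {v\<in>V - ?Y. p v \<in> away (curve4 u y1 b y2) (p x)})"
  proof (rule region_count[OF ub subset_refl finite_common two V(2) xY ne(1,4)])
    fix y y' assume y: "y \<in> ?Y" "y' \<in> ?Y" "y \<noteq> y'"
    then have "x \<notin> {u, y, b, y'}" using ne xY by auto
    then show "away (curve4 u y b y') (p x) \<inter> p ` V \<noteq> {}"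
      by (rule not_facial_region[OF ub y nf V(2)])
  qed
  let ?R = "away (curve4 u y1 b y2) (p x)" and ?D = "{v\<in>V - ?Y. p v \<in> away (curve4 u y1 b y2) (p x)}"
  have C: "cycle4 E u y1 b y2" by (rule theta_arcs(4)[OF ub r(1,2,3)])
  have "x \<notin> {u, y1, b, y2}" "y \<notin> {u, y1, b, y2}" using ne xY yY r(1,2) by auto
  then have xJ: "p x \<notin> curve4 u y1 b y2" and yQ: "y \<notin> {u, y1, b, y2}" using on_curve4[OF C V(2)] by auto
  have xR: "p x \<notin> ?R" by (rule away_facts(5)[OF jordan_curve4[OF C] xJ])
  have yR: "p y \<notin> ?R"
    using neighbour_side[OF C xJ edge_sym[OF e(2)]] xR \<open>x \<notin> {u, y1, b, y2}\<close> by blast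
  have uR: "p u \<notin> ?R" "p b \<notin> ?R" using side_off_cycle[OF C xJ V(1)] side_off_cycle[OF C xJ V(4)] by auto
  have dis: "{u, x, y, b} \<inter> (?Y \<union> ?D) = {}" using xR yR uR xY yY ubY by blast
  have "card {u, x, y, b} = 4" using ne ub by auto
  moreover have "card (?Y \<union> ?D) = card ?Y + card ?D"
    by (rule card_Un_disjoint) (use finite_common finite_V in auto)
  moreover have "card ({u, x, y, b} \<union> (?Y \<union> ?D)) = card {u, x, y, b} + card (?Y \<union> ?D)"
    by (rule card_Un_disjoint) (use finite_common finite_V dis in auto)
  moreover have "card ({u, x, y, b} \<union> (?Y \<union> ?D)) \<le> card V"
    using common_V[of u b] V by (intro card_mono finite_V) auto
  ultimately show ?thesis using r(4) by linarith
qed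

text \<open>Of the four cycle vertices only \<open>w\<close> is adjacent to \<open>r\<close>:
  \<open>s\<close> is not by assumption, and \<open>y\<close> or \<open>y'\<close> would form a
  triangle with \<open>w\<close>. So an enclosed vertex is not adjacent to \<open>r\<close> and has
  a path of length two to \<open>r\<close> only through \<open>w\<close>.\<close>

lemma region_props:
  assumes sr: "{s, r} \<notin> E" and wr: "{w, r} \<in> E" and sw: "s \<noteq> w"
    and y: "y \<in> common E s w" "y' \<in> common E s w" "y \<noteq> y'"
  shows "cycle4 E s y w y'" "p r \<notin> curve4 s y w y'" "r \<notin> {s, y, w, y'}"
    "\<And>x. x \<in> V \<Longrightarrow> p x \<in> away (curve4 s y w y') (p r) \<Longrightarrow> x \<noteq> s \<and> x \<noteq> r \<and> {x, r} \<notin> E"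
    "\<And>x z. x \<in> V \<Longrightarrow> p x \<in> away (curve4 s y w y') (p r) \<Longrightarrow> {x, z} \<in> E \<Longrightarrow> {z, r} \<in> E \<Longrightarrow> z = w"
proof -
  show C: "cycle4 E s y w y'" by (rule theta_arcs(4)[OF sw y])
  note cD = cycle4D[OF C]
  have "{y, r} \<notin> E" "{y', r} \<notin> E" using trifree[OF cD(2) wr] trifree[OF cD(6) wr] by simp_all
  moreover have yw: "r \<noteq> y" "r \<noteq> y'" "r \<noteq> w" "r \<noteq> s" using cD sr wr edge(3)[OF wr] trifree edge_sym by blast+
  ultimately show rQ: "r \<notin> {s, y, w, y'}" by simp
  have rV: "r \<in> V" using edge[OF wr] by simp
  show rJ: "p r \<notin> curve4 s y w y'" using on_curve4[OF C rV] rQ by simp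
  have nr: "p r \<notin> away (curve4 s y w y') (p r)" by (rule away_facts(5)[OF jordan_curve4[OF C] rJ])
  show 1: "x \<noteq> s \<and> x \<noteq> r \<and> {x, r} \<notin> E" if "x \<in> V" "p x \<in> away (curve4 s y w y') (p r)" for x
    using side_off_cycle[OF C rJ that] nr that(2) neighbour_side[OF C rJ _ that(2) rQ] by auto
  show "z = w" if x: "x \<in> V" "p x \<in> away (curve4 s y w y') (p r)" "{x, z} \<in> E" "{z, r} \<in> E" for x z
  proof (rule ccontr)
    assume zw: "z \<noteq> w"
    have "z \<noteq> s" "z \<noteq> y" "z \<noteq> y'" using x(4) sr \<open>{y, r} \<notin> E\<close> \<open>{y', r} \<notin> E\<close> by auto
    then have "z \<notin> {s, y, w, y'}" using zw by simp
    then have "p z \<in> away (curve4 s y w y') (p r)" by (rule neighbour_side[OF C rJ x(3,2)])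
    then show False using 1[OF edge(2)[OF x(3)]] x(4) by blast
  qed
qed

lemma curve_avoids_region:
  assumes C: "cycle4 E u a b c" and z: "z \<notin> curve4 u a b c" and C': "cycle4 E u' a' b' c'"
    and out: "\<And>x. x \<in> {u', a', b', c'} \<Longrightarrow> p x \<notin> away (curve4 u a b c) z"
  shows "curve4 u' a' b' c' \<inter> away (curve4 u a b c) z = {}"
proof -
  note cD = cycle4D[OF C']
  have "\<Gamma> {u', a'} \<inter> away (curve4 u a b c) z = {}" "\<Gamma> {a', b'} \<inter> away (curve4 u a b c) z = {}"
    "\<Gamma> {b', c'} \<inter> away (curve4 u a b c) z = {}" "\<Gamma> {c', u'} \<inter> away (curve4 u a b c) z = {}"
    using edge_avoids_side[OF C z] cD(1-4) out by simp_all
  then show ?thesis unfolding curve4_def[of u' a' b' c'] UG_def by auto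
qed

text \<open>If no vertex of either cycle lies in the other region, then neither curve enters the
  other region, so overlapping regions coincide. They would then have the same frontier and the same
  vertices on it.\<close>

lemma regions_disjoint:
  assumes C: "cycle4 E u a b c" and z: "z \<notin> curve4 u a b c" and C': "cycle4 E u' a' b' c'" and z': "z' \<notin> curve4 u' a' b' c'"
    and out: "\<And>x. x \<in> {u', a', b', c'} \<Longrightarrow> p x \<notin> away (curve4 u a b c) z"
    and out': "\<And>x. x \<in> {u, a, b, c} \<Longrightarrow> p x \<notin> away (curve4 u' a' b' c') z'"
    and x: "x \<in> {u, a, b, c}" "x \<notin> {u', a', b', c'}"
  shows "away (curve4 u a b c) z \<inter> away (curve4 u' a' b' c') z' = {}"
proof (rule equals0I)
  let ?J = "curve4 u a b c" and ?J' = "curve4 u' a' b' c'"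
  note J = jordan_curve4[OF C] and J' = jordan_curve4[OF C']
  fix m assume m: "m \<in> away ?J z \<inter> away ?J' z'"
  have 1: "?J' \<inter> away ?J z = {}" by (rule curve_avoids_region[OF C z C' out])
  have 2: "?J \<inter> away ?J' z' = {}" by (rule curve_avoids_region[OF C' z' C out'])
  have "away ?J z \<subseteq> away ?J' z'"
    by (rule away_connected_subset[OF away_facts(2)[OF J z], of ?J' m]) (use 1 m in auto)
  moreover have "away ?J' z' \<subseteq> away ?J z"
    by (rule away_connected_subset[OF away_facts(2)[OF J' z'], of ?J m]) (use 2 m in auto)
  ultimately have "away ?J z = away ?J' z'" by simp
  then have "?J = ?J'" using away_facts(6)[OF J z] away_facts(6)[OF J' z'] by metis
  moreover have "x \<in> V" using x(1) cycle4D[OF C] by auto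
  ultimately show False using on_curve4[OF C] on_curve4[OF C'] x by blast
qed

lemma same_pole_regions:
  assumes sr: "{s, r} \<notin> E" and sw: "s \<noteq> w" "s \<noteq> w'" and ww: "w \<noteq> w'" and wr: "{w, r} \<in> E" "{w', r} \<in> E"
    and y: "y1 \<in> common E s w" "y2 \<in> common E s w" "y1 \<noteq> y2"
    and y': "y1' \<in> common E s w'" "y2' \<in> common E s w'" "y1' \<noteq> y2'"
  shows "away (curve4 s y1 w y2) (p r) \<inter> away (curve4 s y1' w' y2') (p r) = {}"
proof -
  note P = region_props[OF sr wr(1) sw(1) y] and P' = region_props[OF sr wr(2) sw(2) y']
  have nb: "{s, y} \<in> E" "{y, w} \<in> E" if "y \<in> common E s w" for y w using that unfolding common_def by auto
  have out: "p x \<notin> away (curve4 s a w b) (p r)" if x: "x \<in> {s, a', w', b'}" and sw: "s \<noteq> w" "s \<noteq> w'" and ww: "w \<noteq> w'"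
      and wr: "{w, r} \<in> E" "{w', r} \<in> E" and y: "a \<in> common E s w" "b \<in> common E s w" "a \<noteq> b"
      and y': "a' \<in> common E s w'" "b' \<in> common E s w'" for x a b w a' b' w'
  proof
    assume h: "p x \<in> away (curve4 s a w b) (p r)"
    note P = region_props[OF sr wr(1) sw(1) y]
    have "x \<in> V" using x edge[OF nb(1)[OF y'(1)]] edge[OF nb(1)[OF y'(2)]] edge[OF wr(2)] by auto
    then have "x \<noteq> s" "{x, r} \<notin> E" "\<And>z. {x, z} \<in> E \<Longrightarrow> {z, r} \<in> E \<Longrightarrow> z = w" using P(4,5) h by blast+
    then show False using x wr(2) ww nb(2)[OF y'(1)] nb(2)[OF y'(2)] by auto
  qed
  have ws: "{s, w} \<notin> E" using trifree[OF nb[OF y(1)]] .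
  have "w \<notin> {s, y1', w', y2'}" using ws sw ww nb(1)[OF y'(1)] nb(1)[OF y'(2)] by auto
  then show ?thesis
    using regions_disjoint[OF P(1,2) P'(1,2), of w] out[of _ y1' w' y2' w y1 y2] out[of _ y1 w y2 w' y1' y2']
      sw ww wr y y' by auto
qed

lemma opposite_pole_regions:
  assumes sr: "{s, r} \<notin> E" "s \<noteq> r" and wr: "{w, r} \<in> E" and ws: "{w', s} \<in> E"
    and y: "y1 \<in> common E s w" "y2 \<in> common E s w" "y1 \<noteq> y2"
    and y': "y1' \<in> common E r w'" "y2' \<in> common E r w'" "y1' \<noteq> y2'"
  shows "away (curve4 s y1 w y2) (p r) \<inter> away (curve4 r y1' w' y2') (p s) = {}"
proof -
  have sw: "s \<noteq> w" "r \<noteq> w'" using sr wr ws edge_sym by blast+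
  have rs: "{r, s} \<notin> E" using sr edge_sym by blast
  note P = region_props[OF sr(1) wr sw(1) y] and P' = region_props[OF rs ws sw(2) y']
  have nb: "{s, y} \<in> E" "{y, w} \<in> E" if "y \<in> common E s w" for y s w using that unfolding common_def by auto
  have out: "p x \<notin> away (curve4 s a w b) (p r)" if x: "x \<in> {r, a', w', b'}" and sr: "{s, r} \<notin> E" and sw: "s \<noteq> w"
      and wr: "{w, r} \<in> E" and ws: "{w', s} \<in> E" and y: "a \<in> common E s w" "b \<in> common E s w" "a \<noteq> b"
      and y': "a' \<in> common E r w'" "b' \<in> common E r w'" "a' \<noteq> b'" for x a b w a' b' w' s r
  proof
    assume h: "p x \<in> away (curve4 s a w b) (p r)"
    note P = region_props[OF sr wr sw y]
    have V: "x \<in> V" using x edge[OF nb(1)[OF y'(1)]] edge[OF nb(1)[OF y'(2)]] edge[OF ws] by auto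
    note P4 = P(4)[OF V h] and P5 = P(5)[OF V h]
    have e: "{a', r} \<in> E" "{b', r} \<in> E" "{w', a'} \<in> E" "{w', b'} \<in> E"
      using nb[OF y'(1)] nb[OF y'(2)] edge_sym by auto
    \<comment> \<open>Among the vertices of the other cycle only \<open>w'\<close> is not excluded
      by its closeness to \<open>r\<close>; but \<open>w'\<close> has two neighbours adjacent to
      \<open>r\<close>, and an enclosed vertex allows only one.\<close>
    have "x = w'" using x P4 e by auto
    then have "a' = w" "b' = w" using P5 e by blast+
    then show False using y'(3) by simp
  qed
  have "s \<notin> {r, y1', w', y2'}" using sr nb(1)[OF y'(1)] nb(1)[OF y'(2)] rs edge(3)[OF ws] by auto
  then show ?thesis
    using regions_disjoint[OF P(1,2) P'(1,2), of s] out[of _ r y1' w' y2' s w y1 y2] out[of _ s y1 w y2 r w' y1' y2']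
      sr rs sw wr ws y y' by auto
qed

lemma card_walks3_fibres:
  assumes "finite T"
  shows "(\<Sum>w\<in>snd ` T. card {x. (x, w) \<in> T}) = card T" "(\<Sum>w\<in>fst ` T. card {x. (w, x) \<in> T}) = card T"
proof -
  have f1: "finite {x. (x, w) \<in> T}" for w
    by (rule finite_subset[of _ "fst ` T"]) (use assms in force)+
  have f2: "finite {x. (w, x) \<in> T}" for w
    by (rule finite_subset[of _ "snd ` T"]) (use assms in force)+
  have "card (SIGMA w:snd ` T. {x. (x, w) \<in> T}) = card T"
    by (rule bij_betw_same_card[of prod.swap]) (auto simp: bij_betw_def inj_on_def image_iff, force)
  then show "(\<Sum>w\<in>snd ` T. card {x. (x, w) \<in> T}) = card T" using f1 assms by (simp add: card_SigmaI)
  have "(SIGMA w:fst ` T. {x. (w, x) \<in> T}) = T" by force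
  then have "card (SIGMA w:fst ` T. {x. (w, x) \<in> T}) = card T" by simp
  then show "(\<Sum>w\<in>fst ` T. card {x. (w, x) \<in> T}) = card T" using f2 assms by (simp add: card_SigmaI)
qed

lemma finite_walks3: "finite (walks3 E s t)"
proof (rule finite_subset)
  show "walks3 E s t \<subseteq> V \<times> V" unfolding walks3_def using edge by blast
qed (simp add: finite_V)

text \<open>Every path is counted once at each of its inner vertices. The paths through an inner
  vertex \<open>w\<close> next to one pole correspond to the common neighbours of \<open>w\<close>
  and the other pole; all but one of them are paid for by vertices enclosed between them, and
  regions of different \<open>w\<close> are disjoint and avoid the poles, their common neighbours
  and all inner vertices. Hence twice the number of paths is at most the number of the remaining
  vertices of the graph.\<close>

lemma bad_pair_bound:
  assumes uv: "u \<noteq> v" "common E u v \<noteq> {}"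
    and nf: "\<And>w y y'. {w, v} \<in> E \<Longrightarrow> y \<in> common E u w \<Longrightarrow> y' \<in> common E u w \<Longrightarrow> y \<noteq> y' \<Longrightarrow> \<not> facial u y w y'"
      "\<And>w y y'. {w, u} \<in> E \<Longrightarrow> y \<in> common E v w \<Longrightarrow> y' \<in> common E v w \<Longrightarrow> y \<noteq> y' \<Longrightarrow> \<not> facial v y w y'"
  shows "2 * card (walks3 E u v) + card (common E u v) + 2 \<le> card V"
proof -
  let ?T = "walks3 E u v" and ?C = "common E u v"
  define X1 where "X1 = fst ` ?T"
  define X2 where "X2 = snd ` ?T"
  obtain c where c: "c \<in> ?C" using uv(2) by blast
  then have nuv: "{u, v} \<notin> E" "{v, u} \<notin> E" using trifree[of u c v] edge_sym unfolding common_def by blast+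
  have uV: "u \<in> V" "v \<in> V" using c edge unfolding common_def by blast+
  have finT: "finite ?T" by (rule finite_walks3)
  have X1: "x \<in> X1 \<longleftrightarrow> {u, x} \<in> E \<and> (\<exists>y. {x, y} \<in> E \<and> {y, v} \<in> E)" for x
    unfolding X1_def walks3_def by force
  have X2: "y \<in> X2 \<longleftrightarrow> {y, v} \<in> E \<and> (\<exists>x. {u, x} \<in> E \<and> {x, y} \<in> E)" for y
    unfolding X2_def walks3_def by force
  have fib2: "{x. (x, w) \<in> ?T} = common E u w" if "w \<in> X2" for w
    using that X2 unfolding walks3_def common_def by auto
  have fib1: "{x. (w, x) \<in> ?T} = common E v w" if "w \<in> X1" for w
    using that X1[of w] edge_sym unfolding walks3_def common_def by auto
  have dX: "X1 \<inter> X2 = {}" using X1 X2 trifree by blast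
  have CX: "?C \<inter> (X1 \<union> X2) = {}" using X1 X2 trifree edge_sym unfolding common_def by blast
  have uvX: "u \<notin> ?C \<union> X1 \<union> X2" "v \<notin> ?C \<union> X1 \<union> X2"
    using X1 X2 nuv edge(3) unfolding common_def by blast+
  \<comment> \<open>\<open>R w\<close> is the pole adjacent to \<open>w\<close> and serves as the
    viewpoint; \<open>S w\<close> is the other pole, whose common neighbours with \<open>w\<close>
    are counted.\<close>
  define S where "S = (\<lambda>w. if w \<in> X2 then u else v)"
  define R where "R = (\<lambda>w. if w \<in> X2 then v else u)"
  have SR: "{S w, R w} \<notin> E" "S w \<noteq> R w" for w
    unfolding S_def R_def using nuv uv(1) by (cases "w \<in> X2"; simp)+
  have wR: "{w, R w} \<in> E" if "w \<in> X1 \<union> X2" for w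
  proof (cases "w \<in> X2")
    case True then show ?thesis using X2[of w] unfolding R_def by simp
  next
    case False
    then have "{u, w} \<in> E" using that X1[of w] by blast
    then show ?thesis using False edge_sym[of u w] unfolding R_def by simp
  qed
  have Sw: "S w \<noteq> w" if "w \<in> X1 \<union> X2" for w unfolding S_def using that uvX by (cases "w \<in> X2") auto
  let ?Y = "\<lambda>w. common E (S w) w"
  have ex: "\<exists>y y'. y \<in> ?Y w \<and> y' \<in> ?Y w \<and> y \<noteq> y' \<and>
      card (?Y w) \<le> Suc (card {x\<in>V - ?Y w. p x \<in> away (curve4 (S w) y w y') (p (R w))})"
    if w: "w \<in> X1 \<union> X2" "card (?Y w) \<ge> 2" for w
  proof -
    have rV: "R w \<in> V" using uV unfolding R_def by simp
    have rn: "R w \<notin> ?Y w" "R w \<noteq> S w" "R w \<noteq> w"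
    proof -
      show "R w \<notin> ?Y w" using SR(1)[of w] unfolding common_def by blast
      show "R w \<noteq> S w" using SR(2)[of w] by simp
      show "R w \<noteq> w" using edge(3)[OF wR[OF w(1)]] by simp
    qed
    show ?thesis
    proof (rule region_count[OF Sw[OF w(1)] subset_refl finite_common w(2) rV rn])
      fix y y' assume y: "y \<in> ?Y w" "y' \<in> ?Y w" "y \<noteq> y'"
      have "\<not> facial (S w) y w y'"
        using nf(1)[of w y y'] nf(2)[of w y y'] y wR[OF w(1)] unfolding S_def R_def by (cases "w \<in> X2") simp_all
      moreover have "R w \<notin> {S w, y, w, y'}" using rn y by auto
      ultimately show "away (curve4 (S w) y w y') (p (R w)) \<inter> p ` V \<noteq> {}"
        using not_facial_region[OF Sw[OF w(1)] y _ rV] by blast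
    qed blast
  qed
  \<comment> \<open>With at most one common neighbour there is no region, and the empty set already
    suffices for the bound with \<open>Suc\<close>.\<close>
  define B where "B = (\<lambda>w. if card (?Y w) \<ge> 2 then SOME B. \<exists>y y'. y \<in> ?Y w \<and> y' \<in> ?Y w \<and> y \<noteq> y' \<and>
      card (?Y w) \<le> Suc (card B) \<and> B = {x\<in>V - ?Y w. p x \<in> away (curve4 (S w) y w y') (p (R w))} else {})"
  have B: "\<exists>y y'. y \<in> ?Y w \<and> y' \<in> ?Y w \<and> y \<noteq> y' \<and>
      card (?Y w) \<le> Suc (card (B w)) \<and> B w = {x\<in>V - ?Y w. p x \<in> away (curve4 (S w) y w y') (p (R w))}"
    if w: "w \<in> X1 \<union> X2" "card (?Y w) \<ge> 2" for w
  proof -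
    let ?P = "\<lambda>B. \<exists>y y'. y \<in> ?Y w \<and> y' \<in> ?Y w \<and> y \<noteq> y' \<and>
      card (?Y w) \<le> Suc (card B) \<and> B = {x\<in>V - ?Y w. p x \<in> away (curve4 (S w) y w y') (p (R w))}"
    have "B w = (SOME B. ?P B)" using w(2) unfolding B_def by simp
    moreover have "\<exists>B. ?P B" using ex[OF w] by blast
    ultimately show ?thesis using someI_ex[of ?P] by simp
  qed
  have cardB: "card (?Y w) \<le> Suc (card (B w))" if "w \<in> X1 \<union> X2" for w
  proof (cases "card (?Y w) \<ge> 2")
    case True then show ?thesis using B[OF that] by blast
  next
    case False then show ?thesis by simp
  qed
  define Dst where "Dst = V - ({u, v} \<union> ?C \<union> X1 \<union> X2)"
  have Bsub: "B w \<subseteq> Dst" if w: "w \<in> X1 \<union> X2" for w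
  proof (cases "card (?Y w) \<ge> 2")
    case True
    obtain y y' where y: "y \<in> ?Y w" "y' \<in> ?Y w" "y \<noteq> y'"
      and Bw: "B w = {x\<in>V - ?Y w. p x \<in> away (curve4 (S w) y w y') (p (R w))}" using B[OF w True] by blast
    note P = region_props[OF SR(1) wR[OF w] Sw[OF w] y]
    show ?thesis
    proof
      fix x assume "x \<in> B w"
      then have x: "x \<in> V" "x \<notin> ?Y w" "p x \<in> away (curve4 (S w) y w y') (p (R w))" using Bw by auto
      note P4 = P(4)[OF x(1,3)] and P5 = P(5)[OF x(1,3)]
      have p5: False if "{S w, x} \<in> E" "{x, z} \<in> E" "{z, R w} \<in> E" for z
        using P5[OF that(2,3)] that x(2) unfolding common_def by blast
      have sr: "(S w = u \<and> R w = v) \<or> (S w = v \<and> R w = u)" unfolding S_def R_def by simp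
      have "x \<noteq> u" "x \<noteq> v" using P4 sr by auto
      moreover have "x \<notin> ?C"
      proof
        assume "x \<in> ?C"
        then have "{x, u} \<in> E" "{x, v} \<in> E" using edge_sym[of u x] unfolding common_def by simp_all
        then show False using P4 sr by auto
      qed
      moreover have "x \<notin> X1"
      proof
        assume "x \<in> X1"
        then obtain z where z: "{u, x} \<in> E" "{x, z} \<in> E" "{z, v} \<in> E" using X1 by blast
        show False using sr P4 p5[OF _ z(2)] z(1,3) edge_sym[OF z(1)] by auto
      qed
      moreover have "x \<notin> X2"
      proof
        assume "x \<in> X2"
        then obtain z where z: "{x, v} \<in> E" "{u, z} \<in> E" "{z, x} \<in> E" using X2 by blast
        show False using sr P4 p5[OF _ edge_sym[OF z(3)]] z(1) edge_sym[OF z(1)] edge_sym[OF z(2)] by auto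
      qed
      ultimately show "x \<in> Dst" unfolding Dst_def using x(1) by simp
    qed
  next
    case False then show ?thesis unfolding B_def by simp
  qed
  have Bdis: "B w \<inter> B w' = {}" if w: "w \<in> X1 \<union> X2" and w': "w' \<in> X1 \<union> X2" and ww: "w \<noteq> w'" for w w'
  proof (cases "card (?Y w) \<ge> 2 \<and> card (?Y w') \<ge> 2")
    case True
    obtain y1 y2 where y: "y1 \<in> ?Y w" "y2 \<in> ?Y w" "y1 \<noteq> y2"
      and Bw: "B w = {x\<in>V - ?Y w. p x \<in> away (curve4 (S w) y1 w y2) (p (R w))}" using B[OF w] True by blast
    obtain y1' y2' where y': "y1' \<in> ?Y w'" "y2' \<in> ?Y w'" "y1' \<noteq> y2'"
      and Bw': "B w' = {x\<in>V - ?Y w'. p x \<in> away (curve4 (S w') y1' w' y2') (p (R w'))}" using B[OF w'] True by blast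
    have "away (curve4 (S w) y1 w y2) (p (R w)) \<inter> away (curve4 (S w') y1' w' y2') (p (R w')) = {}"
    proof (cases "S w = S w'")
      case True
      then have "R w = R w'" using uv(1) unfolding S_def R_def by (cases "w \<in> X2"; cases "w' \<in> X2") simp_all
      then show ?thesis using same_pole_regions[OF SR(1) Sw[OF w] _ ww wR[OF w] _ y, of y1' y2']
          True Sw[OF w'] wR[OF w'] y' by simp
    next
      case False
      then have sr: "S w' = R w" "R w' = S w" unfolding S_def R_def by (cases "w \<in> X2"; cases "w' \<in> X2"; simp)+
      show ?thesis
        using opposite_pole_regions[OF SR(1,2) wR[OF w] _ y, of w' y1' y2'] wR[OF w'] y' unfolding sr by simp
    qed
    then show ?thesis unfolding Bw Bw' by blast
  next
    case False then show ?thesis unfolding B_def by auto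
  qed
  have finX: "finite X1" "finite X2" unfolding X1_def X2_def using finT by simp_all
  have finB: "finite (B w)" if "w \<in> X1 \<union> X2" for w
    using Bsub[OF that] finite_V unfolding Dst_def by (meson finite_Diff finite_subset)
  have "(\<Sum>w\<in>X1 \<union> X2. card (B w)) = card (\<Union>w\<in>X1 \<union> X2. B w)"
    using card_UN_disjoint[of "X1 \<union> X2" B] finX finB Bdis by simp
  also have "\<dots> \<le> card Dst"
    using Bsub finite_V unfolding Dst_def by (intro card_mono) auto
  finally have sB: "(\<Sum>w\<in>X1 \<union> X2. card (B w)) \<le> card Dst" .
  have "(\<Sum>w\<in>X1 \<union> X2. card (?Y w)) \<le> (\<Sum>w\<in>X1 \<union> X2. 1 + card (B w))"
    using cardB by (intro sum_mono) simp
  also have "\<dots> = card X1 + card X2 + (\<Sum>w\<in>X1 \<union> X2. card (B w))"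
    unfolding sum.distrib using finX dX by (simp add: card_Un_disjoint)
  finally have le: "(\<Sum>w\<in>X1 \<union> X2. card (?Y w)) \<le> card X1 + card X2 + card Dst" using sB by linarith
  have "(\<Sum>w\<in>X2. card (?Y w)) = card ?T"
  proof -
    have "(\<Sum>w\<in>X2. card (?Y w)) = (\<Sum>w\<in>snd ` ?T. card {x. (x, w) \<in> ?T})"
      unfolding X2_def[symmetric] by (rule sum.cong) (simp_all add: S_def fib2)
    then show ?thesis using card_walks3_fibres(1)[OF finT] by simp
  qed
  moreover have "(\<Sum>w\<in>X1. card (?Y w)) = card ?T"
  proof -
    have "(\<Sum>w\<in>X1. card (?Y w)) = (\<Sum>w\<in>fst ` ?T. card {x. (w, x) \<in> ?T})"
      unfolding X1_def[symmetric] by (rule sum.cong) (use dX in \<open>auto simp: S_def fib1\<close>)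
    then show ?thesis using card_walks3_fibres(2)[OF finT] by simp
  qed
  moreover have "(\<Sum>w\<in>X1 \<union> X2. card (?Y w)) = (\<Sum>w\<in>X1. card (?Y w)) + (\<Sum>w\<in>X2. card (?Y w))"
    by (rule sum.union_disjoint[OF finX dX])
  ultimately have T2: "2 * card ?T \<le> card X1 + card X2 + card Dst" using le by linarith
  have "X1 \<union> X2 \<subseteq> V" using X1 X2 edge by blast
  then have sub: "{u, v} \<union> ?C \<union> X1 \<union> X2 \<subseteq> V" using uV common_V[of u v] by blast
  have cu: "card ({u, v} \<union> ?C \<union> X1 \<union> X2) = 2 + card ?C + card X1 + card X2"
  proof -
    have "card (({u, v} \<union> ?C) \<union> (X1 \<union> X2)) = card ({u, v} \<union> ?C) + card (X1 \<union> X2)"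
      by (rule card_Un_disjoint) (use finX finite_common CX uvX in auto)
    moreover have "card ({u, v} \<union> ?C) = 2 + card ?C"
      using card_Un_disjoint[of "{u, v}" ?C] finite_common[of u v] uvX uv(1) by simp
    moreover have "card (X1 \<union> X2) = card X1 + card X2" by (rule card_Un_disjoint[OF finX dX])
    ultimately show ?thesis by (simp add: Un_assoc)
  qed
  have "card Dst = card V - card ({u, v} \<union> ?C \<union> X1 \<union> X2)"
    unfolding Dst_def by (rule card_Diff_subset[OF _ sub]) (use finX finite_common in simp)
  moreover have "card ({u, v} \<union> ?C \<union> X1 \<union> X2) \<le> card V" by (rule card_mono[OF finite_V sub])
  ultimately show ?thesis using T2 cu by linarith
qed

end

section \<open>Closed 5-walks and identification of vertices\<close>

definition triangle_free :: "'a set set \<Rightarrow> bool" where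
  "triangle_free E \<longleftrightarrow> (\<forall>x y z. {x, y} \<in> E \<longrightarrow> {y, z} \<in> E \<longrightarrow> {x, z} \<notin> E)"

lemma triangle_freeD: "triangle_free E \<Longrightarrow> {x, y} \<in> E \<Longrightarrow> {y, z} \<in> E \<Longrightarrow> {x, z} \<in> E \<Longrightarrow> False"
  unfolding triangle_free_def by blast

lemma edge_commute: "{x, y} \<in> E \<longleftrightarrow> {y, x} \<in> E"
  by (simp add: insert_commute)

lemma edge_flip: "{x, y} \<in> E \<Longrightarrow> {y, x} \<in> E"
  by (simp add: insert_commute)

lemma simple_graph_finite:
  assumes "simple_graph (V, E)"
  shows "finite V" "finite E"
proof -
  show 1: "finite V" using assms unfolding simple_graph_def by simp
  show "finite E" by (rule finite_subset[of _ "Pow V"]) (use 1 simple_graph_edge_subset[OF assms] in auto)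
qed

lemma triangle_free_subset: "triangle_free E \<Longrightarrow> E' \<subseteq> E \<Longrightarrow> triangle_free E'"
  unfolding triangle_free_def by blast

lemma common_commute: "common E s t = common E t s"
  unfolding common_def by (auto simp: insert_commute)

lemma walks3_commute: "walks3 E t s = prod.swap ` walks3 E s t"
  unfolding walks3_def by (force simp: insert_commute)

lemma card_walks3_commute: "card (walks3 E t s) = card (walks3 E s t)"
  unfolding walks3_commute[of E t s] by (simp add: card_image)

lemma finite_walks3_simple: "simple_graph (V, E) \<Longrightarrow> finite (walks3 E s t)"
  by (rule finite_subset[of _ "V \<times> V"]) (auto simp: walks3_def simple_graph_finite dest: simple_graph_edge)

lemma finite_common_simple: "simple_graph (V, E) \<Longrightarrow> finite (common E s t)"
  by (rule finite_subset[of _ "V"]) (auto simp: common_def simple_graph_finite dest: simple_graph_edge)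

type_synonym 'a tuple5 = "'a \<times> 'a \<times> 'a \<times> 'a \<times> 'a"

text \<open>In a simple triangle-free graph every copy of the pentagon gives ten such tuples.\<close>

definition walks5 :: "'a set set \<Rightarrow> 'a tuple5 set" where
  "walks5 E = {(x1, x2, x3, x4, x5). {x1, x2} \<in> E \<and> {x2, x3} \<in> E \<and> {x3, x4} \<in> E \<and> {x4, x5} \<in> E \<and> {x5, x1} \<in> E}"

definition rot :: "'a tuple5 \<Rightarrow> 'a tuple5" where
  "rot = (\<lambda>(x1, x2, x3, x4, x5). (x2, x3, x4, x5, x1))"

lemma rot_simp [simp]: "rot (x1, x2, x3, x4, x5) = (x2, x3, x4, x5, x1)"
  unfolding rot_def by simp

lemma finite_walks5: "simple_graph (V, E) \<Longrightarrow> finite (walks5 E)"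
  by (rule finite_subset[of _ "V \<times> V \<times> V \<times> V \<times> V"])
    (auto simp: walks5_def simple_graph_finite dest: simple_graph_edge)

text \<open>A repeated vertex would split off a closed walk of length three.\<close>

lemma walks5_distinct:
  assumes G: "simple_graph (V, E)" "triangle_free E" and w: "(x1, x2, x3, x4, x5) \<in> walks5 E"
  shows "distinct [x1, x2, x3, x4, x5]"
proof -
  have e: "{x1, x2} \<in> E" "{x2, x3} \<in> E" "{x3, x4} \<in> E" "{x4, x5} \<in> E" "{x5, x1} \<in> E"
    using w unfolding walks5_def by auto
  have ne: "x1 \<noteq> x2" "x2 \<noteq> x3" "x3 \<noteq> x4" "x4 \<noteq> x5" "x5 \<noteq> x1"
    using simple_graph_edge(3)[OF G(1)] e by blast+
  have "x1 \<noteq> x3" using triangle_freeD[OF G(2) e(3,4)] e(5) edge_commute[of x5 x1] edge_commute[of x3 x5] by auto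
  moreover have "x2 \<noteq> x4" using triangle_freeD[OF G(2) e(4,5)] e(1) edge_commute[of x4 x1] by auto
  moreover have "x3 \<noteq> x5" using triangle_freeD[OF G(2) e(5,1)] e(2) edge_commute[of x2 x5] by auto
  moreover have "x4 \<noteq> x1" using triangle_freeD[OF G(2) e(1,2)] e(3) edge_commute[of x3 x1] by auto
  moreover have "x5 \<noteq> x2" using triangle_freeD[OF G(2) e(2,3)] e(4) edge_commute[of x4 x2] by auto
  ultimately show ?thesis using ne by auto
qed

text \<open>Four rotations undo one, so \<open>S\<close> is covered by five images of
  \<open>T\<close>.\<close>

lemma card_le_rotations:
  assumes "finite T"
    and cov: "\<And>w. w \<in> S \<Longrightarrow> w \<in> T \<or> rot w \<in> T \<or> rot (rot w) \<in> T \<or> rot (rot (rot w)) \<in> T \<or> rot (rot (rot (rot w))) \<in> T"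
  shows "card S \<le> 5 * card T"
proof -
  let ?r = "\<lambda>w. rot (rot (rot (rot w)))"
  have inv: "?r (rot w) = w" for w :: "'a tuple5" by (cases w) simp
  have S: "S \<subseteq> T \<union> ?r ` T \<union> ?r ` ?r ` T \<union> ?r ` ?r ` ?r ` T \<union> ?r ` ?r ` ?r ` ?r ` T"
  proof
    fix w assume "w \<in> S"
    from cov[OF this] show "w \<in> T \<union> ?r ` T \<union> ?r ` ?r ` T \<union> ?r ` ?r ` ?r ` T \<union> ?r ` ?r ` ?r ` ?r ` T"
    proof (elim disjE)
      assume "rot w \<in> T"
      then have "?r (rot w) \<in> ?r ` T" by (rule imageI)
      then show ?thesis unfolding inv by simp
    next
      assume "rot (rot w) \<in> T"
      then have "?r (?r (rot (rot w))) \<in> ?r ` ?r ` T" by (intro imageI)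
      then show ?thesis unfolding inv by simp
    next
      assume "rot (rot (rot w)) \<in> T"
      then have "?r (?r (?r (rot (rot (rot w))))) \<in> ?r ` ?r ` ?r ` T" by (intro imageI)
      then show ?thesis unfolding inv by simp
    next
      assume "?r w \<in> T"
      then have "?r (?r (?r (?r (rot (rot (rot (rot w))))))) \<in> ?r ` ?r ` ?r ` ?r ` T" by (intro imageI)
      then show ?thesis unfolding inv by simp
    qed simp
  qed
  have c: "card (?r ` A) \<le> card A" "finite (?r ` A)" if "finite A" for A :: "'a tuple5 set"
    using that card_image_le by auto
  note c1 = c[OF assms(1)] note c2 = c[OF c1(2)] note c3 = c[OF c2(2)] note c4 = c[OF c3(2)]
  have "card S \<le> card (T \<union> ?r ` T \<union> ?r ` ?r ` T \<union> ?r ` ?r ` ?r ` T \<union> ?r ` ?r ` ?r ` ?r ` T)"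
    using S assms(1) c1(2) c2(2) c3(2) c4(2) by (intro card_mono) simp_all
  also have "\<dots> \<le> card T + card (?r ` T) + card (?r ` ?r ` T) + card (?r ` ?r ` ?r ` T) + card (?r ` ?r ` ?r ` ?r ` T)"
    by (meson add_mono card_Un_le le_refl order_trans)
  finally show ?thesis using c1(1) c2(1) c3(1) c4(1) by linarith
qed

text \<open>Nonadjacency of \<open>a\<close> and \<open>c\<close> prevents loops after the merge,
  and the absence of walks of length three between them prevents triangles. Common neighbours are
  allowed, so that both reductions are instances.\<close>

locale identification =
  fixes V :: "'a set" and F :: "'a set set" and a c :: 'a
  assumes simple: "simple_graph (V, F)" and trif: "triangle_free F"
    and ac: "a \<in> V" "c \<in> V" "a \<noteq> c" "{a, c} \<notin> F" and no3: "walks3 F a c = {}"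
begin

lemma com: "{x, y} \<in> F \<longleftrightarrow> {y, x} \<in> F"
  by (rule edge_commute)

lemma identify_iff:
  "{x, y} \<in> identify a c F \<longleftrightarrow> x \<noteq> c \<and> y \<noteq> c \<and> ({x, y} \<in> F \<or> (x = a \<and> {c, y} \<in> F) \<or> (y = a \<and> {x, c} \<in> F))"
proof
  assume "{x, y} \<in> identify a c F"
  then obtain e where e: "e \<in> F" "{x, y} = redirect a c ` e" unfolding identify_def by blast
  obtain x' y' where xy: "e = {x', y'}" "x' \<noteq> y'" using simple_graph_edge_ex[OF simple e(1)] by blast
  have F: "{x', y'} \<in> F" "{y', x'} \<in> F" using e(1) xy com by auto
  have *: "redirect a c z \<noteq> c" for z using ac(3) by (simp add: redirect_def)
  have main: "x \<noteq> c \<and> y \<noteq> c \<and> ({x, y} \<in> F \<or> (x = a \<and> {c, y} \<in> F) \<or> (y = a \<and> {x, c} \<in> F))"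
    if r: "redirect a c x' = x" "redirect a c y' = y" "{x', y'} \<in> F" for x' y'
  proof -
    have ne: "x' \<noteq> y'" by (rule simple_graph_edge(3)[OF simple r(3)])
    show ?thesis using r ne ac by (cases "x' = c"; cases "y' = c") (auto simp: redirect_def)
  qed
  have "(redirect a c x' = x \<and> redirect a c y' = y) \<or> (redirect a c x' = y \<and> redirect a c y' = x)"
    using e(2) xy(1) by (simp add: doubleton_eq_iff) blast
  then show "x \<noteq> c \<and> y \<noteq> c \<and> ({x, y} \<in> F \<or> (x = a \<and> {c, y} \<in> F) \<or> (y = a \<and> {x, c} \<in> F))"
    using main[of x' y'] main[of y' x'] F by blast
next
  assume h: "x \<noteq> c \<and> y \<noteq> c \<and> ({x, y} \<in> F \<or> (x = a \<and> {c, y} \<in> F) \<or> (y = a \<and> {x, c} \<in> F))"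
  have i: "{redirect a c z, redirect a c w} \<in> identify a c F" if "{z, w} \<in> F" for z w
    unfolding identify_def by (rule image_eqI[OF _ that]) simp
  have r: "redirect a c x = x" "redirect a c y = y" "redirect a c c = a" using h by (simp_all add: redirect_def)
  show "{x, y} \<in> identify a c F" using h i[of x y] i[of c y] i[of x c] unfolding r by blast
qed

lemma identify_edge: "{x, y} \<in> F \<Longrightarrow> {redirect a c x, redirect a c y} \<in> identify a c F"
  unfolding identify_def by (rule image_eqI[where x = "{x, y}"]) simp_all

lemma identify_simple: "simple_graph (V - {c}, identify a c F)"
  unfolding simple_graph_def fst_conv snd_conv
proof (intro conjI ballI)
  show "finite (V - {c})" using simple_graph_finite[OF simple] by simp
  fix e assume "e \<in> identify a c F"
  then obtain e' where e: "e' \<in> F" "e = redirect a c ` e'" unfolding identify_def by blast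
  obtain x y where xy: "e' = {x, y}" "x \<in> V" "y \<in> V" "x \<noteq> y" using simple_graph_edge_ex[OF simple e(1)] by blast
  have "{x, y} \<in> F" "{y, x} \<in> F" using e(1) xy(1) com by auto
  then have "redirect a c x \<noteq> redirect a c y" using ac(4) xy(4) unfolding redirect_def by (auto split: if_splits)
  moreover have "redirect a c x \<in> V - {c}" "redirect a c y \<in> V - {c}" using xy ac by (auto simp: redirect_def)
  moreover have "e = {redirect a c x, redirect a c y}" using e(2) xy(1) by simp
  ultimately show "\<exists>x\<in>V - {c}. \<exists>y\<in>V - {c}. x \<noteq> y \<and> e = {x, y}" by blast
qed

lemma no3D: "{a, x} \<in> F \<Longrightarrow> {x, y} \<in> F \<Longrightarrow> {y, c} \<in> F \<Longrightarrow> False"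
  using no3 unfolding walks3_def by blast

lemma identify_triangle_free: "triangle_free (identify a c F)"
  unfolding triangle_free_def
proof (intro allI impI notI)
  let ?E = "identify a c F"
  have H: False if e: "{a, y} \<in> ?E" "{y, z} \<in> ?E" "{a, z} \<in> ?E" for y z
  proof -
    have ne: "y \<noteq> a" "z \<noteq> a" using simple_graph_edge(3)[OF identify_simple] e(1,3) by blast+
    have yz: "{y, z} \<in> F" "{z, y} \<in> F" using e(2) ne com unfolding identify_iff by blast+
    have y: "{a, y} \<in> F \<or> {c, y} \<in> F" and z: "{a, z} \<in> F \<or> {c, z} \<in> F"
      using e(1,3) ne unfolding identify_iff by blast+
    show False
      using y z yz triangle_freeD[OF trif, of a y z] triangle_freeD[OF trif, of c y z]
        no3D[of y z] no3D[of z y] com[of c y] com[of c z] by blast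
  qed
  fix x y z assume e: "{x, y} \<in> ?E" "{y, z} \<in> ?E" "{x, z} \<in> ?E"
  note s = e[THEN edge_flip]
  consider "x = a" | "y = a" | "z = a" | "x \<noteq> a" "y \<noteq> a" "z \<noteq> a" by blast
  then show False
  proof cases
    case 1 then show False using H[of y z] e by simp
  next
    case 2 then show False using H[of x z] e s by simp
  next
    case 3 then show False using H[of x y] e s by simp
  next
    case 4
    then have "{x, y} \<in> F" "{y, z} \<in> F" "{x, z} \<in> F" using e unfolding identify_iff by blast+
    then show False by (rule triangle_freeD[OF trif])
  qed
qed

lemma finite_F: "finite F" by (rule simple_graph_finite(2)[OF simple])

lemma finite_identify: "finite (identify a c F)" by (rule simple_graph_finite(2)[OF identify_simple])

text \<open>Only \<open>{a, y}\<close> and \<open>{c, y}\<close> with \<open>y\<close> a common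
  neighbour fall together; without the latter the map on edges is injective.\<close>

lemma card_identify: "card F \<le> card (identify a c F) + card (common F a c)"
proof -
  let ?B = "(\<lambda>y. {c, y}) ` common F a c"
  have fc: "finite (common F a c)" by (rule finite_common_simple[OF simple])
  have "inj_on ((`) (redirect a c)) (F - ?B)"
  proof (rule inj_onI)
    fix e e' assume e: "e \<in> F - ?B" "e' \<in> F - ?B" "redirect a c ` e = redirect a c ` e'"
    obtain x y where xy: "e = {x, y}" "x \<noteq> y" using simple_graph_edge_ex[OF simple DiffD1[OF e(1)]] by blast
    obtain x' y' where xy': "e' = {x', y'}" "x' \<noteq> y'" using simple_graph_edge_ex[OF simple DiffD1[OF e(2)]] by blast
    have B: "\<not> ({c, z} \<in> {e, e'} \<and> {a, z} \<in> F)" for z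
    proof
      assume z: "{c, z} \<in> {e, e'} \<and> {a, z} \<in> F"
      then have "{c, z} \<in> F" using e(1,2) by auto
      then have "z \<in> common F a c" using z edge_flip[of c z F] unfolding common_def by simp
      then have "{c, z} \<in> ?B" by (rule imageI)
      then show False using z e(1,2) by auto
    qed
    have eF: "{x, y} \<in> F" "{x', y'} \<in> F" "{y, x} \<in> F" "{y', x'} \<in> F" using e(1,2) xy(1) xy'(1) com by auto
    have one: "{x, y} = {x', y'}" if r: "redirect a c x = redirect a c x'" "redirect a c y = redirect a c y'"
      and E: "{x, y} \<in> F" "{x', y'} \<in> F" "{e, e'} = {{x, y}, {x', y'}}" "x \<noteq> y" "x' \<noteq> y'" for x y x' y'
    proof -
      have B1: "\<not> ({c, z} = {x, y} \<and> {a, z} \<in> F)" "\<not> ({c, z} = {x', y'} \<and> {a, z} \<in> F)" for z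
        using B[of z] unfolding E(3) by auto
      have sw: "{c, x} = {x, c}" "{a, x} = {x, a}" by blast+
      show ?thesis
        using r E ac B1[of y] B1[of x] B1[of y'] B1[of x'] unfolding redirect_def
        by (auto split: if_splits simp: insert_commute)
    qed
    have "(redirect a c x = redirect a c x' \<and> redirect a c y = redirect a c y') \<or>
        (redirect a c x = redirect a c y' \<and> redirect a c y = redirect a c x')"
      using e(3) xy(1) xy'(1) by (simp add: doubleton_eq_iff)
    then show "e = e'"
    proof
      assume "redirect a c x = redirect a c x' \<and> redirect a c y = redirect a c y'"
      then show ?thesis using one[of x x' y y'] eF xy xy' by simp
    next
      assume *: "redirect a c x = redirect a c y' \<and> redirect a c y = redirect a c x'"
      have "{x', y'} = {y', x'}" by blast
      then show ?thesis using one[of x y' y x'] * eF xy xy' by simp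
    qed
  qed
  then have "card (F - ?B) = card ((`) (redirect a c) ` (F - ?B))" by (simp add: card_image)
  also have "\<dots> \<le> card (identify a c F)"
    by (rule card_mono[OF finite_identify]) (auto simp: identify_def)
  finally have "card (F - ?B) \<le> card (identify a c F)" .
  moreover have "card F \<le> card (F - ?B) + card ?B"
    using card_Un_le[of "F - ?B" ?B] card_mono[of "(F - ?B) \<union> ?B" F] finite_F fc by auto
  moreover have "card ?B \<le> card (common F a c)" by (rule card_image_le[OF fc])
  ultimately show ?thesis by linarith
qed

definition push :: "'a tuple5 \<Rightarrow> 'a tuple5" where
  "push = (\<lambda>(x1, x2, x3, x4, x5). (redirect a c x1, redirect a c x2, redirect a c x3, redirect a c x4, redirect a c x5))"

text \<open>After merging \<open>c\<close> into \<open>a\<close>, a closed 5-walk that passes through \<open>c\<close> between two common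
  neighbours of \<open>a\<close> and \<open>c\<close> collides with its twin through \<open>a\<close>; there are no other collisions.\<close>

definition pinched :: "'a tuple5 set" where
  "pinched = {(x1, x2, x3, x4, x5). x1 = c \<and> x2 \<in> common F a c \<and> x5 \<in> common F a c}"

definition folded :: "'a tuple5 set" where
  "folded = {w \<in> walks5 F. w \<in> pinched \<or> rot w \<in> pinched \<or> rot (rot w) \<in> pinched \<or>
     rot (rot (rot w)) \<in> pinched \<or> rot (rot (rot (rot w))) \<in> pinched}"

lemma push_walk: "w \<in> walks5 F \<Longrightarrow> push w \<in> walks5 (identify a c F)"
  unfolding walks5_def push_def by (auto intro: identify_edge)

text \<open>An entry is ambiguous only if both \<open>a\<close> and \<open>c\<close> fit in its
  place. Its two neighbours are then different from \<open>a\<close> and \<open>c\<close>, hence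
  unchanged by the merge and adjacent to both.\<close>

lemma push_step:
  assumes "{s, x} \<in> F" "{x, t} \<in> F" "{s', x'} \<in> F" "{x', t'} \<in> F"
    "redirect a c s = redirect a c s'" "redirect a c x = redirect a c x'" "redirect a c t = redirect a c t'"
  shows "x = x' \<or> (x = c \<and> s \<in> common F a c \<and> t \<in> common F a c) \<or> (x' = c \<and> s' \<in> common F a c \<and> t' \<in> common F a c)"
proof (cases "x = x'")
  case False
  have ns: "{a, c} \<notin> F" "{c, a} \<notin> F" "{a} \<notin> F" "{c} \<notin> F"
    using ac(4) com[of a c] simple_graph_edge(3)[OF simple, of a a] simple_graph_edge(3)[OF simple, of c c] by auto
  have xx: "(x = c \<and> x' = a) \<or> (x = a \<and> x' = c)"
    using False assms(6) unfolding redirect_def by (auto split: if_splits)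
  then have "s \<notin> {a, c}" "t \<notin> {a, c}" "s' \<notin> {a, c}" "t' \<notin> {a, c}" using assms(1-4) ns by auto
  then have "s = s'" "t = t'" using assms(5,7) unfolding redirect_def by (auto split: if_splits)
  then show ?thesis using xx assms(1-4) com unfolding common_def by auto
qed simp

lemma push_inj: "inj_on push (walks5 F - folded)"
proof (rule inj_onI)
  fix w w' assume w: "w \<in> walks5 F - folded" "w' \<in> walks5 F - folded" "push w = push w'"
  obtain x1 x2 x3 x4 x5 where x: "w = (x1, x2, x3, x4, x5)" by (cases w)
  obtain y1 y2 y3 y4 y5 where y: "w' = (y1, y2, y3, y4, y5)" by (cases w')
  have ex: "{x1, x2} \<in> F" "{x2, x3} \<in> F" "{x3, x4} \<in> F" "{x4, x5} \<in> F" "{x5, x1} \<in> F"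
    using w(1) unfolding x walks5_def by auto
  have ey: "{y1, y2} \<in> F" "{y2, y3} \<in> F" "{y3, y4} \<in> F" "{y4, y5} \<in> F" "{y5, y1} \<in> F"
    using w(2) unfolding y walks5_def by auto
  have r: "redirect a c x1 = redirect a c y1" "redirect a c x2 = redirect a c y2" "redirect a c x3 = redirect a c y3"
    "redirect a c x4 = redirect a c y4" "redirect a c x5 = redirect a c y5"
    using w(3) unfolding x y push_def by auto
  have wF: "w \<in> walks5 F" "w' \<in> walks5 F" "w \<notin> folded" "w' \<notin> folded" using w by auto
  have n: "\<not> (x1 = c \<and> x5 \<in> common F a c \<and> x2 \<in> common F a c)" "\<not> (x2 = c \<and> x1 \<in> common F a c \<and> x3 \<in> common F a c)"
    "\<not> (x3 = c \<and> x2 \<in> common F a c \<and> x4 \<in> common F a c)" "\<not> (x4 = c \<and> x3 \<in> common F a c \<and> x5 \<in> common F a c)"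
    "\<not> (x5 = c \<and> x4 \<in> common F a c \<and> x1 \<in> common F a c)"
    using wF(1,3) unfolding folded_def pinched_def x by auto
  have n': "\<not> (y1 = c \<and> y5 \<in> common F a c \<and> y2 \<in> common F a c)" "\<not> (y2 = c \<and> y1 \<in> common F a c \<and> y3 \<in> common F a c)"
    "\<not> (y3 = c \<and> y2 \<in> common F a c \<and> y4 \<in> common F a c)" "\<not> (y4 = c \<and> y3 \<in> common F a c \<and> y5 \<in> common F a c)"
    "\<not> (y5 = c \<and> y4 \<in> common F a c \<and> y1 \<in> common F a c)"
    using wF(2,4) unfolding folded_def pinched_def y by auto
  have "x1 = y1" using push_step[OF ex(5,1) ey(5,1) r(5,1,2)] n(1) n'(1) by blast
  moreover have "x2 = y2" using push_step[OF ex(1,2) ey(1,2) r(1,2,3)] n(2) n'(2) by blast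
  moreover have "x3 = y3" using push_step[OF ex(2,3) ey(2,3) r(2,3,4)] n(3) n'(3) by blast
  moreover have "x4 = y4" using push_step[OF ex(3,4) ey(3,4) r(3,4,5)] n(4) n'(4) by blast
  moreover have "x5 = y5" using push_step[OF ex(4,5) ey(4,5) r(4,5,1)] n(5) n'(5) by blast
  ultimately show "w = w'" unfolding x y by simp
qed

lemma card_unfolded: "card (walks5 F - folded) \<le> card (walks5 (identify a c F))"
proof -
  have "card (walks5 F - folded) = card (push ` (walks5 F - folded))" using push_inj by (simp add: card_image)
  also have "\<dots> \<le> card (walks5 (identify a c F))"
    by (rule card_mono[OF finite_walks5[OF identify_simple]]) (use push_walk in auto)
  finally show ?thesis .
qed

lemma walks5_identify_less:
  assumes "common F a c = {}" "w \<in> walks5 (identify a c F)" "w \<notin> push ` walks5 F"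
  shows "card (walks5 F) < card (walks5 (identify a c F))"
proof -
  have "folded = {}" unfolding folded_def pinched_def using assms(1) by auto
  then have "card (walks5 F) = card (push ` walks5 F)" using push_inj by (simp add: card_image)
  also have "push ` walks5 F \<subset> walks5 (identify a c F)" using assms(2,3) push_walk by blast
  then have "card (push ` walks5 F) < card (walks5 (identify a c F))"
    using finite_walks5[OF identify_simple] by (rule psubset_card_mono[rotated])
  finally show ?thesis .
qed

lemma walks5_identify_no_common:
  assumes "common F a c = {}"
  shows "card (walks5 F) \<le> card (walks5 (identify a c F))"
proof -
  have "folded = {}" unfolding folded_def pinched_def using assms(1) by auto
  then show ?thesis using card_unfolded by simp
qed

text \<open>A folded walk passes through \<open>c\<close> between \<open>u\<close> and
  \<open>b\<close>; what remains of it is a path of length three between these two. Five rotations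
  and two directions give the factor ten.\<close>

lemma walks5_identify:
  assumes co: "common F a c = {u, b}"
  shows "card (walks5 F) \<le> card (walks5 (identify a c F)) + 10 * card (walks3 F u b)"
proof -
  let ?W = "walks3 F u b"
  let ?T = "(\<lambda>(x, y). (c, u, x, y, b)) ` ?W \<union> (\<lambda>(x, y). (c, b, y, x, u)) ` ?W"
  have fW: "finite ?W" by (rule finite_walks3_simple[OF simple])
  have fT: "finite ?T" using fW by simp
  have cT: "card ?T \<le> 2 * card ?W"
    using card_Un_le[of "(\<lambda>(x, y). (c, u, x, y, b)) ` ?W" "(\<lambda>(x, y). (c, b, y, x, u)) ` ?W"]
      card_image_le[OF fW, of "\<lambda>(x, y). (c, u, x, y, b)"] card_image_le[OF fW, of "\<lambda>(x, y). (c, b, y, x, u)"] by linarith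
  have rw: "rot w \<in> walks5 F" if "w \<in> walks5 F" for w using that unfolding walks5_def by auto
  have P: "w \<in> ?T" if w: "w \<in> walks5 F" "w \<in> pinched" for w
  proof -
    obtain x1 x2 x3 x4 x5 where x: "w = (x1, x2, x3, x4, x5)" by (cases w)
    have d: "x2 \<noteq> x5" using walks5_distinct[OF simple trif w(1)[unfolded x]] by simp
    have e: "{x2, x3} \<in> F" "{x3, x4} \<in> F" "{x4, x5} \<in> F" "x1 = c" using w unfolding x walks5_def pinched_def by auto
    have "x2 \<in> {u, b}" "x5 \<in> {u, b}" using w(2) unfolding x pinched_def co by auto
    then consider "x2 = u" "x5 = b" | "x2 = b" "x5 = u" using d by auto
    then show ?thesis
    proof cases
      case 1
      then have "(x3, x4) \<in> ?W" using e unfolding walks3_def by simp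
      then show ?thesis unfolding x using e(4) 1 by force
    next
      case 2
      then have "(x4, x3) \<in> ?W" using e com unfolding walks3_def by blast
      then show ?thesis unfolding x using e(4) 2 by force
    qed
  qed
  have "card folded \<le> 5 * card ?T"
  proof (rule card_le_rotations[OF fT])
    fix w assume w: "w \<in> folded"
    then have "w \<in> walks5 F" unfolding folded_def by simp
    note r0 = this note r1 = rw[OF r0] note r2 = rw[OF r1] note r3 = rw[OF r2] note r4 = rw[OF r3]
    show "w \<in> ?T \<or> rot w \<in> ?T \<or> rot (rot w) \<in> ?T \<or> rot (rot (rot w)) \<in> ?T \<or> rot (rot (rot (rot w))) \<in> ?T"
      using w P[OF r0] P[OF r1] P[OF r2] P[OF r3] P[OF r4] unfolding folded_def by blast
  qed
  moreover have "card (walks5 F) = card (walks5 F - folded) + card folded"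
  proof -
    have "folded \<subseteq> walks5 F" unfolding folded_def by blast
    then show ?thesis using finite_walks5[OF simple]
      by (metis card_Diff_subset card_mono finite_subset le_add_diff_inverse2)
  qed
  ultimately show ?thesis using card_unfolded cT by linarith
qed

end

text \<open>Rotated so that the edge joins the last entry to the first, a lost walk is a path of
  length four between \<open>a\<close> and \<open>c\<close>; the factor ten again stands for five
  rotations and two directions.\<close>

lemma walks5_delete_edge:
  assumes G: "simple_graph (V, E)" "triangle_free E"
  shows "card (walks5 E) \<le> card (walks5 (E - {{a, c}})) +
    10 * card {(s, t, r). {a, s} \<in> E \<and> {s, t} \<in> E \<and> {t, r} \<in> E \<and> {r, c} \<in> E}"
proof -
  let ?M = "{(s, t, r). {a, s} \<in> E \<and> {s, t} \<in> E \<and> {t, r} \<in> E \<and> {r, c} \<in> E}"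
  let ?F = "E - {{a, c}}"
  let ?T = "(\<lambda>(s, t, r). (a, s, t, r, c)) ` ?M \<union> (\<lambda>(s, t, r). (c, r, t, s, a)) ` ?M"
  have fM: "finite ?M"
    by (rule finite_subset[of _ "V \<times> V \<times> V"]) (auto simp: simple_graph_finite[OF G(1)] dest: simple_graph_edge[OF G(1)])
  have fT: "finite ?T" using fM by simp
  have cT: "card ?T \<le> 2 * card ?M"
    using card_Un_le[of "(\<lambda>(s, t, r). (a, s, t, r, c)) ` ?M" "(\<lambda>(s, t, r). (c, r, t, s, a)) ` ?M"]
      card_image_le[OF fM, of "\<lambda>(s, t, r). (a, s, t, r, c)"] card_image_le[OF fM, of "\<lambda>(s, t, r). (c, r, t, s, a)"] by linarith
  have P: "(x1, x2, x3, x4, x5) \<in> ?T" if w: "(x1, x2, x3, x4, x5) \<in> walks5 E" "{x5, x1} = {a, c}" for x1 x2 x3 x4 x5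
  proof -
    have e: "{x1, x2} \<in> E" "{x2, x3} \<in> E" "{x3, x4} \<in> E" "{x4, x5} \<in> E" using w unfolding walks5_def by auto
    note e' = e[THEN edge_flip]
    consider "x1 = a" "x5 = c" | "x1 = c" "x5 = a" using w(2) by (auto simp: doubleton_eq_iff)
    then show ?thesis
    proof cases
      case 1
      then have "(x2, x3, x4) \<in> ?M" using e by simp
      then show ?thesis using 1 by force
    next
      case 2
      then have "(x4, x3, x2) \<in> ?M" using e' by simp
      then show ?thesis using 2 by force
    qed
  qed
  have "card (walks5 E - walks5 ?F) \<le> 5 * card ?T"
  proof (rule card_le_rotations[OF fT])
    fix w assume w: "w \<in> walks5 E - walks5 ?F"
    obtain x1 x2 x3 x4 x5 where x: "w = (x1, x2, x3, x4, x5)" by (cases w)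
    have wE: "(x1, x2, x3, x4, x5) \<in> walks5 E" "(x2, x3, x4, x5, x1) \<in> walks5 E" "(x3, x4, x5, x1, x2) \<in> walks5 E"
      "(x4, x5, x1, x2, x3) \<in> walks5 E" "(x5, x1, x2, x3, x4) \<in> walks5 E" using w unfolding x walks5_def by auto
    have "{x1, x2} = {a, c} \<or> {x2, x3} = {a, c} \<or> {x3, x4} = {a, c} \<or> {x4, x5} = {a, c} \<or> {x5, x1} = {a, c}"
      using w unfolding x walks5_def by auto
    then show "w \<in> ?T \<or> rot w \<in> ?T \<or> rot (rot w) \<in> ?T \<or> rot (rot (rot w)) \<in> ?T \<or> rot (rot (rot (rot w))) \<in> ?T"
      unfolding x rot_simp using P[OF wE(1)] P[OF wE(2)] P[OF wE(3)] P[OF wE(4)] P[OF wE(5)] by blast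
  qed
  moreover have "card (walks5 E) = card (walks5 E - walks5 ?F) + card (walks5 ?F)"
  proof -
    have "walks5 ?F \<subseteq> walks5 E" unfolding walks5_def by blast
    then show ?thesis using finite_walks5[OF G(1)]
      by (metis card_Diff_subset card_mono finite_subset le_add_diff_inverse2)
  qed
  ultimately show ?thesis using cT by linarith
qed

text \<open>The positions of \<open>u\<close> and \<open>v\<close> in a closed 5-walk through both
  reveal rotation and direction, so the parametrisation \<open>h\<close> is injective. When the
  bound is attained, \<open>h\<close> is also onto, and then no closed 5-walk avoids
  \<open>u\<close> or \<open>v\<close>.\<close>

lemma walks5_pair:
  assumes G: "simple_graph (V, E)" "triangle_free E" and uv: "u \<noteq> v" "{u, v} \<notin> E"
  shows "10 * (card (common E u v) * card (walks3 E u v)) \<le> card (walks5 E)"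
    and "card (walks5 E) \<le> 10 * (card (common E u v) * card (walks3 E u v)) \<Longrightarrow> (x1, x2, x3, x4, x5) \<in> walks5 E \<Longrightarrow>
      u \<in> {x1, x2, x3, x4, x5} \<and> v \<in> {x1, x2, x3, x4, x5}"
proof -
  let ?P = "common E u v \<times> walks3 E u v"
  let ?K = "{0, 1, 2, 3, 4 :: nat} \<times> (UNIV :: bool set)"
  define h where "h = (\<lambda>((k :: nat, b :: bool), (c, (x, y))). (rot ^^ k) (if b then (u, c, v, y, x) else (v, c, u, x, y)))"
  have P: "c \<noteq> u" "c \<noteq> v" "x \<noteq> u" "x \<noteq> v" "y \<noteq> u" "y \<noteq> v"
    "{u, c} \<in> E" "{c, v} \<in> E" "{u, x} \<in> E" "{x, y} \<in> E" "{y, v} \<in> E"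
    "{c, u} \<in> E" "{v, c} \<in> E" "{x, u} \<in> E" "{y, x} \<in> E" "{v, y} \<in> E" if "(c, (x, y)) \<in> ?P" for c x y
  proof -
    show e: "{u, c} \<in> E" "{c, v} \<in> E" "{u, x} \<in> E" "{x, y} \<in> E" "{y, v} \<in> E"
      using that unfolding common_def walks3_def by auto
    show "{c, u} \<in> E" "{v, c} \<in> E" "{x, u} \<in> E" "{y, x} \<in> E" "{v, y} \<in> E" by (rule e[THEN edge_flip])+
    show "c \<noteq> u" "c \<noteq> v" "x \<noteq> u" "y \<noteq> v" using simple_graph_edge(3)[OF G(1)] e by blast+
    show "x \<noteq> v" "y \<noteq> u" using e uv(2) by auto
  qed
  have rotk: "(rot ^^ (1::nat)) w = rot w" "(rot ^^ (2::nat)) w = rot (rot w)" "(rot ^^ (3::nat)) w = rot (rot (rot w))"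
    "(rot ^^ (4::nat)) w = rot (rot (rot (rot w)))" for w :: "'a tuple5"
    by (simp_all add: numeral_eq_Suc)
  have inj: "inj_on h (?K \<times> ?P)"
  proof (rule inj_onI)
    fix i j assume i: "i \<in> ?K \<times> ?P" and j: "j \<in> ?K \<times> ?P" and eq: "h i = h j"
    obtain k b c x y where ii: "i = ((k, b), (c, (x, y)))" by (cases i) auto
    obtain k' b' c' x' y' where jj: "j = ((k', b'), (c', (x', y')))" by (cases j) auto
    have Pi: "(c, (x, y)) \<in> ?P" and Pj: "(c', (x', y')) \<in> ?P" using i j ii jj by auto
    note ni = P(1-6)[OF Pi] and nj = P(1-6)[OF Pj]
    have k: "k = 0 \<or> k = 1 \<or> k = 2 \<or> k = 3 \<or> k = 4" "k' = 0 \<or> k' = 1 \<or> k' = 2 \<or> k' = 3 \<or> k' = 4"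
      using i j ii jj by auto
    have eq': "(rot ^^ k) (if b then (u, c, v, y, x) else (v, c, u, x, y)) = (rot ^^ k') (if b' then (u, c', v, y', x') else (v, c', u, x', y'))"
      using eq unfolding ii jj h_def by simp
    show "i = j" unfolding ii jj using k eq' ni nj uv(1)
      by (elim disjE; cases b; cases b') (simp_all only: rotk funpow_0 if_True if_False rot_simp prod.inject, auto)
  qed
  have into: "h ` (?K \<times> ?P) \<subseteq> walks5 E"
  proof
    fix w assume "w \<in> h ` (?K \<times> ?P)"
    then obtain k b c x y where w: "w = h ((k, b), (c, (x, y)))" and k: "k \<in> {0,1,2,3,4}" and Pi: "(c, (x, y)) \<in> ?P" by force
    have rw: "rot w \<in> walks5 E" if "w \<in> walks5 E" for w using that unfolding walks5_def by auto
    have "(if b then (u, c, v, y, x) else (v, c, u, x, y)) \<in> walks5 E"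
      using P(7-16)[OF Pi] unfolding walks5_def by simp
    then have "(rot ^^ k) (if b then (u, c, v, y, x) else (v, c, u, x, y)) \<in> walks5 E" by (induction k) (auto intro: rw)
    then show "w \<in> walks5 E" unfolding w h_def by simp
  qed
  have fin: "finite (walks5 E)" by (rule finite_walks5[OF G(1)])
  have c: "card (?K \<times> ?P) = 10 * (card (common E u v) * card (walks3 E u v))"
    by (simp add: card_cartesian_product)
  have ci: "card (h ` (?K \<times> ?P)) = 10 * (card (common E u v) * card (walks3 E u v))"
    using card_image[OF inj] c by simp
  show "10 * (card (common E u v) * card (walks3 E u v)) \<le> card (walks5 E)"
    using card_mono[OF fin into] ci by simp
  assume le: "card (walks5 E) \<le> 10 * (card (common E u v) * card (walks3 E u v))" and x: "(x1, x2, x3, x4, x5) \<in> walks5 E"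
  have "h ` (?K \<times> ?P) = walks5 E" using card_subset_eq[OF fin into] le ci card_mono[OF fin into] by simp
  then have "(x1, x2, x3, x4, x5) \<in> h ` (?K \<times> ?P)" using x by simp
  then obtain k b c x y where w: "(x1, x2, x3, x4, x5) = h ((k, b), (c, (x, y)))" and k: "k \<in> {0,1,2,3,4}" by force
  have w': "(x1, x2, x3, x4, x5) = (rot ^^ k) (if b then (u, c, v, y, x) else (v, c, u, x, y))" using w unfolding h_def by simp
  have "k = 0 \<or> k = 1 \<or> k = 2 \<or> k = 3 \<or> k = 4" using k by simp
  then show "u \<in> {x1, x2, x3, x4, x5} \<and> v \<in> {x1, x2, x3, x4, x5}"
    using w' by (elim disjE; cases b) (simp_all only: rotk funpow_0 if_True if_False rot_simp prod.inject, auto)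
qed

section \<open>Edge bounds\<close>

definition tfp :: "'a set \<Rightarrow> 'a set set \<Rightarrow> bool" where
  "tfp V E \<longleftrightarrow> simple_graph (V, E) \<and> triangle_free E \<and> drawable V E"

lemma tfpD: "tfp V E \<Longrightarrow> simple_graph (V, E)" "tfp V E \<Longrightarrow> triangle_free E" "tfp V E \<Longrightarrow> drawable V E"
  "tfp V E \<Longrightarrow> finite V" "tfp V E \<Longrightarrow> finite E"
  unfolding tfp_def using simple_graph_finite by auto

lemma tfp_plane_graph:
  assumes "tfp V E"
  obtains p \<Gamma> where "plane_graph V E p \<Gamma>"
proof -
  obtain p \<Gamma> where "drawn V E p \<Gamma>" using tfpD(3)[OF assms] unfolding drawable_def by blast
  then have "plane_graph V E p \<Gamma>"
    using tfpD(1,2)[OF assms] unfolding plane_graph_def triangle_free_def by blast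
  then show ?thesis by (rule that)
qed

lemma tfp_subgraph:
  assumes "tfp V E" "V' \<subseteq> V" "E' \<subseteq> E" "\<And>e. e \<in> E' \<Longrightarrow> e \<subseteq> V'"
  shows "tfp V' E'"
proof -
  have fin: "finite V'" using tfpD(4)[OF assms(1)] assms(2) finite_subset by blast
  have "simple_graph (V', E')"
    unfolding simple_graph_def fst_conv snd_conv
  proof (intro conjI ballI fin)
    fix e assume e: "e \<in> E'"
    obtain x y where "e = {x, y}" "x \<noteq> y" using simple_graph_edge_ex[OF tfpD(1)[OF assms(1)]] assms(3) e by blast
    then show "\<exists>x\<in>V'. \<exists>y\<in>V'. x \<noteq> y \<and> e = {x, y}" using assms(4)[OF e] by blast
  qed
  then show ?thesis unfolding tfp_def
    using drawable_subgraph[OF tfpD(3)[OF assms(1)] assms(2,3)] triangle_free_subset[OF tfpD(2)[OF assms(1)] assms(3)] by blast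
qed

lemma tfp_induced: "tfp V E \<Longrightarrow> W \<subseteq> V \<Longrightarrow> tfp W {e \<in> E. e \<subseteq> W}"
  by (rule tfp_subgraph) auto

text \<open>Only the drawability of the result is recorded, so that the counting can go on without a
  particular drawing.\<close>

definition mergeable :: "'a set \<Rightarrow> 'a set set \<Rightarrow> 'a \<Rightarrow> 'a \<Rightarrow> 'a \<Rightarrow> 'a \<Rightarrow> bool" where
  "mergeable V E s a t c \<longleftrightarrow> cycle4 E s a t c \<and> walks3 E a c = {} \<and> common E a c = {s, t} \<and>
     drawable (V - {c}) (identify a c E)"

context plane_graph begin

lemma facial_cycle: "facial u a b c \<Longrightarrow> cycle4 E u a b c"
  unfolding facial_def by simp

lemma facial_linked_mergeable:
  assumes F: "facial u a b c" and w: "walks3 E u b \<noteq> {} \<or> \<not> common E u b \<subseteq> {a, c}"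
  shows "mergeable V E u a b c"
proof -
  have "walks3 E a c = {}" and co: "common E a c = {u, b}" using facial_alternative[OF F w] by simp_all
  then show ?thesis unfolding mergeable_def using drawable_merge[OF F co] facial_cycle[OF F] by simp
qed

text \<open>If \<open>u\<close> and \<open>b\<close> are linked outside the cycle, then
  \<open>a\<close> and \<open>c\<close> are not and can be merged; if \<open>u\<close> and
  \<open>b\<close> are not linked, they can be merged themselves.\<close>

lemma facial_some:
  assumes F: "facial u a b c"
  shows "mergeable V E u a b c \<or> mergeable V E a b c u"
proof (cases "walks3 E u b \<noteq> {} \<or> \<not> common E u b \<subseteq> {a, c}")
  case True
  then show ?thesis using facial_linked_mergeable[OF F] by simp
next
  case False
  have C: "cycle4 E u a b c" by (rule facial_cycle[OF F])
  note cD = cycle4D[OF C]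
  have "{a, c} \<subseteq> common E u b" using cD unfolding common_def by simp
  then have co: "common E b u = {a, c}" unfolding common_commute[of E b u] using False by (intro equalityI) simp_all
  have "walks3 E b u = {}" using False walks3_commute[of E b u] by simp
  then show ?thesis unfolding mergeable_def
    using cycle4_rotate[OF C] co drawable_merge[OF facial_rotate[OF F] co] by simp
qed

lemma isolated_side:
  assumes nf: "\<And>u a b c. \<not> facial u a b c" and C: "cycle4 E u0 a0 b0 c0"
  obtains u a b c I where "cycle4 E u a b c" "I \<subseteq> V" "I \<noteq> {}" "I \<inter> {u, a, b, c} = {}"
    "\<And>x y. x \<in> I \<Longrightarrow> {x, y} \<in> E \<Longrightarrow> y \<in> I \<union> {u, a, b, c}" "\<And>x d e f. x \<in> I \<Longrightarrow> \<not> cycle4 E x d e f"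
proof -
  let ?P = "\<lambda>(u, a, b, c, z). cycle4 E u a b c \<and> z \<notin> curve4 u a b c"
  let ?f = "\<lambda>(u, a, b, c, z). card {x\<in>V. p x \<in> away (curve4 u a b c) z}"
  obtain z0 where "z0 \<in> inside (curve4 u0 a0 b0 c0)" using jordan_facts(2)[OF jordan_curve4[OF C]] by blast
  then have "z0 \<notin> curve4 u0 a0 b0 c0" using inside_no_overlap by blast
  then have "?P (u0, a0, b0, c0, z0)" using C by simp
  then obtain m where m: "?P m" "\<And>y. ?P y \<Longrightarrow> ?f m \<le> ?f y"
    using ex_has_least_nat[of ?P "(u0, a0, b0, c0, z0)" ?f] by blast
  obtain u a b c z where mm: "m = (u, a, b, c, z)" by (cases m)
  have C: "cycle4 E u a b c" and z: "z \<notin> curve4 u a b c" using m(1) unfolding mm by auto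
  have min: "card {x\<in>V. p x \<in> away (curve4 u a b c) z} \<le> card {x\<in>V. p x \<in> away (curve4 u' a' b' c') z'}"
    if "cycle4 E u' a' b' c'" "z' \<notin> curve4 u' a' b' c'" for u' a' b' c' z'
    using m(2)[of "(u', a', b', c', z')"] that unfolding mm by simp
  let ?I = "{x\<in>V. p x \<in> away (curve4 u a b c) z}"
  show ?thesis
  proof (rule that[OF C, of ?I])
    show "?I \<subseteq> V" by blast
    show "?I \<noteq> {}" using nf[of u a b c] C z unfolding facial_def by blast
    show "?I \<inter> {u, a, b, c} = {}" using side_off_cycle[OF C z] by blast
    show "y \<in> ?I \<union> {u, a, b, c}" if "x \<in> ?I" "{x, y} \<in> E" for x y
    proof -
      have "p x \<in> away (curve4 u a b c) z" using that(1) by simp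
      then show ?thesis using neighbour_side[OF C z that(2)] edge(2)[OF that(2)] by blast
    qed
    show "\<not> cycle4 E x d e f" if "x \<in> ?I" for x d e f
      using minimal_side_no_cycle4[OF C z min] that by blast
  qed
qed

end

lemma mergeable_identification:
  assumes G: "tfp V E" and m: "mergeable V E s a t c"
  shows "identification V E a c" "tfp (V - {c}) (identify a c E)"
proof -
  have C: "{s, a} \<in> E" "{a, t} \<in> E" "{t, c} \<in> E" "{c, s} \<in> E" "a \<noteq> c" and w: "walks3 E a c = {}"
    using m unfolding mergeable_def cycle4_def by auto
  have ac: "{a, c} \<notin> E" using triangle_freeD[OF tfpD(2)[OF G] C(2,3)] by blast
  show 1: "identification V E a c"
    unfolding identification_def using G C ac w simple_graph_edge[OF tfpD(1)[OF G]] unfolding tfp_def by blast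
  show "tfp (V - {c}) (identify a c E)" unfolding tfp_def
    using identification.identify_simple[OF 1] identification.identify_triangle_free[OF 1] m
    unfolding mergeable_def by blast
qed

text \<open>A walk of length three between the ends would close a 4-cycle with the edge, and a
  common neighbour a triangle.\<close>

lemma contract_identification:
  assumes G: "tfp V E" and ac: "{a, c} \<in> E" and nc: "\<And>x y. \<not> cycle4 E a x y c"
  shows "identification V (E - {{a, c}}) a c" "tfp (V - {c}) (identify a c (E - {{a, c}}))" "common (E - {{a, c}}) a c = {}"
proof -
  let ?F = "E - {{a, c}}"
  have acV: "a \<in> V" "c \<in> V" "a \<noteq> c" using simple_graph_edge[OF tfpD(1)[OF G] ac] by auto
  have no: False if "{a, y} \<in> E" "{c, y} \<in> E" for y
    using triangle_freeD[OF tfpD(2)[OF G] edge_flip[OF ac] that(1) that(2)] .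
  show "common ?F a c = {}" unfolding common_def using no edge_flip[of _ c E] by blast
  have "walks3 ?F a c = {}"
  proof -
    have False if w: "{a, x} \<in> ?F" "{x, y} \<in> ?F" "{y, c} \<in> ?F" for x y
    proof -
      have "x \<noteq> c" using w(1) by auto
      moreover have "y \<noteq> a" using w(3) by auto
      ultimately have "cycle4 E a x y c" unfolding cycle4_def using w edge_flip[OF ac] by auto
      then show False using nc by blast
    qed
    then show ?thesis unfolding walks3_def by blast
  qed
  moreover have "simple_graph (V, ?F)" using tfpD(1)[OF G] unfolding simple_graph_def by auto
  moreover have "triangle_free ?F" by (rule triangle_free_subset[OF tfpD(2)[OF G]]) blast
  ultimately show 1: "identification V ?F a c" unfolding identification_def using acV by simp
  have "drawable (V - {c}) (identify a c ?F)"
    by (rule drawable_contract[OF tfpD(1,3)[OF G] ac]) (use no in blast)+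
  then show "tfp (V - {c}) (identify a c ?F)" unfolding tfp_def
    using identification.identify_simple[OF 1] identification.identify_triangle_free[OF 1] by blast
qed

definition nbrs :: "'a set set \<Rightarrow> 'a \<Rightarrow> 'a set" where "nbrs E x = {y. {x, y} \<in> E}"

lemma finite_nbrs: "simple_graph (V, E) \<Longrightarrow> finite (nbrs E x)"
  by (rule finite_subset[of _ V]) (auto simp: nbrs_def simple_graph_finite dest: simple_graph_edge)

lemma card_delete_vertex:
  assumes G: "simple_graph (V, E)" and d: "card (nbrs E x) \<le> 1"
  shows "card E \<le> card {e \<in> E. e \<subseteq> V - {x}} + 1" "walks5 E \<noteq> {} \<Longrightarrow> triangle_free E \<Longrightarrow> walks5 {e \<in> E. e \<subseteq> V - {x}} = walks5 E"
proof -
  let ?E = "{e \<in> E. e \<subseteq> V - {x}}"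
  have sub: "E \<subseteq> ?E \<union> (\<lambda>y. {x, y}) ` nbrs E x"
  proof
    fix e assume e: "e \<in> E"
    obtain y z where yz: "e = {y, z}" "y \<in> V" "z \<in> V" using simple_graph_edge_ex[OF G e] by blast
    show "e \<in> ?E \<union> (\<lambda>y. {x, y}) ` nbrs E x"
    proof (cases "x \<in> e")
      case True
      then have "e = {x, y} \<or> e = {x, z}" using yz by auto
      then show ?thesis using e unfolding nbrs_def by auto
    next
      case False then show ?thesis using yz e by auto
    qed
  qed
  have fn: "finite (nbrs E x)" by (rule finite_nbrs[OF G])
  have fE: "finite ?E" using simple_graph_finite[OF G] by simp
  have "card E \<le> card (?E \<union> (\<lambda>y. {x, y}) ` nbrs E x)" using sub fn fE by (intro card_mono) auto
  also have "\<dots> \<le> card ?E + card ((\<lambda>y. {x, y}) ` nbrs E x)" by (rule card_Un_le)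
  also have "\<dots> \<le> card ?E + 1" using card_image_le[OF fn, of "\<lambda>y. {x, y}"] d by linarith
  finally show "card E \<le> card ?E + 1" .
  assume tf: "triangle_free E"
  show "walks5 ?E = walks5 E"
  proof
    show "walks5 ?E \<subseteq> walks5 E" unfolding walks5_def by auto
    show "walks5 E \<subseteq> walks5 ?E"
    proof
      fix w assume w: "w \<in> walks5 E"
      obtain x1 x2 x3 x4 x5 where x: "w = (x1, x2, x3, x4, x5)" by (cases w)
      have d5: "distinct [x1, x2, x3, x4, x5]" using walks5_distinct[OF G tf w[unfolded x]] .
      have e: "{x1, x2} \<in> E" "{x2, x3} \<in> E" "{x3, x4} \<in> E" "{x4, x5} \<in> E" "{x5, x1} \<in> E" using w unfolding x walks5_def by auto
      have two: False if "{y, x} \<in> E" "{x, z} \<in> E" "y \<noteq> z" for y z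
      proof -
        have "{y, z} \<subseteq> nbrs E x" using that edge_flip[OF that(1)] unfolding nbrs_def by auto
        then have "card {y, z} \<le> card (nbrs E x)" using fn card_mono by blast
        then show False using d that(3) by simp
      qed
      have "x1 \<noteq> x" "x2 \<noteq> x" "x3 \<noteq> x" "x4 \<noteq> x" "x5 \<noteq> x" using two e d5 by auto
      moreover have "x1 \<in> V" "x2 \<in> V" "x3 \<in> V" "x4 \<in> V" "x5 \<in> V" using simple_graph_edge(1)[OF G] e by blast+
      ultimately show "w \<in> walks5 ?E" using e unfolding x walks5_def by auto
    qed
  qed
qed

lemma walks5_five_vertices:
  assumes G: "simple_graph (V, E)" "triangle_free E" and w: "walks5 E \<noteq> {}"
  shows "5 \<le> card V"
proof -
  obtain x1 x2 x3 x4 x5 where x: "(x1, x2, x3, x4, x5) \<in> walks5 E" using w by auto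
  have e: "{x1, x2} \<in> E" "{x2, x3} \<in> E" "{x3, x4} \<in> E" "{x4, x5} \<in> E" "{x5, x1} \<in> E" using x unfolding walks5_def by auto
  have "set [x1, x2, x3, x4, x5] \<subseteq> V" using simple_graph_edge(1)[OF G(1)] e by auto
  then have "card (set [x1, x2, x3, x4, x5]) \<le> card V" using simple_graph_finite[OF G(1)] card_mono by blast
  then show ?thesis using distinct_card[OF walks5_distinct[OF G x]] by simp
qed

text \<open>A merge loses at most two edges and keeps a pentagon if there was one, so both bounds
  are inherited from \<open>n - 1\<close> vertices. Contracting an edge or deleting a vertex of
  degree at most one loses at most one edge where two are allowed; this gives the stronger bound at
  once. On three vertices at most two edges are free of triangles.\<close>

theorem edge_bound:
  assumes "tfp V E" "card V \<ge> 3"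
  shows "card E + 4 \<le> 2 * card V \<and> (walks5 E \<noteq> {} \<longrightarrow> card E + 5 \<le> 2 * card V)"
  using assms
proof (induction "card V" arbitrary: V E rule: less_induct)
  case (less V E)
  note G = less.prems(1) and sg = tfpD(1)[OF less.prems(1)] and tf = tfpD(2)[OF less.prems(1)]
  show ?case
  proof (cases "card V = 3")
    case True
    then obtain x y z where V: "V = {x, y, z}" "x \<noteq> y" "x \<noteq> z" "y \<noteq> z" by (metis card_3_iff)
    have sub: "E \<subseteq> {{x, y}, {y, z}, {x, z}}"
    proof
      fix e assume "e \<in> E"
      then obtain a b where "e = {a, b}" "a \<in> V" "b \<in> V" "a \<noteq> b" using simple_graph_edge_ex[OF sg] by blast
      then show "e \<in> {{x, y}, {y, z}, {x, z}}" unfolding V(1) by (auto simp: insert_commute)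
    qed
    have "\<not> {{x, y}, {y, z}, {x, z}} \<subseteq> E" using triangle_freeD[OF tf, of x y z] by auto
    then have "E \<subset> {{x, y}, {y, z}, {x, z}}" using sub by blast
    then have "card E < card {{x, y}, {y, z}, {x, z}}" by (intro psubset_card_mono) auto
    also have "\<dots> \<le> 3" by (simp add: card_insert_if)
    finally have "card E \<le> 2" by simp
    moreover have "walks5 E = {}" using walks5_five_vertices[OF sg tf] True by fastforce
    ultimately show ?thesis using True by simp
  next
    case False
    then have n4: "card V \<ge> 4" using less.prems(2) by simp
    have red: "card V' < card V \<and> card V' \<ge> 3 \<and> card V' + 1 = card V" if "V' = V - {x}" "x \<in> V" for V' x
      using that n4 tfpD(4)[OF G] by (simp add: card_Diff_singleton)
    obtain p \<Gamma> where "plane_graph V E p \<Gamma>" using tfp_plane_graph[OF G] .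
    then interpret plane_graph V E p \<Gamma> .
    have contraction: ?thesis if ac: "{a, c} \<in> E" and nc: "\<And>x y. \<not> cycle4 E a x y c" for a c
    proof -
      note I = contract_identification[OF G ac nc]
      have cV: "c \<in> V" using edge(2)[OF ac] .
      note r = red[OF refl cV]
      have "card (identify a c (E - {{a, c}})) + 4 \<le> 2 * card (V - {c})" using less.hyps[OF _ I(2)] r by blast
      moreover have "card (E - {{a, c}}) \<le> card (identify a c (E - {{a, c}}))"
        using identification.card_identify[OF I(1)] I(3) by simp
      moreover have "card E = card (E - {{a, c}}) + 1"
        using ac tfpD(5)[OF G] by (metis Suc_eq_plus1 card_Suc_Diff1)
      ultimately show ?thesis using r by linarith
    qed
    have merge: ?thesis if m: "mergeable V E s a t c" for s a t c
    proof -
      note I = mergeable_identification[OF G m]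
      have cV: "c \<in> V" using identification.ac(2)[OF I(1)] .
      note r = red[OF refl cV]
      have IH: "card (identify a c E) + 4 \<le> 2 * card (V - {c}) \<and>
          (walks5 (identify a c E) \<noteq> {} \<longrightarrow> card (identify a c E) + 5 \<le> 2 * card (V - {c}))"
        using less.hyps[OF _ I(2)] r by blast
      have "common E a c = {s, t}" using m unfolding mergeable_def by simp
      then have "card (common E a c) \<le> 2" by (simp add: card_insert_if)
      then have "card E \<le> card (identify a c E) + 2" using identification.card_identify[OF I(1)] by linarith
      moreover have "walks5 (identify a c E) \<noteq> {}" if "walks5 E \<noteq> {}"
        using that identification.push_walk[OF I(1)] by blast
      ultimately show ?thesis using IH r by linarith
    qed
    show ?thesis
    proof (cases "\<exists>u a b c. facial u a b c")
      case True
      then show ?thesis using facial_some merge by blast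
    next
      case nf: False
      show ?thesis
      proof (cases "\<exists>u a b c. cycle4 E u a b c")
        case False
        show ?thesis
        proof (cases "E = {}")
          case True
          then show ?thesis using n4 by (simp add: walks5_def)
        next
          case ne: False
          then obtain a c where "{a, c} \<in> E" using simple_graph_edge_ex[OF sg] by blast
          then show ?thesis using contraction False by blast
        qed
      next
        case True
        then obtain u0 a0 b0 c0 where "cycle4 E u0 a0 b0 c0" by blast
        then obtain u a b c I where I: "cycle4 E u a b c" "I \<subseteq> V" "I \<noteq> {}" "\<And>x d e f. x \<in> I \<Longrightarrow> \<not> cycle4 E x d e f"
          using isolated_side[of u0 a0 b0 c0] nf by metis
        then obtain x where x: "x \<in> I" by blast
        show ?thesis
        proof (cases "card (nbrs E x) \<le> 1")
          case True
          have xV: "x \<in> V" using x I(2) by blast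
          note r = red[OF refl xV]
          have "card {e \<in> E. e \<subseteq> V - {x}} + 4 \<le> 2 * card (V - {x})"
            using less.hyps[OF _ tfp_induced[OF G Diff_subset]] r by blast
          then show ?thesis using card_delete_vertex(1)[OF sg True] r by linarith
        next
          case False
          then have "nbrs E x \<noteq> {}" by auto
          then obtain y where "{x, y} \<in> E" unfolding nbrs_def by blast
          then show ?thesis using contraction[of x y] I(4)[OF x] by blast
        qed
      qed
    qed
  qed
qed

section \<open>Path counts from spanned subgraphs\<close>

lemma card_oriented_edges:
  assumes "finite R" "\<And>x y. (x, y) \<in> R \<Longrightarrow> (y, x) \<notin> R"
  shows "card ((\<lambda>(x, y). {x, y}) ` R) = card R"
proof (rule card_image, rule inj_onI)
  fix r r' assume r: "r \<in> R" "r' \<in> R" "(\<lambda>(x, y). {x, y}) r = (\<lambda>(x, y). {x, y}) r'"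
  obtain x y where x: "r = (x, y)" by (cases r)
  obtain x' y' where x': "r' = (x', y')" by (cases r')
  have "(x = x' \<and> y = y') \<or> (x = y' \<and> y = x')" using r(3) unfolding x x' by (simp add: doubleton_eq_iff)
  then show "r = r'" using assms(2) r(1,2) unfolding x x' by auto
qed

text \<open>Oriented so that each edge of the subgraph spanned by the paths between \<open>u\<close> and \<open>v\<close> occurs once.\<close>

definition link :: "'a set set \<Rightarrow> 'a \<Rightarrow> 'a \<Rightarrow> ('a \<times> 'a) set" where
  "link E u v = {u} \<times> nbrs E u \<union> {v} \<times> nbrs E v \<union> walks3 E u v"

lemma link_facts:
  assumes G: "simple_graph (V, E)" "triangle_free E" and uv: "u \<noteq> v" "common E u v \<noteq> {}"
  shows "card ((\<lambda>(x, y). {x, y}) ` link E u v) = card (nbrs E u) + card (nbrs E v) + card (walks3 E u v)"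
    "(\<lambda>(x, y). {x, y}) ` link E u v \<subseteq> E"
    "card ({u, v} \<union> nbrs E u \<union> nbrs E v) + card (common E u v) = 2 + card (nbrs E u) + card (nbrs E v)"
proof -
  obtain c where c: "{u, c} \<in> E" "{c, v} \<in> E" using uv(2) unfolding common_def by blast
  have nuv: "{u, v} \<notin> E" "{v, u} \<notin> E" using triangle_freeD[OF G(2) c] edge_flip[of v u E] by blast+
  have nl: "{x} \<notin> E" for x using simple_graph_edge(3)[OF G(1), of x x] by auto
  have fin: "finite (nbrs E u)" "finite (nbrs E v)" "finite (walks3 E u v)" "finite (common E u v)"
    using finite_nbrs[OF G(1)] finite_walks3_simple[OF G(1)] finite_common_simple[OF G(1)] by blast+
  have d1: "({u} \<times> nbrs E u) \<inter> ({v} \<times> nbrs E v) = {}" using uv(1) by auto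
  have d2: "({u} \<times> nbrs E u \<union> {v} \<times> nbrs E v) \<inter> walks3 E u v = {}"
    using nuv nl unfolding walks3_def by auto
  have "card (link E u v) = card (nbrs E u) + card (nbrs E v) + card (walks3 E u v)"
    unfolding link_def using d1 d2 fin by (simp add: card_Un_disjoint card_cartesian_product)
  moreover have "(y, x) \<notin> link E u v" if h: "(x, y) \<in> link E u v" for x y
  proof
    assume h': "(y, x) \<in> link E u v"
    have w: "{u, x} \<in> E \<and> {x, y} \<in> E \<and> {y, v} \<in> E" if "(x, y) \<in> walks3 E u v" for x y using that unfolding walks3_def by simp
    have t: "False" if "{u, x} \<in> E" "{x, y} \<in> E" "{u, y} \<in> E" for x y using triangle_freeD[OF G(2) that] .
    consider "x = u" "{u, y} \<in> E" | "x = v" "{v, y} \<in> E" | "(x, y) \<in> walks3 E u v" using h unfolding link_def nbrs_def by auto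
    then show False
    proof cases
      case 1
      then have "(y, x) \<in> walks3 E u v" using h' nuv nl uv(1) unfolding link_def nbrs_def by auto
      then show False using w[of y x] 1 nuv by simp
    next
      case 2
      then have "(y, x) \<in> walks3 E u v" using h' nuv nl uv(1) unfolding link_def nbrs_def by auto
      then show False using w[of y x] 2 nl by simp
    next
      case 3
      then have "x \<noteq> u" "y \<noteq> v" "y \<noteq> u" using w[OF 3] nl nuv by auto
      then have "(y, x) \<in> walks3 E u v" using h' unfolding link_def by auto
      then show False using w[OF 3] w[of y x] t[of x y] by blast
    qed
  qed
  moreover have "finite (link E u v)" unfolding link_def using fin by simp
  ultimately show "card ((\<lambda>(x, y). {x, y}) ` link E u v) = card (nbrs E u) + card (nbrs E v) + card (walks3 E u v)"
    using card_oriented_edges[of "link E u v"] by simp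
  show "(\<lambda>(x, y). {x, y}) ` link E u v \<subseteq> E" unfolding link_def nbrs_def walks3_def by auto
  have "nbrs E u \<inter> nbrs E v = common E u v" unfolding nbrs_def common_def using edge_commute[of v _ E] by auto
  then have "card (nbrs E u \<union> nbrs E v) + card (common E u v) = card (nbrs E u) + card (nbrs E v)"
    using card_Un_Int[OF fin(1,2)] by simp
  moreover have "card ({u, v} \<union> (nbrs E u \<union> nbrs E v)) = card {u, v} + card (nbrs E u \<union> nbrs E v)"
    by (rule card_Un_disjoint) (use fin nuv nl in \<open>auto simp: nbrs_def\<close>)
  ultimately show "card ({u, v} \<union> nbrs E u \<union> nbrs E v) + card (common E u v) = 2 + card (nbrs E u) + card (nbrs E v)"
    using uv(1) by (simp add: Un_assoc)
qed

lemma walks5_from_pair: "c \<in> common E u v \<Longrightarrow> (x, y) \<in> walks3 E u v \<Longrightarrow> (u, c, v, y, x) \<in> walks5 E"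
  unfolding common_def walks3_def walks5_def using edge_commute[of v y E] edge_commute[of y x E] edge_commute[of x u E] by auto

text \<open>Let \<open>c\<close> and \<open>e\<close> be the two counts and \<open>d\<close> the sum
  of the degrees of \<open>u\<close> and \<open>v\<close>. The spanned subgraph contains a pentagon,
  has \<open>d + e\<close> edges and \<open>2 + d - c\<close> vertices, so the bound
  \<open>2 m - 5\<close> on its edges is exactly the claim. If \<open>c + e + 3 = card V\<close>, it
  uses all vertices, and the same edge bound for \<open>E\<close> leaves no room for another
  edge.\<close>

lemma pair_bound:
  assumes G: "tfp V E" and uv: "u \<noteq> v" "common E u v \<noteq> {}" "walks3 E u v \<noteq> {}"
  shows "card (walks3 E u v) + card (common E u v) + 3 \<le> card ({u, v} \<union> nbrs E u \<union> nbrs E v)"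
    and "card (walks3 E u v) + card (common E u v) + 3 \<le> card V"
    and "card (walks3 E u v) + card (common E u v) + 3 = card V \<Longrightarrow>
      V = {u, v} \<union> nbrs E u \<union> nbrs E v \<and> E = (\<lambda>(x, y). {x, y}) ` link E u v"
proof -
  note sg = tfpD(1)[OF G] and tf = tfpD(2)[OF G]
  note L = link_facts[OF sg tf uv(1,2)]
  let ?W = "{u, v} \<union> nbrs E u \<union> nbrs E v" and ?L = "(\<lambda>(x, y). {x, y}) ` link E u v"
  obtain c where c: "c \<in> common E u v" using uv(2) by blast
  obtain x y where xy: "(x, y) \<in> walks3 E u v" using uv(3) by auto
  have uvV: "u \<in> V" "v \<in> V" using c simple_graph_edge[OF sg] unfolding common_def by blast+
  have WV: "?W \<subseteq> V" using uvV simple_graph_edge[OF sg] unfolding nbrs_def by blast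
  have L2: "e \<subseteq> ?W" if "e \<in> ?L" for e
    using that edge_commute[of _ v E] unfolding link_def walks3_def nbrs_def by auto
  have H: "tfp ?W ?L" by (rule tfp_subgraph[OF G WV L(2) L2])
  have in_L: "{s, t} \<in> ?L" if "(s, t) \<in> link E u v" for s t using that by force
  have lk: "(u, c) \<in> link E u v" "(v, c) \<in> link E u v" "(u, x) \<in> link E u v" "(v, y) \<in> link E u v" "(x, y) \<in> link E u v"
    using c xy edge_commute[of v _ E] unfolding link_def nbrs_def common_def walks3_def by auto
  have "(u, c, v, y, x) \<in> walks5 ?L"
    using in_L[OF lk(1)] in_L[OF lk(2)] in_L[OF lk(3)] in_L[OF lk(4)] in_L[OF lk(5)]
      edge_commute[of c v ?L] edge_commute[of y x ?L] edge_commute[of x u ?L] unfolding walks5_def by simp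
  then have w5: "walks5 ?L \<noteq> {}" "walks5 E \<noteq> {}" using walks5_from_pair[OF c xy] by auto
  have W5: "card ?W \<ge> 5" by (rule walks5_five_vertices[OF tfpD(1,2)[OF H] w5(1)])
  have eb: "card ?L + 5 \<le> 2 * card ?W" using edge_bound[OF H] w5(1) W5 by linarith
  show 1: "card (walks3 E u v) + card (common E u v) + 3 \<le> card ?W" using eb L(1,3) by linarith
  have le: "card ?W \<le> card V" by (rule card_mono[OF tfpD(4)[OF G] WV])
  show "card (walks3 E u v) + card (common E u v) + 3 \<le> card V" using 1 le by linarith
  assume eq: "card (walks3 E u v) + card (common E u v) + 3 = card V"
  then have "card ?W = card V" using 1 le by linarith
  then have VW: "?W = V" by (rule card_subset_eq[OF tfpD(4)[OF G] WV])
  have "card E + 5 \<le> 2 * card V" using edge_bound[OF G] w5(2) W5 le by linarith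
  then have "card E \<le> card ?L" using eq L(1,3) VW by simp
  then have "?L = E" using card_seteq[OF tfpD(5)[OF G] L(2)] by simp
  then show "V = ?W \<and> E = ?L" using VW by simp
qed

text \<open>Counting edges in the subgraph spanned by both pairs leaves no room for two large pairs
  \<open>{u, v}\<close> and \<open>{u, w}\<close> with \<open>v\<close> and \<open>w\<close> adjacent.\<close>

lemma adjacent_pairs_bound:
  assumes G: "tfp V E" and uv: "u \<noteq> v" and c: "c \<in> common E u v" and vw: "{v, w} \<in> E" and a: "a \<in> common E u w"
  shows "card (walks3 E u v) + card (walks3 E u w) + 3 \<le> card V"
proof -
  note sg = tfpD(1)[OF G] and tf = tfpD(2)[OF G]
  have ce: "{u, c} \<in> E" "{c, v} \<in> E" and ae: "{u, a} \<in> E" "{a, w} \<in> E" using c a unfolding common_def by auto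
  have une: "common E u v \<noteq> {}" using c by blast
  note L = link_facts[OF sg tf uv une]
  have nl: "{x} \<notin> E" for x using simple_graph_edge(3)[OF sg, of x x] by auto
  have nuv: "{u, v} \<notin> E" "{v, u} \<notin> E" using triangle_freeD[OF tf ce] edge_flip[of v u E] by blast+
  have nuw: "{u, w} \<notin> E" "{w, u} \<notin> E" using triangle_freeD[OF tf ae] edge_flip[of w u E] by blast+
  have wv: "{w, v} \<in> E" by (rule edge_flip[OF vw])
  \<comment> \<open>\<open>?D\<close> holds the new last inner vertices of paths from
    \<open>u\<close> to \<open>w\<close>, and \<open>?T\<close> those paths themselves. Each element
    of \<open>?D\<close> adds one vertex and one edge, each element of \<open>?T\<close> one edge;
    the edge bound \<open>2 m - 5\<close> then gives the claim with
    \<open>card ?T + card (common E u v)\<close> in place of the second path count.\<close>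
  let ?D = "nbrs E w - nbrs E u - {v}"
  let ?T = "{(x, y). {u, x} \<in> E \<and> {x, y} \<in> E \<and> y \<in> ?D}"
  let ?R = "link E u v \<union> ({w} \<times> ?D \<union> ?T)"
  have D: "{w, d} \<in> E" "{u, d} \<notin> E" "d \<noteq> v" "{v, d} \<notin> E" "{d, v} \<notin> E" "d \<noteq> u" "d \<noteq> w" if "d \<in> ?D" for d
  proof -
    show e: "{w, d} \<in> E" "{u, d} \<notin> E" "d \<noteq> v" using that unfolding nbrs_def by auto
    show "{v, d} \<notin> E" using triangle_freeD[OF tf vw e(1)] by blast
    then show "{d, v} \<notin> E" using edge_flip[of d v E] by blast
    show "d \<noteq> u" "d \<noteq> w" using e(1) nuw nl by auto
  qed
  \<comment> \<open>The last inner vertex is adjacent to \<open>w\<close> but not to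
    \<open>u\<close>; if it is \<open>v\<close>, the first one is a common neighbour of
    \<open>u\<close> and \<open>v\<close>.\<close>
  have w3: "walks3 E u w = ?T \<union> (\<lambda>x. (x, v)) ` common E u v"
  proof (intro equalityI subsetI)
    fix q assume "q \<in> walks3 E u w"
    then obtain x y where q: "q = (x, y)" "{u, x} \<in> E" "{x, y} \<in> E" "{y, w} \<in> E" unfolding walks3_def by auto
    have "{u, y} \<notin> E" using triangle_freeD[OF tf q(2,3)] by blast
    then show "q \<in> ?T \<union> (\<lambda>x. (x, v)) ` common E u v"
      using q edge_flip[OF q(4)] unfolding nbrs_def common_def by (cases "y = v") auto
  next
    fix q assume "q \<in> ?T \<union> (\<lambda>x. (x, v)) ` common E u v"
    then show "q \<in> walks3 E u w"
      using vw edge_flip[of w _ E] unfolding walks3_def nbrs_def common_def by auto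
  qed
  have fin: "finite (nbrs E w)" "finite (common E u v)" "finite (walks3 E u w)" "finite (link E u v)"
    using finite_nbrs[OF sg] finite_walks3_simple[OF sg] finite_common_simple[OF sg] unfolding link_def by blast+
  have fT: "finite ?T" by (rule finite_subset[OF _ fin(3)]) (unfold w3, blast)
  have c3: "card (walks3 E u w) \<le> card ?T + card (common E u v)"
    unfolding w3 using card_Un_le card_image_le[OF fin(2), of "\<lambda>x. (x, v)"] by (meson add_left_mono order_trans)
  have lk: "fst q = u \<or> fst q = v \<or> ({u, fst q} \<in> E \<and> {snd q, v} \<in> E)" if "q \<in> link E u v" for q
    using that unfolding link_def walks3_def by auto
  have lkD: "snd q \<in> ?D \<Longrightarrow> False" if "q \<in> link E u v" for q
    using that D(2)[of "snd q"] D(4)[of "snd q"] D(5)[of "snd q"] unfolding link_def walks3_def nbrs_def by auto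
  have d1: "link E u v \<inter> ({w} \<times> ?D \<union> ?T) = {}"
  proof (rule equals0I)
    fix q assume q: "q \<in> link E u v \<inter> ({w} \<times> ?D \<union> ?T)"
    then have "snd q \<in> ?D" by auto
    then show False using lkD q by blast
  qed
  have d2: "({w} \<times> ?D) \<inter> ?T = {}" using nuw by auto
  have cR: "card ?R = card (link E u v) + card ?D + card ?T"
    using d1 d2 fin fT by (simp add: card_Un_disjoint card_cartesian_product)
  have anti: "(y, x) \<notin> ?R" if h: "(x, y) \<in> ?R" for x y
  proof
    assume h': "(y, x) \<in> ?R"
    have T: False if "(s, t) \<in> {w} \<times> ?D \<union> ?T" "(t, s) \<in> ?R" for s t
    proof -
      have t: "t \<in> ?D" "s = w \<or> {u, s} \<in> E" using that(1) by auto
      have "(t, s) \<notin> link E u v"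
      proof
        assume l: "(t, s) \<in> link E u v"
        then show False using lk[OF l] D[OF t(1)] by auto
      qed
      then have s: "s \<in> ?D" using that(2) by auto
      then have "s \<noteq> w" "{u, s} \<notin> E" using D by blast+
      then show False using t(2) by blast
    qed
    show False
    proof (cases "(x, y) \<in> link E u v \<and> (y, x) \<in> link E u v")
      case True
      have "(y, x) \<notin> link E u v" if "(x, y) \<in> link E u v"
      proof
        assume "(y, x) \<in> link E u v"
        have inj: "inj_on (\<lambda>(x, y). {x, y}) (link E u v)"
        proof (rule eq_card_imp_inj_on[OF fin(4)])
          have "card ({u} \<times> nbrs E u \<union> {v} \<times> nbrs E v) \<le> card (nbrs E u) + card (nbrs E v)"
            using card_Un_le[of "{u} \<times> nbrs E u" "{v} \<times> nbrs E v"] by (simp add: card_cartesian_product)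
          then have "card (link E u v) \<le> card (nbrs E u) + card (nbrs E v) + card (walks3 E u v)"
            unfolding link_def using card_Un_le[of "{u} \<times> nbrs E u \<union> {v} \<times> nbrs E v" "walks3 E u v"] by linarith
          then show "card ((\<lambda>(x, y). {x, y}) ` link E u v) = card (link E u v)"
            using L(1) card_image_le[OF fin(4), of "\<lambda>(x, y). {x, y}"] by linarith
        qed
        have "(x, y) = (y, x)" by (rule inj_onD[OF inj]) (use that \<open>(y, x) \<in> link E u v\<close> in auto)
        moreover have "x \<noteq> y" using that nl unfolding link_def nbrs_def walks3_def by auto
        ultimately show False by simp
      qed
      then show False using True by blast
    next
      case False
      then show False using T[of x y] T[of y x] h h' by blast
    qed
  qed
  let ?L = "(\<lambda>(x, y). {x, y}) ` ?R"
  have cL: "card ?L = card ?R" by (rule card_oriented_edges) (use fin fT anti in auto)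
  have LE: "?L \<subseteq> E" using L(2) D(1) by auto
  let ?W = "({u, v} \<union> nbrs E u \<union> nbrs E v) \<union> ?D"
  have uvV: "u \<in> V" "v \<in> V" using simple_graph_edge[OF sg ce(1)] simple_graph_edge[OF sg ce(2)] by simp_all
  have WV: "?W \<subseteq> V" using uvV simple_graph_edge[OF sg] unfolding nbrs_def by blast
  have wW: "w \<in> nbrs E v" using vw unfolding nbrs_def by simp
  have L2: "e \<subseteq> ?W" if eL: "e \<in> ?L" for e
  proof -
    obtain q where q: "e = (\<lambda>(x, y). {x, y}) q" "q \<in> ?R" using eL by (rule imageE)
    obtain x y where "q = (x, y)" by (cases q)
    then have e: "e = {x, y}" "(x, y) \<in> ?R" using q by simp_all
    have "x \<in> ?W \<and> y \<in> ?W"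
    proof (cases "(x, y) \<in> link E u v")
      case True
      then show ?thesis using edge_commute[of y v E] unfolding link_def walks3_def nbrs_def by auto
    next
      case False
      then have "y \<in> ?D" "x = w \<or> {u, x} \<in> E" using e(2) by auto
      then show ?thesis using wW unfolding nbrs_def by auto
    qed
    then show ?thesis using e(1) by simp
  qed
  have H: "tfp ?W ?L" by (rule tfp_subgraph[OF G WV LE L2])
  have in_L: "{s, t} \<in> ?L" if "(s, t) \<in> link E u v" for s t using that by force
  have lks: "(u, c) \<in> link E u v" "(v, c) \<in> link E u v" "(u, a) \<in> link E u v" "(v, w) \<in> link E u v" "(a, w) \<in> link E u v"
    using ce ae vw wv edge_flip[OF ce(2)] unfolding link_def nbrs_def walks3_def by auto
  have "(u, c, v, w, a) \<in> walks5 ?L"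
    using in_L[OF lks(1)] in_L[OF lks(2)] in_L[OF lks(3)] in_L[OF lks(4)] in_L[OF lks(5)]
      edge_commute[of c v ?L] edge_commute[of w a ?L] edge_commute[of a u ?L] unfolding walks5_def by simp
  then have w5: "walks5 ?L \<noteq> {}" by auto
  have W5: "card ?W \<ge> 5" by (rule walks5_five_vertices[OF tfpD(1,2)[OF H] w5])
  have eb: "card ?L + 5 \<le> 2 * card ?W" using edge_bound[OF H] w5 W5 by linarith
  have cW: "card ?W = card ({u, v} \<union> nbrs E u \<union> nbrs E v) + card ?D"
  proof (rule card_Un_disjoint)
    show "finite ({u, v} \<union> nbrs E u \<union> nbrs E v)" "finite ?D" using finite_nbrs[OF sg] by simp_all
    show "({u, v} \<union> nbrs E u \<union> nbrs E v) \<inter> ?D = {}"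
    proof (rule equals0I)
      fix d assume d: "d \<in> ({u, v} \<union> nbrs E u \<union> nbrs E v) \<inter> ?D"
      then have "d \<in> ?D" by blast
      from D(2,3,4,6)[OF this] show False using d unfolding nbrs_def by blast
    qed
  qed
  have "card (link E u v) \<ge> card (nbrs E u) + card (nbrs E v) + card (walks3 E u v)"
    using L(1) card_image_le[OF fin(4), of "\<lambda>(x, y). {x, y}"] by simp
  then have "card (walks3 E u v) + card (walks3 E u w) + 3 \<le> card ?W"
    using eb cL cR cW c3 L(3) by linarith
  also have "\<dots> \<le> card V" by (rule card_mono[OF tfpD(4)[OF G] WV])
  finally show ?thesis .
qed

section \<open>Reductions with small loss\<close>

text \<open>Makes the middle vertices of paths disappear, so that the edge bound limits the number of paths.\<close>

lemma contract_middles: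
  assumes "finite T" "simple_graph (W, B)" "T \<inter> W = {}"
    and "\<And>t. t \<in> T \<Longrightarrow> \<sigma> t \<in> W \<and> \<rho> t \<in> W \<and> \<sigma> t \<noteq> \<rho> t \<and> {\<sigma> t, \<rho> t} \<notin> B"
    and "inj_on (\<lambda>t. {\<sigma> t, \<rho> t}) T"
    and "drawable (W \<union> T) (B \<union> (\<Union>t\<in>T. {{\<sigma> t, t}, {t, \<rho> t}}))"
  shows "drawable W (B \<union> (\<lambda>t. {\<sigma> t, \<rho> t}) ` T)"
  using assms
proof (induction T arbitrary: B rule: finite_induct)
  case empty
  then show ?case by simp
next
  case (insert t T)
  let ?s = "\<sigma> t" and ?r = "\<rho> t"
  let ?U = "\<Union>t\<in>T. {{\<sigma> t, t}, {t, \<rho> t}}"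
  let ?E = "B \<union> (\<Union>t\<in>insert t T. {{\<sigma> t, t}, {t, \<rho> t}})"
  have tW: "t \<notin> W" "t \<notin> T" and TW: "T \<inter> W = {}" using insert.prems(2) insert.hyps by auto
  have sr: "?s \<in> W" "?r \<in> W" "?s \<noteq> ?r" "{?s, ?r} \<notin> B" using insert.prems(3)[of t] by auto
  have sr': "?s \<noteq> t" "?r \<noteq> t" using sr tW by auto
  have prT: "\<sigma> x \<in> W \<and> \<rho> x \<in> W \<and> \<sigma> x \<noteq> \<rho> x \<and> {\<sigma> x, \<rho> x} \<notin> B" if "x \<in> T" for x
    using insert.prems(3)[of x] that by simp
  have BW: "e \<subseteq> W" if "e \<in> B" for e by (rule simple_graph_edge_subset[OF insert.prems(1) that])
  have nt: "t \<notin> e" if "e \<in> B \<union> ?U" for e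
  proof -
    from that consider "e \<in> B" | x where "x \<in> T" "e = {\<sigma> x, x} \<or> e = {x, \<rho> x}" by blast
    then show ?thesis
    proof cases
      case 1 then show ?thesis using BW tW by blast
    next
      case 2
      then show ?thesis using prT[of x] tW by auto
    qed
  qed
  have Eeq: "?E = insert {?s, t} (insert {t, ?r} (B \<union> ?U))" by blast
  have finW: "finite W" using simple_graph_finite[OF insert.prems(1)] by simp
  have sgE: "simple_graph (W \<union> insert t T, ?E)"
    unfolding simple_graph_def fst_conv snd_conv
  proof (intro conjI ballI)
    show "finite (W \<union> insert t T)" using finW insert.hyps by simp
    fix e assume "e \<in> ?E"
    then consider "e \<in> B" | x where "x \<in> insert t T" "e = {\<sigma> x, x} \<or> e = {x, \<rho> x}" by blast
    then show "\<exists>x\<in>W \<union> insert t T. \<exists>y\<in>W \<union> insert t T. x \<noteq> y \<and> e = {x, y}"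
    proof cases
      case 1
      then show ?thesis using simple_graph_edge_ex[OF insert.prems(1)] by blast
    next
      case 2
      have "\<sigma> x \<in> W" "\<rho> x \<in> W" using insert.prems(3)[OF 2(1)] by auto
      moreover have "x \<notin> W" using insert.prems(2) 2(1) by blast
      ultimately have "\<sigma> x \<in> W \<union> insert t T" "\<rho> x \<in> W \<union> insert t T" "x \<in> W \<union> insert t T" "\<sigma> x \<noteq> x" "x \<noteq> \<rho> x"
        using 2(1) by auto
      then show ?thesis using 2(2) by blast
    qed
  qed
  have ed: "{?s, t} \<in> ?E" unfolding Eeq by simp
  have nsr: "{?s, ?r} \<notin> ?E"
  proof
    assume "{?s, ?r} \<in> ?E"
    then have "{?s, ?r} \<in> ?U" unfolding Eeq using sr(4) sr' by (auto simp: doubleton_eq_iff)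
    then obtain x where "x \<in> T" "x \<in> {?s, ?r}" by blast
    then show False using sr TW by auto
  qed
  have "drawable (W \<union> insert t T - {t}) (identify ?s t (?E - {{?s, t}}))"
  proof (rule drawable_contract[OF sgE insert.prems(5) ed])
    fix y show "\<not> ({?s, y} \<in> ?E \<and> {t, y} \<in> ?E)"
    proof
      assume y: "{?s, y} \<in> ?E \<and> {t, y} \<in> ?E"
      then have "{t, y} \<in> {{?s, t}, {t, ?r}}" unfolding Eeq using nt by blast
      then have "y = ?s \<or> y = ?r" using sr' by (auto simp: doubleton_eq_iff)
      then show False
      proof
        assume ys: "y = ?s"
        from y have "{?s, y} \<in> ?E" ..
        then show False using simple_graph_edge(3)[OF sgE] ys by blast
      next
        assume yr: "y = ?r"
        from y have "{?s, y} \<in> ?E" ..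
        then show False using nsr unfolding yr by contradiction
      qed
    qed
  qed
  moreover have "W \<union> insert t T - {t} = W \<union> T" using tW by auto
  moreover have "identify ?s t (?E - {{?s, t}}) = insert {?s, ?r} B \<union> ?U"
  proof -
    have "{?s, t} \<noteq> {t, ?r}" using sr by (auto simp: doubleton_eq_iff)
    then have "?E - {{?s, t}} = insert {t, ?r} (B \<union> ?U)" unfolding Eeq using nt[of "{?s, t}"] by blast
    moreover have "redirect ?s t ` {t, ?r} = {?s, ?r}" using sr' by (simp add: redirect_def insert_commute)
    moreover have "redirect ?s t ` e = e" if "e \<in> B \<union> ?U" for e
      using nt[OF that] by (force simp: redirect_def)
    then have "(\<lambda>e. redirect ?s t ` e) ` (B \<union> ?U) = B \<union> ?U" by simp
    ultimately show ?thesis unfolding identify_def by simp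
  qed
  ultimately have dr: "drawable (W \<union> T) (insert {?s, ?r} B \<union> ?U)" by simp
  have inj: "inj_on (\<lambda>t. {\<sigma> t, \<rho> t}) T" and injt: "{\<sigma> x, \<rho> x} \<noteq> {?s, ?r}" if "x \<in> T" for x
    using insert.prems(4) tW(2) that unfolding inj_on_def by (metis insertCI)+
  have inj: "inj_on (\<lambda>t. {\<sigma> t, \<rho> t}) T" using insert.prems(4) by (rule inj_on_subset) blast
  have "simple_graph (W, insert {?s, ?r} B)"
    using insert.prems(1) sr unfolding simple_graph_def by auto
  then have "drawable W (insert {?s, ?r} B \<union> (\<lambda>t. {\<sigma> t, \<rho> t}) ` T)"
    using insert.IH[of "insert {?s, ?r} B"] TW prT injt inj dr by simp
  then show ?case by simp
qed

text \<open>As \<open>p\<close> and \<open>q\<close> lie on no 4-cycle, the middle \<open>t\<close>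
  determines \<open>s\<close> and \<open>r\<close>; conversely \<open>s\<close> and \<open>r\<close>
  determine \<open>t\<close> by \<open>uniq\<close>. Replacing each path \<open>s t r\<close> by an
  edge gives a bipartite planar graph on \<open>p\<close>, \<open>q\<close> and their neighbours,
  whose edge bound leaves at most \<open>card X + card Y - 1\<close> such paths. Since the middles
  are further vertices of \<open>V\<close>, they count twice.\<close>

lemma contraction_loss_bound:
  assumes G: "tfp V E" and pq: "{p, q} \<in> E" and n3: "card V \<ge> 3"
    and ncp: "\<And>x y z. \<not> cycle4 E p x y z" and ncq: "\<And>x y z. \<not> cycle4 E q x y z"
    and uniq: "\<And>s r t t'. {p, s} \<in> E \<Longrightarrow> {r, q} \<in> E \<Longrightarrow> t \<in> common E s r \<Longrightarrow> t' \<in> common E s r \<Longrightarrow> t = t'"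
  shows "2 * card {(s, t, r). {p, s} \<in> E \<and> {s, t} \<in> E \<and> {t, r} \<in> E \<and> {r, q} \<in> E} + 3 \<le> card V"
proof -
  let ?M = "{(s, t, r). {p, s} \<in> E \<and> {s, t} \<in> E \<and> {t, r} \<in> E \<and> {r, q} \<in> E}"
  note sg = tfpD(1)[OF G] and tf = tfpD(2)[OF G]
  have tri: False if "{x, y} \<in> E" "{y, z} \<in> E" "{x, z} \<in> E" for x y z using triangle_freeD[OF tf that] .
  have qp: "{q, p} \<in> E" by (rule edge_flip[OF pq])
  have nl: "{x} \<notin> E" for x using simple_graph_edge(3)[OF sg, of x x] by auto
  have fM: "finite ?M"
    by (rule finite_subset[of _ "V \<times> V \<times> V"]) (auto simp: tfpD(4)[OF G] dest: simple_graph_edge[OF sg])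
  define T where "T = (\<lambda>(s, t, r). t) ` ?M"
  have fT: "finite T" unfolding T_def using fM by (rule finite_imageI)
  have us: "s = s'" if "{p, s} \<in> E" "{s, t} \<in> E" "{p, s'} \<in> E" "{s', t} \<in> E" "t \<noteq> p" for s s' t
  proof (rule ccontr)
    assume "s \<noteq> s'"
    then have "cycle4 E p s t s'" unfolding cycle4_def using that edge_flip by auto
    then show False using ncp by blast
  qed
  have ur: "r = r'" if "{t, r} \<in> E" "{r, q} \<in> E" "{t, r'} \<in> E" "{r', q} \<in> E" "t \<noteq> q" for r r' t
  proof (rule ccontr)
    assume "r \<noteq> r'"
    then have "cycle4 E q r t r'" unfolding cycle4_def using that edge_flip[OF that(1)] edge_flip[OF that(2)] by auto
    then show False using ncq by blast
  qed
  define X where "X = nbrs E p - {q}"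
  define Y where "Y = nbrs E q - {p}"
  have X: "x \<in> X \<longleftrightarrow> {p, x} \<in> E \<and> x \<noteq> q" for x unfolding X_def nbrs_def by auto
  have Y: "y \<in> Y \<longleftrightarrow> {y, q} \<in> E \<and> y \<noteq> p" for y unfolding Y_def nbrs_def using edge_commute[of q y E] by auto
  have finXY: "finite X" "finite Y" unfolding X_def Y_def using finite_nbrs[OF sg] by auto
  have XY: "X \<inter> Y = {}" using X Y tri[of p _ q] pq by blast
  have pqX: "p \<notin> X" "q \<notin> X" "p \<notin> Y" "q \<notin> Y" "p \<noteq> q" using X[of p] X[of q] Y[of p] Y[of q] nl pq by auto
  have M: "s \<in> X" "r \<in> Y" "t \<notin> X" "t \<notin> Y" "t \<noteq> p" "t \<noteq> q" "s \<noteq> r" if m: "(s, t, r) \<in> ?M" for s t r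
  proof -
    have e: "{p, s} \<in> E" "{s, t} \<in> E" "{t, r} \<in> E" "{r, q} \<in> E" using m by auto
    have "s \<noteq> q" using tri[of q t r] e edge_flip[OF e(4)] by auto
    then show "s \<in> X" using X e by blast
    have "r \<noteq> p" using tri[of s t p] e edge_flip[OF e(1)] by auto
    then show "r \<in> Y" using Y e by blast
    show "t \<notin> X" using X tri[OF e(1,2)] by blast
    show "t \<notin> Y" using Y tri[OF e(3,4)] by blast
    show "t \<noteq> p" using \<open>r \<noteq> p\<close> e tri[of p r q] pq by auto
    show "t \<noteq> q" using \<open>s \<noteq> q\<close> e tri[of p s q] pq by auto
    show "s \<noteq> r" using \<open>s \<in> X\<close> \<open>r \<in> Y\<close> XY by blast
  qed
  define \<sigma> where "\<sigma> = (\<lambda>t. SOME s. \<exists>r. (s, t, r) \<in> ?M)"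
  define \<rho> where "\<rho> = (\<lambda>t. SOME r. \<exists>s. (s, t, r) \<in> ?M)"
  have sr: "\<sigma> t = s" "\<rho> t = r" if m: "(s, t, r) \<in> ?M" for s t r
  proof -
    have "\<exists>r. (\<sigma> t, t, r) \<in> ?M" unfolding \<sigma>_def by (rule someI_ex) (use m in blast)
    then have "{p, \<sigma> t} \<in> E" "{\<sigma> t, t} \<in> E" by auto
    moreover have "{p, s} \<in> E" "{s, t} \<in> E" using m by auto
    ultimately show "\<sigma> t = s" using us M(5)[OF m] by blast
    have "\<exists>s. (s, t, \<rho> t) \<in> ?M" unfolding \<rho>_def by (rule someI_ex) (use m in blast)
    then have "{t, \<rho> t} \<in> E" "{\<rho> t, q} \<in> E" by auto
    moreover have "{t, r} \<in> E" "{r, q} \<in> E" using m by auto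
    ultimately show "\<rho> t = r" using ur M(6)[OF m] by blast
  qed
  have TM: "(\<sigma> t, t, \<rho> t) \<in> ?M" if tT: "t \<in> T" for t
  proof -
    obtain m where m: "t = (\<lambda>(s, t, r). t) m" "m \<in> ?M" using tT unfolding T_def by (rule imageE)
    obtain s t' r where "m = (s, t', r)" by (cases m)
    then have "(s, t, r) \<in> ?M" using m by auto
    then show ?thesis using sr[of s t r] by auto
  qed
  have "inj_on (\<lambda>(s, t, r). t) ?M"
  proof (rule inj_onI)
    fix m m' assume mm: "m \<in> ?M" "m' \<in> ?M" "(\<lambda>(s, t, r). t) m = (\<lambda>(s, t, r). t) m'"
    obtain s t r where m: "m = (s, t, r)" by (cases m)
    obtain s' t' r' where m': "m' = (s', t', r')" by (cases m')
    have "(s, t, r) \<in> ?M" "(s', t, r') \<in> ?M" using mm unfolding m m' by simp_all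
    from sr[OF this(1)] sr[OF this(2)] show "m = m'" using mm(3) unfolding m m' by auto
  qed
  then have cMT: "card ?M = card T" unfolding T_def by (simp add: card_image)
  show ?thesis
  proof (cases "T = {}")
    case True
    then show ?thesis using cMT n3 by simp
  next
    case False
    let ?W = "{p, q} \<union> X \<union> Y"
    let ?base = "{(p, q)} \<union> {p} \<times> X \<union> {q} \<times> Y"
    let ?B = "(\<lambda>(x, y). {x, y}) ` ?base"
    let ?R = "?base \<union> (\<lambda>t. (\<sigma> t, \<rho> t)) ` T"
    have st: "\<sigma> t \<in> X" "\<rho> t \<in> Y" "t \<notin> ?W" "{\<sigma> t, t} \<in> E" "{t, \<rho> t} \<in> E" if "t \<in> T" for t
      using M[OF TM[OF that]] TM[OF that] by auto
    have injp: "t = t'" if "t \<in> T" "t' \<in> T" "\<sigma> t = \<sigma> t'" "\<rho> t = \<rho> t'" for t t'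
    proof (rule uniq)
      show "{p, \<sigma> t} \<in> E" "{\<rho> t, q} \<in> E" using TM[OF that(1)] by auto
      show "t \<in> common E (\<sigma> t) (\<rho> t)" "t' \<in> common E (\<sigma> t) (\<rho> t)"
        using TM[OF that(1)] TM[OF that(2)] that(3,4) unfolding common_def by auto
    qed
    have BE: "?B \<subseteq> E" using pq X Y edge_commute[of q _ E] by auto
    have BW: "e \<subseteq> ?W" if "e \<in> ?B" for e using that by auto
    have pqV: "p \<in> V" "q \<in> V" using simple_graph_edge[OF sg pq] by auto
    have WV: "?W \<subseteq> V" using pqV X Y simple_graph_edge[OF sg] by blast
    have TV: "T \<subseteq> V" using st(4) simple_graph_edge(2)[OF sg] by blast
    have sgB: "simple_graph (?W, ?B)" by (rule tfpD(1)[OF tfp_subgraph[OF G WV BE BW]])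
    have H: "tfp (?W \<union> T) (?B \<union> (\<Union>t\<in>T. {{\<sigma> t, t}, {t, \<rho> t}}))"
    proof (rule tfp_subgraph[OF G])
      show "?W \<union> T \<subseteq> V" using WV TV by blast
      show "?B \<union> (\<Union>t\<in>T. {{\<sigma> t, t}, {t, \<rho> t}}) \<subseteq> E" using BE st by blast
      fix e assume "e \<in> ?B \<union> (\<Union>t\<in>T. {{\<sigma> t, t}, {t, \<rho> t}})"
      then consider "e \<in> ?B" | t where "t \<in> T" "e = {\<sigma> t, t} \<or> e = {t, \<rho> t}" by blast
      then show "e \<subseteq> ?W \<union> T"
      proof cases
        case 1 then show ?thesis using BW by blast
      next
        case 2
        then show ?thesis using st(1,2)[OF 2(1)] by auto
      qed
    qed
    have B2: "{x, y} \<notin> ?B" if "x \<in> X" "y \<in> Y" for x y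
    proof
      assume "{x, y} \<in> ?B"
      then have "p \<in> {x, y} \<or> q \<in> {x, y}" by auto
      then show False using that pqX by auto
    qed
    have dW: "drawable ?W (?B \<union> (\<lambda>t. {\<sigma> t, \<rho> t}) ` T)"
    proof (rule contract_middles[OF fT sgB])
      show "T \<inter> ?W = {}" using st(3) by blast
      show "\<sigma> t \<in> ?W \<and> \<rho> t \<in> ?W \<and> \<sigma> t \<noteq> \<rho> t \<and> {\<sigma> t, \<rho> t} \<notin> ?B" if "t \<in> T" for t
      proof -
        note t = st(1,2)[OF that]
        have ne: "\<sigma> t \<noteq> \<rho> t"
        proof
          assume "\<sigma> t = \<rho> t"
          then have "\<sigma> t \<in> X \<inter> Y" using t by simp
          then show False unfolding XY by simp
        qed
        show ?thesis by (intro conjI ne B2 t UnI2[OF t(2)] UnI1 UnI2[OF t(1)])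
      qed
      show "inj_on (\<lambda>t. {\<sigma> t, \<rho> t}) T"
      proof (rule inj_onI)
        fix t t' assume t: "t \<in> T" "t' \<in> T" "{\<sigma> t, \<rho> t} = {\<sigma> t', \<rho> t'}"
        then have "\<sigma> t = \<sigma> t' \<and> \<rho> t = \<rho> t'"
          using st(1,2)[OF t(1)] st(1,2)[OF t(2)] XY by (auto simp: doubleton_eq_iff)
        then show "t = t'" using injp t by blast
      qed
      show "drawable (?W \<union> T) (?B \<union> (\<Union>t\<in>T. {{\<sigma> t, t}, {t, \<rho> t}}))" by (rule tfpD(3)[OF H])
    qed
    have im: "?B \<union> (\<lambda>t. {\<sigma> t, \<rho> t}) ` T = (\<lambda>(x, y). {x, y}) ` ?R" by (simp add: image_Un image_image)
    \<comment> \<open>A proper 2-colouring with classes \<open>p\<close>, \<open>Y\<close> and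
      \<open>q\<close>, \<open>X\<close>; it excludes triangles after the middles have been
      contracted.\<close>
    let ?c = "\<lambda>x. x = p \<or> x \<in> Y"
    have R: "(?c x \<and> \<not> ?c y \<and> y \<in> ?W \<and> x \<in> ?W) \<or> (\<not> ?c x \<and> ?c y \<and> y \<in> ?W \<and> x \<in> ?W)" if "(x, y) \<in> ?R" for x y
    proof -
      from that consider "x = p" "y = q" | "x = p" "y \<in> X" | "x = q" "y \<in> Y" | t where "t \<in> T" "x = \<sigma> t" "y = \<rho> t" by auto
      then show ?thesis
      proof cases
        case 1 then show ?thesis using pqX by simp
      next
        case 2 then show ?thesis using pqX XY by auto
      next
        case 3 then show ?thesis using pqX by auto
      next
        case 4 then show ?thesis using st(1,2)[OF 4(1)] pqX XY by auto
      qed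
    qed
    let ?EE = "(\<lambda>(x, y). {x, y}) ` ?R"
    have col: "?c x \<noteq> ?c y" "x \<in> ?W" "y \<in> ?W" if h: "{x, y} \<in> ?EE" for x y
    proof -
      obtain q' where q': "{x, y} = (\<lambda>(x, y). {x, y}) q'" "q' \<in> ?R" using h by (rule imageE)
      obtain x' y' where "q' = (x', y')" by (cases q')
      then have "{x, y} = {x', y'}" "(x', y') \<in> ?R" using q' by auto
      then have "(x, y) \<in> ?R \<or> (y, x) \<in> ?R" by (auto simp only: doubleton_eq_iff)
      then show "?c x \<noteq> ?c y" "x \<in> ?W" "y \<in> ?W" using R[of x y] R[of y x] by blast+
    qed
    have finR: "finite ?R" using finXY fT by simp
    have "tfp ?W ?EE" unfolding tfp_def
    proof (intro conjI)
      show "drawable ?W ?EE" using dW unfolding im .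
      show "triangle_free ?EE" unfolding triangle_free_def
      proof (intro allI impI notI)
        fix x y z assume xyz: "{x, y} \<in> ?EE" "{y, z} \<in> ?EE" "{x, z} \<in> ?EE"
        show False using col(1)[OF xyz(1)] col(1)[OF xyz(2)] col(1)[OF xyz(3)] by argo
      qed
      show "simple_graph (?W, ?EE)" unfolding simple_graph_def fst_conv snd_conv
      proof (intro conjI ballI)
        show "finite ?W" using finXY by simp
        fix e assume e: "e \<in> ?EE"
        obtain q' where q': "e = (\<lambda>(x, y). {x, y}) q'" using e by (rule imageE)
        obtain x y where "q' = (x, y)" by (cases q')
        then have xy: "e = {x, y}" using q' by simp
        have h: "{x, y} \<in> ?EE" using e unfolding xy .
        have "x \<noteq> y" by (rule notI, rule notE[OF col(1)[OF h]]) simp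
        then show "\<exists>x\<in>?W. \<exists>y\<in>?W. x \<noteq> y \<and> e = {x, y}" using col(2,3)[OF h] xy by blast
      qed
    qed
    moreover have cW: "card ?W = 2 + card X + card Y"
    proof -
      have "card ({p, q} \<union> (X \<union> Y)) = card {p, q} + card (X \<union> Y)"
        by (rule card_Un_disjoint) (use finXY pqX in auto)
      moreover have "card (X \<union> Y) = card X + card Y" by (rule card_Un_disjoint[OF finXY XY])
      ultimately show ?thesis using pqX by (simp add: Un_assoc)
    qed
    moreover obtain t where "t \<in> T" using False by blast
    then have "card X > 0" using st(1) finXY card_gt_0_iff by blast
    ultimately have eb: "card ?EE + 4 \<le> 2 * card ?W" using edge_bound[of ?W ?EE] by linarith
    have R2: "(x = p \<and> y \<in> insert q X) \<or> (x \<in> insert q X \<and> y \<in> Y)" if "(x, y) \<in> ?R" for x y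
    proof -
      from that consider "x = p" "y = q" | "x = p" "y \<in> X" | "x = q" "y \<in> Y" | t where "t \<in> T" "x = \<sigma> t" "y = \<rho> t" by auto
      then show ?thesis by cases (use st(1,2) in simp_all)
    qed
    have qX: "p \<notin> insert q X" "insert q X \<inter> Y = {}" using pqX XY by simp_all
    have "card ?EE = card ?R"
    proof (rule card_oriented_edges[OF finR], rule notI)
      fix x y assume "(x, y) \<in> ?R" "(y, x) \<in> ?R"
      from R2[OF this(1)] R2[OF this(2)] show False using qX pqX(3) by blast
    qed
    moreover have "card ?R = 1 + card X + card Y + card T"
    proof -
      have "card ((\<lambda>t. (\<sigma> t, \<rho> t)) ` T) = card T" by (rule card_image) (use injp in \<open>auto simp: inj_on_def\<close>)
      moreover have "card ?R = card ?base + card ((\<lambda>t. (\<sigma> t, \<rho> t)) ` T)"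
      proof (rule card_Un_disjoint)
        show "finite ?base" "finite ((\<lambda>t. (\<sigma> t, \<rho> t)) ` T)" using finXY fT by simp_all
        show "?base \<inter> (\<lambda>t. (\<sigma> t, \<rho> t)) ` T = {}"
        proof (rule equals0I)
          fix m assume m: "m \<in> ?base \<inter> (\<lambda>t. (\<sigma> t, \<rho> t)) ` T"
          then have "fst m = p \<or> fst m = q" "fst m \<in> X" using st(1) by auto
          then show False using pqX by auto
        qed
      qed
      moreover have "card ?base = card ({(p, q)} \<union> {p} \<times> X) + card ({q} \<times> Y)"
        by (rule card_Un_disjoint) (use finXY pqX in auto)
      moreover have "card ({(p, q)} \<union> {p} \<times> X) = 1 + card X"
        using pqX finXY by (simp add: card_cartesian_product)
      ultimately show ?thesis by (simp add: card_cartesian_product)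
    qed
    ultimately have TX: "card T + 1 \<le> card X + card Y" using eb cW by linarith
    have "card (?W \<union> T) = card ?W + card T"
      by (rule card_Un_disjoint) (use finXY fT st(3) in auto)
    moreover have "card (?W \<union> T) \<le> card V" by (rule card_mono[OF tfpD(4)[OF G]]) (use WV TV in auto)
    ultimately show ?thesis using TX cW cMT by linarith
  qed
qed

context plane_graph begin

lemma plane_tfp: "tfp V E"
  unfolding tfp_def triangle_free_def drawable_def using simple trifree drawing by blast

text \<open>An edge inside the isolated side satisfies the bound unless some pair of ends is joined
  through two different middles. Those ends are then opposite vertices of the bounding cycle. A
  further neighbour of \<open>p\<close> or \<open>q\<close> leads to a better edge; without one, all
  paths run between this single pair and \<open>thin_path_bound\<close> applies.\<close>

lemma contraction_choice:
  assumes nf: "\<And>u a b c. \<not> facial u a b c" and n3: "card V \<ge> 3" and deg: "\<And>x. x \<in> V \<Longrightarrow> card (nbrs E x) \<ge> 2"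
  shows "\<exists>p q. {p, q} \<in> E \<and> (\<forall>x y. \<not> cycle4 E p x y q) \<and>
    2 * card {(s, t, r). {p, s} \<in> E \<and> {s, t} \<in> E \<and> {t, r} \<in> E \<and> {r, q} \<in> E} + 3 \<le> card V"
proof (cases "\<exists>u a b c. cycle4 E u a b c")
  case False
  have "V \<noteq> {}" using n3 by auto
  then obtain x where "x \<in> V" by blast
  then have "nbrs E x \<noteq> {}" using deg[of x] by auto
  then obtain y where xy: "{x, y} \<in> E" unfolding nbrs_def by blast
  have unq: "t = t'" if "t \<in> common E s r" "t' \<in> common E s r" "{x, s} \<in> E" "{r, y} \<in> E" for s r t t'
  proof (rule ccontr)
    assume tt: "t \<noteq> t'"
    have e: "{s, t} \<in> E" "{t, r} \<in> E" "{s, t'} \<in> E" "{t', r} \<in> E" using that unfolding common_def by auto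
    have "s \<noteq> r"
    proof
      assume "s = r"
      then show False using trifree[OF that(3)] that(4) xy edge_sym by blast
    qed
    then have "cycle4 E s t r t'" unfolding cycle4_def using e tt edge_sym[OF e(3)] edge_sym[OF e(4)] by simp
    then show False using False by blast
  qed
  have "2 * card {(s, t, r). {x, s} \<in> E \<and> {s, t} \<in> E \<and> {t, r} \<in> E \<and> {r, y} \<in> E} + 3 \<le> card V"
    by (rule contraction_loss_bound[OF plane_tfp xy n3]) (use False in blast, use False in blast, rule unq)
  then show ?thesis using False xy by (intro exI[of _ x] exI[of _ y]) simp
next
  case True
  then obtain u0 a0 b0 c0 where "cycle4 E u0 a0 b0 c0" by blast
  then obtain u a b c I where C: "cycle4 E u a b c" and I: "I \<subseteq> V" "I \<noteq> {}" "I \<inter> {u, a, b, c} = {}"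
    and nb: "\<And>x y. x \<in> I \<Longrightarrow> {x, y} \<in> E \<Longrightarrow> y \<in> I \<union> {u, a, b, c}" and nc: "\<And>x d e f. x \<in> I \<Longrightarrow> \<not> cycle4 E x d e f"
    using isolated_side[OF nf] by metis
  let ?Q = "{u, a, b, c}"
  note cD = cycle4D[OF C]
  have opp: "(x = u \<and> y = b) \<or> (x = b \<and> y = u) \<or> (x = a \<and> y = c) \<or> (x = c \<and> y = a)"
    if "x \<in> ?Q" "y \<in> ?Q" "x \<noteq> y" "{x, y} \<notin> E" for x y
    using that cD(1-8) by auto
  \<comment> \<open>Two neighbours on the cycle would be opposite, and a cycle vertex adjacent to
    both would complete a 4-cycle through \<open>x\<close>.\<close>
  have oneQ: "s = s'" if x: "x \<in> I" and s: "{x, s} \<in> E" "s \<in> ?Q" "{x, s'} \<in> E" "s' \<in> ?Q" for x s s'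
  proof (rule ccontr)
    assume ne: "s \<noteq> s'"
    have "{s, s'} \<notin> E" using trifree[OF edge_sym[OF s(1)] s(3)] .
    then have o: "(s = u \<and> s' = b) \<or> (s = b \<and> s' = u) \<or> (s = a \<and> s' = c) \<or> (s = c \<and> s' = a)" using opp s ne by blast
    have xn: "x \<noteq> u" "x \<noteq> a" "x \<noteq> b" "x \<noteq> c" using x I(3) by auto
    have "cycle4 E x s a s' \<or> cycle4 E x s u s'"
      using o s cD(1-8) xn ne edge_sym[OF s(3)] unfolding cycle4_def by auto
    then show False using nc[OF x] by blast
  qed
  \<comment> \<open>Failure of the uniqueness hypothesis of \<open>contraction_loss_bound\<close>.
    It puts \<open>s\<close> and \<open>r\<close> on a 4-cycle, so they cannot lie in
    \<open>I\<close>.\<close>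
  define bad where "bad = (\<lambda>p q. \<exists>s r t t'. {p, s} \<in> E \<and> {r, q} \<in> E \<and> t \<in> common E s r \<and> t' \<in> common E s r \<and> t \<noteq> t')"
  have badD: "\<exists>s r. s \<in> ?Q \<and> r \<in> ?Q \<and> {p, s} \<in> E \<and> {r, q} \<in> E \<and> s \<noteq> r \<and> {s, r} \<notin> E \<and> 2 \<le> card (common E s r)"
    if B: "bad p q" and pq: "p \<in> I" "q \<in> I" "{p, q} \<in> E" for p q
  proof -
    obtain s r t t' where h: "{p, s} \<in> E" "{r, q} \<in> E" "t \<in> common E s r" "t' \<in> common E s r" "t \<noteq> t'"
      using B unfolding bad_def by blast
    have e: "{s, t} \<in> E" "{t, r} \<in> E" "{s, t'} \<in> E" "{t', r} \<in> E" using h unfolding common_def by auto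
    have sr: "s \<noteq> r"
    proof
      assume "s = r"
      then show False using trifree[OF h(1)] h(2) pq(3) edge_sym by blast
    qed
    have "{s, r} \<notin> E" using trifree[OF e(1,2)] .
    have C1: "cycle4 E s t r t'" unfolding cycle4_def using e sr h(5) edge_sym[OF e(3)] edge_sym[OF e(4)] by simp
    have C2: "cycle4 E r t' s t" by (rule cycle4_rotate[OF cycle4_rotate[OF C1]])
    have "s \<in> ?Q" "r \<in> ?Q" using nb[OF pq(1) h(1)] nb[OF pq(2) edge_sym[OF h(2)]] nc[of s] nc[of r] C1 C2 by blast+
    moreover have "card {t, t'} \<le> card (common E s r)" by (rule card_mono[OF finite_common]) (use h in auto)
    ultimately show ?thesis using h sr \<open>{s, r} \<notin> E\<close> by (intro exI[of _ s] exI[of _ r]) auto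
  qed
  have good: ?thesis if pq: "p \<in> I" "q \<in> I" "{p, q} \<in> E" "\<not> bad p q" for p q
  proof -
    have unq: "t = t'" if "{p, s} \<in> E" "{r, q} \<in> E" "t \<in> common E s r" "t' \<in> common E s r" for s r t t'
      using pq(4) that unfolding bad_def by blast
    have "2 * card {(s, t, r). {p, s} \<in> E \<and> {s, t} \<in> E \<and> {t, r} \<in> E \<and> {r, q} \<in> E} + 3 \<le> card V"
      by (rule contraction_loss_bound[OF plane_tfp pq(3) n3 nc[OF pq(1)] nc[OF pq(2)]]) (rule unq)
    then show ?thesis using pq(3) nc[OF pq(1)] by (intro exI[of _ p] exI[of _ q]) simp
  qed
  have fn: "finite (nbrs E x)" for x by (rule finite_nbrs[OF simple])
  obtain p where p: "p \<in> I" using I(2) by blast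
  have "\<exists>q. {p, q} \<in> E \<and> q \<in> I"
  proof (rule ccontr)
    assume n: "\<not> ?thesis"
    have "card (nbrs E p) \<le> 1"
    proof (rule card_le_Suc0_iff_eq[OF fn, THEN iffD2, folded One_nat_def], intro ballI)
      fix s s' assume "s \<in> nbrs E p" "s' \<in> nbrs E p"
      then have s: "{p, s} \<in> E" "{p, s'} \<in> E" unfolding nbrs_def by auto
      show "s = s'" using oneQ[OF p s(1) _ s(2)] nb[OF p s(1)] nb[OF p s(2)] n s by blast
    qed
    then show False using deg[of p] p I(1) by auto
  qed
  then obtain q where q: "{p, q} \<in> E" "q \<in> I" by blast
  \<comment> \<open>If the edges from \<open>p\<close> to \<open>q\<close> and to \<open>q'\<close>
    were both bad, both would use the only neighbour of \<open>p\<close> on the cycle and thus the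
    same opposite vertex \<open>r1\<close>, which would close the 4-cycle
    \<open>p q r1 q'\<close>.\<close>
  have two: ?thesis if h: "p \<in> I" "q \<in> I" "{p, q} \<in> E" "bad p q" "{p, s} \<in> E" "s \<in> ?Q" "{p, q'} \<in> E" "q' \<noteq> q" "q' \<noteq> s" for p q s q'
  proof -
    have q'I: "q' \<in> I" using nb[OF h(1,7)] oneQ[OF h(1,5,6,7)] h(9) by blast
    show ?thesis
    proof (cases "bad p q'")
      case False then show ?thesis using good[OF h(1) q'I h(7)] by blast
    next
      case True
      obtain s1 r1 where 1: "s1 \<in> ?Q" "r1 \<in> ?Q" "{p, s1} \<in> E" "{r1, q} \<in> E" "s1 \<noteq> r1" "{s1, r1} \<notin> E" using badD[OF h(4,1,2,3)] by blast
      obtain s2 r2 where 2: "s2 \<in> ?Q" "r2 \<in> ?Q" "{p, s2} \<in> E" "{r2, q'} \<in> E" "s2 \<noteq> r2" "{s2, r2} \<notin> E" using badD[OF True h(1) q'I h(7)] by blast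
      have "s1 = s2" using oneQ[OF h(1) 1(3,1) 2(3,1)] .
      then have "r1 = r2" using opp[OF 1(1,2,5,6)] opp[OF 2(1,2,5,6)] cD(9-14) by auto
      moreover have "p \<noteq> r1" using 1(2) h(1) I(3) by auto
      ultimately have "cycle4 E p q r1 q'"
        unfolding cycle4_def using h(3,7,8) 1(4) 2(4) edge_sym by auto
      then show ?thesis using nc[OF h(1)] by blast
    qed
  qed
  show ?thesis
  proof (cases "bad p q")
    case False then show ?thesis using good[OF p q(2,1)] by blast
  next
    case True
    obtain s r where sr: "s \<in> ?Q" "r \<in> ?Q" "{p, s} \<in> E" "{r, q} \<in> E" "s \<noteq> r" "{s, r} \<notin> E" "2 \<le> card (common E s r)"
      using badD[OF True p q(2,1)] by blast
    have badqp: "bad q p" using True edge_sym unfolding bad_def common_commute[of E s r] by (metis common_commute)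
    show ?thesis
    proof (cases "(\<exists>q'. {p, q'} \<in> E \<and> q' \<noteq> q \<and> q' \<noteq> s) \<or> (\<exists>q'. {q, q'} \<in> E \<and> q' \<noteq> p \<and> q' \<noteq> r)")
      case True
      then show ?thesis
        using two[OF p q(2,1) \<open>bad p q\<close> sr(3,1)] two[OF q(2) p edge_sym[OF q(1)] badqp edge_sym[OF sr(4)] sr(2)] by blast
    next
      \<comment> \<open>Now \<open>p\<close> has only the neighbours \<open>q\<close>,
        \<open>s\<close> and \<open>q\<close> only \<open>p\<close>, \<open>r\<close>, so every path
        of length four passes through \<open>s\<close> and \<open>r\<close>.\<close>
      case F: False
      let ?M = "{(s, t, r). {p, s} \<in> E \<and> {s, t} \<in> E \<and> {t, r} \<in> E \<and> {r, q} \<in> E}"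
      have "?M \<subseteq> (\<lambda>t. (s, t, r)) ` common E s r"
      proof
        fix m assume m: "m \<in> ?M"
        obtain s' t r' where m': "m = (s', t, r')" by (cases m)
        have e: "{p, s'} \<in> E" "{s', t} \<in> E" "{t, r'} \<in> E" "{r', q} \<in> E" using m unfolding m' by auto
        have "s' \<noteq> q" using trifree[OF e(2,3)] e(4) edge_sym by blast
        then have s': "s' = s" using F e(1) by blast
        have "r' \<noteq> p" using trifree[OF e(2,3)] e(1) edge_sym by blast
        then have r': "r' = r" using F edge_sym[OF e(4)] by blast
        show "m \<in> (\<lambda>t. (s, t, r)) ` common E s r" unfolding m' s' r' using e s' r' unfolding common_def by blast
      qed
      then have "card ?M \<le> card (common E s r)"
        using card_mono[of "(\<lambda>t. (s, t, r)) ` common E s r" ?M] card_image_le[OF finite_common[of s r], of "\<lambda>t. (s, t, r)"] finite_common[of s r]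
        by (meson finite_imageI order_trans)
      moreover have "2 * card (common E s r) + 3 \<le> card V"
      proof (rule thin_path_bound[OF nf _ sr(5,7)])
        show "(p, q) \<in> walks3 E s r" unfolding walks3_def using sr q edge_sym[OF sr(3)] edge_sym[OF sr(4)] by simp
      qed
      ultimately show ?thesis using q(1) nc[OF p] by (intro exI[of _ p] exI[of _ q]) auto
    qed
  qed
qed

text \<open>If the first merge is too expensive, \<open>bad_pair_bound\<close> must fail, so there
  is a facial cycle \<open>s z w z'\<close> with \<open>w\<close> adjacent to \<open>t\<close>, up
  to exchanging \<open>s\<close> and \<open>t\<close>. The path \<open>s x t w\<close> links its
  poles, so \<open>z\<close> and \<open>z'\<close> can be merged, and
  \<open>adjacent_pairs_bound\<close> makes the new loss small because the old one was
  large.\<close>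

lemma cheap_merge:
  assumes F: "facial u a b c" and n: "card V \<ge> 3"
  shows "\<exists>s x t y. mergeable V E s x t y \<and> 2 * card (walks3 E s t) + 3 \<le> card V"
proof -
  have "\<exists>s x t y. mergeable V E s x t y" using facial_some[OF F] by blast
  then obtain s x t y where m: "mergeable V E s x t y" by blast
  have C: "cycle4 E s x t y" using m unfolding mergeable_def by simp
  note cD = cycle4D[OF C]
  have x: "x \<in> common E s t" unfolding common_def using cD by simp
  show ?thesis
  proof (cases "2 * card (walks3 E s t) + 3 \<le> card V")
    case True then show ?thesis using m by blast
  next
    case big: False
    have "\<not> (2 * card (walks3 E s t) + card (common E s t) + 2 \<le> card V)"
    proof -
      have "card (common E s t) > 0" using x finite_common card_gt_0_iff by blast
      then show ?thesis using big by linarith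
    qed
    then have "(\<exists>w z z'. {w, t} \<in> E \<and> z \<in> common E s w \<and> z' \<in> common E s w \<and> z \<noteq> z' \<and> facial s z w z') \<or>
        (\<exists>w z z'. {w, s} \<in> E \<and> z \<in> common E t w \<and> z' \<in> common E t w \<and> z \<noteq> z' \<and> facial t z w z')"
      using bad_pair_bound[OF cD(9)] x by blast
    moreover have via: ?thesis if h: "{w, t} \<in> E" "z \<in> common E s w" "facial s z w z'"
        and x: "x \<in> common E s t" "s \<noteq> t" and big: "\<not> 2 * card (walks3 E s t) + 3 \<le> card V" for w z z' s t x
    proof -
      have "(x, t) \<in> walks3 E s w" using x(1) edge_sym[OF h(1)] unfolding walks3_def common_def by simp
      then have "walks3 E s w \<noteq> {}" by blast
      then have mm: "mergeable V E s z w z'" using facial_linked_mergeable[OF h(3)] by blast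
      have "card (walks3 E s t) + card (walks3 E s w) + 3 \<le> card V"
        by (rule adjacent_pairs_bound[OF plane_tfp x(2,1) edge_sym[OF h(1)] h(2)])
      then have "2 * card (walks3 E s w) + 3 \<le> card V" using big by linarith
      then show ?thesis using mm by blast
    qed
    moreover have "x \<in> common E t s" using x common_commute by metis
    moreover have "\<not> 2 * card (walks3 E t s) + 3 \<le> card V" using big card_walks3_commute by metis
    ultimately show ?thesis using via[OF _ _ _ x cD(9) big] via[of _ s _ t _ x] cD(9) by blast
  qed
qed

end

section \<open>Equality in the reductions\<close>

text \<open>The quarter square of \<open>n - 3\<close> is the product of its two halves rounded down
  and up, in a form without real numbers.\<close>

definition pent_max :: "nat \<Rightarrow> nat" where "pent_max n = (n - 3)\<^sup>2 div 4"

lemma pent_max_step: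
  assumes "n \<ge> 4"
  shows "pent_max n = pent_max (n - 1) + (n - 3) div 2"
proof -
  obtain k where n: "n = k + 4" using assms by (metis add.commute le_Suc_ex)
  have "(k + 1)\<^sup>2 div 4 = k\<^sup>2 div 4 + (k + 1) div 2"
  proof (cases "even k")
    case True
    then obtain j where k: "k = 2 * j" by (elim evenE)
    have "(k + 1)\<^sup>2 = 1 + 4 * (j * j + j)" "k\<^sup>2 = 4 * (j * j)" unfolding k by (simp_all add: power2_eq_square algebra_simps)
    then show ?thesis unfolding k by simp
  next
    case False
    then obtain j where k: "k = 2 * j + 1" by (elim oddE)
    have "(k + 1)\<^sup>2 = 4 * (j * j + 2 * j + 1)" "k\<^sup>2 = 1 + 4 * (j * j + j)" unfolding k by (simp_all add: power2_eq_square algebra_simps)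
    then show ?thesis unfolding k by simp
  qed
  then show ?thesis unfolding n pent_max_def by simp
qed

lemma pent_max_pos: "n \<ge> 5 \<Longrightarrow> pent_max n \<ge> 1"
  using pent_max_step[of n] by linarith

lemma product_le_quarter_square:
  fixes c e k :: nat
  assumes "c + e \<le> k"
  shows "c * e \<le> k\<^sup>2 div 4"
proof -
  have "4 * (int c * int e) \<le> (int c + int e)\<^sup>2" using zero_le_power2[of "int c - int e"] by (simp add: power2_eq_square algebra_simps)
  then have "int (4 * (c * e)) \<le> int ((c + e)\<^sup>2)" by simp
  then have "4 * (c * e) \<le> (c + e)\<^sup>2" by (simp only: of_nat_le_iff)
  also have "\<dots> \<le> k\<^sup>2" using assms by (rule power_mono) simp
  finally show ?thesis by simp
qed

text \<open>From 2 on quarter squares increase strictly, which forces the sum;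
  \<open>4 * c * e = (c + e)^2 - (c - e)^2\<close> then forces the difference to be at most
  one.\<close>

lemma balanced_product:
  fixes c e k :: nat
  assumes le: "c + e \<le> k" and k: "k \<ge> 2" and prod: "k\<^sup>2 div 4 \<le> c * e"
  shows "c + e = k" "c \<le> (k + 1) div 2" "e \<le> (k + 1) div 2"
proof -
  show ce: "c + e = k"
  proof (rule ccontr)
    assume "c + e \<noteq> k"
    then have "c + e \<le> k - 1" using le by simp
    then have 1: "c * e \<le> (k - 1)\<^sup>2 div 4" by (rule product_le_quarter_square)
    have "pent_max (k + 3) = pent_max (k + 2) + k div 2" using pent_max_step[of "k + 3"] k by simp
    then have "k\<^sup>2 div 4 = (k - 1)\<^sup>2 div 4 + k div 2" unfolding pent_max_def by simp
    then show False using 1 prod k by simp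
  qed
  have d: "\<bar>int c - int e\<bar> \<le> 1"
  proof (rule ccontr)
    assume "\<not> \<bar>int c - int e\<bar> \<le> 1"
    then have 2: "2 \<le> \<bar>int c - int e\<bar>" by simp
    have "2 * 2 \<le> \<bar>int c - int e\<bar> * \<bar>int c - int e\<bar>" by (rule mult_mono[OF 2 2]) simp_all
    then have "4 \<le> (int c - int e)\<^sup>2" by (simp add: power2_eq_square abs_mult[symmetric])
    moreover have "(int c + int e)\<^sup>2 = (int c - int e)\<^sup>2 + 4 * (int c * int e)" by (simp add: power2_eq_square algebra_simps)
    moreover have "int k = int c + int e" using ce by simp
    ultimately have "4 + 4 * (int c * int e) \<le> (int k)\<^sup>2" by simp
    then have "int (4 + 4 * (c * e)) \<le> int (k\<^sup>2)" by simp
    then have "4 + 4 * (c * e) \<le> k\<^sup>2" by (simp only: of_nat_le_iff)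
    then show False using prod by linarith
  qed
  show "c \<le> (k + 1) div 2" "e \<le> (k + 1) div 2" using d ce by linarith+
qed

text \<open>A preimage would have a single vertex, \<open>a\<close> or \<open>c\<close>, adjacent to
  both neighbours; but one of them is attached to \<open>a\<close> only and the other to
  \<open>c\<close> only.\<close>

lemma (in identification) crossing_not_pushed:
  assumes co: "common F a c = {}" and w: "(x1, a, x3, x4, x5) \<in> walks5 (identify a c F)"
    and o: "({a, x1} \<in> F \<and> {c, x3} \<in> F) \<or> ({c, x1} \<in> F \<and> {a, x3} \<in> F)"
  shows "(x1, a, x3, x4, x5) \<notin> push ` walks5 F"
proof
  assume "(x1, a, x3, x4, x5) \<in> push ` walks5 F"
  then obtain q where q: "(x1, a, x3, x4, x5) = push q" "q \<in> walks5 F" by (rule imageE)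
  obtain w1 w2 w3 w4 w5 where qq: "q = (w1, w2, w3, w4, w5)" by (cases q)
  have e: "{w1, w2} \<in> F" "{w2, w3} \<in> F" using q(2) unfolding qq walks5_def by auto
  have r: "redirect a c w1 = x1" "redirect a c w2 = a" "redirect a c w3 = x3" using q(1) unfolding qq push_def by auto
  have ed: "{x1, a} \<in> identify a c F" "{a, x3} \<in> identify a c F" using w unfolding walks5_def by auto
  then have "x1 \<noteq> a" "x3 \<noteq> a" using simple_graph_edge(3)[OF identify_simple] by blast+
  then have w13: "w1 = x1" "w3 = x3" using r unfolding redirect_def by (auto split: if_splits)
  have w2: "w2 = a \<or> w2 = c" using r(2) unfolding redirect_def by (auto split: if_splits)
  have nc: False if "{a, z} \<in> F" "{c, z} \<in> F" for z
    using co that edge_flip[OF that(2)] unfolding common_def by blast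
  have e': "{w2, x1} \<in> F" "{w2, x3} \<in> F" using e edge_flip[OF e(1)] unfolding w13 by simp_all
  from w2 show False
  proof
    assume "w2 = a" then show False using e' o nc[of x1] nc[of x3] by auto
  next
    assume "w2 = c" then show False using e' o nc[of x1] nc[of x3] by auto
  qed
qed

text \<open>Equality in \<open>pair_bound\<close> leaves \<open>H\<close> with nothing but its
  poles, their neighbours and the paths. As \<open>a\<close> and \<open>c\<close> each have another
  neighbour, some closed 5-walk of \<open>H\<close> enters the merged vertex along an edge of one of
  them and leaves along an edge of the other. It has no preimage, so the contracted graph has
  strictly more 5-walks than the graph without the edge.\<close>

lemma contraction_strict:
  assumes G: "tfp V E" and acE: "{a, c} \<in> E" and nc: "\<And>x y. \<not> cycle4 E a x y c"
    and deg: "\<And>x. x \<in> V \<Longrightarrow> card (nbrs E x) \<ge> 2"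
    and uv: "u \<noteq> v" and H: "H = identify a c (E - {{a, c}})"
    and ne: "common H u v \<noteq> {}" "walks3 H u v \<noteq> {}"
    and tight: "card (walks3 H u v) + card (common H u v) + 3 = card (V - {c})"
  shows "card (walks5 (E - {{a, c}})) < card (walks5 H)"
proof -
  let ?F = "E - {{a, c}}"
  note I = contract_identification[OF G acE nc]
  interpret identification V ?F a c by (rule I(1))
  note sg = tfpD(1)[OF G] and tf = tfpD(2)[OF G]
  have HH: "tfp (V - {c}) H" unfolding H by (rule I(2))
  note sgH = tfpD(1)[OF HH] and tfH = tfpD(2)[OF HH]
  have st: "V - {c} = {u, v} \<union> nbrs H u \<union> nbrs H v" "H = (\<lambda>(x, y). {x, y}) ` link H u v"
    using pair_bound(3)[OF HH uv ne tight] by simp_all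
  obtain d where d: "{u, d} \<in> H" "{d, v} \<in> H" using ne(1) unfolding common_def by blast
  have nuv: "{u, v} \<notin> H" "{v, u} \<notin> H" using triangle_freeD[OF tfH d] edge_flip[of v u H] by blast+
  have cls: "z = u \<or> z = v \<or> w = u \<or> w = v \<or> (z, w) \<in> walks3 H u v \<or> (w, z) \<in> walks3 H u v" if zw: "{z, w} \<in> H" for z w
  proof -
    have "{z, w} \<in> (\<lambda>(x, y). {x, y}) ` link H u v" using zw st(2) by simp
    then obtain q where q: "{z, w} = (\<lambda>(x, y). {x, y}) q" "q \<in> link H u v" by (rule imageE)
    obtain x y where qq: "q = (x, y)" by (cases q)
    have "(z = x \<and> w = y) \<or> (z = y \<and> w = x)" using q(1) unfolding qq by (simp add: doubleton_eq_iff)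
    moreover have "x = u \<or> x = v \<or> (x, y) \<in> walks3 H u v" using q(2) unfolding qq link_def by auto
    ultimately show ?thesis by auto
  qed
  have aH: "{a, w} \<in> H \<longleftrightarrow> {a, w} \<in> ?F \<or> {c, w} \<in> ?F" if "w \<noteq> a" "w \<noteq> c" for w
    unfolding H using identify_iff[of a w] that ac by auto
  have acV: "a \<in> V" "c \<in> V" "a \<noteq> c" using simple_graph_edge[OF sg acE] by auto
  \<comment> \<open>Minimum degree two, in the form used: every vertex has a neighbour different
    from a given one.\<close>
  have ex: "\<exists>x. {z, x} \<in> E \<and> x \<noteq> y" if z: "z \<in> V" for z y
  proof (rule ccontr)
    assume "\<not> ?thesis"
    then have "nbrs E z \<subseteq> {y}" unfolding nbrs_def by blast
    then have "card (nbrs E z) \<le> card {y}" by (intro card_mono) simp_all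
    then show False using deg[OF z] by simp
  qed
  obtain x where x: "{a, x} \<in> E" "x \<noteq> c" using ex[OF acV(1)] by blast
  obtain y where y: "{c, y} \<in> E" "y \<noteq> a" using ex[OF acV(2)] by blast
  have xy: "{a, x} \<in> ?F" "{c, y} \<in> ?F" using x y by (auto simp: doubleton_eq_iff)
  have xn: "x \<noteq> a" "y \<noteq> c" using simple_graph_edge(3)[OF sg] x(1) y(1) by blast+
  have xyH: "{a, x} \<in> H" "{a, y} \<in> H" using aH[of x] aH[of y] xy xn x(2) y(2) by auto
  have nocom: False if "{a, z} \<in> ?F" "{c, z} \<in> ?F" for z
    using I(3) that edge_flip[OF that(2)] unfolding common_def by blast
  define opp where "opp = (\<lambda>x1 x3. ({a, x1} \<in> ?F \<and> {c, x3} \<in> ?F) \<or> ({c, x1} \<in> ?F \<and> {a, x3} \<in> ?F))"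
  have nH: "w \<noteq> a" "w \<noteq> c" if "{a, w} \<in> H" for w
    using simple_graph_edge[OF sgH that] by auto
  have crossing: "\<exists>x1 x3 x4 x5. (x1, a, x3, x4, x5) \<in> walks5 H \<and> opp x1 x3"
    if nuv: "{u, v} \<notin> H" and d: "{u, d} \<in> H" "{d, v} \<in> H" and w0: "(x0, y0) \<in> walks3 H u v"
      and cls: "\<And>z w. {z, w} \<in> H \<Longrightarrow> z = u \<or> z = v \<or> w = u \<or> w = v \<or> (z, w) \<in> walks3 H u v \<or> (w, z) \<in> walks3 H u v"
      and a: "a = u \<or> {u, a} \<in> H" for u v d x0 y0
  proof -
    have w0: "{u, x0} \<in> H" "{x0, y0} \<in> H" "{y0, v} \<in> H" using w0 unfolding walks3_def by auto
    have w3: "{u, z} \<in> H \<and> {z, w} \<in> H \<and> {w, v} \<in> H" if "(z, w) \<in> walks3 H u v" for z w using that unfolding walks3_def by simp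
    have hs: "{y, x} \<in> H" if "{x, y} \<in> H" for x y using edge_flip[OF that] .
    show ?thesis
    proof (cases "{u, a} \<in> H")
      case ua: True
      have au: "a \<noteq> u" using simple_graph_edge(3)[OF sgH ua] by blast
      have av: "a \<noteq> v" using ua nuv by auto
      show ?thesis
      proof (cases "{a, v} \<in> H")
        case True
        \<comment> \<open>A common neighbour of the poles has no other neighbours, since an edge of
          a path at it would close a triangle. So \<open>a\<close> keeps one pole as its own
          neighbour and \<open>c\<close> brings the other.\<close>
        have sub: "w = u \<or> w = v" if w: "{a, w} \<in> H" for w
          using cls[OF w]
        proof (elim disjE)
          assume "(a, w) \<in> walks3 H u v"
          then show ?thesis using w3[of a w] triangle_freeD[OF tfH w _ True] by blast
        next
          assume "(w, a) \<in> walks3 H u v"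
          then show ?thesis using w3[of w a] triangle_freeD[OF tfH _ hs[OF w] ua] by blast
        qed (use au av in simp_all)
        have "x \<noteq> y" using nocom xy by blast
        then have "(x = u \<and> y = v) \<or> (x = v \<and> y = u)" using sub[OF xyH(1)] sub[OF xyH(2)] by auto
        then have "opp u v" unfolding opp_def using xy by auto
        moreover have "(u, a, v, y0, x0) \<in> walks5 H" unfolding walks5_def using ua True hs[OF w0(1)] hs[OF w0(2)] hs[OF w0(3)] by simp
        ultimately show ?thesis by blast
      next
        \<comment> \<open>Here the merged vertex is next to \<open>u\<close> only. Every other
          neighbour \<open>w\<close> of it is then adjacent to \<open>v\<close>, so each such edge
          lies on a pentagon through \<open>u\<close> and \<open>v\<close>.\<close>
        case nav: False
        note a_u = hs[OF ua]
        have "{a, u} \<in> ?F \<or> {c, u} \<in> ?F" using aH[OF nH(1)[OF a_u] nH(2)[OF a_u]] a_u by simp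
        then have "\<exists>w. {a, w} \<in> H \<and> w \<noteq> u \<and> opp u w"
        proof
          assume au: "{a, u} \<in> ?F"
          then have "y \<noteq> u" using nocom xy by blast
          then show ?thesis using xyH(2) au xy(2) unfolding opp_def by blast
        next
          assume cu: "{c, u} \<in> ?F"
          then have "x \<noteq> u" using nocom xy by blast
          then show ?thesis using xyH(1) cu xy(1) unfolding opp_def by blast
        qed
        then obtain w where w: "{a, w} \<in> H" "w \<noteq> u" "opp u w" by blast
        have "w \<noteq> v" using w(1) nav by auto
        then have "(a, w) \<in> walks3 H u v \<or> (w, a) \<in> walks3 H u v" using cls[OF w(1)] au av w(2) by simp
        then have "{w, v} \<in> H" using w3[of a w] w3[of w a] nav by blast
        then have "(u, a, w, v, d) \<in> walks5 H" unfolding walks5_def using ua w(1) hs[OF d(1)] hs[OF d(2)] by simp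
        then show ?thesis using w(3) by blast
      qed
    next
      case False
      then have au: "a = u" using a by simp
      have dH: "{a, d} \<in> H" and x0H: "{a, x0} \<in> H" using d(1) w0(1) au by simp_all
      \<comment> \<open>The merged vertex is a pole. \<open>P\<close> and \<open>Q\<close> stand for
        being attached to \<open>a\<close> and to \<open>c\<close> or the other way round, so that
        \<open>d\<close> can be assumed on the \<open>P\<close> side. If \<open>y\<close> is not
        adjacent to \<open>v\<close>, minimum degree two supplies the next vertex \<open>w\<close>
        of a path.\<close>
      have gen: ?thesis if PQ: "\<And>z w. P z \<Longrightarrow> Q w \<Longrightarrow> opp z w \<and> opp w z" and P: "P d" and Q: "Q y" "{a, y} \<in> H"
          and x0: "P x0 \<or> Q x0" for P Q y
      proof (cases "{y, v} \<in> H")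
        case True
        show ?thesis
        proof (cases "P x0")
          case P0: True
          have "(y, a, x0, y0, v) \<in> walks5 H" unfolding walks5_def using hs[OF Q(2)] x0H w0 hs[OF True] by simp
          then show ?thesis using PQ[OF P0 Q(1)] by blast
        next
          case False
          then have "Q x0" using x0 by simp
          moreover have "(d, a, x0, y0, v) \<in> walks5 H" unfolding walks5_def using hs[OF dH] x0H w0 hs[OF d(2)] by simp
          ultimately show ?thesis using PQ[OF P] by blast
        qed
      next
        case nyv: False
        have yn: "y \<noteq> a" "y \<noteq> c" using nH[OF Q(2)] by auto
        have yV: "y \<in> V" using simple_graph_edge(2)[OF sgH Q(2)] by simp
        have "{a, y} \<in> E \<or> {c, y} \<in> E" using aH[OF yn] Q(2) by auto
        then have "\<exists>w. {y, w} \<in> E \<and> w \<noteq> a \<and> w \<noteq> c"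
        proof
          assume ay: "{a, y} \<in> E"
          then have "{y, c} \<notin> E" using triangle_freeD[OF tf ay, of c] acE by blast
          then show ?thesis using ex[OF yV, of a] by metis
        next
          assume cy: "{c, y} \<in> E"
          then have "{y, a} \<notin> E" using triangle_freeD[OF tf cy, of a] edge_flip[OF acE] by blast
          then show ?thesis using ex[OF yV, of c] by metis
        qed
        then obtain w where w: "{y, w} \<in> E" "w \<noteq> a" "w \<noteq> c" by blast
        have "{y, w} \<in> ?F" using w yn by (auto simp: doubleton_eq_iff)
        then have yw: "{y, w} \<in> H" unfolding H using identify_iff[of y w] yn w by blast
        have "y \<noteq> v" using Q(2) nuv au by auto
        moreover have "w \<noteq> v" using yw nyv by auto
        ultimately have "(y, w) \<in> walks3 H u v \<or> (w, y) \<in> walks3 H u v" using cls[OF yw] yn(1) w(2) au by simp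
        then have "{w, v} \<in> H" using w3[of y w] w3[of w y] nyv by blast
        then have "(d, a, y, w, v) \<in> walks5 H" unfolding walks5_def using hs[OF dH] Q(2) yw hs[OF d(2)] by simp
        then show ?thesis using PQ[OF P Q(1)] by blast
      qed
      have dn: "{a, d} \<in> ?F \<or> {c, d} \<in> ?F" and x0n: "{a, x0} \<in> ?F \<or> {c, x0} \<in> ?F"
        using aH[OF nH(1)[OF dH] nH(2)[OF dH]] aH[OF nH(1)[OF x0H] nH(2)[OF x0H]] dH x0H by simp_all
      from dn show ?thesis
      proof
        assume "{a, d} \<in> ?F"
        then show ?thesis
          using gen[of "\<lambda>z. {a, z} \<in> ?F" "\<lambda>z. {c, z} \<in> ?F" y] xy(2) xyH(2) x0n unfolding opp_def by blast
      next
        assume "{c, d} \<in> ?F"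
        then show ?thesis
          using gen[of "\<lambda>z. {c, z} \<in> ?F" "\<lambda>z. {a, z} \<in> ?F" x] xy(1) xyH(1) x0n unfolding opp_def by blast
      qed
    qed
  qed
  obtain x0 y0 where w0: "(x0, y0) \<in> walks3 H u v" using ne(2) by auto
  have sw: "(z, w) \<in> walks3 H v u \<longleftrightarrow> (w, z) \<in> walks3 H u v" for z w
    unfolding walks3_def using edge_commute[of v z H] edge_commute[of z w H] edge_commute[of w u H] by auto
  have "a \<in> V - {c}" using acV by simp
  then have "a \<in> {u, v} \<union> nbrs H u \<union> nbrs H v" unfolding st(1) .
  then have "(a = u \<or> {u, a} \<in> H) \<or> (a = v \<or> {v, a} \<in> H)" unfolding nbrs_def by auto
  then have "\<exists>x1 x3 x4 x5. (x1, a, x3, x4, x5) \<in> walks5 H \<and> opp x1 x3"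
  proof
    assume a: "a = u \<or> {u, a} \<in> H"
    show ?thesis by (rule crossing[OF nuv(1) d w0 _ a]) (rule cls)
  next
    assume a: "a = v \<or> {v, a} \<in> H"
    show ?thesis
    proof (rule crossing[OF nuv(2) edge_flip[OF d(2)] edge_flip[OF d(1)] _ _ a])
      show "(y0, x0) \<in> walks3 H v u" unfolding sw by (rule w0)
      show "z = v \<or> z = u \<or> w = v \<or> w = u \<or> (z, w) \<in> walks3 H v u \<or> (w, z) \<in> walks3 H v u" if "{z, w} \<in> H" for z w
        using cls[OF that] unfolding sw by blast
    qed
  qed
  then obtain x1 x3 x4 x5 where X: "(x1, a, x3, x4, x5) \<in> walks5 H" "opp x1 x3" by blast
  show ?thesis unfolding H
    by (rule walks5_identify_less[OF I(3) X(1)[unfolded H] crossing_not_pushed[OF I(3) X(1)[unfolded H] X(2)[unfolded opp_def]]])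
qed

text \<open>All pentagons of the merged graph pass through \<open>u\<close> and \<open>v\<close>, so the merged vertex is
  a pole, a common neighbour of the poles, or on one of the two sides of the tree.\<close>

lemma merge_extremal:
  assumes G: "tfp V E" and m: "mergeable V E s a t c" and H: "H = identify a c E"
    and uv: "u \<noteq> v" "{u, v} \<notin> H"
    and all5: "\<And>x1 x2 x3 x4 x5. (x1, x2, x3, x4, x5) \<in> walks5 H \<Longrightarrow> u \<in> {x1, x2, x3, x4, x5} \<and> v \<in> {x1, x2, x3, x4, x5}"
    and ne: "walks3 E s t \<noteq> {}" and bal: "card (walks3 H u v) \<le> card (walks3 E s t)"
  shows "\<exists>u' v'. u' \<noteq> v' \<and> card (common H u v) * card (walks3 H u v) + card (walks3 E s t)
    \<le> card (common E u' v') * card (walks3 E u' v')"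
proof -
  note I = mergeable_identification[OF G m]
  interpret identification V E a c by (rule I(1))
  note sg = tfpD(1)[OF G] and tf = tfpD(2)[OF G]
  have HH: "tfp (V - {c}) H" unfolding H by (rule I(2))
  note sgH = tfpD(1)[OF HH] and tfH = tfpD(2)[OF HH]
  have st: "s \<noteq> t" and co: "common E a c = {s, t}" using m unfolding mergeable_def cycle4_def by auto
  have up: "{x, y} \<in> H" if "{x, y} \<in> E" "x \<noteq> c" "y \<noteq> c" for x y unfolding H using identify_iff that by blast
  have low: "{x, y} \<in> E" if "{x, y} \<in> H" "x \<noteq> a" "y \<noteq> a" for x y using that unfolding H identify_iff by blast
  have lowa: "{a, y} \<in> E \<or> {c, y} \<in> E" if "{a, y} \<in> H" for y
    using that simple_graph_edge(3)[OF sgH that] unfolding H identify_iff by blast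
  have hs: "{y, x} \<in> H" if "{x, y} \<in> H" for x y using edge_flip[OF that] .
  have es: "{y, x} \<in> E" if "{x, y} \<in> E" for x y using edge_flip[OF that] .
  have Hc: "x \<noteq> c" "y \<noteq> c" if "{x, y} \<in> H" for x y using simple_graph_edge[OF sgH that] by auto
  have finH: "finite (common H x y)" "finite (walks3 H x y)" "finite (common E x y)" "finite (walks3 E x y)" for x y
    using finite_common_simple[OF sgH] finite_walks3_simple[OF sgH] finite_common_simple[OF sg] finite_walks3_simple[OF sg] by blast+
  have tH: False if "{x, y} \<in> H" "{y, z} \<in> H" "{x, z} \<in> H" for x y z using triangle_freeD[OF tfH that] .
  have pole: "{s, a} \<in> E" "{s, c} \<in> E" "{a, t} \<in> E" "{c, t} \<in> E" "s \<noteq> a" "s \<noteq> c" "t \<noteq> a" "t \<noteq> c"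
      "{s, a} \<in> H" "{a, t} \<in> H"
    if co: "common E a c = {s, t}" for s t
  proof -
    have e: "{a, s} \<in> E" "{s, c} \<in> E" "{a, t} \<in> E" "{t, c} \<in> E" using co unfolding common_def by blast+
    then show "{s, a} \<in> E" "{s, c} \<in> E" "{a, t} \<in> E" "{c, t} \<in> E" using es by blast+
    show n: "s \<noteq> a" "s \<noteq> c" "t \<noteq> a" "t \<noteq> c" using simple_graph_edge(3)[OF sg] e by blast+
    show "{s, a} \<in> H" "{a, t} \<in> H" using up[OF es[OF e(1)]] up[OF e(3)] n ac(3) by blast+
  qed
  have W: "x \<noteq> a" "x \<noteq> c" "y \<noteq> a" "y \<noteq> c" "{s, x} \<in> H" "{x, y} \<in> H" "{y, t} \<in> H"
      "{s, x} \<in> E" "{x, y} \<in> E" "{y, t} \<in> E" "(s, a, t, y, x) \<in> walks5 H"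
    if co: "common E a c = {s, t}" and w: "(x, y) \<in> walks3 E s t" for s t x y
  proof -
    note p = pole[OF co]
    show e: "{s, x} \<in> E" "{x, y} \<in> E" "{y, t} \<in> E" using w unfolding walks3_def by auto
    show n: "x \<noteq> a" "x \<noteq> c" "y \<noteq> a" "y \<noteq> c"
      using triangle_freeD[OF tf e(2,3)] triangle_freeD[OF tf e(1,2)] p(1-4) by blast+
    show h: "{s, x} \<in> H" "{x, y} \<in> H" "{y, t} \<in> H" using up[OF e(1)] up[OF e(2)] up[OF e(3)] n p by blast+
    show "(s, a, t, y, x) \<in> walks5 H" unfolding walks5_def using p(9,10) hs[OF h(1)] hs[OF h(2)] hs[OF h(3)] by simp
  qed
  \<comment> \<open>The same three configurations cover all positions of \<open>u\<close> and
    \<open>v\<close>, up to exchanging \<open>s\<close> with \<open>t\<close> and \<open>u\<close>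
    with \<open>v\<close>.\<close>
  have core: "\<exists>u' v'. u' \<noteq> v' \<and> card (common H u v) * card (walks3 H u v) + card (walks3 E s t)
    \<le> card (common E u' v') * card (walks3 E u' v')"
    if co: "common E a c = {s, t}" and st: "s \<noteq> t"
      and conf: "(u = s \<and> v = t) \<or> (\<exists>y. u = t \<and> (v, y) \<in> walks3 E s t) \<or> (\<exists>x. u = a \<and> (x, v) \<in> walks3 E s t)"
      and all: "\<And>x1 x2 x3 x4 x5. (x1, x2, x3, x4, x5) \<in> walks5 H \<Longrightarrow> v \<in> {x1, x2, x3, x4, x5}"
      and bal: "card (walks3 H u v) \<le> card (walks3 E s t)" for s t u v
  proof -
    note p = pole[OF co]
    note w = W[OF co]
    consider "u = s" "v = t" | y where "u = t" "(v, y) \<in> walks3 E s t" | x where "u = a" "(x, v) \<in> walks3 E s t"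
      using conf by blast
    then show ?thesis
    proof cases
      \<comment> \<open>The merge identified two common neighbours of the poles: \<open>E\<close>
        has one more common neighbour and the same paths.\<close>
      case 1
      have "insert c (common H s t) \<subseteq> common E s t"
      proof
        fix d assume d: "d \<in> insert c (common H s t)"
        show "d \<in> common E s t"
        proof (cases "d = a \<or> d = c")
          case True then show ?thesis using p(1-4) unfolding common_def by blast
        next
          case False
          then have "{s, d} \<in> H" "{d, t} \<in> H" using d unfolding common_def by auto
          then show ?thesis using low p(5,7) False unfolding common_def by blast
        qed
      qed
      then have "card (insert c (common H s t)) \<le> card (common E s t)" by (rule card_mono[OF finH(3)])
      moreover have "c \<notin> common H s t" using Hc(2)[of s c] unfolding common_def by blast
      ultimately have c: "card (common H s t) + 1 \<le> card (common E s t)" using finH(1) by simp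
      have "walks3 H s t \<subseteq> walks3 E s t"
      proof (rule subrelI)
        fix z w assume "(z, w) \<in> walks3 H s t"
        then have h: "{s, z} \<in> H" "{z, w} \<in> H" "{w, t} \<in> H" unfolding walks3_def by auto
        have "z \<noteq> a" using tH[OF h(2,3)] p(10) by blast
        moreover have "w \<noteq> a" using tH[OF h(1,2)] p(9) by blast
        ultimately have "{s, z} \<in> E" "{z, w} \<in> E" "{w, t} \<in> E" using low h p(5,7) by blast+
        then show "(z, w) \<in> walks3 E s t" unfolding walks3_def by simp
      qed
      then have e: "card (walks3 H s t) \<le> card (walks3 E s t)" by (rule card_mono[OF finH(4)])
      have "walks3 E s t \<subseteq> walks3 H s t"
        using w(5-7) unfolding walks3_def by auto
      then have e': "card (walks3 E s t) \<le> card (walks3 H s t)" by (rule card_mono[OF finH(2)])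
      have "(card (common H s t) + 1) * card (walks3 H s t) \<le> card (common E s t) * card (walks3 E s t)"
        using c e by (rule mult_le_mono)
      then have "card (common H s t) * card (walks3 H s t) + card (walks3 E s t) \<le> card (common E s t) * card (walks3 E s t)"
        using e' by simp
      then show ?thesis using st 1 by blast
    next
      \<comment> \<open>Every path from \<open>s\<close> to \<open>t\<close> starts with the pole
        \<open>v\<close>. In \<open>E\<close> the pair \<open>t\<close>, \<open>v\<close> has the
        additional path \<open>t c s v\<close>, and it has at least as many common neighbours as
        there are paths from \<open>s\<close> to \<open>t\<close>; one more path therefore pays for
        the loss.\<close>
      case (2 y)
      note x = w[OF 2(2)]
      have dist: "distinct [s, a, t, y, v]" by (rule walks5_distinct[OF sgH tfH x(11)])
      have av: "{a, v} \<notin> H" using tH[OF hs[OF p(9)] x(5)] by blast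
      have "common H t v \<subseteq> common E t v"
      proof
        fix d assume "d \<in> common H t v"
        then have d: "{t, d} \<in> H" "{d, v} \<in> H" unfolding common_def by auto
        then have "d \<noteq> a" using av by blast
        then show "d \<in> common E t v" using low d p(7) x(1) unfolding common_def by blast
      qed
      then have c: "card (common H t v) \<le> card (common E t v)" by (rule card_mono[OF finH(3)])
      have first: "z = v" if z: "(z, q) \<in> walks3 E s t" for z q
      proof -
        have "v \<in> {s, a, t, q, z}" by (rule all[OF w(11)[OF z]])
        moreover have "v \<noteq> q" using tH[OF x(6,7)] w(7)[OF z] by blast
        ultimately show ?thesis using dist by auto
      qed
      have "inj_on snd (walks3 E s t)"
      proof (rule inj_onI)
        fix z z' assume z: "z \<in> walks3 E s t" "z' \<in> walks3 E s t" "snd z = snd z'"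
        obtain z1 z2 z1' z2' where zz: "z = (z1, z2)" "z' = (z1', z2')" by (cases z, cases z')
          show "z = z'" using first[OF z(1)[unfolded zz]] first[OF z(2)[unfolded zz]] z(3) unfolding zz by simp
      qed
      moreover have "snd ` walks3 E s t \<subseteq> common H t v"
      proof (rule image_subsetI)
        fix z assume z: "z \<in> walks3 E s t"
        obtain z1 z2 where zz: "z = (z1, z2)" by (cases z)
        note h = w(5-7)[OF z[unfolded zz]]
        show "snd z \<in> common H t v" using hs[OF h(2)] hs[OF h(3)] first[OF z[unfolded zz]] unfolding zz common_def by simp
      qed
      ultimately have l: "card (walks3 E s t) \<le> card (common H t v)" by (rule card_inj_on_le[OF _ _ finH(1)])
      \<comment> \<open>Paths through the merged vertex are lifted to \<open>a\<close> whenever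
        possible, which keeps \<open>(c, s)\<close> free as the additional one.\<close>
      define f where "f = (\<lambda>(z, q). if z = a \<and> {a, q} \<notin> E then (c, q) else (z, q))"
      have inW: "z \<noteq> c \<and> q \<noteq> a \<and> {t, z} \<in> H \<and> {z, q} \<in> H \<and> {q, v} \<in> H" if "(z, q) \<in> walks3 H t v" for z q
      proof -
        have h: "{t, z} \<in> H" "{z, q} \<in> H" "{q, v} \<in> H" using that unfolding walks3_def by auto
        moreover have "q \<noteq> a" using h(3) av by blast
        ultimately show ?thesis using Hc(1)[OF h(2)] by simp
      qed
      have inj: "inj_on f (walks3 H t v)"
      proof (rule inj_onI)
        fix z z' assume z: "z \<in> walks3 H t v" "z' \<in> walks3 H t v" "f z = f z'"
        obtain z1 z2 z1' z2' where zz: "z = (z1, z2)" "z' = (z1', z2')" by (cases z, cases z')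
        have "z1 \<noteq> c" "z1' \<noteq> c" using inW z(1,2) unfolding zz by blast+
        then show "z = z'" using z(3) unfolding zz f_def by (auto split: if_splits)
      qed
      have "f z \<in> walks3 E t v" if z: "z \<in> walks3 H t v" for z
      proof -
        obtain z1 q where zz: "z = (z1, q)" by (cases z)
        have h: "{t, z1} \<in> H" "{z1, q} \<in> H" "{q, v} \<in> H" "q \<noteq> a" using inW z unfolding zz by blast+
        have qv: "{q, v} \<in> E" using low[OF h(3)] h(4) x(1) by blast
        show ?thesis
        proof (cases "z1 = a")
          case True
          then have "{a, q} \<in> E \<or> {c, q} \<in> E" using lowa h(2) by blast
          then show ?thesis unfolding zz f_def walks3_def using True qv es[OF p(3)] es[OF p(4)] by auto
        next
          case False
          then show ?thesis unfolding zz f_def walks3_def using qv low[OF h(1)] low[OF h(2)] h(4) p(7) by auto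
        qed
      qed
      moreover have cs: "(c, s) \<in> walks3 E t v" unfolding walks3_def using es[OF p(4)] es[OF p(2)] x(8) by simp
      ultimately have "insert (c, s) (f ` walks3 H t v) \<subseteq> walks3 E t v" by blast
      then have "card (insert (c, s) (f ` walks3 H t v)) \<le> card (walks3 E t v)" by (rule card_mono[OF finH(4)])
      moreover have "(c, s) \<notin> f ` walks3 H t v"
      proof
        assume "(c, s) \<in> f ` walks3 H t v"
        then obtain z where z: "(c, s) = f z" "z \<in> walks3 H t v" by (rule imageE)
        obtain z1 q where zz: "z = (z1, q)" by (cases z)
        have "z1 \<noteq> c" using inW z(2) unfolding zz by blast
        then show False using z(1) es[OF p(1)] unfolding zz f_def by (auto split: if_splits)
      qed
      ultimately have e: "card (walks3 H t v) + 1 \<le> card (walks3 E t v)"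
        using finH(2) card_image[OF inj] by simp
      have "card (common H t v) * (card (walks3 H t v) + 1) \<le> card (common E t v) * card (walks3 E t v)"
        using c e by (rule mult_le_mono)
      then have "card (common H t v) * card (walks3 H t v) + card (walks3 E s t) \<le> card (common E t v) * card (walks3 E t v)"
        using l by simp
      moreover have "t \<noteq> v" using dist by simp
      ultimately show ?thesis using 2(1) by blast
    next
      \<comment> \<open>The merged vertex is a pole and every path from \<open>s\<close> to
        \<open>t\<close> ends with \<open>v\<close>. The new poles are \<open>s\<close> and
        \<open>v\<close>, with the two factors interchanged: first inner vertices become common
        neighbours, and each old common neighbour gives a path through \<open>a\<close> or
        \<open>c\<close>, with \<open>s c t v\<close> in addition. The hypothesis \<open>bal\<close>
        is what makes this exchange favourable.\<close>
      case (3 x0)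
      note x = w[OF 3(2)]
      have dist: "distinct [s, a, t, v, x0]" by (rule walks5_distinct[OF sgH tfH x(11)])
      have last: "q = v" if z: "(z, q) \<in> walks3 E s t" for z q
      proof -
        have "v \<in> {s, a, t, q, z}" by (rule all[OF w(11)[OF z]])
        moreover have "v \<noteq> z" using tH[OF x(5,6)] w(5)[OF z] by blast
        ultimately show ?thesis using dist by auto
      qed
      have "inj_on fst (walks3 E s t)"
      proof (rule inj_onI)
        fix z z' assume z: "z \<in> walks3 E s t" "z' \<in> walks3 E s t" "fst z = fst z'"
        obtain z1 z2 z1' z2' where zz: "z = (z1, z2)" "z' = (z1', z2')" by (cases z, cases z')
          show "z = z'" using last[OF z(1)[unfolded zz]] last[OF z(2)[unfolded zz]] z(3) unfolding zz by simp
      qed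
      moreover have "fst ` walks3 E s t \<subseteq> common E s v"
      proof (rule image_subsetI)
        fix z assume z: "z \<in> walks3 E s t"
        obtain z1 z2 where zz: "z = (z1, z2)" by (cases z)
        note h = w(8,9)[OF z[unfolded zz]]
        show "fst z \<in> common E s v" using h last[OF z[unfolded zz]] unfolding zz common_def by simp
      qed
      ultimately have l: "card (walks3 E s t) \<le> card (common E s v)" by (rule card_inj_on_le[OF _ _ finH(3)])
      define g where "g = (\<lambda>d. if {a, d} \<in> E then (a, d) else (c, d))"
      have inj: "inj_on g (common H a v)" unfolding g_def inj_on_def by auto
      have "g d \<in> walks3 E s v" if "d \<in> common H a v" for d
      proof -
        have d: "{a, d} \<in> H" "{d, v} \<in> H" using that unfolding common_def by auto
        have "d \<noteq> a" using simple_graph_edge(3)[OF sgH d(1)] by blast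
        then have "{d, v} \<in> E" using low[OF d(2)] x(3) by blast
        then show ?thesis unfolding g_def walks3_def using lowa[OF d(1)] p(1,2) by auto
      qed
      moreover have "(c, t) \<in> walks3 E s v" unfolding walks3_def using p(2,4) es[OF x(10)] by simp
      ultimately have "insert (c, t) (g ` common H a v) \<subseteq> walks3 E s v" by blast
      then have "card (insert (c, t) (g ` common H a v)) \<le> card (walks3 E s v)" by (rule card_mono[OF finH(4)])
      moreover have "(c, t) \<notin> g ` common H a v" unfolding g_def using p(3) ac(3) by auto
      ultimately have e: "card (common H a v) + 1 \<le> card (walks3 E s v)"
        using finH(1) card_image[OF inj] by simp
      have "card (common H a v) * card (walks3 H a v) \<le> card (common H a v) * card (walks3 E s t)"
        using bal 3(1) by simp
      then have "card (common H a v) * card (walks3 H a v) + card (walks3 E s t) \<le> card (walks3 E s t) * (card (common H a v) + 1)"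
        by (simp add: algebra_simps)
      also have "\<dots> \<le> card (common E s v) * card (walks3 E s v)"
        using l e by (rule mult_le_mono)
      finally have "card (common H a v) * card (walks3 H a v) + card (walks3 E s t) \<le> card (common E s v) * card (walks3 E s v)" .
      moreover have "s \<noteq> v" using dist by auto
      ultimately show ?thesis using 3(1) by blast
    qed
  qed
  obtain x y where xy: "(x, y) \<in> walks3 E s t" using ne by auto
  have yx: "(y, x) \<in> walks3 E t s" using xy unfolding walks3_commute[of E t s] by force
  have co': "common E a c = {t, s}" using co by auto
  note w = W[OF co xy] and p = pole[OF co]
  have inuv: "u \<in> {s, a, t, y, x}" "v \<in> {s, a, t, y, x}" using all5[OF w(11)] by simp_all
  have nuv: "{v, u} \<notin> H" using uv(2) edge_flip[of v u H] by blast
  define conf where "conf = (\<lambda>s t u v. (u = s \<and> v = t) \<or> (\<exists>y. u = t \<and> (v, y) \<in> walks3 E s t) \<or> (\<exists>x. u = a \<and> (x, v) \<in> walks3 E s t))"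
  have edges: "{s, a} \<in> H" "{a, t} \<in> H" "{t, y} \<in> H" "{y, x} \<in> H" "{x, s} \<in> H" "{a, s} \<in> H" "{t, a} \<in> H" "{y, t} \<in> H" "{x, y} \<in> H" "{s, x} \<in> H"
    using p(9,10) w(5-7) hs[OF p(9)] hs[OF p(10)] hs[OF w(5)] hs[OF w(6)] hs[OF w(7)] by simp_all
  \<comment> \<open>The closed 5-walk \<open>s a t y x\<close> contains both poles, and these are
    distinct and nonadjacent; so they are one of its five nonadjacent pairs.\<close>
  have cf: "conf s t u v \<or> conf s t v u \<or> conf t s u v \<or> conf t s v u"
  proof -
    have "(u = s \<and> v = t) \<or> (u = t \<and> v = s) \<or> (u = t \<and> v = x) \<or> (v = t \<and> u = x) \<or> (u = s \<and> v = y) \<or> (v = s \<and> u = y)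
      \<or> (u = a \<and> v = y) \<or> (v = a \<and> u = y) \<or> (u = a \<and> v = x) \<or> (v = a \<and> u = x)"
    proof -
      have ex: "\<not> (u = z \<and> v = w)" if "{z, w} \<in> H" for z w using uv(2) that by auto
      have eq: "\<not> (u = z \<and> v = z)" for z using uv(1) by auto
      have "u = s \<or> u = a \<or> u = t \<or> u = y \<or> u = x" "v = s \<or> v = a \<or> v = t \<or> v = y \<or> v = x" using inuv by simp_all
      then show ?thesis
        using ex[OF edges(1)] ex[OF edges(2)] ex[OF edges(3)] ex[OF edges(4)] ex[OF edges(5)] ex[OF edges(6)] ex[OF edges(7)]
          ex[OF edges(8)] ex[OF edges(9)] ex[OF edges(10)] eq[of s] eq[of a] eq[of t] eq[of y] eq[of x] by argo
    qed
    then show ?thesis unfolding conf_def using xy yx by blast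
  qed
  have e1: "card (common H v u) * card (walks3 H v u) = card (common H u v) * card (walks3 H u v)"
    using card_walks3_commute[of H u v] common_commute[of H u v] by simp
  have e2: "card (walks3 E t s) = card (walks3 E s t)" by (rule card_walks3_commute)
  have bal': "card (walks3 H v u) \<le> card (walks3 E s t)" "card (walks3 H u v) \<le> card (walks3 E t s)" "card (walks3 H v u) \<le> card (walks3 E t s)"
    using bal card_walks3_commute[of H u v] card_walks3_commute[of E s t] by simp_all
  have u5: "u \<in> {x1, x2, x3, x4, x5}" and v5: "v \<in> {x1, x2, x3, x4, x5}" if "(x1, x2, x3, x4, x5) \<in> walks5 H" for x1 x2 x3 x4 x5
    using all5[OF that] by blast+
  from cf show ?thesis
  proof (elim disjE)
    assume "conf s t u v"
    from core[OF co st this[unfolded conf_def] v5 bal] show ?thesis .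
  next
    assume "conf s t v u"
    from core[OF co st this[unfolded conf_def] u5 bal'(1)] show ?thesis unfolding e1 .
  next
    assume "conf t s u v"
    from core[OF co' st[symmetric] this[unfolded conf_def] v5 bal'(2)] show ?thesis unfolding e2 .
  next
    assume "conf t s v u"
    from core[OF co' st[symmetric] this[unfolded conf_def] u5 bal'(3)] show ?thesis unfolding e1 e2 .
  qed
qed

section \<open>The upper bound and its extremal graphs\<close>

lemma walks5_pair_exists:
  assumes G: "simple_graph (V, E)" "triangle_free E" and w: "walks5 E \<noteq> {}"
  shows "\<exists>u v. u \<noteq> v \<and> 1 \<le> card (common E u v) * card (walks3 E u v)"
proof -
  obtain x1 x2 x3 x4 x5 where x: "(x1, x2, x3, x4, x5) \<in> walks5 E" using w by auto
  have e: "{x1, x2} \<in> E" "{x2, x3} \<in> E" "{x3, x4} \<in> E" "{x4, x5} \<in> E" "{x5, x1} \<in> E" using x unfolding walks5_def by auto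
  have "x2 \<in> common E x1 x3" unfolding common_def using e by simp
  then have "card (common E x1 x3) \<noteq> 0" using finite_common_simple[OF G(1)] by auto
  moreover have "(x5, x4) \<in> walks3 E x1 x3" unfolding walks3_def using edge_flip[OF e(3)] edge_flip[OF e(4)] edge_flip[OF e(5)] by simp
  then have "card (walks3 E x1 x3) \<noteq> 0" using finite_walks3_simple[OF G(1)] by auto
  ultimately have "1 \<le> card (common E x1 x3) * card (walks3 E x1 x3)" by (simp add: Suc_le_eq)
  moreover have "x1 \<noteq> x3" using walks5_distinct[OF G x] by simp
  ultimately show ?thesis by blast
qed

lemma pair_product:
  assumes G: "tfp V E" and n: "card V \<ge> 5" and uv: "u \<noteq> v"
    and big: "pent_max (card V) \<le> card (common E u v) * card (walks3 E u v)"
  shows "common E u v \<noteq> {}" "walks3 E u v \<noteq> {}"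
    "card (common E u v) * card (walks3 E u v) = pent_max (card V)"
    "card (walks3 E u v) + card (common E u v) + 3 = card V"
    "card (common E u v) \<le> (card V - 2) div 2" "card (walks3 E u v) \<le> (card V - 2) div 2"
proof -
  have "card (common E u v) * card (walks3 E u v) \<noteq> 0" using big pent_max_pos[OF n] by linarith
  then show ne: "common E u v \<noteq> {}" "walks3 E u v \<noteq> {}" by auto
  have le: "card (common E u v) + card (walks3 E u v) \<le> card V - 3" using pair_bound(2)[OF G uv ne] by linarith
  have "card (common E u v) * card (walks3 E u v) \<le> pent_max (card V)"
    unfolding pent_max_def by (rule product_le_quarter_square[OF le])
  then show "card (common E u v) * card (walks3 E u v) = pent_max (card V)" using big by simp
  have k: "2 \<le> card V - 3" and k': "card V - 3 + 1 = card V - 2" using n by simp_all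
  note b = balanced_product[OF le k big[unfolded pent_max_def]]
  show "card (walks3 E u v) + card (common E u v) + 3 = card V" using b(1) n by linarith
  show "card (common E u v) \<le> (card V - 2) div 2" "card (walks3 E u v) \<le> (card V - 2) div 2"
    using b(2,3) unfolding k' .
qed

text \<open>Equality is passed on as a pair with a large product, which by
  \<open>pair_product\<close> and \<open>walks5_pair\<close> already determines that every pentagon
  contains both vertices. Equality forces it in the reduced graph too, together with the maximal
  loss.\<close>

theorem walks5_bound:
  assumes "tfp V E" "card V \<ge> 3"
  shows "card (walks5 E) \<le> 10 * pent_max (card V) \<and>
    (card V \<ge> 5 \<and> card (walks5 E) = 10 * pent_max (card V) \<longrightarrow>
      (\<exists>u v. u \<noteq> v \<and> pent_max (card V) \<le> card (common E u v) * card (walks3 E u v)))"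
  using assms
proof (induction "card V" arbitrary: V E rule: less_induct)
  case (less V E)
  note G = less.prems(1) and sg = tfpD(1)[OF less.prems(1)] and tf = tfpD(2)[OF less.prems(1)]
  show ?case
  proof (cases "walks5 E = {}")
    case True
    then show ?thesis using pent_max_pos[of "card V"] by (simp add: pent_max_def) linarith
  next
    case ne: False
    have n5: "card V \<ge> 5" by (rule walks5_five_vertices[OF sg tf ne])
    have step: "pent_max (card V) = pent_max (card V - 1) + (card V - 3) div 2" by (rule pent_max_step) (use n5 in simp)
    have red: "card (V - {x}) < card V" "card (V - {x}) \<ge> 3" "card (V - {x}) = card V - 1" if "x \<in> V" for x
      using that n5 tfpD(4)[OF G] by (simp_all add: card_Diff_singleton)
    \<comment> \<open>With five vertices the reduced graph has only four and supplies no pair; any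
      pentagon does so directly, as the required product is 1.\<close>
    have five: ?thesis if "card (walks5 E) \<le> 10 * pent_max (card V)" "card V = 5"
    proof -
      have "pent_max 5 = 1" by (simp add: pent_max_def)
      then show ?thesis using walks5_pair_exists[OF sg tf ne] that by auto
    qed
    show ?thesis
    proof (cases "\<exists>x\<in>V. card (nbrs E x) \<le> 1")
      case True
      then obtain x where x: "x \<in> V" "card (nbrs E x) \<le> 1" by blast
      have "card (walks5 {e \<in> E. e \<subseteq> V - {x}}) \<le> 10 * pent_max (card V - 1)"
        using less.hyps[OF red(1)[OF x(1)] tfp_induced[OF G Diff_subset] red(2)[OF x(1)]] red(3)[OF x(1)] by simp
      then have "card (walks5 E) \<le> 10 * pent_max (card V - 1)" using card_delete_vertex(2)[OF sg x(2) ne tf] by simp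
      moreover have "(card V - 3) div 2 \<ge> 1" using n5 by simp
      ultimately have "card (walks5 E) < 10 * pent_max (card V)" using step by linarith
      then show ?thesis by simp
    next
      case False
      then have deg: "card (nbrs E x) \<ge> 2" if "x \<in> V" for x
      proof -
        have "\<not> card (nbrs E x) \<le> 1" using False that by blast
        then show ?thesis by linarith
      qed
      obtain p \<Gamma> where "plane_graph V E p \<Gamma>" using tfp_plane_graph[OF G] .
      then interpret plane_graph V E p \<Gamma> .
      have n3: "3 \<le> card V" using n5 by simp
      show ?thesis
      proof (cases "\<exists>u a b c. facial u a b c")
        case True
        then obtain u0 a0 b0 c0 where "facial u0 a0 b0 c0" by blast
        from cheap_merge[OF this n3] obtain s a t c where m: "mergeable V E s a t c" and l: "2 * card (walks3 E s t) + 3 \<le> card V" by blast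
        note I = mergeable_identification[OF G m]
        define H where "H = identify a c E"
        have HH: "tfp (V - {c}) H" unfolding H_def by (rule I(2))
        have cV: "c \<in> V" by (rule identification.ac(2)[OF I(1)])
        note r = red[OF cV]
        note IH = less.hyps[OF r(1) HH r(2), unfolded r(3)]
        have co: "common E a c = {s, t}" using m unfolding mergeable_def by simp
        have w: "card (walks5 E) \<le> card (walks5 H) + 10 * card (walks3 E s t)"
          unfolding H_def by (rule identification.walks5_identify[OF I(1) co])
        have l': "card (walks3 E s t) \<le> (card V - 3) div 2" using l by linarith
        have bd: "card (walks5 E) \<le> 10 * pent_max (card V)" using w l' IH step by linarith
        show ?thesis
        proof (cases "card V = 5")
          case True then show ?thesis by (rule five[OF bd])
        next
          case False
          then have n6: "card V \<ge> 6" using n5 by simp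
          have "\<exists>u v. u \<noteq> v \<and> pent_max (card V) \<le> card (common E u v) * card (walks3 E u v)"
            if eq: "card (walks5 E) = 10 * pent_max (card V)"
          proof -
            have leq: "card (walks3 E s t) = (card V - 3) div 2" and weq: "card (walks5 H) = 10 * pent_max (card V - 1)"
              using eq w l' IH step by linarith+
            obtain u v where uv: "u \<noteq> v" "pent_max (card V - 1) \<le> card (common H u v) * card (walks3 H u v)"
              using IH weq n6 by auto
            have "5 \<le> card (V - {c})" using r(3) n6 by simp
            note P = pair_product[OF HH this uv(1) uv(2)[folded r(3)], unfolded r(3)]
            obtain d where "{u, d} \<in> H" "{d, v} \<in> H" using P(1) unfolding common_def by blast
            then have nuv: "{u, v} \<notin> H" using triangle_freeD[OF tfpD(2)[OF HH]] by blast
            have all5: "u \<in> {x1, x2, x3, x4, x5} \<and> v \<in> {x1, x2, x3, x4, x5}" if "(x1, x2, x3, x4, x5) \<in> walks5 H" for x1 x2 x3 x4 x5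
              by (rule walks5_pair(2)[OF tfpD(1,2)[OF HH] uv(1) nuv _ that]) (simp add: weq P(3))
            have bal: "card (walks3 H u v) \<le> card (walks3 E s t)" using P(6) leq by simp
            have "card (walks3 E s t) \<noteq> 0" using leq n5 by simp
            then have "walks3 E s t \<noteq> {}" by auto
            from merge_extremal[OF G m H_def uv(1) nuv all5 this bal] show ?thesis
              unfolding P(3) leq step .
          qed
          then show ?thesis using bd by blast
        qed
      next
        case False
        then have nf: "\<not> facial u a b c" for u a b c by blast
        from contraction_choice[OF nf n3 deg] obtain a c where ac: "{a, c} \<in> E" and nc: "\<forall>x y. \<not> cycle4 E a x y c"
          and l: "2 * card {(s, t, r). {a, s} \<in> E \<and> {s, t} \<in> E \<and> {t, r} \<in> E \<and> {r, c} \<in> E} + 3 \<le> card V" by blast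
        note nc = nc[rule_format]
        note I = contract_identification[OF G ac nc]
        define H where "H = identify a c (E - {{a, c}})"
        have HH: "tfp (V - {c}) H" unfolding H_def by (rule I(2))
        have cV: "c \<in> V" by (rule identification.ac(2)[OF I(1)])
        note r = red[OF cV]
        note IH = less.hyps[OF r(1) HH r(2), unfolded r(3)]
        let ?m = "card {(s, t, r). {a, s} \<in> E \<and> {s, t} \<in> E \<and> {t, r} \<in> E \<and> {r, c} \<in> E}"
        have w: "card (walks5 E) \<le> card (walks5 (E - {{a, c}})) + 10 * ?m" by (rule walks5_delete_edge[OF sg tf])
        have w': "card (walks5 (E - {{a, c}})) \<le> card (walks5 H)"
          unfolding H_def by (rule identification.walks5_identify_no_common[OF I(1,3)])
        have l': "?m \<le> (card V - 3) div 2" using l by linarith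
        have bd: "card (walks5 E) \<le> 10 * pent_max (card V)" using w w' l' IH step by linarith
        show ?thesis
        proof (cases "card V = 5")
          case True then show ?thesis by (rule five[OF bd])
        next
          case False
          then have n6: "card V \<ge> 6" using n5 by simp
          \<comment> \<open>Equality would make the contracted graph extremal and leave no slack
            between the 5-walks without the edge and those of \<open>H\<close>.\<close>
          have False if eq: "card (walks5 E) = 10 * pent_max (card V)"
          proof -
            have weq: "card (walks5 H) = 10 * pent_max (card V - 1)" and nl: "card (walks5 H) \<le> card (walks5 (E - {{a, c}}))"
              using eq w w' l' IH step by linarith+
            obtain u v where uv: "u \<noteq> v" "pent_max (card V - 1) \<le> card (common H u v) * card (walks3 H u v)"
              using IH weq n6 by auto
            have "5 \<le> card (V - {c})" using r(3) n6 by simp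
            note P = pair_product[OF HH this uv(1) uv(2)[folded r(3)]]
            show False using contraction_strict[OF G ac nc deg uv(1) H_def P(1,2,4)] nl by simp
          qed
          then show ?thesis using bd by blast
        qed
      qed
    qed
  qed
qed

section \<open>Trees recognised by counting edges\<close>

lemma connected_crossing_edge:
  assumes "connected_graph (W, T)" "S \<subseteq> W" "S \<noteq> {}" "S \<noteq> W"
  shows "\<exists>x y. x \<in> S \<and> y \<notin> S \<and> {x, y} \<in> T"
proof (rule ccontr)
  assume none: "\<not> ?thesis"
  obtain x where x: "x \<in> S" using assms(3) by blast
  obtain y where y: "y \<in> W" "y \<notin> S" using assms(2,4) by blast
  have "(x, y) \<in> {(a, b). {a, b} \<in> T}\<^sup>*" using assms(1,2) x y unfolding connected_graph_def by auto
  then have "y \<in> S" by (induction rule: rtrancl_induct) (use x none in auto)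
  then show False using y by simp
qed

text \<open>A vertex set grown one vertex at a time gains an edge with each new vertex.\<close>

lemma connected_card_edges:
  assumes c: "connected_graph (W, T)" and s: "simple_graph (W, T)"
  shows "card W \<le> card T + 1"
proof -
  have fin: "finite W" "finite T" using simple_graph_finite[OF s] by simp_all
  obtain r where r: "r \<in> W" using c unfolding connected_graph_def by auto
  have "\<exists>S. S \<subseteq> W \<and> card S = Suc k \<and> k \<le> card {e \<in> T. e \<subseteq> S}" if "Suc k \<le> card W" for k
    using that
  proof (induction k)
    case 0
    show ?case by (rule exI[of _ "{r}"]) (use r in simp)
  next
    case (Suc k)
    then obtain S where S: "S \<subseteq> W" "card S = Suc k" "k \<le> card {e \<in> T. e \<subseteq> S}" by auto
    have "S \<noteq> {}" "S \<noteq> W" using S(2) Suc.prems by auto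
    from connected_crossing_edge[OF c S(1) this] obtain x y where xy: "x \<in> S" "y \<notin> S" "{x, y} \<in> T" by blast
    have yW: "y \<in> W" using simple_graph_edge(2)[OF s xy(3)] .
    have fS: "finite S" using S(1) fin(1) finite_subset by blast
    have "insert {x, y} {e \<in> T. e \<subseteq> S} \<subseteq> {e \<in> T. e \<subseteq> insert y S}" using xy by blast
    then have "card (insert {x, y} {e \<in> T. e \<subseteq> S}) \<le> card {e \<in> T. e \<subseteq> insert y S}" by (rule card_mono[rotated]) (use fin in simp)
    moreover have "card (insert {x, y} {e \<in> T. e \<subseteq> S}) = Suc (card {e \<in> T. e \<subseteq> S})" using xy(2) fin(2) by simp
    ultimately have "Suc k \<le> card {e \<in> T. e \<subseteq> insert y S}" using S(3) by linarith
    moreover have "card (insert y S) = Suc (Suc k)" using S(2) xy(2) fS by simp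
    ultimately show ?case using S(1) yW by (intro exI[of _ "insert y S"]) simp
  qed
  moreover have "card W \<noteq> 0" using r fin(1) by auto
  then obtain k where k: "card W = Suc k" using not0_implies_Suc by blast
  ultimately obtain S where "k \<le> card {e \<in> T. e \<subseteq> S}" by auto
  moreover have "card {e \<in> T. e \<subseteq> S} \<le> card T" by (rule card_mono[OF fin(2)]) blast
  ultimately show ?thesis using k by simp
qed

lemma cycle_graph_image:
  assumes g: "inj_on g {..<l}" and l: "l \<ge> 3"
  shows "card ((`) g ` edges (cycle_graph l)) = l"
proof -
  let ?f = "\<lambda>i. {g i, g ((i + 1) mod l)}"
  have "edges (cycle_graph l) = (\<lambda>i. {i, (i + 1) mod l}) ` {..<l}" unfolding cycle_graph_def by auto
  then have "(`) g ` edges (cycle_graph l) = ?f ` {..<l}" by (simp add: image_image)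
  moreover have "inj_on ?f {..<l}"
  proof (rule inj_onI)
    fix i j assume ij: "i \<in> {..<l}" "j \<in> {..<l}" and eq: "?f i = ?f j"
    have m: "(i + 1) mod l \<in> {..<l}" "(j + 1) mod l \<in> {..<l}" using l by simp_all
    have "g i = g j \<or> (g i = g ((j + 1) mod l) \<and> g ((i + 1) mod l) = g j)" using eq by (auto simp: doubleton_eq_iff)
    then have "i = j \<or> (i = (j + 1) mod l \<and> (i + 1) mod l = j)" using inj_on_eq_iff[OF g] ij m by metis
    \<comment> \<open>Two indices that are each the cyclic successor of the other exist only for
      \<open>l \<le> 2\<close>.\<close>
    moreover have False if h: "i = (j + 1) mod l" "(i + 1) mod l = j"
    proof -
      have "(j + 1 = l \<and> i = 0) \<or> i = j + 1" using h(1) ij(2) by (cases "j + 1 = l") simp_all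
      moreover have "(i + 1 = l \<and> j = 0) \<or> j = i + 1" using h(2) ij(1) by (cases "i + 1 = l") simp_all
      ultimately show False using l by (elim disjE conjE) linarith+
    qed
    ultimately show "i = j" by blast
  qed
  ultimately show ?thesis by (simp add: card_image)
qed

lemma isomorphic_cycle_graph:
  assumes S: "simple_graph (S, D)" and l: "l > 0"
  shows "isomorphic (S, D) (cycle_graph l) \<longleftrightarrow> (\<exists>g. bij_betw g {..<l} S \<and> D = (`) g ` edges (cycle_graph l))"
proof
  have C: "verts (cycle_graph l) = {..<l}" unfolding cycle_graph_def by simp
  have Csub: "e \<subseteq> {..<l}" if "e \<in> edges (cycle_graph l)" for e using that l unfolding cycle_graph_def by auto
  {
    assume "isomorphic (S, D) (cycle_graph l)"
    then obtain f where f: "bij_betw f S {..<l}" "\<And>x y. x \<in> S \<Longrightarrow> y \<in> S \<Longrightarrow> {x, y} \<in> D \<longleftrightarrow> {f x, f y} \<in> edges (cycle_graph l)"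
      unfolding isomorphic_def C by auto
    define g where "g = inv_into S f"
    have g: "bij_betw g {..<l} S" unfolding g_def by (rule bij_betw_inv_into[OF f(1)])
    have fg: "f (g i) = i" "g i \<in> S" if "i < l" for i
      using that bij_betw_inv_into_right[OF f(1), of i] bij_betwE[OF g] unfolding g_def by auto
    have gf: "g (f x) = x" "f x < l" if "x \<in> S" for x
      using that bij_betw_inv_into_left[OF f(1)] bij_betwE[OF f(1)] unfolding g_def by auto
    have "D = (`) g ` edges (cycle_graph l)"
    proof (intro equalityI subsetI)
      fix e assume e: "e \<in> D"
      obtain x y where xy: "e = {x, y}" "x \<in> S" "y \<in> S" using simple_graph_edge_ex[OF S e] by blast
      have "{f x, f y} \<in> edges (cycle_graph l)" using e f(2)[OF xy(2,3)] unfolding xy(1) by simp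
      moreover have "e = g ` {f x, f y}" unfolding xy(1) using gf[OF xy(2)] gf[OF xy(3)] by simp
      ultimately show "e \<in> (`) g ` edges (cycle_graph l)" by blast
    next
      fix e assume "e \<in> (`) g ` edges (cycle_graph l)"
      then obtain i where i: "i < l" "e = {g i, g ((i + 1) mod l)}" unfolding cycle_graph_def by auto
      have m: "(i + 1) mod l < l" using l by simp
      have "{i, (i + 1) mod l} \<in> edges (cycle_graph l)" unfolding cycle_graph_def using i(1) by auto
      then show "e \<in> D" unfolding i(2) using f(2)[OF fg(2)[OF i(1)] fg(2)[OF m]] fg(1)[OF i(1)] fg(1)[OF m] by simp
    qed
    then show "\<exists>g. bij_betw g {..<l} S \<and> D = (`) g ` edges (cycle_graph l)" using g by blast
  next
    assume "\<exists>g. bij_betw g {..<l} S \<and> D = (`) g ` edges (cycle_graph l)"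
    then obtain g where g: "bij_betw g {..<l} S" and D: "D = (`) g ` edges (cycle_graph l)" by blast
    define f where "f = inv_into {..<l} g"
    have f: "bij_betw f S {..<l}" unfolding f_def by (rule bij_betw_inv_into[OF g])
    have gf: "g (f x) = x" "f x < l" if "x \<in> S" for x
      using that bij_betw_inv_into_right[OF g, of x] bij_betwE[OF f] unfolding f_def by auto
    have inj: "inj_on ((`) g) (Pow {..<l})" by (rule inj_on_image_Pow[OF bij_betw_imp_inj_on[OF g]])
    have "{x, y} \<in> D \<longleftrightarrow> {f x, f y} \<in> edges (cycle_graph l)" if xy: "x \<in> S" "y \<in> S" for x y
    proof -
      have "{x, y} = g ` {f x, f y}" using gf[OF xy(1)] gf[OF xy(2)] by simp
      moreover have "edges (cycle_graph l) \<subseteq> Pow {..<l}" using Csub by blast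
      moreover have "{f x, f y} \<in> Pow {..<l}" using gf(2)[OF xy(1)] gf(2)[OF xy(2)] by simp
      ultimately show ?thesis unfolding D using inj_on_image_mem_iff[OF inj, of "{f x, f y}" "edges (cycle_graph l)"] by metis
    qed
    then have "\<forall>x\<in>S. \<forall>y\<in>S. {x, y} \<in> D \<longleftrightarrow> {f x, f y} \<in> edges (cycle_graph l)" by (intro ballI)
    then show "isomorphic (S, D) (cycle_graph l)" unfolding isomorphic_def C fst_conv snd_conv by (intro exI[of _ f] conjI f)
  }
qed

text \<open>If a vertex were unreachable, sparsity of the reached set and of its complement would
  lose two edges where only one may be missing. A cycle on \<open>S\<close> would have as many edges
  as vertices.\<close>

lemma is_tree_if_sparse:
  assumes s: "simple_graph (W, T)" and ne: "W \<noteq> {}" and full: "card T + 1 = card W"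
    and sparse: "\<And>S. S \<subseteq> W \<Longrightarrow> S \<noteq> {} \<Longrightarrow> card {e \<in> T. e \<subseteq> S} + 1 \<le> card S"
  shows "is_tree (W, T)"
proof -
  have fin: "finite W" "finite T" using simple_graph_finite[OF s] by simp_all
  let ?R = "{(a, b). {a, b} \<in> T}"
  have "(x, y) \<in> ?R\<^sup>*" if xy: "x \<in> W" "y \<in> W" for x y
  proof (rule ccontr)
    assume no: "(x, y) \<notin> ?R\<^sup>*"
    let ?S = "{z \<in> W. (x, z) \<in> ?R\<^sup>*}"
    have "T \<subseteq> {e \<in> T. e \<subseteq> ?S} \<union> {e \<in> T. e \<subseteq> W - ?S}"
    proof
      fix e assume e: "e \<in> T"
      obtain a b where ab: "e = {a, b}" "a \<in> W" "b \<in> W" using simple_graph_edge_ex[OF s e] by blast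
      have "(a, b) \<in> ?R" "(b, a) \<in> ?R" using e edge_flip[of a b T] unfolding ab(1) by simp_all
      then have "(x, a) \<in> ?R\<^sup>* \<longleftrightarrow> (x, b) \<in> ?R\<^sup>*" by (meson rtrancl.rtrancl_into_rtrancl)
      then show "e \<in> {e \<in> T. e \<subseteq> ?S} \<union> {e \<in> T. e \<subseteq> W - ?S}" using e ab by auto
    qed
    then have "card T \<le> card ({e \<in> T. e \<subseteq> ?S} \<union> {e \<in> T. e \<subseteq> W - ?S})" by (rule card_mono[rotated]) (use fin in simp)
    also have "\<dots> \<le> card {e \<in> T. e \<subseteq> ?S} + card {e \<in> T. e \<subseteq> W - ?S}" by (rule card_Un_le)
    finally have 1: "card T \<le> card {e \<in> T. e \<subseteq> ?S} + card {e \<in> T. e \<subseteq> W - ?S}" .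
    have 2: "card {e \<in> T. e \<subseteq> ?S} + 1 \<le> card ?S" by (rule sparse) (use xy in auto)
    have 3: "card {e \<in> T. e \<subseteq> W - ?S} + 1 \<le> card (W - ?S)" by (rule sparse) (use xy no in auto)
    have "card (W - ?S) = card W - card ?S" by (rule card_Diff_subset) (use fin in auto)
    moreover have "card ?S \<le> card W" by (rule card_mono[OF fin(1)]) blast
    ultimately show False using 1 2 3 full by linarith
  qed
  then have con: "connected_graph (W, T)" unfolding connected_graph_def using ne by simp
  have "free_of (cycle_graph l) (W, T)" if l: "l \<ge> 3" for l
    unfolding free_of_def
  proof
    assume "\<exists>K. subgraph K (W, T) \<and> isomorphic K (cycle_graph l)"
    then obtain K where K: "subgraph K (W, T)" "isomorphic K (cycle_graph l)" by blast
    obtain S D where SD: "K = (S, D)" by (cases K)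
    have sub: "simple_graph (S, D)" "S \<subseteq> W" "D \<subseteq> T" using K(1) unfolding subgraph_def SD by auto
    obtain g where g: "bij_betw g {..<l} S" and D: "D = (`) g ` edges (cycle_graph l)"
      using K(2) isomorphic_cycle_graph[OF sub(1), of l] l unfolding SD by auto
    have "D \<subseteq> {e \<in> T. e \<subseteq> S}" using sub(3) simple_graph_edge_subset[OF sub(1)] by blast
    then have "card D \<le> card {e \<in> T. e \<subseteq> S}" by (rule card_mono[rotated]) (use fin in simp)
    then have "l \<le> card {e \<in> T. e \<subseteq> S}" unfolding D using cycle_graph_image[OF bij_betw_imp_inj_on[OF g] l] by simp
    moreover have "card S = l" using bij_betw_same_card[OF g] by simp
    moreover have "S \<noteq> {}" using \<open>card S = l\<close> l by auto
    ultimately show False using sparse[OF sub(2)] by simp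
  qed
  then show ?thesis unfolding is_tree_def using s con by blast
qed

text \<open>Equality in \<open>pair_bound\<close> gives everything except that the middle edges form
  a tree. Their number is right by the vertex count, and sparsity on \<open>S\<close> is the same
  bound applied to the subgraph induced by the poles, \<open>C\<close> and \<open>S\<close>.\<close>

lemma extremal_in_J_class:
  assumes G: "tfp V E" and n: "card V = n" "n \<ge> 5" and uv: "u \<noteq> v"
    and big: "pent_max n \<le> card (common E u v) * card (walks3 E u v)"
  shows "(V, E) \<in> J_class n"
proof -
  note sg = tfpD(1)[OF G] and tf = tfpD(2)[OF G]
  have n5: "card V \<ge> 5" using n by simp
  note P = pair_product[OF G n5 uv big[folded n(1)]]
  note st = pair_bound(3)[OF G uv P(1,2,4)]
  define C A B T where "C = common E u v" and "A = nbrs E u - C" and "B = nbrs E v - C" and "T = (\<lambda>(x, y). {x, y}) ` walks3 E u v"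
  obtain c where c: "{u, c} \<in> E" "{c, v} \<in> E" using P(1) unfolding common_def by blast
  have nuv: "{u, v} \<notin> E" "{v, u} \<notin> E" using triangle_freeD[OF tf c] edge_flip[of v u E] by blast+
  have nl: "{x} \<notin> E" for x using simple_graph_edge(3)[OF sg, of x x] by auto
  have C: "C = nbrs E u \<inter> nbrs E v" unfolding C_def nbrs_def common_def using edge_commute[of v _ E] by auto
  have fin: "finite C" "finite A" "finite B" unfolding A_def B_def C_def using finite_nbrs[OF sg] finite_common_simple[OF sg] by simp_all
  have disj: "u \<notin> A \<union> B \<union> C" "v \<notin> A \<union> B \<union> C" "A \<inter> B = {}" "A \<inter> C = {}" "B \<inter> C = {}"
    using nuv nl unfolding A_def B_def C nbrs_def by auto
  have VE: "V = {u, v} \<union> C \<union> A \<union> B" using st unfolding A_def B_def C by blast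
  have w3: "x \<in> A" "y \<in> B" "{x, y} \<in> E" if "(x, y) \<in> walks3 E u v" for x y
  proof -
    have h: "{u, x} \<in> E" "{x, y} \<in> E" "{y, v} \<in> E" using that unfolding walks3_def by auto
    show "{x, y} \<in> E" by (rule h(2))
    show "x \<in> A" unfolding A_def C_def nbrs_def common_def using h(1) triangle_freeD[OF tf h(2,3)] by blast
    show "y \<in> B" unfolding B_def C_def nbrs_def common_def using edge_flip[OF h(3)] triangle_freeD[OF tf h(1,2)] by blast
  qed
  have Tab: "\<forall>e\<in>T. \<exists>a\<in>A. \<exists>b\<in>B. e = {a, b}"
  proof
    fix e assume "e \<in> T"
    then obtain q where q: "e = (\<lambda>(x, y). {x, y}) q" "q \<in> walks3 E u v" unfolding T_def by (rule imageE)
    obtain x y where xy: "q = (x, y)" by (cases q)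
    show "\<exists>a\<in>A. \<exists>b\<in>B. e = {a, b}" using q(1) w3(1,2)[OF q(2)[unfolded xy]] unfolding xy by auto
  qed
  obtain x y where "(x, y) \<in> walks3 E u v" using P(2) by auto
  then have neAB: "A \<noteq> {}" "B \<noteq> {}" using w3 by blast+
  have "A \<union> C = nbrs E u" "B \<union> C = nbrs E v" unfolding A_def B_def C by blast+
  then have lk: "link E u v = {u} \<times> (A \<union> C) \<union> {v} \<times> (B \<union> C) \<union> walks3 E u v" unfolding link_def by simp
  have E: "E = {{u, c} |c. c \<in> C} \<union> {{v, c} |c. c \<in> C} \<union> {{u, a} |a. a \<in> A} \<union> {{v, b} |b. b \<in> B} \<union> T"
  proof -
    have img: "(\<lambda>(x, y). {x, y}) ` ({z} \<times> S) = {{z, s} |s. s \<in> S}" for z :: 'a and S by force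
    have split: "{{z, s} |s. s \<in> S \<union> S'} = {{z, s} |s. s \<in> S} \<union> {{z, s} |s. s \<in> S'}" for z :: 'a and S S' by blast
    have "E = (\<lambda>(x, y). {x, y}) ` link E u v" using st by blast
    then show ?thesis unfolding lk image_Un img split T_def[symmetric] by (simp only: Un_ac)
  qed
  have TE: "T \<subseteq> E" using E by blast
  have cV: "card V = 2 + card C + (card A + card B)"
  proof -
    have "card ({u, v} \<union> C \<union> A \<union> B) = card ({u, v} \<union> C) + card (A \<union> B)"
      unfolding Un_assoc[of "{u, v} \<union> C"] by (rule card_Un_disjoint) (use fin disj in auto)
    also have "card ({u, v} \<union> C) = card {u, v} + card C" by (rule card_Un_disjoint) (use fin disj in auto)
    also have "card (A \<union> B) = card A + card B" by (rule card_Un_disjoint) (use fin disj in auto)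
    finally show ?thesis using uv VE by simp
  qed
  have "(y, x) \<notin> walks3 E u v" if "(x, y) \<in> walks3 E u v" for x y
    using w3(1)[OF that] w3(2)[of y x] disj(3) by blast
  then have cT: "card T = card (walks3 E u v)" unfolding T_def by (rule card_oriented_edges[OF finite_walks3_simple[OF sg]])
  have cAB: "card A + card B = card (walks3 E u v) + 1" using cV P(4) unfolding C_def by linarith
  have cU: "card (A \<union> B) = card A + card B" by (rule card_Un_disjoint[OF fin(2,3) disj(3)])
  have "is_tree (A \<union> B, T)"
  proof (rule is_tree_if_sparse)
    show "simple_graph (A \<union> B, T)" unfolding simple_graph_def fst_conv snd_conv
    proof (intro conjI ballI)
      show "finite (A \<union> B)" using fin by simp
      fix e assume "e \<in> T"
      then obtain a b where ab: "a \<in> A" "b \<in> B" "e = {a, b}" using bspec[OF Tab] by blast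
      moreover have "a \<noteq> b" using ab(1,2) disj(3) by blast
      ultimately show "\<exists>x\<in>A \<union> B. \<exists>y\<in>A \<union> B. x \<noteq> y \<and> e = {x, y}" by blast
    qed
    show "A \<union> B \<noteq> {}" using neAB by simp
    show "card T + 1 = card (A \<union> B)" using cT cAB cU by simp
    fix S assume S: "S \<subseteq> A \<union> B" "S \<noteq> {}"
    \<comment> \<open>All of \<open>C\<close> is kept, so the number of common neighbours does not
      drop and the bound on paths becomes a bound in terms of \<open>card S\<close>.\<close>
    let ?V = "{u, v} \<union> C \<union> S" and ?T = "{e \<in> T. e \<subseteq> S}"
    let ?E = "{e \<in> E. e \<subseteq> ?V}"
    have "?V \<subseteq> V" using S VE by blast
    then have G': "tfp ?V ?E" by (rule tfp_induced[OF G])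
    have fS: "finite S" using S fin finite_subset by blast
    have sub: "?T \<subseteq> (\<lambda>(x, y). {x, y}) ` walks3 ?E u v"
    proof
      fix e assume e: "e \<in> ?T"
      then have "e \<in> T" by simp
      then obtain q where q: "e = (\<lambda>(x, y). {x, y}) q" "q \<in> walks3 E u v" unfolding T_def by (rule imageE)
      obtain x y where xy: "q = (x, y)" by (cases q)
      have exy: "e = {x, y}" using q(1) xy by simp
      then have "x \<in> S" "y \<in> S" using e by auto
      then have "(x, y) \<in> walks3 ?E u v" using q(2) unfolding xy walks3_def by auto
      then show "e \<in> (\<lambda>(x, y). {x, y}) ` walks3 ?E u v" unfolding exy by force
    qed
    show "card ?T + 1 \<le> card S"
    proof (cases "walks3 ?E u v = {}")
      case True
      then have "?T = {}" using sub by simp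
      moreover have "card S \<noteq> 0" using S(2) fS by simp
      ultimately show ?thesis by (simp only: card.empty)
    next
      case False
      have fw: "finite (walks3 ?E u v)" by (rule finite_walks3_simple[OF tfpD(1)[OF G']])
      have "card ?T \<le> card ((\<lambda>(x, y). {x, y}) ` walks3 ?E u v)" by (rule card_mono[OF finite_imageI[OF fw] sub])
      also have "\<dots> \<le> card (walks3 ?E u v)" by (rule card_image_le[OF fw])
      finally have 1: "card ?T \<le> card (walks3 ?E u v)" .
      have Cc: "C \<subseteq> common ?E u v" unfolding C_def common_def by auto
      have ne: "common ?E u v \<noteq> {}" using Cc P(1) unfolding C_def by blast
      have "card C \<le> card (common ?E u v)" by (rule card_mono[OF finite_common_simple[OF tfpD(1)[OF G']] Cc])
      moreover have "card ?V = 2 + card C + card S"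
      proof -
        have "card ({u, v} \<union> C \<union> S) = card ({u, v} \<union> C) + card S" by (rule card_Un_disjoint) (use fin fS disj S(1) in auto)
        also have "card ({u, v} \<union> C) = card {u, v} + card C" by (rule card_Un_disjoint) (use fin disj in auto)
        finally show ?thesis using uv by simp
      qed
      ultimately show ?thesis using pair_bound(2)[OF G' uv ne False] 1 by linarith
    qed
  qed
  moreover have "\<bar>int (card C) - (int (card A) + int (card B) - 1)\<bar> \<le> 1"
  proof -
    have "card C + card (walks3 E u v) + 3 = card V" "card C \<le> (card V - 2) div 2" "card (walks3 E u v) \<le> (card V - 2) div 2"
      using P(4-6) unfolding C_def by simp_all
    then have "\<bar>int (card C) - int (card (walks3 E u v))\<bar> \<le> 1" by linarith
    moreover have "int (card A) + int (card B) - 1 = int (card (walks3 E u v))" using cAB by simp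
    ultimately show ?thesis by simp
  qed
  moreover have "C \<noteq> {}" using P(1) unfolding C_def .
  moreover have "planar (V, E)" using planar_drawable[OF sg] tfpD(3)[OF G] by simp
  ultimately show ?thesis unfolding J_class_def mem_Collect_eq fst_conv snd_conv
    using sg n(1) uv disj neAB VE E Tab
    by (intro conjI exI[of _ u] exI[of _ v] exI[of _ A] exI[of _ B] exI[of _ C] exI[of _ T]) simp_all
qed

text \<open>A connected graph on \<open>A \<union> B\<close> has at least
  \<open>card A + card B - 1\<close> edges, each the middle of a path from \<open>u\<close> to
  \<open>v\<close>; by balance the product with \<open>card C\<close> is a quarter square.\<close>

lemma J_class_walks5:
  assumes J: "(V, E) \<in> J_class n" and tf: "triangle_free E"
  shows "10 * pent_max n \<le> card (walks5 E)"
proof -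
  have sg: "simple_graph (V, E)" and nV: "card V = n" using J unfolding J_class_def by simp_all
  obtain u v A B C T where uv: "u \<noteq> v" and d: "u \<notin> A \<union> B \<union> C" "v \<notin> A \<union> B \<union> C" "A \<inter> B = {}" "A \<inter> C = {}" "B \<inter> C = {}"
    and ne: "A \<noteq> {}" "B \<noteq> {}" "C \<noteq> {}" and V: "V = {u, v} \<union> C \<union> A \<union> B"
    and E: "E = {{u, c} |c. c \<in> C} \<union> {{v, c} |c. c \<in> C} \<union> {{u, a} |a. a \<in> A} \<union> {{v, b} |b. b \<in> B} \<union> T"
    and tree: "is_tree (A \<union> B, T)" and Tab: "\<forall>e\<in>T. \<exists>a\<in>A. \<exists>b\<in>B. e = {a, b}"
    and bal: "\<bar>int (card C) - (int (card A) + int (card B) - 1)\<bar> \<le> 1"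
    using J unfolding J_class_def mem_Collect_eq fst_conv snd_conv by (elim conjE exE) (rule that)
  have finV: "finite V" using simple_graph_finite[OF sg] by simp
  then have fin: "finite A" "finite B" "finite C" unfolding V by simp_all
  have cAB: "card (A \<union> B) = card A + card B" by (rule card_Un_disjoint[OF fin(1,2) d(3)])
  have cV: "card V = 2 + card C + (card A + card B)"
  proof -
    have "card ({u, v} \<union> C \<union> A \<union> B) = card ({u, v} \<union> C) + card (A \<union> B)"
      unfolding Un_assoc[of "{u, v} \<union> C"] by (rule card_Un_disjoint) (use fin d in auto)
    also have "card ({u, v} \<union> C) = card {u, v} + card C" by (rule card_Un_disjoint) (use fin d in auto)
    finally show ?thesis using uv V cAB by simp
  qed
  have hub: "{u, c} \<in> E" "{v, c} \<in> E" if "c \<in> C" for c using that unfolding E by blast+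
  have hubA: "{u, a} \<in> E" if "a \<in> A" for a using that unfolding E by blast
  have hubB: "{v, b} \<in> E" if "b \<in> B" for b using that unfolding E by blast
  have "C \<subseteq> common E u v" unfolding common_def using hub edge_flip[OF hub(2)] by blast
  then have 1: "card C \<le> card (common E u v)" by (rule card_mono[OF finite_common_simple[OF sg]])
  have "T \<subseteq> (\<lambda>(x, y). {x, y}) ` walks3 E u v"
  proof
    fix e assume e: "e \<in> T"
    obtain a b where ab: "a \<in> A" "b \<in> B" "e = {a, b}" using bspec[OF Tab e] by blast
    have "{a, b} \<in> E" using e ab(3) unfolding E by blast
    then have "(a, b) \<in> walks3 E u v" unfolding walks3_def using hubA[OF ab(1)] edge_flip[OF hubB[OF ab(2)]] by simp
    then show "e \<in> (\<lambda>(x, y). {x, y}) ` walks3 E u v" unfolding ab(3) by force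
  qed
  then have "card T \<le> card (walks3 E u v)" by (rule surj_card_le[OF finite_walks3_simple[OF sg]])
  moreover have "card (A \<union> B) \<le> card T + 1" by (rule connected_card_edges) (use tree in \<open>simp_all add: is_tree_def\<close>)
  ultimately have 2: "card A + card B - 1 \<le> card (walks3 E u v)" using cAB by simp
  define q where "q = card A + card B - 1"
  have pos: "card A \<noteq> 0" using ne fin by simp
  have q: "card A + card B = q + 1" unfolding q_def using pos by simp
  have "int (card A) + int (card B) - 1 = int q" using q by simp
  then have "\<bar>int (card C) - int q\<bar> \<le> 1" using bal by simp
  then have b: "card C = q \<or> card C = q + 1 \<or> q = card C + 1" by linarith
  have n3: "n - 3 = card C + q" using cV q nV by simp
  have "pent_max n = card C * q"
    unfolding pent_max_def n3 using b
  proof (elim disjE)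
    assume h: "card C = q + 1"
    have "(q + 1 + q)\<^sup>2 = 4 * ((q + 1) * q) + 1" by (simp add: power2_eq_square algebra_simps)
    then show "(card C + q)\<^sup>2 div 4 = card C * q" unfolding h by simp
  next
    assume h: "q = card C + 1"
    have "(card C + (card C + 1))\<^sup>2 = 4 * (card C * (card C + 1)) + 1" by (simp add: power2_eq_square algebra_simps)
    then show "(card C + q)\<^sup>2 div 4 = card C * q" unfolding h by simp
  next
    assume h: "card C = q"
    have "(q + q)\<^sup>2 = 4 * (q * q)" by (simp add: power2_eq_square algebra_simps)
    then show "(card C + q)\<^sup>2 div 4 = card C * q" unfolding h by simp
  qed
  also have "\<dots> \<le> card (common E u v) * card (walks3 E u v)" using 1 2 unfolding q_def[symmetric] by (rule mult_le_mono)
  finally have 3: "pent_max n \<le> card (common E u v) * card (walks3 E u v)" .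
  obtain c where c: "c \<in> C" using ne by blast
  have "{u, v} \<notin> E" using triangle_freeD[OF tf hub(1)[OF c] edge_flip[OF hub(2)[OF c]]] by blast
  then have "10 * (card (common E u v) * card (walks3 E u v)) \<le> card (walks5 E)" by (rule walks5_pair(1)[OF sg tf uv])
  then show ?thesis using 3 by linarith
qed

theorem walks5_extremal:
  assumes G: "tfp V E" and n: "card V = n" "n \<ge> 5"
  shows "card (walks5 E) \<le> 10 * pent_max n" "card (walks5 E) = 10 * pent_max n \<longleftrightarrow> (V, E) \<in> J_class n"
proof -
  have "card V \<ge> 3" using n by simp
  note B = walks5_bound[OF G this, unfolded n(1)]
  show le: "card (walks5 E) \<le> 10 * pent_max n" using B by simp
  show "card (walks5 E) = 10 * pent_max n \<longleftrightarrow> (V, E) \<in> J_class n"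
  proof
    assume "card (walks5 E) = 10 * pent_max n"
    then obtain u v where "u \<noteq> v" "pent_max n \<le> card (common E u v) * card (walks3 E u v)" using B n(2) by auto
    then show "(V, E) \<in> J_class n" by (rule extremal_in_J_class[OF G n])
  next
    assume "(V, E) \<in> J_class n"
    then show "card (walks5 E) = 10 * pent_max n" using J_class_walks5[OF _ tfpD(2)[OF G]] le by fastforce
  qed
qed

section \<open>Counting copies and the lower bound\<close>

definition pentagon :: "'a tuple5 \<Rightarrow> 'a graph" where
  "pentagon = (\<lambda>(x1, x2, x3, x4, x5). ({x1, x2, x3, x4, x5}, {{x1, x2}, {x2, x3}, {x3, x4}, {x4, x5}, {x5, x1}}))"

lemma edges_cycle_graph_5: "edges (cycle_graph 5) = {{0, 1}, {1, 2}, {2, 3}, {3, 4}, {4, 0}}"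
  and edges_cycle_graph_3: "edges (cycle_graph 3) = {{0, 1}, {1, 2}, {2, 0}}"
proof -
  have E: "edges (cycle_graph l) = (\<lambda>i. {i, (i + 1) mod l}) ` {..<l}" for l unfolding cycle_graph_def by auto
  have 5: "{..<5} = {0, 1, 2, 3, 4 :: nat}" and 3: "{..<3} = {0, 1, 2 :: nat}" by auto
  show "edges (cycle_graph 5) = {{0, 1}, {1, 2}, {2, 3}, {3, 4}, {4, 0}}" unfolding E 5 by (simp add: numeral_2_eq_2)
  show "edges (cycle_graph 3) = {{0, 1}, {1, 2}, {2, 0}}" unfolding E 3 by (simp add: numeral_2_eq_2)
qed

lemma copies_pentagon:
  assumes G: "simple_graph (V, E)" "triangle_free E"
  shows "copies (cycle_graph 5) (V, E) = pentagon ` walks5 E"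
proof (intro equalityI subsetI)
  fix K assume K: "K \<in> copies (cycle_graph 5) (V, E)"
  obtain S D where SD: "K = (S, D)" by (cases K)
  have sub: "simple_graph (S, D)" "D \<subseteq> E" and iso: "isomorphic (S, D) (cycle_graph 5)"
    using K unfolding copies_def subgraph_def SD by auto
  obtain g where g: "bij_betw g {..<5} S" "D = (`) g ` edges (cycle_graph 5)"
    using iso isomorphic_cycle_graph[OF sub(1), of 5] by auto
  have "S = g ` {0, 1, 2, 3, 4}"
  proof -
    have "{..<5} = {0, 1, 2, 3, 4 :: nat}" by auto
    then show ?thesis using bij_betw_imp_surj_on[OF g(1)] by simp
  qed
  then have S: "S = {g 0, g 1, g 2, g 3, g 4}" by simp
  have D: "D = {{g 0, g 1}, {g 1, g 2}, {g 2, g 3}, {g 3, g 4}, {g 4, g 0}}" unfolding g(2) edges_cycle_graph_5 by simp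
  have "(g 0, g 1, g 2, g 3, g 4) \<in> walks5 E" using sub(2) unfolding D walks5_def by simp
  moreover have "K = pentagon (g 0, g 1, g 2, g 3, g 4)" unfolding SD S D pentagon_def by simp
  ultimately show "K \<in> pentagon ` walks5 E" by blast
next
  fix K assume "K \<in> pentagon ` walks5 E"
  then obtain w where w: "K = pentagon w" "w \<in> walks5 E" by (rule imageE)
  obtain x1 x2 x3 x4 x5 where x: "w = (x1, x2, x3, x4, x5)" by (cases w)
  have e: "{x1, x2} \<in> E" "{x2, x3} \<in> E" "{x3, x4} \<in> E" "{x4, x5} \<in> E" "{x5, x1} \<in> E" using w(2) unfolding x walks5_def by auto
  let ?xs = "[x1, x2, x3, x4, x5]"
  let ?S = "{x1, x2, x3, x4, x5}" and ?D = "{{x1, x2}, {x2, x3}, {x3, x4}, {x4, x5}, {x5, x1}}"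
  have d: "distinct ?xs" by (rule walks5_distinct[OF G w(2)[unfolded x]])
  have K: "K = (?S, ?D)" unfolding w(1) x pentagon_def by simp
  have sS: "simple_graph (?S, ?D)" unfolding simple_graph_def fst_conv snd_conv
  proof (intro conjI ballI)
    fix e assume h: "e \<in> ?D"
    then have "e \<in> E" using e by auto
    then obtain x y where "e = {x, y}" "x \<noteq> y" using simple_graph_edge_ex[OF G(1)] by blast
    moreover have "e \<subseteq> ?S" using h by auto
    ultimately show "\<exists>x\<in>?S. \<exists>y\<in>?S. x \<noteq> y \<and> e = {x, y}" by blast
  qed simp
  have "bij_betw ((!) ?xs) {..<5} ?S" by (rule bij_betw_nth[OF d]) simp_all
  moreover have "?D = (`) ((!) ?xs) ` edges (cycle_graph 5)" unfolding edges_cycle_graph_5 by simp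
  ultimately have "isomorphic (?S, ?D) (cycle_graph 5)" using isomorphic_cycle_graph[OF sS, of 5] by auto
  moreover have "?S \<subseteq> V" using simple_graph_edge(1)[OF G(1)] e by blast
  moreover have "?D \<subseteq> E" using e by simp
  ultimately show "K \<in> copies (cycle_graph 5) (V, E)" unfolding copies_def subgraph_def K using sS by simp
qed

text \<open>Once the first step has chosen a direction, each further vertex is the neighbour not yet
  visited.\<close>

lemma walks5_of_pentagon:
  assumes d: "distinct [x1, x2, x3, x4, x5]" and d': "distinct [x1, y2, y3, y4, y5]"
    and w: "(x1, y2, y3, y4, y5) \<in> walks5 (edges (pentagon (x1, x2, x3, x4, x5)))"
  shows "(y2, y3, y4, y5) = (x2, x3, x4, x5) \<or> (y2, y3, y4, y5) = (x5, x4, x3, x2)"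
proof -
  let ?D = "edges (pentagon (x1, x2, x3, x4, x5))"
  have w: "{x1, y2} \<in> ?D" "{y2, y3} \<in> ?D" "{y3, y4} \<in> ?D" "{y4, y5} \<in> ?D" using w unfolding walks5_def by auto
  have n1: "{x1, z} \<in> ?D \<longleftrightarrow> z = x2 \<or> z = x5" and n2: "{x2, z} \<in> ?D \<longleftrightarrow> z = x1 \<or> z = x3"
    and n3: "{x3, z} \<in> ?D \<longleftrightarrow> z = x2 \<or> z = x4" and n4: "{x4, z} \<in> ?D \<longleftrightarrow> z = x3 \<or> z = x5"
    and n5: "{x5, z} \<in> ?D \<longleftrightarrow> z = x4 \<or> z = x1" for z
    using d unfolding pentagon_def by (auto simp: doubleton_eq_iff)
  from w(1) consider "y2 = x2" | "y2 = x5" unfolding n1 by blast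
  then show ?thesis
  proof cases
    case 1
    then have 3: "y3 = x3" using w(2) d' n2 by auto
    then have 4: "y4 = x4" using w(3) d' n3 1 by auto
    then have "y5 = x5" using w(4) d' n4 3 by auto
    then show ?thesis using 1 3 4 by simp
  next
    case 2
    then have 3: "y3 = x4" using w(2) d' n5 by auto
    then have 4: "y4 = x3" using w(3) d' n4 2 by auto
    then have "y5 = x2" using w(4) d' n3 3 by auto
    then show ?thesis using 2 3 4 by simp
  qed
qed

lemma pentagon_rot: "pentagon (x2, x3, x4, x5, x1) = pentagon (x1, x2, x3, x4, x5)"
  and pentagon_rev: "pentagon (x1, x5, x4, x3, x2) = pentagon (x1, x2, x3, x4, x5)"
proof -
  show "pentagon (x2, x3, x4, x5, x1) = pentagon (x1, x2, x3, x4, x5)"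
    unfolding pentagon_def prod.case prod.inject
    by (intro conjI set_eqI; simp only: insert_iff empty_iff; argo)
  show "pentagon (x1, x5, x4, x3, x2) = pentagon (x1, x2, x3, x4, x5)"
    unfolding pentagon_def prod.case prod.inject
      insert_commute[of x1 x5 "{}"] insert_commute[of x5 x4 "{}"] insert_commute[of x4 x3 "{}"] insert_commute[of x3 x2 "{}"] insert_commute[of x2 x1 "{}"]
    by (intro conjI set_eqI; simp only: insert_iff empty_iff; argo)
qed

lemma walks5_rot: "(x2, x3, x4, x5, x1) \<in> walks5 E \<longleftrightarrow> (x1, x2, x3, x4, x5) \<in> walks5 E"
  and walks5_rev: "(x1, x5, x4, x3, x2) \<in> walks5 E \<longleftrightarrow> (x1, x2, x3, x4, x5) \<in> walks5 E"
proof -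
  show "(x2, x3, x4, x5, x1) \<in> walks5 E \<longleftrightarrow> (x1, x2, x3, x4, x5) \<in> walks5 E" unfolding walks5_def by auto
  show "(x1, x5, x4, x3, x2) \<in> walks5 E \<longleftrightarrow> (x1, x2, x3, x4, x5) \<in> walks5 E"
    unfolding walks5_def mem_Collect_eq prod.case
      edge_commute[of x1 x5 E] edge_commute[of x5 x4 E] edge_commute[of x4 x3 E] edge_commute[of x3 x2 E] edge_commute[of x2 x1 E] by argo
qed

lemma pentagon_fibre:
  assumes G: "simple_graph (V, E)" "triangle_free E" and w: "(x1, x2, x3, x4, x5) \<in> walks5 E"
  shows "card {y \<in> walks5 E. pentagon y = pentagon (x1, x2, x3, x4, x5)} = 10"
proof -
  let ?P = "pentagon (x1, x2, x3, x4, x5)"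
  let ?T = "{(x1, x2, x3, x4, x5), (x2, x3, x4, x5, x1), (x3, x4, x5, x1, x2), (x4, x5, x1, x2, x3), (x5, x1, x2, x3, x4),
    (x1, x5, x4, x3, x2), (x2, x1, x5, x4, x3), (x3, x2, x1, x5, x4), (x4, x3, x2, x1, x5), (x5, x4, x3, x2, x1)}"
  have d: "distinct [x1, x2, x3, x4, x5]" by (rule walks5_distinct[OF G w])
  have fw: "pentagon (a2, a3, a4, a5, a1) = ?P \<and> (a2, a3, a4, a5, a1) \<in> walks5 E"
    if "pentagon (a1, a2, a3, a4, a5) = ?P \<and> (a1, a2, a3, a4, a5) \<in> walks5 E" for a1 a2 a3 a4 a5
    using that unfolding pentagon_rot[of a2 a3 a4 a5 a1] walks5_rot[of a2 a3 a4 a5 a1 E] .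
  have bw: "pentagon (a1, a5, a4, a3, a2) = ?P \<and> (a1, a5, a4, a3, a2) \<in> walks5 E"
    if "pentagon (a1, a2, a3, a4, a5) = ?P \<and> (a1, a2, a3, a4, a5) \<in> walks5 E" for a1 a2 a3 a4 a5
    using that unfolding pentagon_rev[of a1 a5 a4 a3 a2] walks5_rev[of a1 a5 a4 a3 a2 E] .
  have r1: "pentagon (x1, x2, x3, x4, x5) = ?P \<and> (x1, x2, x3, x4, x5) \<in> walks5 E" using w by simp
  note r2 = fw[OF r1]
  note r3 = fw[OF r2]
  note r4 = fw[OF r3]
  note r5 = fw[OF r4]
  have "?T \<subseteq> {y \<in> walks5 E. pentagon y = ?P}"
    using r1 r2 r3 r4 r5 bw[OF r1] bw[OF r2] bw[OF r3] bw[OF r4] bw[OF r5] by simp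
  moreover have "{y \<in> walks5 E. pentagon y = ?P} \<subseteq> ?T"
  proof
    fix y assume y: "y \<in> {y \<in> walks5 E. pentagon y = ?P}"
    obtain y1 y2 y3 y4 y5 where yy: "y = (y1, y2, y3, y4, y5)" by (cases y)
    have yE: "(y1, y2, y3, y4, y5) \<in> walks5 E" and yP: "pentagon (y1, y2, y3, y4, y5) = ?P" using y unfolding yy by auto
    have dy: "distinct [y1, y2, y3, y4, y5]" by (rule walks5_distinct[OF G yE])
    have "(y1, y2, y3, y4, y5) \<in> walks5 (edges (pentagon (y1, y2, y3, y4, y5)))" "y1 \<in> verts (pentagon (y1, y2, y3, y4, y5))"
      unfolding walks5_def pentagon_def by simp_all
    then have wy: "(y1, y2, y3, y4, y5) \<in> walks5 (edges ?P)" and y1: "y1 \<in> verts ?P" unfolding yP by simp_all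
    have in_T: "y \<in> ?T" if "y1 = a1" "distinct [a1, a2, a3, a4, a5]" "pentagon (a1, a2, a3, a4, a5) = ?P \<and> (a1, a2, a3, a4, a5) \<in> walks5 E"
      "(a1, a2, a3, a4, a5) \<in> ?T" "(a1, a5, a4, a3, a2) \<in> ?T" for a1 a2 a3 a4 a5
    proof -
      have "(y2, y3, y4, y5) = (a2, a3, a4, a5) \<or> (y2, y3, y4, y5) = (a5, a4, a3, a2)"
        by (rule walks5_of_pentagon[OF that(2)]) (use dy wy that(1) conjunct1[OF that(3)] in simp_all)
      then have "y = (a1, a2, a3, a4, a5) \<or> y = (a1, a5, a4, a3, a2)" unfolding yy that(1) by simp
      then show ?thesis by (elim disjE) (simp_all only: that(4,5))
    qed
    from y1 consider "y1 = x1" | "y1 = x2" | "y1 = x3" | "y1 = x4" | "y1 = x5" unfolding pentagon_def by auto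
    then show "y \<in> ?T"
    proof cases
      case 1 show ?thesis by (rule in_T[OF 1 d r1]) simp_all
    next
      case 2 show ?thesis by (rule in_T[OF 2 _ r2]) (use d in auto)
    next
      case 3 show ?thesis by (rule in_T[OF 3 _ r3]) (use d in auto)
    next
      case 4 show ?thesis by (rule in_T[OF 4 _ r4]) (use d in auto)
    next
      case 5 show ?thesis by (rule in_T[OF 5 _ r5]) (use d in auto)
    qed
  qed
  ultimately have "{y \<in> walks5 E. pentagon y = ?P} = ?T" by (rule equalityI[rotated])
  moreover have "card ?T = 10" using d by (simp add: eq_sym_conv)
  ultimately show ?thesis by simp
qed

lemma card_walks5:
  assumes G: "simple_graph (V, E)" "triangle_free E"
  shows "card (walks5 E) = 10 * card (copies (cycle_graph 5) (V, E))"
proof -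
  have fin: "finite (walks5 E)" by (rule finite_walks5[OF G(1)])
  have "card (walks5 E) = (\<Sum>K\<in>pentagon ` walks5 E. card {y \<in> walks5 E. pentagon y = K})"
    using sum.image_gen[OF fin, of "\<lambda>_. 1 :: nat" pentagon] by simp
  also have "\<dots> = (\<Sum>K\<in>pentagon ` walks5 E. 10)"
  proof (rule sum.cong[OF refl])
    fix K assume "K \<in> pentagon ` walks5 E"
    then obtain w where w: "K = pentagon w" "w \<in> walks5 E" by (rule imageE)
    obtain x1 x2 x3 x4 x5 where x: "w = (x1, x2, x3, x4, x5)" by (cases w)
    show "card {y \<in> walks5 E. pentagon y = K} = 10" unfolding w(1) x by (rule pentagon_fibre[OF G w(2)[unfolded x]])
  qed
  finally show ?thesis unfolding copies_pentagon[OF G] by simp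
qed

lemma free_of_triangle:
  assumes G: "simple_graph (V, E)"
  shows "free_of (cycle_graph 3) (V, E) \<longleftrightarrow> triangle_free E"
proof
  assume F: "free_of (cycle_graph 3) (V, E)"
  show "triangle_free E" unfolding triangle_free_def
  proof (intro allI impI notI)
    fix x y z assume e: "{x, y} \<in> E" "{y, z} \<in> E" "{x, z} \<in> E"
    let ?S = "{x, y, z}" and ?D = "{{x, y}, {y, z}, {z, x}}"
    have d: "distinct [x, y, z]" using simple_graph_edge(3)[OF G] e by auto
    have sS: "simple_graph (?S, ?D)" unfolding simple_graph_def using d by auto
    have "bij_betw ((!) [x, y, z]) {..<3} ?S" by (rule bij_betw_nth[OF d]) simp_all
    moreover have "?D = (`) ((!) [x, y, z]) ` edges (cycle_graph 3)" unfolding edges_cycle_graph_3 by simp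
    ultimately have "isomorphic (?S, ?D) (cycle_graph 3)" using isomorphic_cycle_graph[OF sS, of 3] by auto
    moreover have "subgraph (?S, ?D) (V, E)" unfolding subgraph_def
      using sS e edge_flip[OF e(3)] simple_graph_edge(1,2)[OF G e(1)] simple_graph_edge(2)[OF G e(2)] by simp
    ultimately show False using F unfolding free_of_def by blast
  qed
next
  assume T: "triangle_free E"
  show "free_of (cycle_graph 3) (V, E)" unfolding free_of_def
  proof
    assume "\<exists>K. subgraph K (V, E) \<and> isomorphic K (cycle_graph 3)"
    then obtain K where K: "subgraph K (V, E)" "isomorphic K (cycle_graph 3)" by blast
    obtain S D where SD: "K = (S, D)" by (cases K)
    have sub: "simple_graph (S, D)" "D \<subseteq> E" using K(1) unfolding subgraph_def SD by auto
    obtain g where "D = (`) g ` edges (cycle_graph 3)" using K(2) isomorphic_cycle_graph[OF sub(1), of 3] unfolding SD by auto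
    then have "D = {{g 0, g 1}, {g 1, g 2}, {g 2, g 0}}" unfolding edges_cycle_graph_3 by simp
    then show False using triangle_freeD[OF T, of "g 0" "g 1" "g 2"] sub(2) edge_flip[of "g 2" "g 0" E] by simp
  qed
qed

text \<open>In the notation of \<open>J\<^sub>n\<close>, the vertex \<open>0\<close> is \<open>u\<close>, \<open>1\<close> is \<open>v\<close>, \<open>2\<close> is the only element of
  \<open>B\<close>, the next \<open>k\<close> vertices form \<open>C\<close> and the last \<open>l\<close> vertices form \<open>A\<close>.\<close>

definition fan_edges :: "nat \<Rightarrow> nat \<Rightarrow> nat set set" where
  "fan_edges k l = {{0, m} |m. 3 \<le> m \<and> m < 3 + k + l} \<union> {{1, m} |m. 3 \<le> m \<and> m < 3 + k} \<union>
    {{2, m} |m. 3 + k \<le> m \<and> m < 3 + k + l} \<union> {{1, 2}}"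

lemma fan_edge_cases:
  assumes "e \<in> fan_edges k l"
  obtains (top) m where "e = {0, m}" "3 \<le> m" "m < 3 + k + l"
  | (right) m where "e = {1, m}" "3 \<le> m" "m < 3 + k"
  | (left) m where "e = {2, m}" "3 + k \<le> m" "m < 3 + k + l"
  | (axis) "e = {1, 2}"
  using assms unfolding fan_edges_def by blast

lemma fan_simple: "simple_graph ({..<3 + k + l}, fan_edges k l)"
  unfolding simple_graph_def fst_conv snd_conv
proof (intro conjI ballI)
  fix e assume "e \<in> fan_edges k l"
  then show "\<exists>x\<in>{..<3 + k + l}. \<exists>y\<in>{..<3 + k + l}. x \<noteq> y \<and> e = {x, y}"
  proof (cases rule: fan_edge_cases)
    case (top m) then show ?thesis by (intro bexI[of _ 0] bexI[of _ m]) auto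
  next
    case (right m) then show ?thesis by (intro bexI[of _ 1] bexI[of _ m]) auto
  next
    case (left m) then show ?thesis by (intro bexI[of _ 2] bexI[of _ m]) auto
  next
    case axis then show ?thesis by (intro bexI[of _ 1] bexI[of _ 2]) auto
  qed
qed simp

lemma fan_triangle_free: "triangle_free (fan_edges k l)"
proof -
  \<comment> \<open>A homomorphism onto the pentagon with vertices 0 to 4 in cyclic order; a
    triangle would have to map to a closed walk of length three there.\<close>
  define h :: "nat \<Rightarrow> nat" where "h = (\<lambda>m. if m = 0 then 0 else if m = 1 then 2 else if m = 2 then 3 else if m < 3 + k then 1 else 4)"
  have h012: "h 0 = 0" "h 1 = 2" "h 2 = 3" unfolding h_def by simp_all
  have adj: "h y = h x + 1 \<or> h x = h y + 1 \<or> (h x = 0 \<and> h y = 4) \<or> (h x = 4 \<and> h y = 0)" if "{x, y} \<in> fan_edges k l" for x y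
    using that
  proof (cases rule: fan_edge_cases)
    case (top m)
    have "h m = 1 \<or> h m = 4" using top(2) unfolding h_def by simp
    then show ?thesis using iffD1[OF doubleton_eq_iff top(1)] h012 by (elim disjE conjE) simp_all
  next
    case (right m)
    have "h m = 1" using right(2,3) unfolding h_def by simp
    then show ?thesis using iffD1[OF doubleton_eq_iff right(1)] h012 by (elim disjE conjE) simp_all
  next
    case (left m)
    have "h m = 4" using left(2,3) unfolding h_def by simp
    then show ?thesis using iffD1[OF doubleton_eq_iff left(1)] h012 by (elim disjE conjE) simp_all
  next
    case axis
    then show ?thesis using iffD1[OF doubleton_eq_iff axis] h012 by (elim disjE conjE) simp_all
  qed
  show ?thesis unfolding triangle_free_def
  proof (intro allI impI notI)
    fix x y z assume e: "{x, y} \<in> fan_edges k l" "{y, z} \<in> fan_edges k l" "{x, z} \<in> fan_edges k l"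
    show False using adj[OF e(1)] adj[OF e(2)] adj[OF e(3)] by (elim disjE conjE) linarith+
  qed
qed

lemma closed_segment_to_axis:
  assumes "z \<in> closed_segment (Complex 0 h) (Complex r 0)"
  obtains t where "0 \<le> t" "t \<le> 1" "Im z = t * h" "Re z = (1 - t) * r"
proof -
  obtain s where s: "0 \<le> s" "s \<le> 1" "z = (1 - s) *\<^sub>R Complex 0 h + s *\<^sub>R Complex r 0"
    using assms unfolding closed_segment_def by blast
  show ?thesis by (rule that[of "1 - s"]) (use s in simp_all)
qed

text \<open>A straight-line drawing: \<open>u\<close> above and \<open>v\<close> below the origin on
  the imaginary axis, the vertex of \<open>B\<close> halfway between the origin and
  \<open>v\<close>, \<open>C\<close> on the positive and \<open>A\<close> on the negative real
  axis.\<close>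

lemma fan_drawable: "drawable {..<3 + k + l} (fan_edges k l)"
proof -
  define X :: "nat \<Rightarrow> real" where "X = (\<lambda>m. if m < 3 + k then real m else - real m)"
  define p :: "nat \<Rightarrow> complex" where
    "p = (\<lambda>m. if m = 0 then Complex 0 1 else if m = 1 then Complex 0 (-1) else if m = 2 then Complex 0 (-1/2) else Complex (X m) 0)"
  have p012: "p 0 = Complex 0 1" "p 1 = Complex 0 (-1)" "p 2 = Complex 0 (-1/2)" unfolding p_def by simp_all
  have p3: "p m = Complex (X m) 0" if "3 \<le> m" for m using that unfolding p_def by simp
  have Xinj: "m = m'" if "X m = X m'" "3 \<le> m" "3 \<le> m'" for m m' using that unfolding X_def by (auto split: if_splits)
  have Xpos: "X m > 0" if "3 \<le> m" "m < 3 + k" for m using that unfolding X_def by simp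
  have Xneg: "X m < 0" if "3 + k \<le> m" for m using that unfolding X_def by simp
  have Xnz: "X m \<noteq> 0" if "3 \<le> m" for m using that unfolding X_def by simp
  have vert: "w = 0 \<or> w = 1 \<or> w = 2 \<or> 3 \<le> w" for w :: nat by linarith
  have injp: "inj p"
  proof (rule injI)
    fix a b assume ab: "p a = p b"
    show "a = b"
    proof (cases "3 \<le> a \<and> 3 \<le> b")
      case True
      then show ?thesis using ab p3[of a] p3[of b] Xinj[of a b] by simp
    next
      case False
      have "p m \<noteq> Complex 0 h" if "3 \<le> m" for m h using p3[OF that] Xnz[OF that] by simp
      then have sep: "p m \<noteq> p 0" "p m \<noteq> p 1" "p m \<noteq> p 2" if "3 \<le> m" for m using that p012 by simp_all
      have "p 0 \<noteq> p 1" "p 0 \<noteq> p 2" "p 1 \<noteq> p 2" using p012 by simp_all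
      with vert[of a] vert[of b] False show ?thesis
        using ab sep[of a] sep[of b] by metis
    qed
  qed
  define \<Gamma> where "\<Gamma> = (\<lambda>e. convex hull (p ` e))"
  have \<Gamma>: "\<Gamma> {x, y} = closed_segment (p x) (p y)" for x y unfolding \<Gamma>_def by (simp add: segment_convex_hull)
  \<comment> \<open>Coordinates of points strictly inside an edge. The signs of \<open>Im z\<close>
    and \<open>Re z\<close> tell the four kinds of edges apart, and within a kind the equation for
    \<open>Re z\<close> recovers the end on the real axis.\<close>
  define inner where "inner = (\<lambda>e z.
    (\<exists>m. e = {0, m} \<and> 3 \<le> m \<and> 0 < Im z \<and> Im z < 1 \<and> Re z = (1 - Im z) * X m) \<or>
    (\<exists>m. e = {1, m} \<and> 3 \<le> m \<and> -1 < Im z \<and> Im z < 0 \<and> 0 < Re z \<and> Re z = (1 + Im z) * X m) \<or>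
    (\<exists>m. e = {2, m} \<and> 3 \<le> m \<and> -1/2 < Im z \<and> Im z < 0 \<and> Re z < 0 \<and> Re z = (1 + 2 * Im z) * X m) \<or>
    (e = {1, 2} \<and> -1 < Im z \<and> Im z < -1/2 \<and> Re z = 0))"
  have on_edge: "(\<exists>w\<in>e. z = p w) \<or> inner e z" if e: "e \<in> fan_edges k l" and z: "z \<in> \<Gamma> e" for e z
    using e
  proof (cases rule: fan_edge_cases)
    case (top m)
    have "z \<in> closed_segment (Complex 0 1) (Complex (X m) 0)" using z p012 p3[OF top(2)] unfolding top(1) \<Gamma> by simp
    then obtain t where t: "0 \<le> t" "t \<le> 1" "Im z = t * 1" "Re z = (1 - t) * X m" by (rule closed_segment_to_axis)
    consider "t = 0" | "t = 1" | "0 < t" "t < 1" using t by linarith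
    then show ?thesis
    proof cases
      case 1 then have "z = p m" using t p3[OF top(2)] by (simp add: complex_eq_iff)
      then show ?thesis using top by blast
    next
      case 2 then have "z = p 0" using t p012 by (simp add: complex_eq_iff)
      then show ?thesis using top by blast
    next
      case 3 then show ?thesis using t top unfolding inner_def by auto
    qed
  next
    case (right m)
    have "z \<in> closed_segment (Complex 0 (-1)) (Complex (X m) 0)" using z p012 p3[OF right(2)] unfolding right(1) \<Gamma> by simp
    then obtain t where t: "0 \<le> t" "t \<le> 1" "Im z = t * (-1)" "Re z = (1 - t) * X m" by (rule closed_segment_to_axis)
    consider "t = 0" | "t = 1" | "0 < t" "t < 1" using t by linarith
    then show ?thesis
    proof cases
      case 1 then have "z = p m" using t p3[OF right(2)] by (simp add: complex_eq_iff)
      then show ?thesis using right by blast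
    next
      case 2 then have "z = p 1" using t p012 by (simp add: complex_eq_iff)
      then show ?thesis using right by blast
    next
      case 3
      then have "0 < Re z" using t Xpos[OF right(2,3)] by simp
      then show ?thesis using t 3 right unfolding inner_def by auto
    qed
  next
    case (left m)
    have m3: "3 \<le> m" using left by simp
    have "z \<in> closed_segment (Complex 0 (-1/2)) (Complex (X m) 0)" using z p012 p3[OF m3] unfolding left(1) \<Gamma> by simp
    then obtain t where t: "0 \<le> t" "t \<le> 1" "Im z = t * (-1/2)" "Re z = (1 - t) * X m" by (rule closed_segment_to_axis)
    consider "t = 0" | "t = 1" | "0 < t" "t < 1" using t by linarith
    then show ?thesis
    proof cases
      case 1 then have "z = p m" using t p3[OF m3] by (simp add: complex_eq_iff)
      then show ?thesis using left by blast
    next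
      case 2 then have "z = p 2" using t p012 by (simp add: complex_eq_iff)
      then show ?thesis using left by blast
    next
      case 3
      then have "Re z < 0" using t Xneg[OF left(2)] by (simp add: mult_pos_neg)
      then show ?thesis using t 3 left m3 unfolding inner_def by auto
    qed
  next
    case axis
    have "z \<in> closed_segment (Complex 0 (-1)) (Complex 0 (-1/2))" using z p012 unfolding axis \<Gamma> by simp
    then obtain s where s: "0 \<le> s" "s \<le> 1" "z = (1 - s) *\<^sub>R Complex 0 (-1) + s *\<^sub>R Complex 0 (-1/2)"
      unfolding closed_segment_def by blast
    have r: "Re z = 0" "Im z = -1 + s / 2" unfolding s(3) by simp_all
    consider "s = 0" | "s = 1" | "0 < s" "s < 1" using s by linarith
    then show ?thesis
    proof cases
      case 1 then have "z = p 1" using r p012 by (simp add: complex_eq_iff)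
      then show ?thesis using axis by blast
    next
      case 2 then have "z = p 2" using r p012 by (simp add: complex_eq_iff)
      then show ?thesis using axis by blast
    next
      case 3 then show ?thesis using r axis unfolding inner_def by auto
    qed
  qed
  have not_inner: "\<not> inner e (p w)" for e w
    using vert[of w] p012 p3[of w] unfolding inner_def by (elim disjE) auto
  have inner_unique: "e = e'" if "inner e z" "inner e' z" for e e' z
  proof -
    have eq: "m = m'" if "r = q * X m" "r = q * X m'" "q \<noteq> 0" "3 \<le> m" "3 \<le> m'" for q r m m'
      using that Xinj[of m m'] by simp
    have eqA: "m = m'" if "Re z = (1 - Im z) * X m" "Re z = (1 - Im z) * X m'" "Im z < 1" "3 \<le> m" "3 \<le> m'" for m m'
      by (rule eq[OF that(1,2) _ that(4,5)]) (use that(3) in simp)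
    have eqB: "m = m'" if "Re z = (1 + Im z) * X m" "Re z = (1 + Im z) * X m'" "-1 < Im z" "3 \<le> m" "3 \<le> m'" for m m'
      by (rule eq[OF that(1,2) _ that(4,5)]) (use that(3) in simp)
    have eqC: "m = m'" if "Re z = (1 + 2 * Im z) * X m" "Re z = (1 + 2 * Im z) * X m'" "-1/2 < Im z" "3 \<le> m" "3 \<le> m'" for m m'
      by (rule eq[OF that(1,2) _ that(4,5)]) (use that(3) in simp)
    from that(1)[unfolded inner_def] that(2)[unfolded inner_def] show ?thesis
      by (elim disjE exE conjE) ((rule FalseE, linarith) | metis eqA | metis eqB | metis eqC | simp)+
  qed
  have ends: "p ` e \<subseteq> \<Gamma> e" for e unfolding \<Gamma>_def by (rule hull_subset)
  have "drawn {..<3 + k + l} (fan_edges k l) p \<Gamma>" unfolding drawn_def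
  proof (intro conjI allI ballI impI)
    show "inj_on p {..<3 + k + l}" using injp inj_on_subset by blast
    fix x y assume "{x, y} \<in> fan_edges k l"
    then have "p x \<noteq> p y" using simple_graph_edge(3)[OF fan_simple] injp by (metis injD)
    then show "arc_set (\<Gamma> {x, y}) (p x) (p y)" unfolding \<Gamma> arc_set_def
      by (intro exI[of _ "linepath (p x) (p y)"]) (simp add: arc_linepath)
  next
    fix e assume e: "e \<in> fan_edges k l"
    show "\<Gamma> e \<inter> p ` {..<3 + k + l} = p ` e"
      using on_edge[OF e] not_inner[of e] ends[of e] simple_graph_edge_subset[OF fan_simple e] by blast
  next
    fix e e' assume e: "e \<in> fan_edges k l" "e' \<in> fan_edges k l" "e \<noteq> e'"
    show "\<Gamma> e \<inter> \<Gamma> e' = p ` (e \<inter> e')"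
    proof (intro equalityI subsetI)
      fix z assume z: "z \<in> \<Gamma> e \<inter> \<Gamma> e'"
      have "(\<exists>w\<in>e. z = p w) \<or> inner e z" "(\<exists>w\<in>e'. z = p w) \<or> inner e' z" using on_edge e z by blast+
      then obtain w w' where w: "w \<in> e" "z = p w" "w' \<in> e'" "z = p w'" using inner_unique[of e z e'] e(3) not_inner by metis
      then have "w = w'" using injp by (simp add: inj_eq)
      then show "z \<in> p ` (e \<inter> e')" using w by blast
    next
      fix z assume "z \<in> p ` (e \<inter> e')"
      then show "z \<in> \<Gamma> e \<inter> \<Gamma> e'" using ends by blast
    qed
  qed
  then show ?thesis unfolding drawable_def by blast
qed

lemma half_product: "(m div 2) * (m - m div 2) = m\<^sup>2 div (4 :: nat)"
proof (cases "even m")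
  case True
  then obtain j where m: "m = 2 * j" by (elim evenE)
  show ?thesis unfolding m by (simp add: power2_eq_square)
next
  case False
  then obtain j where m: "m = 2 * j + 1" by (elim oddE)
  have "m\<^sup>2 = 1 + 4 * (j * (j + 1))" unfolding m by (simp add: power2_eq_square algebra_simps)
  then show ?thesis unfolding m by simp
qed

lemma pent_max_attained:
  assumes n: "n \<ge> 5"
  shows "\<exists>E :: nat set set. tfp {..<n} E \<and> 10 * pent_max n \<le> card (walks5 E)"
proof -
  define k where "k = (n - 3) div 2"
  define l where "l = n - 3 - k"
  have nkl: "n = 3 + k + l" unfolding l_def k_def using n by linarith
  let ?E = "fan_edges k l"
  have G: "tfp {..<n} ?E" unfolding tfp_def nkl using fan_simple fan_triangle_free fan_drawable by blast
  note sg = tfpD(1)[OF G] and tf = tfpD(2)[OF G]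
  have E: "{0, m} \<in> ?E" if "3 \<le> m" "m < 3 + k + l" for m using that unfolding fan_edges_def by blast
  have E1: "{m, 1} \<in> ?E" if "3 \<le> m" "m < 3 + k" for m
    by (rule edge_flip) (use that in \<open>unfold fan_edges_def, blast\<close>)
  have E2: "{m, 2} \<in> ?E" if "3 + k \<le> m" "m < 3 + k + l" for m
    by (rule edge_flip) (use that in \<open>unfold fan_edges_def, blast\<close>)
  have E3: "{2, 1} \<in> ?E" by (rule edge_flip) (simp add: fan_edges_def)
  have "{3..<3 + k} \<subseteq> common ?E 0 1" unfolding common_def using E E1 by auto
  then have "card {3..<3 + k} \<le> card (common ?E 0 1)" by (rule card_mono[OF finite_common_simple[OF sg]])
  then have 1: "k \<le> card (common ?E 0 1)" by simp
  have "(\<lambda>m. (m, 2)) ` {3 + k..<3 + k + l} \<subseteq> walks3 ?E 0 1" unfolding walks3_def using E E2 E3 by auto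
  then have "card ((\<lambda>m. (m, 2 :: nat)) ` {3 + k..<3 + k + l}) \<le> card (walks3 ?E 0 1)" by (rule card_mono[OF finite_walks3_simple[OF sg]])
  then have 2: "l \<le> card (walks3 ?E 0 1)" by (simp add: card_image inj_on_def)
  have "{0, 1} \<notin> ?E"
  proof
    assume "{0, 1} \<in> ?E"
    then show False by (cases rule: fan_edge_cases) (auto simp: doubleton_eq_iff)
  qed
  then have "10 * (card (common ?E 0 1) * card (walks3 ?E 0 1)) \<le> card (walks5 ?E)"
    by (rule walks5_pair(1)[OF sg tf zero_neq_one])
  moreover have "k * l \<le> card (common ?E 0 1) * card (walks3 ?E 0 1)" using 1 2 by (rule mult_le_mono)
  moreover have "k * l = pent_max n" unfolding pent_max_def l_def k_def by (rule half_product)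
  ultimately show ?thesis using G by (intro exI[of _ ?E]) linarith
qed

lemma pent_max_floor_ceiling:
  assumes "n \<ge> 3"
  shows "\<lfloor>(real n - 3) / 2\<rfloor> * \<lceil>(real n - 3) / 2\<rceil> = int (pent_max n)"
proof -
  define m where "m = n - 3"
  have m: "real n - 3 = real m" unfolding m_def using assms by simp
  have "\<lfloor>real m / 2\<rfloor> = int (m div 2)" using floor_divide_of_nat_eq[of m 2, where 'a = real] by simp
  moreover have "\<lceil>real m / 2\<rceil> = int (m - m div 2)"
  proof (rule ceiling_unique)
    have "2 * (m - m div 2) = m \<or> 2 * (m - m div 2) = m + 1" by linarith
    then have "2 * real (m - m div 2) = real m \<or> 2 * real (m - m div 2) = real m + 1" by (metis of_nat_mult of_nat_numeral of_nat_add of_nat_1)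
    then show "of_int (int (m - m div 2)) - 1 < real m / 2" "real m / 2 \<le> of_int (int (m - m div 2))" by auto
  qed
  ultimately show ?thesis unfolding m pent_max_def m_def[symmetric] half_product[symmetric] by simp
qed

theorem theorem7:
  fixes n :: nat
  assumes "n \<ge> 5"
  shows "int (ex_planar n (cycle_graph 5) (cycle_graph 3))
           = \<lfloor>(real n - 3) / 2\<rfloor> * \<lceil>(real n - 3) / 2\<rceil> \<and>
         (\<forall>G :: 'a graph.
            simple_graph G \<and> card (verts G) = n \<and> planar G \<and> free_of (cycle_graph 3) G \<longrightarrow>
              (int (card (copies (cycle_graph 5) G))
                 = \<lfloor>(real n - 3) / 2\<rfloor> * \<lceil>(real n - 3) / 2\<rceil>
               \<longleftrightarrow> G \<in> J_class n))"
proof -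
  have val: "\<lfloor>(real n - 3) / 2\<rfloor> * \<lceil>(real n - 3) / 2\<rceil> = int (pent_max n)"
    by (rule pent_max_floor_ceiling) (use assms in simp)
  \<comment> \<open>Stated for any vertex type, because it is needed both for the natural numbers in
    the maximum and for the type of the theorem.\<close>
  have bound: "card (copies (cycle_graph 5) (V, E)) \<le> pent_max n"
      "card (copies (cycle_graph 5) (V, E)) = pent_max n \<longleftrightarrow> (V, E) \<in> J_class n"
    if "simple_graph (V, E)" "card V = n" "planar (V, E)" "free_of (cycle_graph 3) (V, E)" for V :: "'b set" and E
  proof -
    have tf: "triangle_free E" using free_of_triangle[OF that(1)] that(4) by simp
    then have "tfp V E" unfolding tfp_def using that(1,3) planar_drawable[OF that(1)] by simp
    note X = walks5_extremal[OF this that(2) assms, unfolded card_walks5[OF that(1) tf]]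
    show "card (copies (cycle_graph 5) (V, E)) \<le> pent_max n" using X(1) by simp
    show "card (copies (cycle_graph 5) (V, E)) = pent_max n \<longleftrightarrow> (V, E) \<in> J_class n" using X(2) by simp
  qed
  have "ex_planar n (cycle_graph 5) (cycle_graph 3) = pent_max n"
    unfolding ex_planar_def
  proof (rule Max_eqI[OF finite_copy_counts])
    fix y assume "y \<in> {card (copies (cycle_graph 5) G) |G :: nat graph.
      simple_graph G \<and> card (verts G) = n \<and> planar G \<and> free_of (cycle_graph 3) G}"
    then obtain G :: "nat graph" where G: "y = card (copies (cycle_graph 5) G)" "simple_graph G" "card (verts G) = n"
      "planar G" "free_of (cycle_graph 3) G" by blast
    then show "y \<le> pent_max n" using bound(1)[of "fst G" "snd G"] by simp
  next
    obtain E :: "nat set set" where E: "tfp {..<n} E" "10 * pent_max n \<le> card (walks5 E)" using pent_max_attained[OF assms] by blast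
    note D = tfpD(1-3)[OF E(1)]
    have P: "planar ({..<n}, E)" using planar_drawable[OF D(1)] D(3) by simp
    have F: "free_of (cycle_graph 3) ({..<n}, E)" using free_of_triangle[OF D(1)] D(2) by simp
    have "card (copies (cycle_graph 5) ({..<n}, E)) \<le> pent_max n" using bound(1)[OF D(1) _ P F] by simp
    then have "card (copies (cycle_graph 5) ({..<n}, E)) = pent_max n" using E(2) card_walks5[OF D(1,2)] by simp
    then show "pent_max n \<in> {card (copies (cycle_graph 5) G) |G :: nat graph.
      simple_graph G \<and> card (verts G) = n \<and> planar G \<and> free_of (cycle_graph 3) G}"
      using D(1) P F by (intro CollectI exI[of _ "({..<n}, E)"]) simp
  qed
  moreover have "int (card (copies (cycle_graph 5) G)) = int (pent_max n) \<longleftrightarrow> G \<in> J_class n"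
    if "simple_graph G \<and> card (verts G) = n \<and> planar G \<and> free_of (cycle_graph 3) G" for G :: "'a graph"
    using bound(2)[of "fst G" "snd G"] that by simp
  ultimately show ?thesis unfolding val by simp
qed

end
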